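(* Let $h\in\mathbb{C}\setminus\{0\}$ and let $\mathcal{X}$ be the variety obtained from $\mathbb{P}^2\times\mathbb{P}^2$ by the 17 successive blow-ups described in the context, with $\mathrm{Pic}(\mathcal{X})=\mathbb{Z}\mathcal{H}_a\oplus\mathbb{Z}\mathcal{H}_b\oplus\bigoplus_{i=1}^{17}\mathbb{Z}\mathcal{E}_i$ and $\mathcal{E}_{i_1,\dots,i_k}=\mathcal{E}_{i_1}+\dots+\mathcal{E}_{i_k}$. Let \begin{align*} I_1=&-hx_0^2-hx_0x_2+h^2x_0x_2+hx_0^2x_2-hx_2^2+hx_0x_2^2,\\ I_2=&\,2hx_0+x_0^2-2hx_0x_1+2hx_2+x_0x_2-hx_1x_2+h^2x_1x_2+2hx_0x_1x_2\\ &+x_2^2+hx_1x_2^2-hx_0x_3+h^2x_0x_3+hx_0^2x_3-2hx_2x_3+2hx_0x_2x_3. \end{align*} (1) The hyper-surfaces whose class is $2\mathcal{H}_a+2\mathcal{H}_b-2\mathcal{E}_1-2\mathcal{E}_6-4\mathcal{E}_{11}-\mathcal{E}_{2,4,7,9,12,13,14,16}$ are given by $C_0+C_1I_1=0$ with $(C_0:C_1)\in\mathbb{P}^1$ and $C_1\neq 0$. (2) The hyper-surfaces whose class is $2\mathcal{H}_a+2\mathcal{H}_b-3\mathcal{E}_{11}-\mathcal{E}_{1,2,4,5,6,7,9,10,12,13,14,16,17}$ are given by $C_0+C_1I_1+C_2I_2=0$ with $(C_0:C_1:C_2)\in\mathbb{P}^2$ and $C_2\neq 0$.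
   Context: **Convention.** Hyper-surfaces are given by polynomial equations $f(x_0,x_1,x_2,x_3)=0$ (as divisors, counted with multiplicity), and the class of a hyper-surface means the class in $\mathrm{Pic}(\mathcal{X})$ of its proper transform in $\mathcal{X}$. $C_0,C_1,C_2$ in the equations of the hyper-surfaces are constants (not to be confused with the blow-up centers $C_i$ below). **Charts of $\mathbb{P}^2\times\mathbb{P}^2$.** The coordinates are $(x_0:x_1:1,\ x_2:x_3:1)$. Besides $(x_0,x_1,x_2,x_3)$ we use, for $i=0,2$, the coordinates $(z_i,z_{i+1})=(x_ix_{i+1}^{-1},\,x_{i+1}^{-1})$ on the corresponding $\mathbb{P}^2$ factor; mixed charts such as $(x_0,x_1,z_2,z_3)$, $(z_0,z_1,x_2,x_3)$, $(z_0,z_1,z_2,z_3)$ are used. **The variety $\mathcal{X}$.** The blow-ups are performed successively for $i=1,\dots,17$. The $i$-th center $C_i$ is the Zariski closure (in the variety obtained so far) of the set given parametrically below, $P,Q$ being $\mathbb{C}$-valued parameters (independent for each $C_i$). After "$\leftarrow$" one local chart $(s_i,t_i,u_i,v_i)$ of the $i$-th blow-up is given in terms of earlier coordinates; it is used to describe later centers. $C_1$: $(x_0,x_1,z_2,z_3)=(1,P,0,0)$ $\leftarrow$ $(s_1,t_1,u_1,v_1)=(x_0-1,\ x_1,\ z_2(x_0-1)^{-1},\ z_3(x_0-1)^{-1})$. $C_2$: $(s_1,t_1,u_1,v_1)=(0,P,Q,0)$ $\leftarrow$ $(s_2,t_2,u_2,v_2)=(s_1,t_1,u_1,v_1s_1^{-1})$.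 $C_3$: $(s_2,t_2,u_2,v_2)=(0,P,-h(1+hP)^{-1},Q)$ $\leftarrow$ $(s_3,t_3,u_3,v_3)=(s_2,t_2,(u_2+h(1+ht_2)^{-1})s_2^{-1},v_2)$. $C_4$: $(s_3,t_3,u_3,v_3)=(0,P,Q,(1+hP)^{-1})$ $\leftarrow$ $(s_4,t_4,u_4,v_4)=(s_3,t_3,u_3,(v_3-(1+ht_3)^{-1})s_3^{-1})$. $C_5$: $(s_4,t_4,u_4,v_4)=(0,P,Q,(1+hP)^{-2})$ $\leftarrow$ $(s_5,t_5,u_5,v_5)=(s_4,t_4,u_4,(v_4-(1+ht_4)^{-2})s_4^{-1})$. $C_6$: $(z_0,z_1,x_2,x_3)=(0,0,1,P)$ $\leftarrow$ $(s_6,t_6,u_6,v_6)=(x_2-1,\ x_3,\ z_0(x_2-1)^{-1},\ z_1(x_2-1)^{-1})$. $C_7$: $(s_6,t_6,u_6,v_6)=(0,P,Q,0)$ $\leftarrow$ $(s_7,t_7,u_7,v_7)=(s_6,t_6,u_6,v_6s_6^{-1})$. $C_8$: $(s_7,t_7,u_7,v_7)=(0,P,-h(1+hP)^{-1},Q)$ $\leftarrow$ $(s_8,t_8,u_8,v_8)=(s_7,t_7,(u_7+h(1+ht_7)^{-1})s_7^{-1},v_7)$. $C_9$: $(s_8,t_8,u_8,v_8)=(0,P,Q,(1+hP)^{-1})$ $\leftarrow$ $(s_9,t_9,u_9,v_9)=(s_8,t_8,u_8,(v_8-(1+ht_8)^{-1})s_8^{-1})$. $C_{10}$: $(s_9,t_9,u_9,v_9)=(0,P,Q,(1+hP)^{-2})$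 $\leftarrow$ $(s_{10},t_{10},u_{10},v_{10})=(s_9,t_9,u_9,(v_9-(1+ht_9)^{-2})s_9^{-1})$. $C_{11}$: $(z_0,z_1,z_2,z_3)=(0,0,0,0)$ $\leftarrow$ $(s_{11},t_{11},u_{11},v_{11})=(z_0,\ z_1z_0^{-1},\ z_2z_0^{-1},\ z_3z_0^{-1})$. $C_{12}$: $(s_{11},t_{11},u_{11},v_{11})=(P,0,1,0)$ $\leftarrow$ $(s_{12},t_{12},u_{12},v_{12})=(s_{11},t_{11},(u_{11}-1)t_{11}^{-1},v_{11}t_{11}^{-1})$. $C_{13}$: $(s_{12},t_{12},u_{12},v_{12})=(P,0,Q,-1)$ $\leftarrow$ $(s_{13},t_{13},u_{13},v_{13})=(s_{12},t_{12},u_{12},(v_{12}+1)t_{12}^{-1})$. $C_{14}$: $(s_{13},t_{13},u_{13},v_{13})=(0,0,1+h,0)$ $\leftarrow$ $(s_{14},t_{14},u_{14},v_{14})=(s_{13}t_{13}^{-1},t_{13},(u_{13}-1-h)t_{13}^{-1},v_{13}t_{13}^{-1})$. $C_{15}$: $(s_{14},t_{14},u_{14},v_{14})=(P,0,-2Q-Ph^{-1},Q)$ $\leftarrow$ $(s_{15},t_{15},u_{15},v_{15})=(s_{14},t_{14},v_{14},(u_{14}+2v_{14}+s_{14}h^{-1})t_{14}^{-1})$. $C_{16}$: $(s_{15},t_{15},u_{15},v_{15})=(P,0,-Ph^{-1},Q)$ $\leftarrow$ $(s_{16},t_{16},u_{16},v_{16})=(s_{15},t_{15},(u_{15}+s_{15}h^{-1})t_{15}^{-1},v_{15})$.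 $C_{17}$: $(s_{16},t_{16},u_{16},v_{16})=(P,0,Q,2^{-1}Q+(1+h)h^{-1}P)$ $\leftarrow$ $(s_{17},t_{17},u_{17},v_{17})=(s_{16},t_{16},u_{16},(v_{16}-2^{-1}u_{16}-(1+h)h^{-1}s_{16})t_{16}^{-1})$. **Picard group.** $\mathcal{H}_a$ (resp. $\mathcal{H}_b$) is the class of the total transform in $\mathcal{X}$ of a divisor $c_0x_0+c_1x_1+a=0$ (resp. $c_2x_2+c_3x_3+b=0$) with $(c_0:c_1:a)\in\mathbb{P}^2$ (resp. $(c_2:c_3:b)\in\mathbb{P}^2$) constant, and $\mathcal{E}_i$ is the class of the total transform in $\mathcal{X}$ of the exceptional divisor of the $i$-th blow-up.
   Formalization: The blow-ups are performed in the order 11, 1,…,10, 12,…,17: the point C_11 lies on the closures of C_1 and C_6, so it is no longer a point of the variety once these are blown up and must be blown up first; parameters with 1+hP=0 are excluded. *)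

theory Defs
  imports
    Complex_Main
    "HOL-Computational_Algebra.Polynomial"
    "HOL-Computational_Algebra.Fraction_Field"
    "HOL-Algebra.Coset"
    "HOL-Algebra.Ideal"
    "HOL-Algebra.Subrings"
    "HOL-Algebra.Generated_Rings"
begin

section \<open>Varieties as sets of local rings of the function field\<close>

text \<open>
  All varieties below are birational to affine 4-space, so they share one function field
  \<open>K = \<complex>(x0,x1,x2,x3)\<close>.  A variety is represented, following Zariski and Chevalley, by the
  set of the local rings of all its scheme points, that is, of all its irreducible closed
  subvarieties, as subrings of \<open>K\<close>; the generic point is \<open>K\<close> itself.  A point \<open>R\<close> lies on the
  subvariety with generic point \<open>P\<close> iff \<open>R \<subseteq> P\<close>, and a point \<open>S\<close> of a blow-up lies over \<open>R\<close>
  iff \<open>S\<close> dominates \<open>R\<close>.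
\<close>

type_synonym ratfun = "complex poly poly poly poly fract"
type_synonym local_ring = "ratfun set"
type_synonym variety = "local_ring set"
type_synonym coords = "ratfun \<times> ratfun \<times> ratfun \<times> ratfun"
type_synonym pt = "complex \<times> complex \<times> complex \<times> complex"

definition cst :: "complex \<Rightarrow> ratfun" where
  "cst c = Fract [:[:[:[:c:]:]:]:] 1"

definition x0 :: ratfun where "x0 = Fract [:[:[:[:0, 1:]:]:]:] 1"
definition x1 :: ratfun where "x1 = Fract [:[:[:0, 1:]:]:] 1"
definition x2 :: ratfun where "x2 = Fract [:[:0, 1:]:] 1"
definition x3 :: ratfun where "x3 = Fract [:0, 1:] 1"

definition Kring :: "ratfun ring" where
  "Kring = \<lparr>carrier = UNIV, mult = (*), one = 1, zero = 0, add = (+)\<rparr>"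

abbreviation subring_of_K :: "ratfun set \<Rightarrow> ratfun ring" where
  "subring_of_K A \<equiv> Kring\<lparr>carrier := A\<rparr>"

definition polyring :: "ratfun set \<Rightarrow> ratfun set" where
  "polyring G = generate_ring Kring (range cst \<union> G)"

definition localization :: "ratfun set \<Rightarrow> ratfun set \<Rightarrow> local_ring" where
  "localization A p = {a / b | a b. a \<in> A \<and> b \<in> A \<and> b \<notin> p}"

definition affine :: "ratfun set \<Rightarrow> variety" where
  "affine A = {localization A p | p. primeideal p (subring_of_K A)}"

definition maxideal :: "local_ring \<Rightarrow> ratfun set" where
  "maxideal R = {a \<in> R. a = 0 \<or> inverse a \<notin> R}"

definition dominates :: "local_ring \<Rightarrow> local_ring \<Rightarrow> bool" where
  "dominates S R \<longleftrightarrow> R \<subseteq> S \<and> maxideal R = maxideal S \<inter> R"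

text \<open>The three standard affine charts of the projective plane with affine coordinates \<open>x\<close>, \<open>y\<close>,
  i.e. homogeneous coordinates \<open>(x : y : 1)\<close>.\<close>

definition P2_charts :: "ratfun \<Rightarrow> ratfun \<Rightarrow> ratfun set set" where
  "P2_charts x y = {{x, y}, {x / y, 1 / y}, {1 / x, y / x}}"

definition P2xP2 :: variety where
  "P2xP2 = (\<Union>G \<in> P2_charts x0 x1. \<Union>H \<in> P2_charts x2 x3. affine (polyring (G \<union> H)))"

text \<open>The sets \<open>{S \<in> X. G \<subseteq> S}\<close> with \<open>G\<close> finite (the points at which all functions in \<open>G\<close>
  are regular) form a basis of the Zariski topology.\<close>

definition zariski_closure :: "variety \<Rightarrow> local_ring set \<Rightarrow> local_ring set" where
  "zariski_closure X W = {R \<in> X. \<forall>G. finite G \<and> G \<subseteq> R \<longrightarrow> (\<exists>S \<in> W. G \<subseteq> S)}"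

text \<open>Stalk at \<open>R\<close> of the (radical) ideal sheaf of a closed subset \<open>Z\<close>: the functions vanishing
  at every point of \<open>Z\<close> specialising to \<open>R\<close>.  It is all of \<open>R\<close> if \<open>R\<close> is not on \<open>Z\<close>.\<close>

definition ideal_at :: "local_ring set \<Rightarrow> local_ring \<Rightarrow> ratfun set" where
  "ideal_at Z R = R \<inter> (\<Inter>P \<in> {P \<in> Z. R \<subseteq> P}. maxideal P)"

text \<open>Blow-up along the closed subset \<open>Z\<close>: over a point \<open>R\<close> with \<open>I = ideal_at Z R\<close>, it is
  covered by the spectra of the rings \<open>R[I/f]\<close>, \<open>0 \<noteq> f \<in> I\<close>; the points over \<open>R\<close> are the
  primes contracting to the maximal ideal of \<open>R\<close>.\<close>

definition blowup :: "variety \<Rightarrow> local_ring set \<Rightarrow> variety" where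
  "blowup X Z =
     {localization A p | R f A p.
        R \<in> X \<and> f \<in> ideal_at Z R \<and> f \<noteq> 0 \<and>
        A = generate_ring Kring (R \<union> {a / f | a. a \<in> ideal_at Z R}) \<and>
        primeideal p (subring_of_K A) \<and> p \<inter> R = maxideal R}"

text \<open>The closed point with coordinates \<open>(a,b,c,d)\<close> in the chart with coordinate functions
  \<open>(s,t,u,v)\<close>.\<close>

fun point_at :: "coords \<Rightarrow> pt \<Rightarrow> local_ring" where
  "point_at (s, t, u, v) (a, b, c, d) =
     (let A = polyring {s, t, u, v}
      in localization A (Idl\<^bsub>subring_of_K A\<^esub> {s - cst a, t - cst b, u - cst c, v - cst d}))"


section \<open>Divisors and the Picard group\<close>

definition units_in :: "local_ring \<Rightarrow> ratfun set" where
  "units_in R = {a \<in> R. a \<noteq> 0 \<and> inverse a \<in> R}"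

definition uniformizer :: "local_ring \<Rightarrow> ratfun \<Rightarrow> bool" where
  "uniformizer V \<pi> \<longleftrightarrow> \<pi> \<noteq> 0 \<and> \<pi> \<in> maxideal V \<and> (\<forall>a. a \<noteq> 0 \<longrightarrow> (\<exists>n::int. a / \<pi> powi n \<in> units_in V))"

definition is_dvr :: "local_ring \<Rightarrow> bool" where
  "is_dvr V \<longleftrightarrow> subring V Kring \<and> (\<exists>\<pi>. uniformizer V \<pi>)"

text \<open>Order of vanishing of \<open>a \<noteq> 0\<close> along the prime divisor with local ring \<open>V\<close>.\<close>

definition ord_at :: "local_ring \<Rightarrow> ratfun \<Rightarrow> int" where
  "ord_at V a = (THE n. \<exists>\<pi>. uniformizer V \<pi> \<and> a / \<pi> powi n \<in> units_in V)"

text \<open>On a normal variety the generic points of the prime divisors are exactly the points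
  whose local ring is a discrete valuation ring.\<close>

definition prime_divisors :: "variety \<Rightarrow> local_ring set" where
  "prime_divisors X = {V \<in> X. is_dvr V}"

type_synonym divisor = "local_ring \<Rightarrow> int"

definition Div :: "variety \<Rightarrow> divisor monoid" where
  "Div X = \<lparr>carrier = {D. finite {V. D V \<noteq> 0} \<and> {V. D V \<noteq> 0} \<subseteq> prime_divisors X},
            mult = (\<lambda>D D' V. D V + D' V), one = (\<lambda>V. 0)\<rparr>"

definition div_of :: "variety \<Rightarrow> ratfun \<Rightarrow> divisor" where
  "div_of X g = (\<lambda>V. if V \<in> prime_divisors X then ord_at V g else 0)"

definition principal_divisors :: "variety \<Rightarrow> divisor set" where
  "principal_divisors X = {div_of X g | g. g \<noteq> 0}"

text \<open>Divisors modulo linear equivalence.\<close>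

definition Pic :: "variety \<Rightarrow> divisor set monoid" where
  "Pic X = Div X Mod principal_divisors X"

definition div_class :: "variety \<Rightarrow> divisor \<Rightarrow> divisor set" where
  "div_class X D = principal_divisors X #>\<^bsub>Div X\<^esub> D"

definition point_below :: "variety \<Rightarrow> local_ring \<Rightarrow> local_ring" where
  "point_below Y V = (THE R. R \<in> Y \<and> dominates V R)"

text \<open>Pull-back to \<open>X\<close> of the subscheme of \<open>Y\<close> with ideal sheaf \<open>J\<close> whose inverse image ideal
  sheaf on \<open>X\<close> is invertible, as a divisor.\<close>

definition total_transform :: "variety \<Rightarrow> variety \<Rightarrow> (local_ring \<Rightarrow> ratfun set) \<Rightarrow> divisor" where
  "total_transform X Y J =
     (\<lambda>V. if V \<in> prime_divisors X
          then Inf {ord_at V a | a. a \<in> J (point_below Y V) \<and> a \<noteq> 0} else 0)"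

text \<open>The generic point of the proper transform of a prime divisor of \<open>Y\<close> has the same local
  ring, because \<open>X \<rightarrow> Y\<close> is an isomorphism there.\<close>

definition proper_transform :: "variety \<Rightarrow> variety \<Rightarrow> divisor \<Rightarrow> divisor" where
  "proper_transform X Y D =
     (\<lambda>V. if V \<in> prime_divisors X \<and> V \<in> prime_divisors Y then D V else 0)"

text \<open>The divisor on \<open>\<P>\<^sup>2 \<times> \<P>\<^sup>2\<close> of the hypersurface \<open>f = 0\<close>: the closure of the zero divisor of
  \<open>f\<close> in the affine chart \<open>(x0,x1,x2,x3)\<close>, so no component lies at infinity.\<close>

definition hypersurface :: "ratfun \<Rightarrow> divisor" where
  "hypersurface f =
     (\<lambda>V. if V \<in> prime_divisors P2xP2 \<and> {x0, x1, x2, x3} \<subseteq> V then ord_at V f else 0)"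

definition hypersurfaces :: "divisor set" where
  "hypersurfaces = {hypersurface f | f. f \<in> polyring {x0, x1, x2, x3} \<and> f \<noteq> 0}"

text \<open>Ideal sheaf of the line \<open>c x + d y + e = 0\<close> in the projective plane with homogeneous
  coordinates \<open>(x : y : 1)\<close>; near \<open>R\<close> a local equation is \<open>(c x + d y + e) / w\<close>, where \<open>w\<close> is a
  homogeneous coordinate not vanishing at \<open>R\<close>.\<close>

fun line_ideal :: "ratfun \<Rightarrow> ratfun \<Rightarrow> complex \<times> complex \<times> complex \<Rightarrow> local_ring \<Rightarrow> ratfun set" where
  "line_ideal x y (c, d, e) R =
     {r * ((cst c * x + cst d * y + cst e) / w) | r w.
        r \<in> R \<and> w \<in> {x, y, 1} \<and> {x / w, y / w, 1 / w} \<subseteq> R}"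


section \<open>The seventeen blow-ups\<close>

definition chart_xx :: coords where "chart_xx = (x0, x1, x2, x3)"
definition chart_xz :: coords where "chart_xz = (x0, x1, x2 / x3, 1 / x3)"
definition chart_zx :: coords where "chart_zx = (x0 / x1, 1 / x1, x2, x3)"
definition chart_zz :: coords where "chart_zz = (x0 / x1, 1 / x1, x2 / x3, 1 / x3)"

text \<open>The coordinate changes for the blow-ups 1--5 and 6--10 are the same, with the two factors
  interchanged.\<close>

fun step1 :: "coords \<Rightarrow> coords" where
  "step1 (x, y, z, w) = (x - 1, y, z / (x - 1), w / (x - 1))"
fun step2 :: "coords \<Rightarrow> coords" where
  "step2 (s, t, u, v) = (s, t, u, v / s)"
fun step3 :: "complex \<Rightarrow> coords \<Rightarrow> coords" where
  "step3 h (s, t, u, v) = (s, t, (u + cst h / (1 + cst h * t)) / s, v)"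
fun step4 :: "complex \<Rightarrow> coords \<Rightarrow> coords" where
  "step4 h (s, t, u, v) = (s, t, u, (v - 1 / (1 + cst h * t)) / s)"
fun step5 :: "complex \<Rightarrow> coords \<Rightarrow> coords" where
  "step5 h (s, t, u, v) = (s, t, u, (v - 1 / (1 + cst h * t) ^ 2) / s)"
fun step11 :: "coords \<Rightarrow> coords" where
  "step11 (z0, z1, z2, z3) = (z0, z1 / z0, z2 / z0, z3 / z0)"
fun step12 :: "coords \<Rightarrow> coords" where
  "step12 (s, t, u, v) = (s, t, (u - 1) / t, v / t)"
fun step13 :: "coords \<Rightarrow> coords" where
  "step13 (s, t, u, v) = (s, t, u, (v + 1) / t)"
fun step14 :: "complex \<Rightarrow> coords \<Rightarrow> coords" where
  "step14 h (s, t, u, v) = (s / t, t, (u - 1 - cst h) / t, v / t)"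
fun step15 :: "complex \<Rightarrow> coords \<Rightarrow> coords" where
  "step15 h (s, t, u, v) = (s, t, v, (u + 2 * v + s / cst h) / t)"
fun step16 :: "complex \<Rightarrow> coords \<Rightarrow> coords" where
  "step16 h (s, t, u, v) = (s, t, (u + s / cst h) / t, v)"

definition chart1 :: coords where "chart1 = step1 chart_xz"
definition chart2 :: coords where "chart2 = step2 chart1"
definition chart3 :: "complex \<Rightarrow> coords" where "chart3 h = step3 h chart2"
definition chart4 :: "complex \<Rightarrow> coords" where "chart4 h = step4 h (chart3 h)"
definition chart5 :: "complex \<Rightarrow> coords" where "chart5 h = step5 h (chart4 h)"

definition chart6 :: coords where
  "chart6 = (case chart_zx of (z0, z1, y2, y3) \<Rightarrow> step1 (y2, y3, z0, z1))"
definition chart7 :: coords where "chart7 = step2 chart6"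
definition chart8 :: "complex \<Rightarrow> coords" where "chart8 h = step3 h chart7"
definition chart9 :: "complex \<Rightarrow> coords" where "chart9 h = step4 h (chart8 h)"
definition chart10 :: "complex \<Rightarrow> coords" where "chart10 h = step5 h (chart9 h)"

definition chart11 :: coords where "chart11 = step11 chart_zz"
definition chart12 :: coords where "chart12 = step12 chart11"
definition chart13 :: coords where "chart13 = step13 chart12"
definition chart14 :: "complex \<Rightarrow> coords" where "chart14 h = step14 h chart13"
definition chart15 :: "complex \<Rightarrow> coords" where "chart15 h = step15 h (chart14 h)"
definition chart16 :: "complex \<Rightarrow> coords" where "chart16 h = step16 h (chart15 h)"

text \<open>Chart and parametrised set of points for the centers 1 to 17, in this order.  Parameter
  values at which a denominator \<open>1 + h P\<close> vanishes are excluded, as division by zero would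
  yield \<open>0\<close>.\<close>

definition center_data :: "complex \<Rightarrow> (coords \<times> pt set) list" where
  "center_data h =
    [(chart_xz,  {(1, P, 0, 0) | P. True}),
     (chart1,    {(0, P, Q, 0) | P Q. True}),
     (chart2,    {(0, P, - h / (1 + h * P), Q) | P Q. 1 + h * P \<noteq> 0}),
     (chart3 h,  {(0, P, Q, 1 / (1 + h * P)) | P Q. 1 + h * P \<noteq> 0}),
     (chart4 h,  {(0, P, Q, 1 / (1 + h * P) ^ 2) | P Q. 1 + h * P \<noteq> 0}),
     (chart_zx,  {(0, 0, 1, P) | P. True}),
     (chart6,    {(0, P, Q, 0) | P Q. True}),
     (chart7,    {(0, P, - h / (1 + h * P), Q) | P Q. 1 + h * P \<noteq> 0}),
     (chart8 h,  {(0, P, Q, 1 / (1 + h * P)) | P Q. 1 + h * P \<noteq> 0}),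
     (chart9 h,  {(0, P, Q, 1 / (1 + h * P) ^ 2) | P Q. 1 + h * P \<noteq> 0}),
     (chart_zz,  {(0, 0, 0, 0)}),
     (chart11,   {(P, 0, 1, 0) | P. True}),
     (chart12,   {(P, 0, Q, - 1) | P Q. True}),
     (chart13,   {(0, 0, 1 + h, 0)}),
     (chart14 h, {(P, 0, - 2 * Q - P / h, Q) | P Q. True}),
     (chart15 h, {(P, 0, - P / h, Q) | P Q. True}),
     (chart16 h, {(P, 0, Q, Q / 2 + (1 + h) / h * P) | P Q. True})]"

definition center :: "complex \<Rightarrow> nat \<Rightarrow> variety \<Rightarrow> local_ring set" where
  "center h i X =
     (case center_data h ! (i - 1) of (c, Z) \<Rightarrow> zariski_closure X (X \<inter> point_at c ` Z))"

text \<open>The curves with indices 1 and 6 meet exactly at the point with index 11, the origin of the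
  chart \<open>(z0,z1,z2,z3)\<close>.  That chart is a chart at this point only as long as neither curve has
  been blown up, so the point is blown up first; otherwise the numerical order is kept.\<close>

definition blowup_order :: "nat list" where
  "blowup_order = [11, 1, 2, 3, 4, 5, 6, 7, 8, 9, 10, 12, 13, 14, 15, 16, 17]"

primrec stage :: "complex \<Rightarrow> nat \<Rightarrow> variety" where
  "stage h 0 = P2xP2"
| "stage h (Suc n) = blowup (stage h n) (center h (blowup_order ! n) (stage h n))"

definition var_X :: "complex \<Rightarrow> variety" where
  "var_X h = stage h 17"

text \<open>The variety in which the \<open>i\<close>-th center lies.\<close>

definition stage_before :: "complex \<Rightarrow> nat \<Rightarrow> variety" where
  "stage_before h i = stage h (if i = 11 then 0 else if i \<le> 10 then i else i - 1)"

text \<open>Total transforms in \<open>\<X>\<close> of a line in the first and in the second factor and of the \<open>i\<close>-th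
  exceptional divisor.  The ideal sheaf of the latter is the inverse image of that of the
  \<open>i\<close>-th center, so its total transform is the total transform of the center.\<close>

definition H_a :: "complex \<Rightarrow> complex \<times> complex \<times> complex \<Rightarrow> divisor" where
  "H_a h l = total_transform (var_X h) P2xP2 (line_ideal x0 x1 l)"

definition H_b :: "complex \<Rightarrow> complex \<times> complex \<times> complex \<Rightarrow> divisor" where
  "H_b h l = total_transform (var_X h) P2xP2 (line_ideal x2 x3 l)"

definition E :: "complex \<Rightarrow> nat \<Rightarrow> divisor" where
  "E h i = total_transform (var_X h) (stage_before h i) (ideal_at (center h i (stage_before h i)))"

text \<open>\<open>Pic(\<X>)\<close> is freely generated by the classes of \<open>H_a\<close>, \<open>H_b\<close> and \<open>E 1, \<dots>, E 17\<close>.\<close>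

definition Pic_free_basis ::
    "complex \<Rightarrow> complex \<times> complex \<times> complex \<Rightarrow> complex \<times> complex \<times> complex \<Rightarrow> bool" where
  "Pic_free_basis h la lb \<longleftrightarrow>
     bij_betw (\<lambda>(a, b, e). div_class (var_X h)
                 (\<lambda>V. a * H_a h la V + b * H_b h lb V + (\<Sum>i = 1..17. e i * E h i V)))
       (UNIV \<times> UNIV \<times> {e. \<forall>i. i \<notin> {1..17} \<longrightarrow> e i = 0})
       (carrier (Pic (var_X h)))"

definition I1 :: "complex \<Rightarrow> ratfun" where
  "I1 h = (let k = cst h in
     - k * x0^2 - k * x0 * x2 + k^2 * x0 * x2 + k * x0^2 * x2 - k * x2^2 + k * x0 * x2^2)"

definition I2 :: "complex \<Rightarrow> ratfun" where
  "I2 h = (let k = cst h in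
     2 * k * x0 + x0^2 - 2 * k * x0 * x1 + 2 * k * x2 + x0 * x2 - k * x1 * x2 + k^2 * x1 * x2
     + 2 * k * x0 * x1 * x2 + x2^2 + k * x1 * x2^2 - k * x0 * x3 + k^2 * x0 * x3 + k * x0^2 * x3
     - 2 * k * x2 * x3 + 2 * k * x0 * x2 * x3)"

end

theory Submission
  imports Defs "HOL-Computational_Algebra.Polynomial_Factorial" "HOL-Computational_Algebra.Field_as_Ring"
begin

text \<open>
  A prime divisor is represented by its discrete valuation ring. Each of the exceptional divisors is the ring of a
  coordinate hyperplane of an explicit chart, so orders of vanishing along it can be read off from the expansion of a
  function in the coordinates of that chart. A blow-up changes a discrete valuation ring only if every function of it
  is regular somewhere on the center; exhibiting one function that is regular nowhere on the center therefore shows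
  that a divisor survives and that the total transform of the center vanishes along it. This yields the
  orders of \<open>H_a\<close>, \<open>H_b\<close> and \<open>E i\<close> along all divisors at infinity. Surjectivity in \<open>Pic_free_basis\<close> implies that there are no
  further prime divisors. Hence a hypersurface lies in the given class iff its equation has prescribed orders along
  19 valuations. The equation is then a bidegree (2,2) polynomial, the divisor 11 reduces it to 21 coefficients, and
  restricting to one test curve through each of the divisors 5, 10 and 17 leaves exactly the span of \<open>1\<close>, \<open>I1\<close>, \<open>I2\<close>.
\<close>

section \<open>Subrings and local rings of the function field\<close>

text \<open>No blow-up is described globally: of each one a single affine chart is followed, in
  coordinates translated so that the center is a coordinate subspace. This is enough because that
  chart contains the generic point of the new exceptional divisor. Denominators such as
  \<open>1 + h P\<close> force most charts to be shrunk to a principal open set, and one then has to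
  know that the inverted function is a unit along the new divisor. The matrix of orders of
  \<open>E i\<close> along the exceptional divisors is triangular with ones on the diagonal; this is
  what translates multiplicities in a class into orders and back. Principal divisors are under
  control because affine 4-space has no nonconstant invertible functions: a rational function is
  determined up to a constant by its divisor there, so all further information sits at the two
  divisors at infinity and at the 17 exceptional ones. The test curves are chosen so that the
  numerators restrict to multiples of one common factor that is a unit at the origin of the curve;
  after cancelling it only a few low coefficients have to vanish.\<close>

definition sring :: "ratfun set \<Rightarrow> bool" where
  "sring A \<longleftrightarrow> 1 \<in> A \<and> (\<forall>a\<in>A. \<forall>b\<in>A. a + b \<in> A \<and> a * b \<in> A) \<and> (\<forall>a\<in>A. - a \<in> A)"

lemma sringD:
  assumes "sring A"
  shows "1 \<in> A" "0 \<in> A" "a \<in> A \<Longrightarrow> b \<in> A \<Longrightarrow> a + b \<in> A" "a \<in> A \<Longrightarrow> b \<in> A \<Longrightarrow> a * b \<in> A"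
    "a \<in> A \<Longrightarrow> - a \<in> A" "a \<in> A \<Longrightarrow> b \<in> A \<Longrightarrow> a - b \<in> A"
proof -
  show 1: "1 \<in> A" and add: "\<And>a b. a \<in> A \<Longrightarrow> b \<in> A \<Longrightarrow> a + b \<in> A"
    and "a \<in> A \<Longrightarrow> b \<in> A \<Longrightarrow> a * b \<in> A" and neg: "\<And>a. a \<in> A \<Longrightarrow> - a \<in> A"
    using assms by (auto simp: sring_def)
  show "0 \<in> A" using add[OF 1 neg[OF 1]] by simp
  show "a \<in> A \<Longrightarrow> b \<in> A \<Longrightarrow> a - b \<in> A" using add[of a "- b"] neg by simp
qed

lemma sring_power: "sring A \<Longrightarrow> a \<in> A \<Longrightarrow> a ^ n \<in> A"
  by (induction n) (auto simp: sringD)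

lemma Kring_sel [simp]:
  "carrier (Kring\<lparr>carrier := A\<rparr>) = A" "mult (Kring\<lparr>carrier := A\<rparr>) = (*)" "one (Kring\<lparr>carrier := A\<rparr>) = 1"
  "zero (Kring\<lparr>carrier := A\<rparr>) = 0" "add (Kring\<lparr>carrier := A\<rparr>) = (+)"
  "carrier Kring = UNIV" "mult Kring = (*)" "one Kring = 1" "zero Kring = 0" "add Kring = (+)"
  by (simp_all add: Kring_def)

lemma cring_subring_of_K:
  assumes "sring A"
  shows "cring (subring_of_K A)"
proof (rule cringI)
  show "abelian_group (subring_of_K A)"
    by (rule abelian_groupI) (auto simp: sringD[OF assms] algebra_simps intro: bexI[of _ "- x" for x])
  show "Group.comm_monoid (subring_of_K A)"
    by (rule comm_monoidI) (auto simp: sringD[OF assms] algebra_simps)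
qed (auto simp: algebra_simps)

lemma sring_UNIV: "sring UNIV"
  by (simp add: sring_def)

lemma cring_Kring: "cring Kring"
  using cring_subring_of_K[OF sring_UNIV] by (simp add: Kring_def)

lemma Kring_uminus [simp]: "\<ominus>\<^bsub>Kring\<^esub> a = - a"
proof -
  interpret cring Kring by (rule cring_Kring)
  show ?thesis using minus_equality[of "- a" a] by simp
qed

lemma sring_subring: "sring A \<longleftrightarrow> subring A Kring"
proof
  interpret cring Kring by (rule cring_Kring)
  show "sring A \<Longrightarrow> subring A Kring"
    by (rule subringI) (auto simp: sringD)
  show "subring A Kring \<Longrightarrow> sring A"
    using subringE[of A Kring] by (auto simp: sring_def)
qed

text \<open>Prime ideals spelled out elementwise, as \<open>sring\<close> does for subrings;
  \<open>primeideal_iff_prm\<close> is the bridge to the structure-based notion used in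
  \<open>affine\<close> and \<open>blowup\<close>.\<close>

definition prm :: "ratfun set \<Rightarrow> ratfun set \<Rightarrow> bool" where
  "prm A p \<longleftrightarrow> p \<subseteq> A \<and> 0 \<in> p \<and> (\<forall>a\<in>p. \<forall>b\<in>p. a + b \<in> p) \<and> (\<forall>a\<in>A. \<forall>b\<in>p. a * b \<in> p) \<and> 1 \<notin> p \<and>
     (\<forall>a\<in>A. \<forall>b\<in>A. a * b \<in> p \<longrightarrow> a \<in> p \<or> b \<in> p)"

lemma prmD:
  assumes "prm A p"
  shows "a \<in> p \<Longrightarrow> a \<in> A" "0 \<in> p" "a \<in> p \<Longrightarrow> b \<in> p \<Longrightarrow> a + b \<in> p" "a \<in> A \<Longrightarrow> b \<in> p \<Longrightarrow> a * b \<in> p"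
    "a \<in> p \<Longrightarrow> b \<in> A \<Longrightarrow> a * b \<in> p"
    "1 \<notin> p" "a \<in> A \<Longrightarrow> b \<in> A \<Longrightarrow> a * b \<in> p \<Longrightarrow> a \<in> p \<or> b \<in> p"
  using assms unfolding prm_def by (auto simp: mult.commute)

lemma subring_of_K_uminus:
  assumes "sring A" "a \<in> A"
  shows "\<ominus>\<^bsub>subring_of_K A\<^esub> a = - a"
proof -
  interpret cring "subring_of_K A" using assms by (intro cring_subring_of_K)
  show ?thesis using minus_equality[of "- a" a] assms by (simp add: sringD)
qed

lemma ideal_subring_of_KI:
  assumes A: "sring A" and p: "p \<subseteq> A" "0 \<in> p" "\<And>a b. a \<in> p \<Longrightarrow> b \<in> p \<Longrightarrow> a + b \<in> p"
    "\<And>a b. a \<in> A \<Longrightarrow> b \<in> p \<Longrightarrow> a * b \<in> p"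
  shows "ideal p (subring_of_K A)"
proof -
  interpret cring "subring_of_K A" using A by (intro cring_subring_of_K)
  have neg: "- a \<in> p" if "a \<in> p" for a
    using p(4)[of "- 1" a] that A by (simp add: sringD)
  have "subgroup p (add_monoid (subring_of_K A))"
  proof (rule add.subgroupI)
    show "\<And>a. a \<in> p \<Longrightarrow> \<ominus>\<^bsub>subring_of_K A\<^esub> a \<in> p"
      using neg p(1) A by (auto simp: subring_of_K_uminus subset_iff)
  qed (use p in auto)
  moreover have "b * a \<in> p" if "a \<in> A" "b \<in> p" for a b
    using p(4)[OF that] by (simp add: mult.commute)
  ultimately show ?thesis
    by (intro idealI[OF ring_axioms]) (use p in auto)
qed

lemma primeideal_iff_prm:
  assumes A: "sring A"
  shows "primeideal p (subring_of_K A) \<longleftrightarrow> prm A p"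
proof
  assume "primeideal p (subring_of_K A)"
  then interpret primeideal p "subring_of_K A" .
  have "1 \<notin> p" using one_imp_carrier I_notcarr by auto
  then show "prm A p" unfolding prm_def
    using a_subset I_l_closed I_prime additive_subgroup.zero_closed[OF is_additive_subgroup]
      additive_subgroup.a_closed[OF is_additive_subgroup] by auto
next
  assume p: "prm A p"
  show "primeideal p (subring_of_K A)"
  proof (rule primeidealI)
    show "ideal p (subring_of_K A)" by (rule ideal_subring_of_KI[OF A]) (use prmD[OF p] in auto)
    show "cring (subring_of_K A)" using A by (rule cring_subring_of_K)
    show "carrier (subring_of_K A) \<noteq> p" using prmD[OF p] sringD[OF A] by auto
  qed (use prmD[OF p] in auto)
qed

abbreviation gen :: "ratfun set \<Rightarrow> ratfun set" where
  "gen H \<equiv> generate_ring Kring H"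

lemma sring_gen: "sring (gen H)"
proof -
  interpret cring Kring by (rule cring_Kring)
  show ?thesis unfolding sring_subring by (rule generate_ring_is_subring) simp
qed

lemma gen_incl: "H \<subseteq> gen H"
  by (auto intro: generate_ring.incl)

lemma gen_min: "sring T \<Longrightarrow> H \<subseteq> T \<Longrightarrow> gen H \<subseteq> T"
proof -
  interpret cring Kring by (rule cring_Kring)
  show "sring T \<Longrightarrow> H \<subseteq> T \<Longrightarrow> gen H \<subseteq> T"
    unfolding sring_subring by (rule generate_ring_min_subring1) auto
qed

text \<open>A ring is local exactly when its nonunits form an ideal, so the condition on
  \<open>maxideal R\<close> encodes locality, and the maximal ideal need not be carried
  along.\<close>

definition lring :: "ratfun set \<Rightarrow> bool" where
  "lring R \<longleftrightarrow> sring R \<and> prm R (maxideal R)"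

lemma lring_sring: "lring R \<Longrightarrow> sring R" and lring_prm: "lring R \<Longrightarrow> prm R (maxideal R)"
  by (auto simp: lring_def)

lemma maxideal_iff: "a \<in> maxideal R \<longleftrightarrow> a \<in> R \<and> (a = 0 \<or> inverse a \<notin> R)"
  by (simp add: maxideal_def)

lemma localizationI: "a \<in> A \<Longrightarrow> b \<in> A \<Longrightarrow> b \<notin> p \<Longrightarrow> a / b \<in> localization A p"
  unfolding localization_def by blast

lemma localizationE:
  assumes "x \<in> localization A p"
  obtains a b where "x = a / b" "a \<in> A" "b \<in> A" "b \<notin> p"
  using assms unfolding localization_def by blast

lemma lring_localization:
  assumes A: "sring A" and p: "prm A p"
  shows "lring (localization A p)" "A \<subseteq> localization A p"
    "maxideal (localization A p) = {a / b | a b. a \<in> p \<and> b \<in> A \<and> b \<notin> p}"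
    "maxideal (localization A p) \<inter> A = p"
proof -
  let ?R = "localization A p"
  have nz: "b \<noteq> 0" if "b \<notin> p" for b using that prmD[OF p] by auto
  show sub: "A \<subseteq> ?R"
    using localizationI[of _ A 1 p] prmD(6)[OF p] sringD(1)[OF A] by auto
  have mulnp: "b * d \<notin> p" if "b \<in> A" "d \<in> A" "b \<notin> p" "d \<notin> p" for b d
    using prmD(7)[OF p] that by blast
  have sr: "sring ?R" unfolding sring_def
  proof (intro conjI ballI)
    show "1 \<in> ?R" using sub sringD[OF A] by auto
    fix x assume "x \<in> ?R"
    then obtain a b where x: "x = a / b" "a \<in> A" "b \<in> A" "b \<notin> p" by (auto simp: localization_def)
    have "- x = (- a) / b" using x by simp
    then show "- x \<in> ?R" using localizationI[OF sringD(5)[OF A x(2)] x(3,4)] by simp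
    fix y assume "y \<in> ?R"
    then obtain c d where y: "y = c / d" "c \<in> A" "d \<in> A" "d \<notin> p" by (auto simp: localization_def)
    have "x + y = (a * d + c * b) / (b * d)" using x y nz by (simp add: field_simps)
    also have "\<dots> \<in> ?R"
      using x y mulnp by (intro localizationI sringD[OF A]) auto
    finally show "x + y \<in> ?R" .
    have "x * y = (a * c) / (b * d)" using x y by simp
    also have "\<dots> \<in> ?R"
      using x y mulnp by (intro localizationI sringD[OF A]) auto
    finally show "x * y \<in> ?R" .
  qed
  \<comment> \<open>Whether a fraction is a unit depends on its numerator alone, whatever
    representation is chosen; the claims about the maximal ideal all reduce to this.\<close>
  have key: "a / b \<in> maxideal ?R \<longleftrightarrow> a \<in> p" if ab: "a \<in> A" "b \<in> A" "b \<notin> p" for a b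
  proof
    assume "a \<in> p"
    have "a = 0" if "inverse (a / b) \<in> ?R"
    proof (rule ccontr)
      assume a0: "a \<noteq> 0"
      from that obtain c d where y: "b / a = c / d" "c \<in> A" "d \<in> A" "d \<notin> p"
        by (auto simp: localization_def)
      have "b * d = c * a" using y a0 nz[OF y(4)] by (simp add: field_simps)
      moreover have "c * a \<in> p" using prmD[OF p] y \<open>a \<in> p\<close> by auto
      ultimately show False using mulnp ab y by metis
    qed
    then show "a / b \<in> maxideal ?R" unfolding maxideal_iff
      using ab by (auto simp: localization_def)
  next
    assume m: "a / b \<in> maxideal ?R"
    show "a \<in> p"
    proof (rule ccontr)
      assume "a \<notin> p"
      then have "b / a \<in> ?R" using ab by (intro localizationI)
      then show False using m \<open>a \<notin> p\<close> nz[of a] nz[of b] ab unfolding maxideal_iff by simp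
    qed
  qed
  show mx: "maxideal ?R = {a / b | a b. a \<in> p \<and> b \<in> A \<and> b \<notin> p}"
  proof (intro subset_antisym subsetI)
    fix x assume x: "x \<in> maxideal ?R"
    then obtain a b where "x = a / b" "a \<in> A" "b \<in> A" "b \<notin> p" by (auto simp: localization_def maxideal_iff)
    then show "x \<in> {a / b | a b. a \<in> p \<and> b \<in> A \<and> b \<notin> p}" using key x by blast
  qed (use key prmD[OF p] in blast)
  have keyA: "a \<in> maxideal ?R \<longleftrightarrow> a \<in> p" if "a \<in> A" for a
    using key[of a 1] that sringD[OF A] prmD[OF p] by simp
  then show "maxideal ?R \<inter> A = p" using prmD(1)[OF p] by auto
  have "prm ?R (maxideal ?R)" unfolding prm_def
  proof (intro conjI ballI impI)
    show "maxideal ?R \<subseteq> ?R" by (auto simp: maxideal_iff)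
    show "0 \<in> maxideal ?R" using sringD[OF sr] by (auto simp: maxideal_iff)
    show "1 \<notin> maxideal ?R" using sringD[OF sr] by (auto simp: maxideal_iff)
  next
    fix x y assume "x \<in> maxideal ?R" "y \<in> maxideal ?R"
    then obtain a b c d where *: "x = a / b" "a \<in> p" "b \<in> A" "b \<notin> p" "y = c / d" "c \<in> p" "d \<in> A" "d \<notin> p"
      unfolding mx by blast
    have "x + y = (a * d + c * b) / (b * d)" using * nz by (simp add: field_simps)
    moreover have "a * d + c * b \<in> p" using * prmD[OF p] by auto
    moreover have "b * d \<in> A" "b * d \<notin> p" using * mulnp sringD[OF A] by auto
    ultimately show "x + y \<in> maxideal ?R" unfolding mx by blast
  next
    fix x y assume "x \<in> ?R" "y \<in> maxideal ?R"
    then obtain a b c d where *: "x = a / b" "a \<in> A" "b \<in> A" "b \<notin> p" "y = c / d" "c \<in> p" "d \<in> A" "d \<notin> p"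
      unfolding mx by (blast elim: localizationE)
    have "x * y = (a * c) / (b * d)" using * by simp
    moreover have "a * c \<in> p" using * prmD[OF p] by auto
    moreover have "b * d \<in> A" "b * d \<notin> p" using * mulnp sringD[OF A] by auto
    ultimately show "x * y \<in> maxideal ?R" unfolding mx by blast
  next
    fix x y assume "x \<in> ?R" "y \<in> ?R" and xy: "x * y \<in> maxideal ?R"
    then obtain a b c d where *: "x = a / b" "a \<in> A" "b \<in> A" "b \<notin> p" "y = c / d" "c \<in> A" "d \<in> A" "d \<notin> p"
      unfolding localization_def by blast
    have "(a * c) / (b * d) \<in> maxideal ?R" using xy * by simp
    then have "a * c \<in> p" using key[of "a * c" "b * d"] * mulnp[of b d] sringD(4)[OF A] by blast
    then show "x \<in> maxideal ?R \<or> y \<in> maxideal ?R" using prmD(7)[OF p *(2,6)] key * by blast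
  qed
  then show "lring ?R" using sr by (simp add: lring_def)
qed

lemma lring_units:
  assumes "lring R" "a \<in> R" "a \<notin> maxideal R"
  shows "a \<noteq> 0" "inverse a \<in> R" "1 / a \<in> R"
  using assms sringD[OF lring_sring[OF assms(1)]] by (auto simp: maxideal_iff divide_inverse)

lemma localization_subset:
  assumes "lring R" "A \<subseteq> R" "A \<inter> maxideal R \<subseteq> p"
  shows "localization A p \<subseteq> R"
proof
  fix x assume "x \<in> localization A p"
  then obtain a b where x: "x = a / b" "a \<in> A" "b \<in> A" "b \<notin> p" by (auto simp: localization_def)
  then have "inverse b \<in> R" using lring_units[OF assms(1), of b] assms by auto
  then show "x \<in> R" using x assms sringD[OF lring_sring[OF assms(1)]] by (auto simp: divide_inverse)
qed

lemma prm_contract: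
  assumes "lring V" "sring B" "B \<subseteq> V"
  shows "prm B (B \<inter> maxideal V)"
  using prmD[OF lring_prm[OF assms(1)]] assms(3) sringD[OF assms(2)] unfolding prm_def
  by (auto simp: subset_iff)

text \<open>The center of \<open>V\<close> on the affine chart with ring \<open>B\<close>:
  contracting the maximal ideal of \<open>V\<close> gives the point of the chart that lies under
  \<open>V\<close>. This is how points below a divisor are located.\<close>

lemma dominates_localization:
  assumes "lring V" "sring B" "B \<subseteq> V"
  shows "dominates V (localization B (B \<inter> maxideal V))"
proof -
  let ?p = "B \<inter> maxideal V"
  have p: "prm B ?p" by (rule prm_contract[OF assms])
  have s: "localization B ?p \<subseteq> V" by (rule localization_subset[OF assms(1,3)]) auto
  have "maxideal (localization B ?p) = maxideal V \<inter> localization B ?p"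
  proof (intro subset_antisym subsetI)
    fix x assume "x \<in> maxideal (localization B ?p)"
    then obtain a b where x: "x = a / b" "a \<in> ?p" "b \<in> B" "b \<notin> ?p"
      unfolding lring_localization(3)[OF assms(2) p] by blast
    then have "inverse b \<in> V" using lring_units[OF assms(1), of b] assms(3) by auto
    then have "x \<in> maxideal V" using x prmD(5)[OF lring_prm[OF assms(1)], of a "inverse b"] by (simp add: divide_inverse)
    moreover have "x \<in> localization B ?p" using x unfolding localization_def by blast
    ultimately show "x \<in> maxideal V \<inter> localization B ?p" by blast
  next
    fix x assume "x \<in> maxideal V \<inter> localization B ?p"
    then show "x \<in> maxideal (localization B ?p)" using s by (auto simp: maxideal_iff)
  qed
  then show ?thesis using s by (simp add: dominates_def)
qed

lemma dominatesD:
  assumes "dominates S R"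
  shows "R \<subseteq> S" "a \<in> R \<Longrightarrow> a \<in> maxideal R \<longleftrightarrow> a \<in> maxideal S"
  using assms by (auto simp: dominates_def)

lemma dominates_trans: "dominates S R \<Longrightarrow> dominates R Q \<Longrightarrow> dominates S Q"
  by (auto simp: dominates_def)

lemma dominates_refl: "dominates R R"
  by (auto simp: dominates_def maxideal_iff)

text \<open>An element invertible in \<open>V\<close> lies outside the maximal ideal of
  \<open>V\<close>, hence by domination outside that of \<open>R\<close>. The separatedness proofs
  for the product of planes and for blow-ups rest on this.\<close>

lemma dominates_unit:
  assumes "lring R" "dominates V R" "a \<in> R" "inverse a \<in> V" "a \<noteq> 0"
  shows "inverse a \<in> R"
proof -
  have "a \<notin> maxideal V" using assms by (auto simp: maxideal_iff)
  then have "a \<notin> maxideal R" using assms by (auto simp: dominates_def)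
  then show ?thesis using lring_units assms by blast
qed

section \<open>Discrete valuation rings\<close>

lemma units_in_mult: "sring V \<Longrightarrow> a \<in> units_in V \<Longrightarrow> b \<in> units_in V \<Longrightarrow> a * b \<in> units_in V"
  by (auto simp: units_in_def sringD)

lemma units_in_inverse: "a \<in> units_in V \<Longrightarrow> inverse a \<in> units_in V"
  by (auto simp: units_in_def)

lemma units_in_powi: 
  assumes "sring V" "a \<in> units_in V"
  shows "a powi n \<in> units_in V"
proof -
  have "b ^ m \<in> units_in V" if "b \<in> units_in V" for b m
    using that by (induction m) (auto simp: units_in_mult[OF assms(1)] units_in_def sringD[OF assms(1)])
  then show ?thesis using assms units_in_inverse by (auto simp: power_int_def)
qed

lemma neg_int_obtain: "(n::int) < 0 \<Longrightarrow> \<exists>m. n = - int (Suc m)"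
  by (cases n rule: int_cases) auto

text \<open>Independence of the uniformizer: \<open>ord_at\<close> quantifies over it existentially
  inside a definite description, and this equivalence makes that description computable with any
  fixed \<open>\<pi>\<close>.\<close>

lemma dvr_ord:
  assumes V: "sring V" and u: "uniformizer V \<pi>" and a: "a \<noteq> 0"
  shows "a / \<pi> powi n \<in> units_in V \<longleftrightarrow> ord_at V a = n"
proof -
  have p0: "\<pi> \<noteq> 0" and pm: "\<pi> \<in> V" "inverse \<pi> \<notin> V" using u by (auto simp: uniformizer_def maxideal_iff)
  have nou: "n = 0" if "\<pi> powi n \<in> units_in V" for n
  proof (rule ccontr)
    assume "n \<noteq> 0"
    have "inverse (\<pi> ^ Suc m) \<notin> V" for m
    proof
      assume "inverse (\<pi> ^ Suc m) \<in> V"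
      then have "inverse (\<pi> ^ Suc m) * \<pi> ^ m \<in> V" by (rule sringD(4)[OF V _ sring_power[OF V pm(1)]])
      also have "inverse (\<pi> ^ Suc m) * \<pi> ^ m = inverse \<pi>" using p0 by (simp add: field_simps)
      finally show False using pm by simp
    qed
    then have "\<pi> powi k \<notin> V" if "k < 0" for k
      using neg_int_obtain[OF that] by (auto simp: power_int_minus simp del: of_nat_Suc power_Suc)
    from this[of n] this[of "- n"] that \<open>n \<noteq> 0\<close> show False 
      by (cases "n < 0") (auto simp: units_in_def power_int_minus)
  qed
  \<comment> \<open>Up to units each uniformizer is a power of the other, with exponents satisfying
    \<open>k * l = 1\<close>. A negative \<open>k\<close> would make the inverse of
    \<open>\<rho>\<close> regular, so \<open>k = 1\<close> and the quotient of the two uniformizers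
    is a unit.\<close>
  have uniq: "m = n" if h: "uniformizer V \<rho>" "a / \<pi> powi n \<in> units_in V" "a / \<rho> powi m \<in> units_in V" for \<rho> n m
  proof -
    have r0: "\<rho> \<noteq> 0" and rm: "\<rho> \<in> V" "inverse \<rho> \<notin> V" using h(1) by (auto simp: uniformizer_def maxideal_iff)
    obtain k where k: "\<rho> / \<pi> powi k \<in> units_in V" using u r0 by (auto simp: uniformizer_def)
    obtain l where l: "\<pi> / \<rho> powi l \<in> units_in V" using h(1) p0 by (auto simp: uniformizer_def)
    have "(\<pi> / \<rho> powi l) * (\<rho> / \<pi> powi k) powi l \<in> units_in V"
      using units_in_mult[OF V l units_in_powi[OF V k]] .
    also have "(\<pi> / \<rho> powi l) * (\<rho> / \<pi> powi k) powi l = \<pi> powi (1 - k * l)"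
      using r0 p0 by (simp add: power_int_divide_distrib power_int_mult power_int_diff field_simps)
    finally have "k * l = 1" using nou by fastforce
    moreover have "k \<ge> 0"
    proof (rule ccontr)
      assume "\<not> k \<ge> 0"
      then obtain m where m: "k = - int (Suc m)" using neg_int_obtain[of k] by (meson not_le)
      have "\<rho> * \<pi> ^ Suc m \<in> units_in V" using k p0 by (simp add: m power_int_minus divide_inverse del: of_nat_Suc power_Suc)
      then have "inverse \<rho> * inverse (\<pi> ^ Suc m) \<in> V" by (simp add: units_in_def)
      then have "inverse \<rho> * inverse (\<pi> ^ Suc m) * \<pi> ^ Suc m \<in> V" by (rule sringD(4)[OF V _ sring_power[OF V pm(1)]])
      then show False using p0 rm by (simp add: mult.assoc del: power_Suc)
    qed
    ultimately have k1: "k = 1" by (auto simp: zmult_eq_1_iff)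
    have "(a / \<pi> powi n) * inverse (a / \<rho> powi m) * inverse ((\<rho> / \<pi>) powi m) \<in> units_in V"
      by (intro units_in_mult[OF V] units_in_inverse units_in_powi[OF V]) (use h k k1 in simp_all)
    also have "(a / \<pi> powi n) * inverse (a / \<rho> powi m) * inverse ((\<rho> / \<pi>) powi m) = \<pi> powi (m - n)"
      using r0 p0 a by (simp add: power_int_divide_distrib power_int_diff field_simps)
    finally show ?thesis using nou by fastforce
  qed
  obtain n0 where n0: "a / \<pi> powi n0 \<in> units_in V" using u a by (auto simp: uniformizer_def)
  have "ord_at V a = n0" unfolding ord_at_def
    by (rule the_equality) (use u n0 uniq in blast)+
  then show ?thesis using n0 uniq[OF u] by auto
qed

locale dvr =
  fixes V :: "ratfun set" and \<pi> :: ratfun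
  assumes sr: "sring V" and unif: "uniformizer V \<pi>"
begin

lemma pi: "\<pi> \<noteq> 0" "\<pi> \<in> V" "inverse \<pi> \<notin> V"
  using unif by (auto simp: uniformizer_def maxideal_iff)

lemma ordI: "a \<noteq> 0 \<Longrightarrow> a / \<pi> powi n \<in> units_in V \<Longrightarrow> ord_at V a = n"
  using dvr_ord[OF sr unif] by blast

lemma ordD: "a \<noteq> 0 \<Longrightarrow> a / \<pi> powi ord_at V a \<in> units_in V"
  using dvr_ord[OF sr unif] by blast

lemma ord_mult: "a \<noteq> 0 \<Longrightarrow> b \<noteq> 0 \<Longrightarrow> ord_at V (a * b) = ord_at V a + ord_at V b"
  using units_in_mult[OF sr ordD[of a] ordD[of b]] pi
  by (intro ordI) (auto simp: power_int_add)

lemma ord_unit: "a \<in> units_in V \<Longrightarrow> ord_at V a = 0"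
  by (rule ordI) (auto simp: units_in_def)

lemma ord_1: "ord_at V 1 = 0"
  by (rule ord_unit) (auto simp: units_in_def sringD[OF sr])

lemma ord_pi: "ord_at V \<pi> = 1"
  by (rule ordI) (auto simp: units_in_def sringD[OF sr] pi)

lemma ord_inverse: "a \<noteq> 0 \<Longrightarrow> ord_at V (inverse a) = - ord_at V a"
  using ord_mult[of a "inverse a"] ord_1 by simp

lemma ord_divide: "a \<noteq> 0 \<Longrightarrow> b \<noteq> 0 \<Longrightarrow> ord_at V (a / b) = ord_at V a - ord_at V b"
  using ord_mult[of a "inverse b"] ord_inverse[of b] by (simp add: divide_inverse)

lemma ord_power: "a \<noteq> 0 \<Longrightarrow> ord_at V (a ^ n) = int n * ord_at V a"
  by (induction n) (auto simp: ord_1 ord_mult algebra_simps)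

lemma ord_nonneg_iff: 
  assumes "a \<noteq> 0"
  shows "ord_at V a \<ge> 0 \<longleftrightarrow> a \<in> V"
proof -
  obtain u where u: "u \<in> units_in V" "a = u * \<pi> powi ord_at V a"
    using ordD[OF assms] pi by (metis nonzero_eq_divide_eq power_int_eq_0_iff)
  show ?thesis
  proof
    assume "ord_at V a \<ge> 0"
    then have "a = u * \<pi> ^ nat (ord_at V a)" using u(2) by (simp add: power_int_def)
    moreover have "u * \<pi> ^ nat (ord_at V a) \<in> V"
      using u(1) by (intro sringD(4)[OF sr _ sring_power[OF sr pi(2)]]) (simp add: units_in_def)
    ultimately show "a \<in> V" by simp
  next
    assume a: "a \<in> V"
    show "ord_at V a \<ge> 0"
    proof (rule ccontr)
      assume "\<not> ?thesis"
      then obtain m where m: "ord_at V a = - int (Suc m)" using neg_int_obtain[of "ord_at V a"] by (meson not_le)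
      have "a * inverse u * \<pi> ^ m \<in> V" using a u(1) sringD[OF sr] sring_power[OF sr pi(2)] by (auto simp: units_in_def)
      also have "a * inverse u * \<pi> ^ m = inverse \<pi>" using u pi
        by (subst u(2)) (simp add: m power_int_minus units_in_def field_simps del: of_nat_Suc)
      finally show False using pi by simp
    qed
  qed
qed

lemma ord_pos_iff: "a \<noteq> 0 \<Longrightarrow> ord_at V a > 0 \<longleftrightarrow> a \<in> maxideal V"
  using ord_nonneg_iff[of a] ord_nonneg_iff[of "inverse a"] ord_inverse[of a] by (auto simp: maxideal_iff)

lemma maxideal_eq: "a \<in> maxideal V \<longleftrightarrow> a / \<pi> \<in> V"
  using ord_pos_iff[of a] ord_nonneg_iff[of "a / \<pi>"] ord_divide[of a \<pi>] pi sringD[OF sr]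
  by (cases "a = 0") (auto simp: ord_pi maxideal_iff)

lemma lring: "lring V"
proof -
  have "prm V (maxideal V)" unfolding prm_def
  proof (intro conjI ballI impI)
    show "maxideal V \<subseteq> V" "0 \<in> maxideal V" "1 \<notin> maxideal V" using sringD[OF sr] by (auto simp: maxideal_iff)
    show "a + b \<in> maxideal V" if "a \<in> maxideal V" "b \<in> maxideal V" for a b
      using that sringD[OF sr] by (auto simp: maxideal_eq add_divide_distrib)
    show "a * b \<in> maxideal V" if "a \<in> V" "b \<in> maxideal V" for a b
      using that sringD(4)[OF sr, of a "b / \<pi>"] by (auto simp: maxideal_eq)
    show "a \<in> maxideal V \<or> b \<in> maxideal V" if "a \<in> V" "b \<in> V" "a * b \<in> maxideal V" for a b
      using that sringD(4)[OF sr, of "inverse a" "inverse b"] by (auto simp: maxideal_iff)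
  qed
  then show ?thesis by (simp add: lring_def sr)
qed

text \<open>A discrete valuation ring is maximal among the proper subrings of its field: an element
  of negative order produces the inverse of \<open>\<pi>\<close>, and then every element. This
  rigidity lets divisors survive blow-ups and turns inclusions of valuation rings into
  equalities.\<close>

lemma overring:
  assumes "sring R" "V \<subseteq> R"
  shows "R = V \<or> R = UNIV"
proof (rule disjCI)
  assume "R \<noteq> UNIV"
  show "R = V"
  proof (rule ccontr)
    assume "R \<noteq> V"
    then obtain a where a: "a \<in> R" "a \<notin> V" using assms by auto
    then have a0: "a \<noteq> 0" using sringD[OF sr] by auto
    have "ord_at V a < 0" using ord_nonneg_iff[OF a0] a by auto
    then have "inverse (a * \<pi>) \<in> V" using a0 pi
      by (subst ord_nonneg_iff[symmetric]) (auto simp: ord_inverse ord_mult ord_pi)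
    then have "a * inverse (a * \<pi>) \<in> R" using a assms sringD[OF assms(1)] by auto
    then have ip: "inverse \<pi> \<in> R" using a0 by (simp add: field_simps)
    have "b \<in> R" for b
    proof (cases "b = 0")
      case False
      obtain n where n: "ord_at V b + int n \<ge> 0" using that[of "nat (- ord_at V b)"] by simp
      have "b * \<pi> ^ n \<in> V" using False pi n by (subst ord_nonneg_iff[symmetric]) (auto simp: ord_mult ord_power ord_pi)
      then have "b * \<pi> ^ n * inverse \<pi> ^ n \<in> R" using sring_power[OF assms(1) ip, of n] sringD(4)[OF assms(1)] assms(2) by auto
      then show ?thesis using pi by (simp add: field_simps)
    qed (use sringD[OF assms(1)] in auto)
    then show False using \<open>R \<noteq> UNIV\<close> by auto
  qed
qed

end

lemma is_dvr_dvr: "is_dvr V \<longleftrightarrow> (\<exists>\<pi>. dvr V \<pi>)"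
  by (auto simp: is_dvr_def dvr_def sring_subring)

section \<open>Models and their blow-ups\<close>

lemma affineI: "sring A \<Longrightarrow> prm A p \<Longrightarrow> localization A p \<in> affine A"
  unfolding affine_def using primeideal_iff_prm by blast

lemma affineE:
  assumes "R \<in> affine A" "sring A"
  obtains p where "prm A p" "R = localization A p"
  using assms primeideal_iff_prm unfolding affine_def by blast

lemma affine_lring: "sring A \<Longrightarrow> R \<in> affine A \<Longrightarrow> lring R \<and> A \<subseteq> R"
  using lring_localization(1,2) by (blast elim: affineE)

lemma affine_eq:
  assumes "sring A" "R \<in> affine A"
  shows "R = localization A (A \<inter> maxideal R)"
  using lring_localization(4)[OF assms(1)] by (metis affineE[OF assms(2,1)] Int_commute)

lemma sring_polyring: "sring (polyring G)"
  and polyring_cst: "cst c \<in> polyring G"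
  and polyring_gen: "G \<subseteq> polyring G"
  using sring_gen gen_incl[of "range cst \<union> G"] by (auto simp: polyring_def)

lemma polyring_min: "sring T \<Longrightarrow> range cst \<subseteq> T \<Longrightarrow> G \<subseteq> T \<Longrightarrow> polyring G \<subseteq> T"
  unfolding polyring_def by (rule gen_min) auto

text \<open>The second clause is separatedness in valuative form, uniqueness of the point dominated
  by a given local ring. It gives the definite description in \<open>point_below\<close> its
  meaning.\<close>

definition model :: "variety \<Rightarrow> bool" where
  "model X \<longleftrightarrow> (\<forall>R\<in>X. lring R \<and> range cst \<subseteq> R) \<and>
     (\<forall>V R R'. lring V \<longrightarrow> R \<in> X \<longrightarrow> R' \<in> X \<longrightarrow> dominates V R \<longrightarrow> dominates V R' \<longrightarrow> R = R')"

lemma modelD: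
  assumes "model X"
  shows "R \<in> X \<Longrightarrow> lring R" "R \<in> X \<Longrightarrow> cst c \<in> R"
    "lring V \<Longrightarrow> R \<in> X \<Longrightarrow> R' \<in> X \<Longrightarrow> dominates V R \<Longrightarrow> dominates V R' \<Longrightarrow> R = R'"
  using assms unfolding model_def by blast+

lemma point_below_eq:
  assumes "model Y" "lring V" "R \<in> Y" "dominates V R"
  shows "point_below Y V = R"
  unfolding point_below_def
  by (rule the_equality) (use assms modelD(3)[OF assms(1,2)] in auto)

lemma localization_eq_of_dominates:
  assumes "lring V" "sring A" "prm A p" "dominates V (localization A p)"
  shows "p = A \<inter> maxideal V"
  using lring_localization(2,4)[OF assms(2,3)] dominatesD(2)[OF assms(4)] by blast

text \<open>The separatedness argument common to all charts: two localizations dominated by the same ring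
  coincide as soon as each contains the chart of the other.\<close>

lemma localization_subset_of_dominates:
  assumes V: "lring V" and A: "sring A" "prm A p" and B: "sring B" "prm B q"
    and dA: "dominates V (localization A p)" and dB: "dominates V (localization B q)"
    and BA: "B \<subseteq> localization A p"
  shows "localization B q \<subseteq> localization A p"
proof (rule localization_subset)
  show "lring (localization A p)" by (rule lring_localization[OF A])
  have "q = B \<inter> maxideal V" by (rule localization_eq_of_dominates[OF V B dB])
  then show "B \<inter> maxideal (localization A p) \<subseteq> q" using dominatesD(2)[OF dA] BA by auto
qed (rule BA)

lemma zariski_closureD:
  assumes "P \<in> zariski_closure X W" "c \<in> P"
  shows "\<exists>S\<in>W. c \<in> S"
proof -
  have "finite {c} \<and> {c} \<subseteq> P" using assms(2) by simp
  then show ?thesis using assms(1) unfolding zariski_closure_def by blast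
qed

text \<open>A point of the closure specialising to \<open>R\<close> would have \<open>c\<close>
  among its functions, so by the definition of the closure \<open>c\<close> would be regular at some
  point of \<open>W\<close>. Hence no such point exists, the intersection in \<open>ideal_at\<close>
  runs over the empty family, and the stalk is the unit ideal.\<close>

lemma ideal_at_kill:
  assumes "c \<in> R" "\<And>S. S \<in> W \<Longrightarrow> c \<notin> S"
  shows "ideal_at (zariski_closure X (X \<inter> W)) R = R"
proof -
  have "\<not> (P \<in> zariski_closure X (X \<inter> W) \<and> R \<subseteq> P)" for P
    using zariski_closureD[of P X "X \<inter> W" c] assms by blast
  then show ?thesis unfolding ideal_at_def by auto
qed

text \<open>If \<open>e\<close> did not vanish at some point of the closure, its inverse would be
  regular there, and therefore also at a closed point of \<open>W\<close>, where \<open>e\<close>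
  vanishes.\<close>

lemma ideal_at_mem:
  assumes e: "e \<in> R" "e \<noteq> 0" and m: "model X" and W: "\<And>S. S \<in> W \<Longrightarrow> e \<in> maxideal S"
  shows "e \<in> ideal_at (zariski_closure X (X \<inter> W)) R"
proof -
  have "e \<in> maxideal P" if P: "P \<in> zariski_closure X (X \<inter> W)" "R \<subseteq> P" for P
  proof (rule ccontr)
    assume "e \<notin> maxideal P"
    then have "inverse e \<in> P" using P e by (auto simp: maxideal_iff)
    then obtain S where "S \<in> W" "inverse e \<in> S" using zariski_closureD[OF P(1)] by blast
    then show False using W[of S] e by (auto simp: maxideal_iff)
  qed
  then show ?thesis using e unfolding ideal_at_def by auto
qed

section \<open>Points of a blow-up\<close>

lemma blowupI:
  assumes "R \<in> X" "f \<in> ideal_at Z R" "f \<noteq> 0" "prm (gen (R \<union> {a / f | a. a \<in> ideal_at Z R})) p" "p \<inter> R = maxideal R"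
  shows "localization (gen (R \<union> {a / f | a. a \<in> ideal_at Z R})) p \<in> blowup X Z"
  unfolding blowup_def using assms primeideal_iff_prm[OF sring_gen] by blast

lemma blowupE:
  assumes "S \<in> blowup X Z"
  obtains R f A p where "R \<in> X" "f \<in> ideal_at Z R" "f \<noteq> 0"
    "A = gen (R \<union> {a / f | a. a \<in> ideal_at Z R})" "prm A p" "p \<inter> R = maxideal R" "S = localization A p"
    "sring A" "lring S" "dominates S R"
proof -
  obtain R f A p where *: "R \<in> X" "f \<in> ideal_at Z R" "f \<noteq> 0"
    "A = gen (R \<union> {a / f | a. a \<in> ideal_at Z R})" "primeideal p (subring_of_K A)" "p \<inter> R = maxideal R" "S = localization A p"
    using assms unfolding blowup_def by blast
  have A: "sring A" using *(4) sring_gen by simp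
  have p: "prm A p" using *(5) primeideal_iff_prm[OF A] by simp
  have RA: "R \<subseteq> A" using gen_incl *(4) by blast
  have "dominates S R" unfolding dominates_def
    using lring_localization(2,4)[OF A p] RA *(6,7) by blast
  then show thesis using that[OF *(1-4) p *(6,7) A] lring_localization(1)[OF A p] *(7) by simp
qed

text \<open>Membership in a blow-up without naming a prime: the prime is the contraction of the
  maximal ideal of \<open>S\<close>, and the last assumption says that \<open>S\<close> is no larger
  than the localization there.\<close>

lemma blowup_intro:
  assumes R: "R \<in> X" and S: "lring S" and d: "dominates S R" and f: "f \<in> ideal_at Z R" "f \<noteq> 0"
    and q: "\<And>a. a \<in> ideal_at Z R \<Longrightarrow> a / f \<in> S"
    and s: "\<And>c. c \<in> S \<Longrightarrow> \<exists>a b. a \<in> gen (R \<union> {a / f | a. a \<in> ideal_at Z R}) \<and>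
              b \<in> gen (R \<union> {a / f | a. a \<in> ideal_at Z R}) \<and> b \<notin> maxideal S \<and> c = a / b"
  shows "S \<in> blowup X Z"
proof -
  let ?A = "gen (R \<union> {a / f | a. a \<in> ideal_at Z R})"
  have AS: "?A \<subseteq> S"
    by (rule gen_min[OF lring_sring[OF S]]) (use dominatesD(1)[OF d] q in auto)
  have p: "prm ?A (?A \<inter> maxideal S)" by (rule prm_contract[OF S sring_gen AS])
  have "S \<subseteq> localization ?A (?A \<inter> maxideal S)"
  proof
    fix c assume "c \<in> S"
    from s[OF this] show "c \<in> localization ?A (?A \<inter> maxideal S)" by (auto intro: localizationI)
  qed
  moreover have "localization ?A (?A \<inter> maxideal S) \<subseteq> S" by (rule localization_subset[OF S AS]) auto
  ultimately have eq: "localization ?A (?A \<inter> maxideal S) = S" by auto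
  have "R \<subseteq> ?A" using gen_incl by blast
  then have "?A \<inter> maxideal S \<inter> R = maxideal R" using d by (auto simp: dominates_def)
  from blowupI[OF R f p this] eq show ?thesis by simp
qed

text \<open>Separatedness is inherited: points dominated by the same ring lie over one point
  \<open>R\<close>, and the quotient \<open>f / f'\<close> of the two generators is regular at
  \<open>S'\<close> and invertible in \<open>V\<close>, hence a unit of \<open>S'\<close>. Division
  by \<open>f\<close> is therefore possible in \<open>S'\<close>, which contains the chart ring of
  \<open>S\<close>.\<close>

lemma model_blowup:
  assumes X: "model X"
  shows "model (blowup X Z)"
  unfolding model_def
proof (intro conjI ballI allI impI)
  fix S assume "S \<in> blowup X Z"
  then show "lring S" "range cst \<subseteq> S"
    by (auto elim!: blowupE dest: dominatesD(1) modelD(2)[OF X])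
next
  have half: "S \<subseteq> S'" if V: "lring V" and S: "S \<in> blowup X Z" "S' \<in> blowup X Z" "dominates V S" "dominates V S'" for V S S'
  proof -
    from S(1) obtain R f A p where *: "R \<in> X" "f \<in> ideal_at Z R" "f \<noteq> 0"
      "A = gen (R \<union> {a / f | a. a \<in> ideal_at Z R})" "prm A p" "p \<inter> R = maxideal R" "S = localization A p"
      "sring A" "lring S" "dominates S R" by (rule blowupE)
    from S(2) obtain R' f' A' p' where **: "R' \<in> X" "f' \<in> ideal_at Z R'" "f' \<noteq> 0"
      "A' = gen (R' \<union> {a / f' | a. a \<in> ideal_at Z R'})" "prm A' p'" "p' \<inter> R' = maxideal R'" "S' = localization A' p'"
      "sring A'" "lring S'" "dominates S' R'" by (rule blowupE)
    have RR: "R = R'" using modelD(3)[OF X V *(1) **(1)] dominates_trans S *(10) **(10) by blast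
    have quot: "x / g \<in> localization (gen (R \<union> {a / g | a. a \<in> ideal_at Z R})) r"
      if "x \<in> ideal_at Z R" "prm (gen (R \<union> {a / g | a. a \<in> ideal_at Z R})) r" for x g r
    proof -
      have "x / g \<in> gen (R \<union> {a / g | a. a \<in> ideal_at Z R})"
        using that(1) by (intro subsetD[OF gen_incl]) auto
      then show ?thesis using lring_localization(2)[OF sring_gen that(2)] by blast
    qed
    have quot': "x / f' \<in> S'" if "x \<in> ideal_at Z R" for x
      using quot[OF that, of f' p'] **(4,5,7) RR by simp
    have "f / f' \<in> S'" by (rule quot'[OF *(2)])
    moreover have "inverse (f / f') \<in> V"
    proof -
      have "f' / f \<in> S" using quot[of f' f p] **(2) *(4,5,7) RR by simp
      then show ?thesis using dominatesD(1)[OF S(3)] by auto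
    qed
    ultimately have ff: "inverse (f / f') \<in> S'"
      by (intro dominates_unit[OF **(9) S(4)]) (use *(3) **(3) in auto)
    have "A \<subseteq> S'" unfolding *(4)
    proof (rule gen_min[OF lring_sring[OF **(9)]], safe)
      fix a assume "a \<in> R" then show "a \<in> S'" using dominatesD(1)[OF **(10)] RR by auto
    next
      fix a assume "a \<in> ideal_at Z R"
      then have "a / f' * inverse (f / f') \<in> S'" by (intro sringD(4)[OF lring_sring[OF **(9)] quot' ff])
      then show "a / f \<in> S'" using **(3) *(3) by (simp add: field_simps)
    qed
    then show ?thesis
      using localization_subset_of_dominates[OF V **(8,5) *(8,5)] S *(7) **(7) by simp
  qed
  show "R = R'" if "lring V" "R \<in> blowup X Z" "R' \<in> blowup X Z" "dominates V R" "dominates V R'" for V R R'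
    using half that by blast
qed

lemma blowup_stays:
  assumes "model X" "R \<in> X" "ideal_at Z R = R"
  shows "R \<in> blowup X Z"
proof (rule blowup_intro[of R X R 1])
  have R: "lring R" using modelD(1) assms by auto
  show "lring R" by (rule R)
  show "dominates R R" by (rule dominates_refl)
  show "1 \<in> ideal_at Z R" using sringD[OF lring_sring[OF R]] assms by simp
  show "\<exists>a b. a \<in> gen (R \<union> {a / 1 |a. a \<in> ideal_at Z R}) \<and> b \<in> gen (R \<union> {a / 1 |a. a \<in> ideal_at Z R}) \<and>
      b \<notin> maxideal R \<and> c = a / b" if "c \<in> R" for c
  proof (intro exI conjI)
    show "c = c / 1" by simp
    show "c \<in> gen (R \<union> {a / 1 |a. a \<in> ideal_at Z R})" "1 \<in> gen (R \<union> {a / 1 |a. a \<in> ideal_at Z R})"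
      using that gen_incl sringD(1)[OF sring_gen] by blast+
    show "1 \<notin> maxideal R" by (rule prmD(6)[OF lring_prm[OF R]])
  qed
qed (use assms in auto)

lemma affine_stays:
  assumes "model X" "affine B \<subseteq> X" "sring B" "c \<in> B" "\<And>S. S \<in> W \<Longrightarrow> c \<notin> S"
  shows "affine B \<subseteq> blowup X (zariski_closure X (X \<inter> W))"
proof
  fix R assume "R \<in> affine B"
  then show "R \<in> blowup X (zariski_closure X (X \<inter> W))"
    using affine_lring[OF assms(3)] assms by (intro blowup_stays ideal_at_kill[of c]) auto
qed

text \<open>A prime divisor is not changed by a blow-up: its local ring is a discrete valuation ring, so
  every ideal of it is principal already.\<close>

lemma dvr_stays:
  assumes X: "model X" and V: "V \<in> X" "dvr V \<pi>" and c: "c \<noteq> 0" "\<And>S. S \<in> W \<Longrightarrow> c \<notin> S"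
  shows "V \<in> blowup X (zariski_closure X (X \<inter> W))"
proof (cases "\<exists>P \<in> zariski_closure X (X \<inter> W). V \<subseteq> P")
  case False
  then have "ideal_at (zariski_closure X (X \<inter> W)) V = V" by (auto simp: ideal_at_def)
  then show ?thesis by (rule blowup_stays[OF X V(1)])
next
  case True
  interpret dvr V \<pi> by (rule V(2))
  let ?Z = "zariski_closure X (X \<inter> W)"
  \<comment> \<open>By \<open>overring\<close> the only alternative is the generic point of the
    whole variety. It is excluded by \<open>c\<close>, which would then be regular at some point of
    \<open>W\<close>.\<close>
  have *: "P = V" if P: "P \<in> ?Z" "V \<subseteq> P" for P
  proof -
    have "sring P" using P modelD(1)[OF X] lring_sring by (auto simp: zariski_closure_def)
    moreover have "P \<noteq> UNIV" using zariski_closureD[OF P(1), of c] c by auto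
    ultimately show ?thesis using overring P(2) by blast
  qed
  then have "V \<in> ?Z" using True by blast
  then have "{P \<in> ?Z. V \<subseteq> P} = {V}" using * by blast
  then have I: "ideal_at ?Z V = maxideal V" by (auto simp: ideal_at_def maxideal_iff)
  let ?A = "gen (V \<union> {a / \<pi> | a. a \<in> ideal_at ?Z V})"
  show ?thesis
  proof (rule blowup_intro[OF V(1) lring dominates_refl, of \<pi>])
    show "\<pi> \<in> ideal_at ?Z V" unfolding I using pi by (auto simp: maxideal_iff)
    show "\<exists>a b. a \<in> ?A \<and> b \<in> ?A \<and> b \<notin> maxideal V \<and> c = a / b" if "c \<in> V" for c
    proof (intro exI conjI)
      show "c = c / 1" by simp
      show "c \<in> ?A" "1 \<in> ?A" using that gen_incl sringD(1)[OF sring_gen] by blast+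
      show "1 \<notin> maxideal V" by (rule prmD(6)[OF lring_prm[OF lring]])
    qed
  qed (use pi in \<open>auto simp: I maxideal_eq\<close>)
qed

text \<open>Data of a blow-up chart: on the affine open set with ring \<open>B\<close> the centre, which is the closure
  of the closed points \<open>W\<close>, is given by the prime ideal \<open>q\<close> generated by \<open>Es\<close>.\<close>

locale blowup_chart =
  fixes X :: variety and B :: "ratfun set" and W :: "local_ring set" and Es q :: "ratfun set" and e :: ratfun
  assumes X: "model X" and B: "sring B" and BX: "affine B \<subseteq> X"
    and Es: "Es \<subseteq> B" "e \<in> Es" "0 \<notin> Es"
    and W: "\<And>S x. S \<in> W \<Longrightarrow> x \<in> Es \<Longrightarrow> x \<in> maxideal S"
    and q: "prm B q"
    and q_gen: "\<And>T b. sring T \<Longrightarrow> B \<subseteq> T \<Longrightarrow> (\<And>x. x \<in> Es \<Longrightarrow> x / e \<in> T) \<Longrightarrow> b \<in> q \<Longrightarrow> b / e \<in> T"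
    and q_le: "\<And>p. prm B p \<Longrightarrow> Es \<subseteq> p \<Longrightarrow> q \<subseteq> p"
    and dense: "\<And>b. b \<in> B \<Longrightarrow> b \<notin> q \<Longrightarrow> \<exists>S \<in> X \<inter> W. B \<subseteq> S \<and> b \<notin> maxideal S"
begin

abbreviation "Z \<equiv> zariski_closure X (X \<inter> W)"

text \<open>Finitely many functions regular at the prime \<open>q\<close> have a common denominator
  \<open>d\<close> outside \<open>q\<close>, and by density some closed point of the center lies in
  the chart off the zeros of \<open>d\<close>.\<close>

lemma generic: "localization B q \<in> Z"
proof -
  have "\<exists>S \<in> X \<inter> W. G \<subseteq> S" if G: "finite G" "G \<subseteq> localization B q" for G
  proof -
    have "\<exists>d. d \<in> B \<and> d \<notin> q \<and> (\<forall>g\<in>G. g * d \<in> B)" using G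
    proof (induction G)
      case empty then show ?case using sringD[OF B] prmD[OF q] by auto
    next
      case (insert g G)
      then obtain d where d: "d \<in> B" "d \<notin> q" "\<forall>g\<in>G. g * d \<in> B" by auto
      from insert obtain a b where ab: "g = a / b" "a \<in> B" "b \<in> B" "b \<notin> q" by (auto elim: localizationE)
      have b0: "b \<noteq> 0" using ab prmD[OF q] by auto
      have "b * d \<notin> q" using prmD(7)[OF q ab(3) d(1)] ab d by auto
      moreover have "x * (b * d) \<in> B" if "x \<in> insert g G" for x
      proof (cases "x = g")
        case True
        then have eq: "x * (b * d) = a * d" using ab b0 by simp
        show ?thesis unfolding eq by (rule sringD(4)[OF B ab(2) d(1)])
      next
        case False
        then have "x * d \<in> B" using that d by auto
        then have "b * (x * d) \<in> B" using ab sringD[OF B] by auto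
        then show ?thesis by (simp add: algebra_simps)
      qed
      ultimately show ?case using ab d sringD(4)[OF B] by blast
    qed
    then obtain d where d: "d \<in> B" "d \<notin> q" "\<forall>g\<in>G. g * d \<in> B" by auto
    obtain S where S: "S \<in> X \<inter> W" "B \<subseteq> S" "d \<notin> maxideal S" using dense[OF d(1,2)] by blast
    have lS: "lring S" using S modelD(1)[OF X] by auto
    have "g \<in> S" if "g \<in> G" for g
    proof -
      have "g * d \<in> S" "d \<in> S" using d S that by auto
      then have "g * d * inverse d \<in> S" using lring_units[OF lS, of d] S sringD(4)[OF lring_sring[OF lS]] by blast
      moreover have "g * d * inverse d = g" using lring_units(1)[OF lS \<open>d \<in> S\<close> S(3)] by simp
      ultimately show ?thesis by (simp only:)
    qed
    then show ?thesis using S by blast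
  qed
  moreover have "localization B q \<in> X" using affineI[OF B q] BX by auto
  ultimately show ?thesis unfolding zariski_closure_def by blast
qed

lemma Es_ideal_at:
  assumes "B \<subseteq> R" "x \<in> Es"
  shows "x \<in> ideal_at Z R"
  using assms Es W by (intro ideal_at_mem X) auto

text \<open>Off the center some \<open>x\<close> in \<open>Es\<close> is invertible, and
  \<open>a / e\<close> is \<open>a * (1 / x) * (x / e)\<close>. On the center \<open>a\<close>
  vanishes at the generic point, so its numerator lies in \<open>q\<close> and \<open>q_gen\<close>
  applies. Thus \<open>e\<close> divides the whole stalk as soon as it divides
  \<open>Es\<close>.\<close>

lemma ideal_at_quotient:
  assumes T: "sring T" "B \<subseteq> T" "\<And>x. x \<in> Es \<Longrightarrow> x / e \<in> T"
    and p: "prm B p" "localization B p \<subseteq> T" and a: "a \<in> ideal_at Z (localization B p)"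
  shows "a / e \<in> T"
proof (cases "Es \<subseteq> p")
  case False
  then obtain x where x: "x \<in> Es" "x \<notin> p" by auto
  have "1 / x \<in> localization B p" using x Es sringD[OF B] by (intro localizationI) auto
  then have "a * (1 / x) * (x / e) \<in> T"
    by (intro sringD(4)[OF T(1)] T(3) x) (use a p(2) in \<open>auto simp: ideal_at_def\<close>)
  then show ?thesis using x Es by (auto split: if_splits)
next
  case True
  note loc = lring_localization[OF B p(1)]
  have sub: "q \<subseteq> p" by (rule q_le[OF p(1) True])
  have "localization B p \<subseteq> localization B q"
    using sub by (force simp: localization_def)
  then have a: "a \<in> maxideal (localization B q)" "a \<in> localization B p" using a generic by (auto simp: ideal_at_def)
  obtain b d where *: "a = b / d" "b \<in> B" "d \<in> B" "d \<notin> p" using a(2) by (auto elim: localizationE)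
  note locq = lring_localization[OF B q]
  have d0: "d \<noteq> 0" using * prmD[OF p(1)] by auto
  have "b = a * d" using * d0 by simp
  also have "\<dots> \<in> maxideal (localization B q)"
    using prmD(5)[OF lring_prm[OF locq(1)] a(1), of d] locq(2) *(3) by blast
  finally have "b \<in> q" using locq(4) * by auto
  then have "b / e \<in> T" using q_gen[OF T] by blast
  moreover have "1 / d \<in> T" using p(2) * sringD[OF B] by (auto intro: localizationI)
  ultimately have "b / e * (1 / d) \<in> T" using sringD(4)[OF T(1)] by blast
  then show ?thesis using * by (simp add: field_simps)
qed

text \<open>The weak generation hypothesis makes room for principal open sets: \<open>C\<close>
  consists of fractions over the ring generated by \<open>B\<close> and the quotients
  \<open>x / e\<close>, with denominators that are units of \<open>C\<close>.\<close>

lemma affine_blowup: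
  assumes C: "sring C" "B \<subseteq> C" "\<And>x. x \<in> Es \<Longrightarrow> x / e \<in> C"
    and gen: "\<And>c. c \<in> C \<Longrightarrow> \<exists>a d. c = a / d \<and> a \<in> gen (B \<union> {x / e | x. x \<in> Es}) \<and>
        d \<in> gen (B \<union> {x / e | x. x \<in> Es}) \<and> d \<noteq> 0 \<and> 1 / d \<in> C"
  shows "affine C \<subseteq> blowup X Z"
proof
  fix S assume "S \<in> affine C"
  then have S: "lring S" "C \<subseteq> S" "S = localization C (C \<inter> maxideal S)"
    using affine_lring[OF C(1)] affine_eq[OF C(1)] by blast+
  note sS = sringD[OF lring_sring[OF S(1)]]
  let ?p = "B \<inter> maxideal S" let ?R = "localization B ?p"
  have BS: "B \<subseteq> S" using S C by auto
  have p: "prm B ?p" by (rule prm_contract[OF S(1) B BS])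
  have d: "dominates S ?R" by (rule dominates_localization[OF S(1) B BS])
  have BR: "B \<subseteq> ?R" by (rule lring_localization[OF B p])
  let ?G = "gen (?R \<union> {a / e | a. a \<in> ideal_at Z ?R})"
  have G: "gen (B \<union> {x / e | x. x \<in> Es}) \<subseteq> ?G"
    by (rule gen_min[OF sring_gen order_trans[OF _ gen_incl]]) (use BR Es_ideal_at[OF BR] in blast)
  note sG = sringD[OF sring_gen]
  show "S \<in> blowup X Z"
  proof (rule blowup_intro[OF _ S(1) d])
    show "?R \<in> X" using BX affineI[OF B p] by auto
    show "e \<in> ideal_at Z ?R" using Es_ideal_at[OF BR] Es by auto
    show "e \<noteq> 0" using Es by auto
    show "a / e \<in> S" if "a \<in> ideal_at Z ?R" for a
      by (rule ideal_at_quotient[OF lring_sring[OF S(1)] BS _ p _ that]) (use C S dominatesD(1)[OF d] in auto)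
  next
    fix c assume "c \<in> S"
    then have "c \<in> localization C (C \<inter> maxideal S)" by (subst S(3)[symmetric])
    then obtain c1 c2 where c': "c = c1 / c2" "c1 \<in> C" "c2 \<in> C" "c2 \<notin> C \<inter> maxideal S"
      by (rule localizationE)
    then have c: "c = c1 / c2" "c1 \<in> C" "c2 \<in> C" "c2 \<notin> maxideal S" by auto
    obtain a1 d1 where 1: "c1 = a1 / d1" "a1 \<in> ?G" "d1 \<in> ?G" "1 / d1 \<in> C" "d1 \<noteq> 0" using gen[OF c(2)] G by blast
    obtain a2 d2 where 2: "c2 = a2 / d2" "a2 \<in> ?G" "d2 \<in> ?G" "1 / d2 \<in> C" "d2 \<noteq> 0" using gen[OF c(3)] G by blast
    have "c2 \<noteq> 0" "inverse c2 \<in> S" using lring_units[OF S(1) _ c(4)] c S by auto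
    then have "inverse c2 * (1 / d1) * (1 / d2) \<in> S"
      using 1(4) 2(4) S(2) by (intro sS(4)) auto
    moreover have "inverse c2 * (1 / d1) * (1 / d2) = inverse (d1 * a2)" "a2 \<noteq> 0"
      using \<open>c2 \<noteq> 0\<close> 1(5) 2(1,5) by (auto simp: field_simps)
    ultimately have "d1 * a2 \<notin> maxideal S" using 1(5) by (simp add: maxideal_iff)
    moreover have "c = (a1 * d2) / (d1 * a2)" using c 1 2 by (simp add: field_simps)
    moreover have "a1 * d2 \<in> ?G" "d1 * a2 \<in> ?G" using 1 2 sG(4) by blast+
    ultimately show "\<exists>a b. a \<in> ?G \<and> b \<in> ?G \<and> b \<notin> maxideal S \<and> c = a / b" by blast
  qed
qed

text \<open>Every element of the stalk is divisible by \<open>e\<close> in \<open>V\<close>, so the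
  minimal order is attained at \<open>e\<close> itself. Orders of total transforms of centers along
  later divisors are computed this way.\<close>

lemma total_transform_value:
  assumes V: "dvr V \<pi>" "B \<subseteq> V" "\<And>x. x \<in> Es \<Longrightarrow> x / e \<in> V"
  shows "Inf {ord_at V a | a. a \<in> ideal_at Z (point_below X V) \<and> a \<noteq> 0} = ord_at V e"
proof -
  interpret dvr V \<pi> by (rule V)
  let ?p = "B \<inter> maxideal V" let ?R = "localization B ?p"
  have p: "prm B ?p" by (rule prm_contract[OF lring B V(2)])
  have d: "dominates V ?R" by (rule dominates_localization[OF lring B V(2)])
  have BR: "B \<subseteq> ?R" by (rule lring_localization[OF B p])
  have pb: "point_below X V = ?R"
    by (rule point_below_eq[OF X lring _ d]) (use BX affineI[OF B p] in auto)
  have e0: "e \<noteq> 0" using Es by auto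
  show ?thesis unfolding pb
  proof (rule cInf_eq_minimum)
    show "ord_at V e \<in> {ord_at V a | a. a \<in> ideal_at Z ?R \<and> a \<noteq> 0}"
      using Es_ideal_at[OF BR] Es e0 by blast
    fix n assume "n \<in> {ord_at V a | a. a \<in> ideal_at Z ?R \<and> a \<noteq> 0}"
    then obtain a where a: "n = ord_at V a" "a \<in> ideal_at Z ?R" "a \<noteq> 0" by blast
    have "a / e \<in> V"
      by (rule ideal_at_quotient[OF sr V(2,3) p _ a(2)]) (use dominatesD(1)[OF d] in auto)
    then have "ord_at V (a / e) \<ge> 0" using ord_nonneg_iff[of "a / e"] a(3) e0 by simp
    then show "ord_at V e \<le> n" using a e0 by (simp add: ord_divide)
  qed
qed

end

text \<open>The stalk at the point below is the unit ideal, and the minimal order is that of the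
  function 1.\<close>

lemma total_transform_kill:
  assumes V: "dvr V \<pi>" and X: "model X" and R: "R \<in> X" "dominates V R" and c: "c \<in> R" "\<And>S. S \<in> W \<Longrightarrow> c \<notin> S"
  shows "Inf {ord_at V a | a. a \<in> ideal_at (zariski_closure X (X \<inter> W)) (point_below X V) \<and> a \<noteq> 0} = 0"
proof -
  interpret dvr V \<pi> by (rule V)
  have pb: "point_below X V = R" by (rule point_below_eq[OF X lring R])
  have I: "ideal_at (zariski_closure X (X \<inter> W)) R = R" by (rule ideal_at_kill[of c]) (use c in auto)
  show ?thesis unfolding pb I
  proof (rule cInf_eq_minimum)
    show "0 \<in> {ord_at V a | a. a \<in> R \<and> a \<noteq> 0}"
      using ord_1 sringD(1)[OF lring_sring[OF modelD(1)[OF X R(1)]]] by (auto intro!: exI[of _ 1])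
    fix n assume "n \<in> {ord_at V a | a. a \<in> R \<and> a \<noteq> 0}"
    then obtain a where a: "n = ord_at V a" "a \<in> R" "a \<noteq> 0" by blast
    then have "a \<in> V" using dominatesD(1)[OF R(2)] by blast
    then show "0 \<le> n" using ord_nonneg_iff[OF a(3)] a(1) by simp
  qed
qed

section \<open>Coordinate systems\<close>

type_synonym poly4 = "complex poly poly poly poly"

definition rhom :: "('a::comm_ring_1 \<Rightarrow> 'b::comm_ring_1) \<Rightarrow> bool" where
  "rhom f \<longleftrightarrow> f 0 = 0 \<and> f 1 = 1 \<and> (\<forall>a b. f (a + b) = f a + f b) \<and> (\<forall>a b. f (a * b) = f a * f b)"

lemma rhomD:
  assumes "rhom f"
  shows "f 0 = 0" "f 1 = 1" "f (a + b) = f a + f b" "f (a * b) = f a * f b"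
    "f (- a) = - f a" "f (a - b) = f a - f b" "f (a ^ n) = f a ^ n" "f (sum g A) = (\<Sum>i\<in>A. f (g i))"
proof -
  show 0: "f 0 = 0" and "f 1 = 1" and add: "\<And>a b. f (a + b) = f a + f b" and "f (a * b) = f a * f b"
    using assms by (auto simp: rhom_def)
  show neg: "f (- a) = - f a" for a using add[of a "- a"] 0 by (simp add: eq_neg_iff_add_eq_0 add.commute)
  show "f (a - b) = f a - f b" using add[of a "- b"] neg[of b] by simp
  show "f (a ^ n) = f a ^ n" using assms by (induction n) (auto simp: rhom_def)
  show "f (sum g A) = (\<Sum>i\<in>A. f (g i))" using 0 add by (induction A rule: infinite_finite_induct) auto
qed

lemma rhom_poly_map_poly:
  fixes f :: "'a::comm_ring_1 \<Rightarrow> 'b::comm_ring_1"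
  assumes f: "rhom f"
  shows "rhom (\<lambda>p. poly (map_poly f p) x)"
proof -
  have "map_poly f (p + q) = map_poly f p + map_poly f q" for p q
    by (rule poly_eqI) (simp add: coeff_map_poly rhomD[OF f])
  moreover have "map_poly f (p * q) = map_poly f p * map_poly f q" for p q
    by (rule poly_eqI) (simp add: coeff_map_poly rhomD[OF f] coeff_mult)
  ultimately show ?thesis
    by (simp add: rhom_def rhomD[OF f] map_poly_1)
qed

text \<open>The map \<open>f\<close> embeds the constants, so one definition covers evaluation in
  the function field (\<open>ev\<close>), at complex points (\<open>val\<close>) and substitution of
  polynomials (\<open>zer\<close>). The innermost of the nested variables is coordinate 0.\<close>

definition ev4 :: "(complex \<Rightarrow> 'a::comm_ring_1) \<Rightarrow> 'a \<times> 'a \<times> 'a \<times> 'a \<Rightarrow> poly4 \<Rightarrow> 'a" where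
  "ev4 f = (\<lambda>(a, b, c, d) F. poly (map_poly (\<lambda>F. poly (map_poly (\<lambda>F. poly (map_poly (\<lambda>F. poly (map_poly f F) a) F) b) F) c) F) d)"

definition C4 :: "complex \<Rightarrow> poly4" where "C4 c = [:[:[:[:c:]:]:]:]"
definition X4 :: "poly4 \<times> poly4 \<times> poly4 \<times> poly4" where
  "X4 = ([:[:[:[:0, 1:]:]:]:], [:[:[:0, 1:]:]:], [:[:0, 1:]:], [:0, 1:])"

fun crd :: "'a \<times> 'a \<times> 'a \<times> 'a \<Rightarrow> nat \<Rightarrow> 'a" where
  "crd (a, b, c, d) i = [a, b, c, d] ! i"

lemma less4_cases: "(\<forall>i<4. P i) \<longleftrightarrow> P 0 \<and> P 1 \<and> P 2 \<and> P (3::nat)"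
  by (auto simp: less_Suc_eq numeral_eq_Suc)

lemma less4E:
  assumes "i < (4::nat)"
  obtains "i = 0" | "i = 1" | "i = 2" | "i = 3"
  using assms by linarith

lemma crd_sel [simp]: "crd (a, b, c, d) 0 = a" "crd (a, b, c, d) (Suc 0) = b" "crd (a, b, c, d) 2 = c" "crd (a, b, c, d) 3 = d"
  by (simp_all add: numeral_eq_Suc)

declare crd.simps [simp del]

abbreviation X :: "nat \<Rightarrow> poly4" where "X i \<equiv> crd X4 i"

lemma rhom_ev4:
  assumes "rhom f"
  shows "rhom (ev4 f y)"
proof -
  obtain a b c d where y: "y = (a, b, c, d)" by (metis prod.exhaust)
  show ?thesis unfolding ev4_def y prod.case
    by (intro rhom_poly_map_poly assms)
qed

lemma ev4_C4: "rhom f \<Longrightarrow> ev4 f y (C4 c) = f c"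
  by (cases y) (simp add: ev4_def C4_def map_poly_pCons rhomD)

lemma ev4_X: "rhom f \<Longrightarrow> i < 4 \<Longrightarrow> ev4 f y (X i) = crd y i"
  by (cases y; elim less4E) (simp_all add: ev4_def X4_def map_poly_pCons rhomD)

lemma poly_ring_induct:
  assumes "\<And>c. P [:c:]" "P [:0, 1:]" "\<And>p q. P p \<Longrightarrow> P q \<Longrightarrow> P (p + q)" "\<And>p q. P p \<Longrightarrow> P q \<Longrightarrow> P (p * q)"
  shows "P (p :: 'a::comm_ring_1 poly)"
proof (induction p)
  case (pCons a p)
  have "pCons a p = [:a:] + [:0, 1:] * p" by simp
  then show ?case using assms pCons by metis
qed (use assms(1)[of 0] in simp)

text \<open>Constants and variables generate the polynomial ring; as an induction rule this avoids
  unfolding the nested type. The proof climbs through the levels, carrying closure under sums and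
  products over to constant polynomials of the next level.\<close>

lemma poly4_induct:
  assumes "\<And>c. P (C4 c)" "\<And>i. i < 4 \<Longrightarrow> P (X i)" "\<And>F G. P F \<Longrightarrow> P G \<Longrightarrow> P (F + G)" "\<And>F G. P F \<Longrightarrow> P G \<Longrightarrow> P (F * G)"
  shows "P F"
proof -
  have h: "P [:f + g:]" "P [:f * g:]" if "P [:f:]" "P [:g:]" for f g
    using assms(3)[OF that] assms(4)[OF that] by (simp_all add: mult.commute)
  have h2: "P [:[:f + g:]:]" "P [:[:f * g:]:]" if "P [:[:f:]:]" "P [:[:g:]:]" for f g
    using h[of "[:f:]" "[:g:]"] that by (simp_all add: mult.commute)
  have h3: "P [:[:[:f + g:]:]:]" "P [:[:[:f * g:]:]:]" if "P [:[:[:f:]:]:]" "P [:[:[:g:]:]:]" for f g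
    using h2[of "[:f:]" "[:g:]"] that by (simp_all add: mult.commute)
  have 1: "P [:[:[:f:]:]:]" for f
    by (induction f rule: poly_ring_induct) (use assms(1) assms(2)[of 0] h3 in \<open>auto simp: C4_def X4_def\<close>)
  have 2: "P [:[:f:]:]" for f
    by (induction f rule: poly_ring_induct) (use 1 assms(2)[of 1] h2 in \<open>auto simp: X4_def\<close>)
  have 3: "P [:f:]" for f
    by (induction f rule: poly_ring_induct) (use 2 assms(2)[of 2] h in \<open>auto simp: X4_def\<close>)
  show ?thesis
    by (induction F rule: poly_ring_induct) (use 3 assms(2)[of 3] assms(3,4) in \<open>auto simp: X4_def\<close>)
qed

lemma rhom_unique:
  assumes f: "rhom f" and g: "rhom g" and "\<And>c. f (C4 c) = g (C4 c)" "\<And>i. i < 4 \<Longrightarrow> f (X i) = g (X i)"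
  shows "f F = g F"
  by (induction F rule: poly4_induct) (use assms in \<open>auto simp: rhomD[OF f] rhomD[OF g]\<close>)

lemma rhom_cst: "rhom cst"
  by (simp add: rhom_def cst_def Zero_fract_def One_fract_def flip: pCons_one)

lemma cst_simps [simp]: "cst 0 = 0" "cst 1 = 1"
  using rhomD[OF rhom_cst] by auto

lemmas cst_hom = rhomD(3-7)[OF rhom_cst]

lemma cst_eq_0 [simp]: "cst c = 0 \<longleftrightarrow> c = 0"
  by (simp add: cst_def Zero_fract_def eq_fract)

lemma cst_inverse: "cst (inverse c) = inverse (cst c)"
proof (cases "c = 0")
  case False
  then have "cst c * cst (inverse c) = 1" by (simp flip: cst_hom(2))
  then show ?thesis using False by (simp add: field_simps)
qed simp

lemma cst_divide: "cst (a / b) = cst a / cst b"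
  by (simp add: divide_inverse cst_hom cst_inverse)

lemma cst_numeral: "cst (numeral n) = numeral n"
proof -
  have "cst (of_nat k) = of_nat k" for k by (induction k) (auto simp: cst_hom)
  from this[of "numeral n"] show ?thesis by simp
qed

abbreviation ev :: "coords \<Rightarrow> poly4 \<Rightarrow> ratfun" where "ev \<equiv> ev4 cst"
abbreviation val :: "pt \<Rightarrow> poly4 \<Rightarrow> complex" where "val \<equiv> ev4 (\<lambda>c. c)"

lemma rhom_id: "rhom (\<lambda>c. c)" by (simp add: rhom_def)

lemmas ev_hom [simp] = rhomD(1-7)[OF rhom_ev4[OF rhom_cst]] ev4_C4[OF rhom_cst] ev4_X[OF rhom_cst]
lemmas val_hom [simp] = rhomD(1-7)[OF rhom_ev4[OF rhom_id]] ev4_C4[OF rhom_id] ev4_X[OF rhom_id]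

text \<open>Pass to leading coefficients down to the innermost level, then choose the coordinates
  one at a time from the inside, each avoiding the zeros of a polynomial whose leading coefficient
  has stayed nonzero under the earlier choices.\<close>

lemma ex_val_nonzero:
  assumes "F \<noteq> 0"
  shows "\<exists>b. val b F \<noteq> 0"
proof -
  have step: "\<exists>x. poly (map_poly f p) x \<noteq> 0" if "p \<noteq> 0" "f 0 = 0" "f (lead_coeff p) \<noteq> 0"
    for f :: "'a::comm_ring_1 \<Rightarrow> complex" and p
  proof -
    have "Polynomial.coeff (map_poly f p) (degree p) \<noteq> 0" using that by (simp add: coeff_map_poly)
    then have "map_poly f p \<noteq> 0" by auto
    then show ?thesis by (metis poly_all_0_iff_0)
  qed
  let ?c3 = "lead_coeff F" let ?c2 = "lead_coeff ?c3" let ?c1 = "lead_coeff ?c2"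
  have nz: "?c3 \<noteq> 0" "?c2 \<noteq> 0" "?c1 \<noteq> 0" "lead_coeff ?c1 \<noteq> 0" using assms by auto
  have r1: "rhom (\<lambda>F. poly (map_poly (\<lambda>c::complex. c) F) a)" for a by (intro rhom_poly_map_poly rhom_id)
  have r2: "rhom (\<lambda>F. poly (map_poly (\<lambda>F. poly (map_poly (\<lambda>c::complex. c) F) a) F) b)" for a b
    by (intro rhom_poly_map_poly rhom_id)
  have r3: "rhom (\<lambda>F. poly (map_poly (\<lambda>F. poly (map_poly (\<lambda>F. poly (map_poly (\<lambda>c::complex. c) F) a) F) b) F) c)" for a b c
    by (intro rhom_poly_map_poly rhom_id)
  obtain a where a: "poly (map_poly (\<lambda>c. c) ?c1) a \<noteq> 0" using step[of ?c1 "\<lambda>c. c"] nz by auto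
  obtain b where b: "poly (map_poly (\<lambda>F. poly (map_poly (\<lambda>c. c) F) a) ?c2) b \<noteq> 0"
    using step[of ?c2 "\<lambda>F. poly (map_poly (\<lambda>c. c) F) a"] nz a by auto
  obtain c where c: "poly (map_poly (\<lambda>F. poly (map_poly (\<lambda>F. poly (map_poly (\<lambda>c. c) F) a) F) b) ?c3) c \<noteq> 0"
    using step[of ?c3 "\<lambda>F. poly (map_poly (\<lambda>F. poly (map_poly (\<lambda>c. c) F) a) F) b"] nz b rhomD(1)[OF r2] by auto
  obtain d where "poly (map_poly (\<lambda>F. poly (map_poly (\<lambda>F. poly (map_poly (\<lambda>F. poly (map_poly (\<lambda>c. c) F) a) F) b) F) c) F) d \<noteq> 0"
    using step[of F "\<lambda>F. poly (map_poly (\<lambda>F. poly (map_poly (\<lambda>F. poly (map_poly (\<lambda>c. c) F) a) F) b) F) c"] assms c rhomD(1)[OF r3] by auto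
  then have "val (a, b, c, d) F \<noteq> 0" by (simp add: ev4_def)
  then show ?thesis by blast
qed

text \<open>Algebraic independence together with generation of the whole function field, that is, a
  birational identification with affine 4-space.\<close>

definition coordsys :: "coords \<Rightarrow> bool" where
  "coordsys y \<longleftrightarrow> (\<forall>F. ev y F = 0 \<longrightarrow> F = 0) \<and> (\<forall>k. \<exists>F G. ev y G \<noteq> 0 \<and> k = ev y F / ev y G)"

lemma sring_range_ev: "sring (range (ev y))"
proof -
  note h = rhomD[OF rhom_ev4[OF rhom_cst], of y]
  have "1 \<in> range (ev y)" using h(2) by (metis rangeI)
  moreover have "ev y F + ev y G \<in> range (ev y)" "ev y F * ev y G \<in> range (ev y)" "- ev y F \<in> range (ev y)" for F G
    using rangeI[of "ev y" "F + G"] rangeI[of "ev y" "F * G"] rangeI[of "ev y" "- F"] by (simp_all only: h)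
  ultimately show ?thesis unfolding sring_def by auto
qed

lemma range_ev_mem: "cst c \<in> range (ev y)" "i < 4 \<Longrightarrow> crd y i \<in> range (ev y)" "1 \<in> range (ev y)"
proof -
  show "cst c \<in> range (ev y)" using rangeI[of "ev y" "C4 c"] by simp
  show "i < 4 \<Longrightarrow> crd y i \<in> range (ev y)" using rangeI[of "ev y" "X i"] by simp
  show "1 \<in> range (ev y)" using rangeI[of "ev y" 1] by simp
qed

lemma polyring_eq: "polyring {s, t, u, v} = range (ev (s, t, u, v))"
proof
  show "polyring {s, t, u, v} \<subseteq> range (ev (s, t, u, v))"
    by (rule polyring_min[OF sring_range_ev])
       (use range_ev_mem(1)[of _ "(s, t, u, v)"] range_ev_mem(2)[of 0 "(s, t, u, v)"] range_ev_mem(2)[of 1 "(s, t, u, v)"]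
         range_ev_mem(2)[of 2 "(s, t, u, v)"] range_ev_mem(2)[of 3 "(s, t, u, v)"] in auto)
  have "ev (s, t, u, v) F \<in> polyring {s, t, u, v}" for F
  proof (induction F rule: poly4_induct)
    case (2 i)
    then show ?case using polyring_gen[of "{s, t, u, v}"] by (auto elim: less4E)
  qed (auto simp: sringD[OF sring_polyring] polyring_cst)
  then show "range (ev (s, t, u, v)) \<subseteq> polyring {s, t, u, v}" by auto
qed

definition pring :: "coords \<Rightarrow> ratfun set" where
  "pring y = range (ev y)"

lemma sring_pring: "sring (pring y)"
  by (simp add: pring_def sring_range_ev)

lemma pring_mem: "cst c \<in> pring y" "i < 4 \<Longrightarrow> crd y i \<in> pring y" "ev y F \<in> pring y"
  unfolding pring_def using range_ev_mem by auto

lemma ev_mem: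
  assumes "sring T" "range cst \<subseteq> T" "\<And>i. i < 4 \<Longrightarrow> crd y i \<in> T"
  shows "ev y F \<in> T"
  by (induction F rule: poly4_induct) (use assms in \<open>auto simp: sringD\<close>)

lemma pring_min:
  assumes "sring T" "range cst \<subseteq> T" "\<And>i. i < 4 \<Longrightarrow> crd y i \<in> T"
  shows "pring y \<subseteq> T"
  unfolding pring_def using ev_mem[OF assms] by blast

lemma coordsys_std: "coordsys (x0, x1, x2, x3)"
proof -
  have F: "Fract F 1 = ev (x0, x1, x2, x3) F" for F :: poly4
  proof (rule rhom_unique)
    show "rhom (\<lambda>F::poly4. Fract F 1)" by (simp add: rhom_def Zero_fract_def One_fract_def)
    show "rhom (ev (x0, x1, x2, x3))" by (rule rhom_ev4[OF rhom_cst])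
    show "Fract (C4 c) 1 = ev (x0, x1, x2, x3) (C4 c)" for c unfolding ev4_C4[OF rhom_cst] by (simp add: C4_def cst_def)
    show "i < 4 \<Longrightarrow> Fract (X i) 1 = ev (x0, x1, x2, x3) (X i)" for i
      by (simp add: ev4_X[OF rhom_cst]) (auto elim!: less4E simp: X4_def x0_def x1_def x2_def x3_def)
  qed
  show ?thesis unfolding coordsys_def
  proof (intro conjI allI impI)
    show "G = 0" if "ev (x0, x1, x2, x3) G = 0" for G
      using that by (simp add: F[symmetric] Zero_fract_def eq_fract)
    show "\<exists>F G. ev (x0, x1, x2, x3) G \<noteq> 0 \<and> k = ev (x0, x1, x2, x3) F / ev (x0, x1, x2, x3) G" for k
    proof (cases k)
      case (Fract a b)
      then show ?thesis by (intro exI[of _ a] exI[of _ b]) (simp add: F[symmetric] Zero_fract_def eq_fract)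
    qed
  qed
qed

section \<open>Local rings and residue values at closed points of a chart\<close>

definition Oring :: "coords \<Rightarrow> pt \<Rightarrow> ratfun set" where
  "Oring y b = {ev y F / ev y G | F G. val b G \<noteq> 0}"

text \<open>The residue of a function at the closed point \<open>b\<close>. Uniqueness of the value
  needs injectivity of \<open>ev y\<close>: only then do equal fractions come from polynomials with
  equal cross products.\<close>

definition pval :: "coords \<Rightarrow> pt \<Rightarrow> ratfun \<Rightarrow> complex" where
  "pval y b k = (THE z. \<exists>F G. val b G \<noteq> 0 \<and> k = ev y F / ev y G \<and> z = val b F / val b G)"

lemma coordsys_ev_0: "coordsys y \<Longrightarrow> ev y F = 0 \<longleftrightarrow> F = 0"
  by (auto simp: coordsys_def)

lemma pval_eq:
  assumes y: "coordsys y" and G: "val b G \<noteq> 0"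
  shows "pval y b (ev y F / ev y G) = val b F / val b G"
  unfolding pval_def
proof (rule the_equality)
  fix z assume "\<exists>F' G'. val b G' \<noteq> 0 \<and> ev y F / ev y G = ev y F' / ev y G' \<and> z = val b F' / val b G'"
  then obtain F' G' where *: "val b G' \<noteq> 0" "ev y F / ev y G = ev y F' / ev y G'" "z = val b F' / val b G'" by blast
  have "ev y G \<noteq> 0" "ev y G' \<noteq> 0" using G * coordsys_ev_0[OF y] by auto
  then have "ev y (F * G' - F' * G) = 0" using *(2) by (simp add: field_simps)
  then have "F * G' - F' * G = 0" using coordsys_ev_0[OF y] by blast
  then have "F * G' = F' * G" by simp
  then have "val b (F * G') = val b (F' * G)" by simp
  then show "z = val b F / val b G" unfolding *(3) using *(1) G by (simp add: frac_eq_eq)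
qed (use G in blast)

lemma OringE:
  assumes "k \<in> Oring y b" "coordsys y"
  obtains F G where "k = ev y F / ev y G" "val b G \<noteq> 0" "ev y G \<noteq> 0" "pval y b k = val b F / val b G"
proof -
  obtain F G where *: "k = ev y F / ev y G" "val b G \<noteq> 0" using assms(1) by (auto simp: Oring_def)
  then have "ev y G \<noteq> 0" using coordsys_ev_0[OF assms(2)] by auto
  then show ?thesis using that * pval_eq[OF assms(2) *(2)] by simp
qed

lemma OringI:
  assumes "coordsys y" "val b G \<noteq> 0" "k = ev y F / ev y G"
  shows "k \<in> Oring y b" "pval y b k = val b F / val b G"
  using assms pval_eq by (auto simp: Oring_def)

lemma place_add:
  assumes y: "coordsys y" and k: "k \<in> Oring y b" "l \<in> Oring y b"
  shows "k + l \<in> Oring y b" "pval y b (k + l) = pval y b k + pval y b l"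
proof -
  obtain F G where *: "k = ev y F / ev y G" "val b G \<noteq> 0" "ev y G \<noteq> 0" "pval y b k = val b F / val b G" by (rule OringE[OF k(1) y])
  obtain F' G' where **: "l = ev y F' / ev y G'" "val b G' \<noteq> 0" "ev y G' \<noteq> 0" "pval y b l = val b F' / val b G'" by (rule OringE[OF k(2) y])
  have eq: "k + l = ev y (F * G' + F' * G) / ev y (G * G')"
    unfolding *(1) **(1) using *(3) **(3) by (simp add: field_simps)
  have nz: "val b (G * G') \<noteq> 0" using * ** by simp
  show "k + l \<in> Oring y b" by (rule OringI(1)[OF y nz eq])
  show "pval y b (k + l) = pval y b k + pval y b l"
    unfolding OringI(2)[OF y nz eq] *(4) **(4) using *(2) **(2) by (simp add: add_frac_eq)
qed

lemma place_mult:
  assumes y: "coordsys y" and k: "k \<in> Oring y b" "l \<in> Oring y b"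
  shows "k * l \<in> Oring y b" "pval y b (k * l) = pval y b k * pval y b l"
proof -
  obtain F G where *: "k = ev y F / ev y G" "val b G \<noteq> 0" "ev y G \<noteq> 0" "pval y b k = val b F / val b G" by (rule OringE[OF k(1) y])
  obtain F' G' where **: "l = ev y F' / ev y G'" "val b G' \<noteq> 0" "ev y G' \<noteq> 0" "pval y b l = val b F' / val b G'" by (rule OringE[OF k(2) y])
  have eq: "k * l = ev y (F * F') / ev y (G * G')" unfolding *(1) **(1) by simp
  have nz: "val b (G * G') \<noteq> 0" using * ** by simp
  show "k * l \<in> Oring y b" by (rule OringI(1)[OF y nz eq])
  show "pval y b (k * l) = pval y b k * pval y b l"
    unfolding OringI(2)[OF y nz eq] *(4) **(4) by simp
qed

lemma place_ev:
  assumes y: "coordsys y"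
  shows "ev y F \<in> Oring y b" "pval y b (ev y F) = val b F"
  using OringI[OF y, of b 1 "ev y F" F] by auto

lemma place_cst:
  assumes y: "coordsys y"
  shows "cst c \<in> Oring y b" "pval y b (cst c) = c"
  using place_ev[OF y, where F = "C4 c"] by auto

lemma place_0_1:
  assumes y: "coordsys y"
  shows "0 \<in> Oring y b" "pval y b 0 = 0" "1 \<in> Oring y b" "pval y b 1 = 1" 
    "numeral n \<in> Oring y b" "pval y b (numeral n) = numeral n"
  using place_cst[OF y, where c = 0] place_cst[OF y, where c = 1] place_cst[OF y, where c = "numeral n"] by (auto simp: cst_numeral)

lemma place_uminus:
  assumes y: "coordsys y" and k: "k \<in> Oring y b"
  shows "- k \<in> Oring y b" "pval y b (- k) = - pval y b k"
  using place_mult[OF y place_cst(1)[OF y, where c = "-1"] k] place_cst[OF y, where c = "-1"] by (auto simp: cst_hom)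

lemma place_diff:
  assumes y: "coordsys y" and k: "k \<in> Oring y b" "l \<in> Oring y b"
  shows "k - l \<in> Oring y b" "pval y b (k - l) = pval y b k - pval y b l"
  using place_add[OF y k(1) place_uminus(1)[OF y k(2)]] place_uminus[OF y k(2)] by auto

lemma place_power:
  assumes y: "coordsys y" and k: "k \<in> Oring y b"
  shows "k ^ n \<in> Oring y b" "pval y b (k ^ n) = pval y b k ^ n"
proof -
  have "k ^ n \<in> Oring y b \<and> pval y b (k ^ n) = pval y b k ^ n"
    by (induction n) (auto simp: place_0_1[OF y] place_mult[OF y k])
  then show "k ^ n \<in> Oring y b" "pval y b (k ^ n) = pval y b k ^ n" by auto
qed

lemma place_inverse:
  assumes y: "coordsys y" and k: "k \<in> Oring y b" "pval y b k \<noteq> 0"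
  shows "inverse k \<in> Oring y b" "pval y b (inverse k) = inverse (pval y b k)"
proof -
  obtain F G where *: "k = ev y F / ev y G" "val b G \<noteq> 0" "ev y G \<noteq> 0" "pval y b k = val b F / val b G" by (rule OringE[OF k(1) y])
  have "inverse k = ev y G / ev y F" "val b F \<noteq> 0" using * k(2) by auto
  then show "inverse k \<in> Oring y b" "pval y b (inverse k) = inverse (pval y b k)" 
    using OringI[OF y, of b F "inverse k" G] * by auto
qed

lemma place_divide:
  assumes y: "coordsys y" and k: "l \<in> Oring y b" "k \<in> Oring y b" "pval y b k \<noteq> 0"
  shows "l / k \<in> Oring y b" "pval y b (l / k) = pval y b l / pval y b k"
  using place_mult[OF y k(1) place_inverse(1)[OF y k(2,3)]] place_inverse[OF y k(2,3)]
  by (auto simp: divide_inverse)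

lemma place_inverse_iff:
  assumes y: "coordsys y" and k: "k \<in> Oring y b" "pval y b k = 0"
  shows "inverse k \<notin> Oring y b \<or> k = 0"
  using place_mult(2)[OF y k(1), of "inverse k"] k(2) place_0_1(4)[OF y] by (cases "k = 0") auto

lemma place_crd:
  assumes y: "coordsys y" "i < 4"
  shows "crd y i \<in> Oring y b" "pval y b (crd y i) = crd b i"
  using place_ev[OF y(1), where F = "X i"] y by auto

lemmas place = place_add place_mult place_cst place_0_1 place_uminus place_diff place_power place_divide

lemma sring_Oring: "coordsys y \<Longrightarrow> sring (Oring y b)"
  by (auto simp: sring_def place)

lemma maxideal_Oring:
  assumes y: "coordsys y"
  shows "maxideal (Oring y b) = {k \<in> Oring y b. pval y b k = 0}"
  using place_inverse(1)[OF y, where b = b] place_inverse_iff[OF y, where b = b] place_0_1(1,2)[OF y, where b = b]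
  unfolding maxideal_def by blast

lemma lring_Oring:
  assumes y: "coordsys y"
  shows "lring (Oring y b)"
  unfolding lring_def prm_def maxideal_Oring[OF y]
  by (auto simp: place[OF y] sring_Oring[OF y])

text \<open>A second quadruple is a coordinate system if it takes generic values, relative to the first one,
  and generates the same field.\<close>

definition gfield :: "ratfun set \<Rightarrow> ratfun set" where
  "gfield G = \<Inter>{T. sring T \<and> (\<forall>a\<in>T. inverse a \<in> T) \<and> range cst \<subseteq> T \<and> G \<subseteq> T}"

lemma gfield_mem:
  "cst c \<in> gfield G" "a \<in> G \<Longrightarrow> a \<in> gfield G" "a \<in> gfield G \<Longrightarrow> b \<in> gfield G \<Longrightarrow> a + b \<in> gfield G"
  "a \<in> gfield G \<Longrightarrow> b \<in> gfield G \<Longrightarrow> a * b \<in> gfield G" "a \<in> gfield G \<Longrightarrow> b \<in> gfield G \<Longrightarrow> a - b \<in> gfield G"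
  "a \<in> gfield G \<Longrightarrow> b \<in> gfield G \<Longrightarrow> a / b \<in> gfield G" "a \<in> gfield G \<Longrightarrow> - a \<in> gfield G"
  "1 \<in> gfield G" "numeral n \<in> gfield G" "a \<in> gfield G \<Longrightarrow> a ^ k \<in> gfield G"
proof -
  have n: "numeral n \<in> T" if "sring T" "range cst \<subseteq> T" for T
    using that(2) cst_numeral[of n] by (metis rangeI subsetD)
  show "cst c \<in> gfield G" "a \<in> G \<Longrightarrow> a \<in> gfield G" "a \<in> gfield G \<Longrightarrow> b \<in> gfield G \<Longrightarrow> a + b \<in> gfield G"
  "a \<in> gfield G \<Longrightarrow> b \<in> gfield G \<Longrightarrow> a * b \<in> gfield G" "a \<in> gfield G \<Longrightarrow> b \<in> gfield G \<Longrightarrow> a - b \<in> gfield G"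
  "a \<in> gfield G \<Longrightarrow> b \<in> gfield G \<Longrightarrow> a / b \<in> gfield G" "a \<in> gfield G \<Longrightarrow> - a \<in> gfield G"
  "1 \<in> gfield G" "numeral n \<in> gfield G" "a \<in> gfield G \<Longrightarrow> a ^ k \<in> gfield G"
    unfolding gfield_def using n by (auto simp: sringD divide_inverse sring_power)
qed

lemma gfield_min:
  "sring T \<Longrightarrow> (\<And>a. a \<in> T \<Longrightarrow> inverse a \<in> T) \<Longrightarrow> range cst \<subseteq> T \<Longrightarrow> G \<subseteq> T \<Longrightarrow> gfield G \<subseteq> T"
  unfolding gfield_def by blast

text \<open>Independence is tested at points: a nonzero \<open>F\<close> multiplied by
  \<open>H\<close> is nonzero at some \<open>b\<close>, and \<open>b\<close> is the image of a point
  \<open>a\<close> of the old chart, where the function \<open>ev y' F\<close> takes the nonzero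
  value \<open>val b F\<close>. The factor \<open>H\<close> removes the points that are not
  reached.\<close>

lemma coordsysI:
  assumes y: "coordsys y"
    and gen: "\<And>i. i < 4 \<Longrightarrow> crd y i \<in> gfield {crd y' 0, crd y' 1, crd y' 2, crd y' 3}"
    and H: "H \<noteq> 0" and pts: "\<And>b. val b H \<noteq> 0 \<Longrightarrow> \<exists>a. \<forall>i<4. crd y' i \<in> Oring y a \<and> pval y a (crd y' i) = crd b i"
  shows "coordsys y'"
proof -
  have inj: "F = 0" if F: "ev y' F = 0" for F
  proof (rule ccontr)
    assume "F \<noteq> 0"
    then have "H * F \<noteq> 0" using H by simp
    then obtain b where "val b (H * F) \<noteq> 0" using ex_val_nonzero by blast
    then have b: "val b H \<noteq> 0" "val b F \<noteq> 0" by auto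
    obtain a where a: "\<forall>i<4. crd y' i \<in> Oring y a \<and> pval y a (crd y' i) = crd b i" using pts[OF b(1)] by blast
    have "ev y' G \<in> Oring y a \<and> pval y a (ev y' G) = val b G" for G
      by (induction G rule: poly4_induct) (use a in \<open>auto simp: place[OF y]\<close>)
    from this[of F] F b(2) place_0_1(2)[OF y] show False by simp
  qed
  let ?T = "{k. \<exists>F G. ev y' G \<noteq> 0 \<and> k = ev y' F / ev y' G}"
  have "k \<in> ?T" for k
  proof -
    have mem: "a / b \<in> ?T" if "a \<in> range (ev y')" "b \<in> range (ev y')" "b \<noteq> 0" for a b using that by blast
    have T: "sring ?T" unfolding sring_def
    proof (intro conjI ballI)
      show "1 \<in> ?T" using mem[OF range_ev_mem(3,3)] by simp
      fix a assume "a \<in> ?T"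
      then obtain F G where a: "a = ev y' F / ev y' G" "ev y' G \<noteq> 0" by blast
      then have "- a = ev y' (- F) / ev y' G" by simp
      then show "- a \<in> ?T" using a by blast
      fix b assume "b \<in> ?T"
      then obtain F' G' where b: "b = ev y' F' / ev y' G'" "ev y' G' \<noteq> 0" by blast
      have nz: "ev y' (G * G') \<noteq> 0" using a b by simp
      have "a + b = ev y' (F * G' + F' * G) / ev y' (G * G')"
        unfolding a(1) b(1) using a(2) b(2) by (simp add: add_frac_eq)
      then show "a + b \<in> ?T" using nz by blast
      have "a * b = ev y' (F * F') / ev y' (G * G')" unfolding a(1) b(1) by simp
      then show "a * b \<in> ?T" using nz by blast
    qed
    have inv: "inverse a \<in> ?T" if "a \<in> ?T" for a
    proof -
      from that obtain F G where a: "a = ev y' F / ev y' G" "ev y' G \<noteq> 0" by blast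
      show ?thesis
      proof (cases "ev y' F = 0")
        case True then show ?thesis using a sringD(2)[OF T] by simp
      next
        case False
        have "inverse a = ev y' G / ev y' F" using a by simp
        then show ?thesis using False by blast
      qed
    qed
    have cT: "range cst \<subseteq> ?T"
    proof
      fix a assume "a \<in> range cst"
      then have "a / 1 \<in> ?T" by (intro mem) (use range_ev_mem[where y = y'] in auto)
      then show "a \<in> ?T" by simp
    qed
    have gT: "crd y' i \<in> ?T" if "i < 4" for i
      using mem[OF range_ev_mem(2)[OF that] range_ev_mem(3)] by simp
    have "crd y i \<in> ?T" if "i < 4" for i
    proof -
      have "gfield {crd y' 0, crd y' 1, crd y' 2, crd y' 3} \<subseteq> ?T"
      proof (rule gfield_min[OF T inv cT])
        show "{crd y' 0, crd y' 1, crd y' 2, crd y' 3} \<subseteq> ?T" by (intro insert_subsetI gT empty_subsetI) simp_all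
      qed
      then show ?thesis using gen[OF that] by blast
    qed
    then have m: "ev y F \<in> ?T" for F using ev_mem[OF T cT] by blast
    obtain F G where k: "k = ev y F * inverse (ev y G)" using y unfolding coordsys_def by (metis divide_inverse)
    show ?thesis unfolding k by (rule sringD(4)[OF T m inv[OF m]])
  qed
  then show ?thesis unfolding coordsys_def using inj by blast
qed

section \<open>Coordinate subspaces, divisorial valuations and points of a chart\<close>

lemma rhom_C4: "rhom C4"
  by (simp add: rhom_def C4_def flip: pCons_one)

text \<open>Restriction to the subspace where the coordinates in \<open>I\<close> vanish, pulled
  back along the projection so that the result stays in the same ring. Its kernel is the ideal of
  the subspace.\<close>

definition zer :: "nat set \<Rightarrow> poly4 \<Rightarrow> poly4" where
  "zer I = ev4 C4 (if 0 \<in> I then 0 else X 0, if 1 \<in> I then 0 else X 1, if 2 \<in> I then 0 else X 2, if 3 \<in> I then 0 else X 3)"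

lemma rhom_zer: "rhom (zer I)"
  unfolding zer_def by (rule rhom_ev4[OF rhom_C4])

lemmas zer_hom [simp] = rhomD(1-7)[OF rhom_zer]

lemma zer_C4 [simp]: "zer I (C4 c) = C4 c"
  by (simp add: zer_def ev4_C4[OF rhom_C4])

lemma zer_X [simp]: "i < 4 \<Longrightarrow> zer I (X i) = (if i \<in> I then 0 else X i)"
  by (simp add: zer_def ev4_X[OF rhom_C4]) (auto elim!: less4E)

fun zpt :: "nat set \<Rightarrow> pt \<Rightarrow> pt" where
  "zpt I (a, b, c, d) = (if 0 \<in> I then 0 else a, if 1 \<in> I then 0 else b, if 2 \<in> I then 0 else c, if 3 \<in> I then 0 else d)"

lemma crd_zpt: "i < 4 \<Longrightarrow> crd (zpt I b) i = (if i \<in> I then 0 else crd b i)"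
  by (cases b) (auto elim!: less4E)

lemma val_zer: "val b (zer I F) = val (zpt I b) F"
  by (induction F rule: poly4_induct) (auto simp: crd_zpt)

text \<open>\<open>F - zer I F\<close> lies in the ideal generated by the coordinates in
  \<open>I\<close>; the induction uses the product rule for such differences. The set
  \<open>p\<close> is only required to be closed under addition and multiplication by
  \<open>T\<close>, since it serves both as a prime ideal and as a principal fractional
  ideal.\<close>

lemma diff_zer_mem:
  assumes T: "sring T" "pring y \<subseteq> T" and add: "\<And>a b. a \<in> p \<Longrightarrow> b \<in> p \<Longrightarrow> a + b \<in> p" "0 \<in> p"
    and mult: "\<And>a b. a \<in> T \<Longrightarrow> b \<in> p \<Longrightarrow> a * b \<in> p" and I: "\<And>i. i \<in> I \<Longrightarrow> i < 4 \<Longrightarrow> crd y i \<in> p"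
  shows "ev y (F - zer I F) \<in> p"
proof (induction F rule: poly4_induct)
  case (3 F G)
  have "ev y (F + G - zer I (F + G)) = ev y (F - zer I F) + ev y (G - zer I G)" by simp
  then show ?case using add(1)[OF 3] by (simp only:)
next
  case (4 F G)
  have "ev y (F * G - zer I (F * G)) = ev y F * ev y (G - zer I G) + ev y (zer I G) * ev y (F - zer I F)"
    by (simp add: algebra_simps)
  moreover have "ev y F \<in> T" "ev y (zer I G) \<in> T" using T(2) by (auto simp: pring_def)
  ultimately show ?case using add(1)[OF mult[OF _ 4(2)] mult[OF _ 4(1)]] by (simp only:)
qed (use add I in auto)

lemma X_dvd_iff:
  assumes i: "i < 4"
  shows "X i dvd F \<longleftrightarrow> zer {i} F = 0"
proof
  assume "X i dvd F"
  then show "zer {i} F = 0" using i by (auto elim!: dvdE)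
next
  assume z: "zer {i} F = 0"
  have "X i dvd G - zer {i} G" for G
  proof (induction G rule: poly4_induct)
    case (3 F G)
    have "F + G - zer {i} (F + G) = (F - zer {i} F) + (G - zer {i} G)" by simp
    then show ?case using 3 by (metis dvd_add)
  next
    case (4 F G)
    have "F * G - zer {i} (F * G) = F * (G - zer {i} G) + zer {i} G * (F - zer {i} F)" by (simp add: algebra_simps)
    then show ?case using 4 by (metis dvd_add dvd_mult)
  qed auto
  from this[of F] z show "X i dvd F" by simp
qed

lemma X_neq_0: "i < 4 \<Longrightarrow> X i \<noteq> 0"
  by (auto elim!: less4E simp: X4_def)

lemma prime_elem_X:
  assumes i: "i < 4"
  shows "prime_elem (X i)"
proof (rule prime_elemI)
  show "X i \<noteq> 0" using X_neq_0[OF i] .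
  show "\<not> is_unit (X i)" using i by (simp add: X_dvd_iff[OF i, of 1])
  show "X i dvd a \<or> X i dvd b" if "X i dvd a * b" for a b
    using that by (simp add: X_dvd_iff[OF i])
qed

text \<open>The four linear generators span the kernel of evaluation at the point, because a
  polynomial minus its value lies in the ideal they generate. After this, points are handled through
  \<open>Oring\<close> and never through generated ideals.\<close>

lemma point_at_eq:
  assumes y: "coordsys (s, t, u, v)"
  shows "point_at (s, t, u, v) (a, b, c, d) = Oring (s, t, u, v) (a, b, c, d)"
proof -
  let ?y = "(s, t, u, v)" and ?b = "(a, b, c, d)"
  let ?A = "polyring {s, t, u, v}" let ?m = "{ev ?y F | F. val ?b F = 0}"
  have A: "?A = range (ev ?y)" by (rule polyring_eq)
  have sA: "sring ?A" by (rule sring_polyring)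
  interpret cring "subring_of_K ?A" by (rule cring_subring_of_K[OF sA])
  have crdA: "crd ?y i - cst (crd ?b i) \<in> ?A" if "i < 4" for i
    unfolding A using range_ev_mem(1)[of "crd ?b i" ?y] range_ev_mem(2)[OF that, of ?y] sringD(6)[OF sring_range_ev] by blast
  have G: "{s - cst a, t - cst b, u - cst c, v - cst d} = (\<lambda>i. crd ?y i - cst (crd ?b i)) ` {..<4}"
    by (auto simp: lessThan_nat_numeral lessThan_Suc numeral_eq_Suc crd.simps)
  have ideal_m: "ideal ?m (subring_of_K ?A)"
  proof (rule ideal_subring_of_KI[OF sA])
    show "?m \<subseteq> ?A" unfolding A by auto
    show "0 \<in> ?m" by (auto intro!: exI[of _ 0])
    fix f g assume g: "g \<in> ?m"
    then obtain G where G: "g = ev ?y G" "val ?b G = 0" by auto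
    { assume "f \<in> ?m" then obtain F where "f = ev ?y F" "val ?b F = 0" by auto
      then show "f + g \<in> ?m" using G by (auto intro!: exI[of _ "F + G"]) }
    { assume "f \<in> ?A" then obtain F where "f = ev ?y F" by (auto simp: A)
      then show "f * g \<in> ?m" using G by (auto intro!: exI[of _ "F * G"]) }
  qed
  have "Idl\<^bsub>subring_of_K ?A\<^esub> {s - cst a, t - cst b, u - cst c, v - cst d} = ?m"
  proof
    show "Idl\<^bsub>subring_of_K ?A\<^esub> {s - cst a, t - cst b, u - cst c, v - cst d} \<subseteq> ?m"
    proof (rule genideal_minimal[OF ideal_m], unfold G, safe)
      fix i :: nat assume i: "i < 4"
      have "crd ?y i - cst (crd ?b i) = ev ?y (X i - C4 (crd ?b i))" "val ?b (X i - C4 (crd ?b i)) = 0"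
        using i by simp_all
      then show "\<exists>F. crd ?y i - cst (crd ?b i) = ev ?y F \<and> val ?b F = 0" by blast
    qed
  next
    let ?J = "Idl\<^bsub>subring_of_K ?A\<^esub> {s - cst a, t - cst b, u - cst c, v - cst d}"
    have sub: "{s - cst a, t - cst b, u - cst c, v - cst d} \<subseteq> carrier (subring_of_K ?A)"
      unfolding G using crdA by auto
    interpret J: ideal ?J "subring_of_K ?A" by (rule genideal_ideal[OF sub])
    have inJ: "crd ?y i - cst (crd ?b i) \<in> ?J" if "i < 4" for i
      using genideal_self[OF sub] that unfolding G by auto
    have add: "f + g \<in> ?J" if "f \<in> ?J" "g \<in> ?J" for f g
      using J.a_closed that by simp
    have mult: "f * g \<in> ?J" if "f \<in> ?A" "g \<in> ?J" for f g
      using J.I_l_closed that by simp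
    have zero: "0 \<in> ?J" using J.zero_closed by simp
    have "ev ?y F - cst (val ?b F) \<in> ?J" for F
    proof (induction F rule: poly4_induct)
      case (3 F G)
      have "ev ?y (F + G) - cst (val ?b (F + G)) = (ev ?y F - cst (val ?b F)) + (ev ?y G - cst (val ?b G))"
        by (simp add: cst_hom)
      then show ?case using add[OF 3] by (simp only:)
    next
      case (4 F G)
      have eq: "ev ?y (F * G) - cst (val ?b (F * G)) =
          ev ?y F * (ev ?y G - cst (val ?b G)) + cst (val ?b G) * (ev ?y F - cst (val ?b F))"
        by (simp add: cst_hom algebra_simps)
      show ?case unfolding eq by (intro add mult 4) (auto simp: A range_ev_mem)
    qed (use inJ zero in auto)
    then have "ev ?y F \<in> ?J" if "val ?b F = 0" for F using that by (metis cst_simps(1) diff_zero)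
    then show "?m \<subseteq> ?J" by blast
  qed
  then have "point_at ?y ?b = localization (range (ev ?y)) ?m"
    by (simp add: A Let_def)
  also have "\<dots> = Oring ?y ?b"
  proof (intro subset_antisym subsetI)
    fix k assume "k \<in> localization (range (ev ?y)) ?m"
    then obtain F G where "k = ev ?y F / ev ?y G" "ev ?y G \<notin> ?m" by (auto elim!: localizationE)
    then show "k \<in> Oring ?y ?b" by (auto simp: Oring_def)
  next
    fix k assume "k \<in> Oring ?y ?b"
    then obtain F G where k: "k = ev ?y F / ev ?y G" "val ?b G \<noteq> 0" by (auto simp: Oring_def)
    have "ev ?y G \<notin> ?m"
    proof
      assume "ev ?y G \<in> ?m"
      then obtain G' where "ev ?y G = ev ?y G'" "val ?b G' = 0" by auto
      then have "ev ?y (G - G') = 0" by simp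
      then have "G - G' = 0" using coordsys_ev_0[OF y] by blast
      then show False using k \<open>val ?b G' = 0\<close> by simp
    qed
    then show "k \<in> localization (range (ev ?y)) ?m" unfolding k(1) by (intro localizationI) auto
  qed
  finally show ?thesis .
qed

section \<open>Valuation rings of prime divisors in a chart\<close>

definition pdv :: "coords \<Rightarrow> poly4 \<Rightarrow> local_ring" where
  "pdv y p = {ev y F / ev y G | F G. \<not> p dvd G}"

lemma pdvI: "\<not> p dvd G \<Longrightarrow> ev y F / ev y G \<in> pdv y p"
  unfolding pdv_def by blast

lemma ev_pdv: "prime_elem p \<Longrightarrow> ev y F \<in> pdv y p"
  using pdvI[of p 1 y F] by (simp add: prime_elem_def)

lemma pdv_localization:
  assumes y: "coordsys y" and p: "prime_elem p"
  shows "prm (pring y) (ev y ` {F. p dvd F})" "pdv y p = localization (pring y) (ev y ` {F. p dvd F})"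
proof -
  have inj: "ev y F = ev y G \<longleftrightarrow> F = G" for F G
    using coordsys_ev_0[OF y, of "F - G"] by auto
  have mem: "ev y F \<in> ev y ` {F. p dvd F} \<longleftrightarrow> p dvd F" for F using inj by auto
  show "prm (pring y) (ev y ` {F. p dvd F})" unfolding prm_def
  proof (intro conjI ballI impI)
    show "1 \<notin> ev y ` {F. p dvd F}" using mem[of 1] p by (simp add: prime_elem_def)
    show "0 \<in> ev y ` {F. p dvd F}" using mem[of 0] by simp
    fix a b
    show "a + b \<in> ev y ` {F. p dvd F}" if "a \<in> ev y ` {F. p dvd F}" "b \<in> ev y ` {F. p dvd F}"
    proof -
      from that obtain F G where "a = ev y F" "b = ev y G" "p dvd F" "p dvd G" by auto
      then show ?thesis using mem[of "F + G"] by simp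
    qed
    show "a * b \<in> ev y ` {F. p dvd F}" if "a \<in> pring y" "b \<in> ev y ` {F. p dvd F}"
    proof -
      from that obtain F G where "a = ev y F" "b = ev y G" "p dvd G" by (auto simp: pring_def)
      then show ?thesis using mem[of "F * G"] by simp
    qed
    show "a \<in> ev y ` {F. p dvd F} \<or> b \<in> ev y ` {F. p dvd F}" if "a \<in> pring y" "b \<in> pring y" "a * b \<in> ev y ` {F. p dvd F}"
    proof -
      from that obtain F G where FG: "a = ev y F" "b = ev y G" by (auto simp: pring_def)
      then have "p dvd F * G" using that mem[of "F * G"] by simp
      then show ?thesis using FG mem prime_elem_dvd_mult_iff[OF p] by auto
    qed
  qed (auto simp: pring_def)
  show "pdv y p = localization (pring y) (ev y ` {F. p dvd F})"
    unfolding pdv_def localization_def pring_def using mem by auto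
qed

lemma dvr_pdv:
  assumes y: "coordsys y" and p: "prime_elem p"
  shows "dvr (pdv y p) (ev y p)"
proof
  note loc = lring_localization[OF sring_pring pdv_localization(1)[OF y p], folded pdv_localization(2)[OF y p]]
  show sr: "sring (pdv y p)" using loc(1) lring_sring by blast
  have p0: "ev y p \<noteq> 0" using p coordsys_ev_0[OF y] by (auto simp: prime_elem_def)
  show "uniformizer (pdv y p) (ev y p)" unfolding uniformizer_def
  proof (intro conjI allI impI p0)
    have "ev y p \<in> ev y ` {F. p dvd F}" by simp
    then show "ev y p \<in> maxideal (pdv y p)" using loc(4) by blast
    fix a :: ratfun assume a: "a \<noteq> 0"
    obtain F G where FG: "a = ev y F / ev y G" "ev y G \<noteq> 0" using y unfolding coordsys_def by blast
    then have nz: "F \<noteq> 0" "G \<noteq> 0" using a by auto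
    have nu: "\<not> is_unit p" using p by (simp add: prime_elem_def)
    obtain F' where F': "F = p ^ multiplicity p F * F'" "\<not> p dvd F'" using multiplicity_decompose'[OF nz(1) nu] by blast
    obtain G' where G': "G = p ^ multiplicity p G * G'" "\<not> p dvd G'" using multiplicity_decompose'[OF nz(2) nu] by blast
    define m n where "m = multiplicity p F" and "n = multiplicity p G"
    have nz': "ev y F' \<noteq> 0" "ev y G' \<noteq> 0" using F'(2) G'(2) coordsys_ev_0[OF y] by auto
    have "ev y F = ev y p ^ m * ev y F'" "ev y G = ev y p ^ n * ev y G'"
      using arg_cong[OF F'(1), of "ev y"] arg_cong[OF G'(1), of "ev y"] by (simp_all add: m_def n_def)
    then have "a = ev y p ^ m * ev y F' / (ev y p ^ n * ev y G')" unfolding FG(1) by (simp only:)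
    then have "a / ev y p powi (int m - int n) = ev y F' / ev y G'"
      using p0 nz' by (simp add: power_int_diff field_simps)
    moreover have "ev y F' / ev y G' \<in> units_in (pdv y p)"
      using nz' pdvI[OF G'(2), of y F'] pdvI[OF F'(2), of y G'] by (simp add: units_in_def)
    ultimately show "\<exists>n. a / ev y p powi n \<in> units_in (pdv y p)" by metis
  qed
qed

lemma maxideal_pdv:
  assumes y: "coordsys y" and p: "prime_elem p"
  shows "ev y F \<in> maxideal (pdv y p) \<longleftrightarrow> p dvd F"
proof -
  have inj: "ev y F = ev y G \<longleftrightarrow> F = G" for F G
    using coordsys_ev_0[OF y, of "F - G"] by auto
  have "maxideal (pdv y p) \<inter> pring y = ev y ` {F. p dvd F}"
    using lring_localization(4)[OF sring_pring pdv_localization(1)[OF y p], folded pdv_localization(2)[OF y p]] .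
  then have "ev y F \<in> maxideal (pdv y p) \<longleftrightarrow> ev y F \<in> ev y ` {F. p dvd F}" using pring_mem(3)[of y F] by blast
  then show ?thesis using inj by auto
qed

lemma Oring_units_pdv:
  assumes y: "coordsys y" and i: "i < 4" "crd b i = 0"
  shows "k \<in> Oring y b \<Longrightarrow> k \<in> pdv y (X i)" "k \<in> Oring y b \<Longrightarrow> pval y b k \<noteq> 0 \<Longrightarrow> k \<in> units_in (pdv y (X i))"
proof -
  have nd: "\<not> X i dvd G" if "val b G \<noteq> 0" for G using that i by (auto elim!: dvdE)
  { fix k assume "k \<in> Oring y b"
    then obtain F G where "k = ev y F / ev y G" "val b G \<noteq> 0" by (auto simp: Oring_def)
    then have "k \<in> pdv y (X i)" using nd pdvI by blast }
  note sub = this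
  show "k \<in> Oring y b \<Longrightarrow> k \<in> pdv y (X i)" by (rule sub)
  show "k \<in> Oring y b \<Longrightarrow> pval y b k \<noteq> 0 \<Longrightarrow> k \<in> units_in (pdv y (X i))"
    using sub place_inverse(1)[OF y, of k b] place_0_1(2)[OF y, where b = b] by (auto simp: units_in_def)
qed

text \<open>One closed point of the hyperplane suffices: a function regular and nonzero at that
  point is a unit along the hyperplane, so a factorization with such a cofactor exhibits the order.
  All explicit orders below are certified in this manner.\<close>

lemma ord_pdv:
  assumes y: "coordsys y" and i: "i < 4" "crd b i = 0" and k: "k = crd y i ^ n * k'" "k' \<in> Oring y b" "pval y b k' \<noteq> 0"
  shows "ord_at (pdv y (X i)) k = int n" "k \<noteq> 0"
proof -
  interpret dvr "pdv y (X i)" "ev y (X i)" by (rule dvr_pdv[OF y prime_elem_X[OF i(1)]])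
  have u: "k' \<in> units_in (pdv y (X i))" by (rule Oring_units_pdv(2)[OF y i k(2,3)])
  then have k0: "k' \<noteq> 0" by (simp add: units_in_def)
  have e: "ev y (X i) = crd y i" using i by simp
  show "k \<noteq> 0" using k0 pi(1) by (simp add: k(1) e)
  then show "ord_at (pdv y (X i)) k = int n"
    using u pi(1) by (intro ordI) (auto simp: k(1) e)
qed

text \<open>Coordinate ring of the principal open set where \<open>g\<close> is invertible. Charts
  are shrunk like this because centers involve the denominator \<open>1 + h * P\<close> and because
  one chart survives the earlier blow-ups only where one of its coordinates is invertible.\<close>

definition Bring :: "coords \<Rightarrow> ratfun \<Rightarrow> ratfun set" where
  "Bring y g = {k / g ^ n | k n. k \<in> pring y}"

lemma BringI: "k \<in> pring y \<Longrightarrow> k / g ^ n \<in> Bring y g"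
  unfolding Bring_def by blast

lemma pring_Bring: "pring y \<subseteq> Bring y g"
  using BringI[of _ y g 0] by auto

lemma Bring_1: "Bring y 1 = pring y"
  by (auto simp: Bring_def)

lemma sring_Bring:
  assumes g: "g \<in> pring y" "g \<noteq> 0"
  shows "sring (Bring y g)"
  unfolding sring_def
proof (intro conjI ballI)
  note s = sringD[OF sring_pring[of y]]
  note sp = sring_power[OF sring_pring[of y] g(1)]
  show "1 \<in> Bring y g" using pring_Bring s(1) by blast
  fix a assume "a \<in> Bring y g"
  then obtain k n where a: "a = k / g ^ n" "k \<in> pring y" by (auto simp: Bring_def)
  have "- a = (- k) / g ^ n" using a by simp
  then show "- a \<in> Bring y g" using BringI[OF s(5)[OF a(2)]] by (simp only:)
  fix b assume "b \<in> Bring y g"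
  then obtain l m where b: "b = l / g ^ m" "l \<in> pring y" by (auto simp: Bring_def)
  have "a + b = (k * g ^ m + l * g ^ n) / g ^ (n + m)"
    unfolding a(1) b(1) using g(2) by (simp add: add_frac_eq power_add)
  moreover have "k * g ^ m + l * g ^ n \<in> pring y" using a b sp s by auto
  ultimately show "a + b \<in> Bring y g" using BringI by (simp only:)
  have "a * b = (k * l) / g ^ (n + m)"
    unfolding a(1) b(1) by (simp add: power_add)
  moreover have "k * l \<in> pring y" using a b s by auto
  ultimately show "a * b \<in> Bring y g" using BringI by (simp only:)
qed

lemma Bring_min:
  assumes "sring T" "range cst \<subseteq> T" "\<And>i. i < 4 \<Longrightarrow> crd y i \<in> T" "1 / g \<in> T"
  shows "Bring y g \<subseteq> T"
proof
  fix a assume "a \<in> Bring y g"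
  then obtain k n where a: "a = k / g ^ n" "k \<in> pring y" by (auto simp: Bring_def)
  have "k \<in> T" using pring_min[OF assms(1-3)] a by blast
  then have "k * (1 / g) ^ n \<in> T" using sringD(4)[OF assms(1)] sring_power[OF assms(1,4)] by blast
  then show "a \<in> T" using a by (simp add: power_one_over)
qed

lemma Bring_inverse: "1 / g \<in> Bring y g"
  using BringI[of 1 y g 1] sringD(1)[OF sring_pring] by simp

lemma cst_Bring: "range cst \<subseteq> Bring y g"
  using pring_Bring pring_mem(1) by blast

lemma Bring_subset:
  assumes "g \<in> pring y'" "g \<noteq> 0" "\<And>i. i < 4 \<Longrightarrow> crd y i \<in> Bring y' g"
  shows "Bring y g \<subseteq> Bring y' g"
  by (rule Bring_min[OF sring_Bring[OF assms(1,2)] cst_Bring assms(3) Bring_inverse])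

lemma affine_mem:
  assumes "sring B" "lring L" "B \<subseteq> L" "\<And>k. k \<in> L \<Longrightarrow> \<exists>a b. a \<in> B \<and> b \<in> B \<and> b \<notin> maxideal L \<and> k = a / b"
  shows "L \<in> affine B"
proof -
  let ?p = "B \<inter> maxideal L"
  have p: "prm B ?p" by (rule prm_contract[OF assms(2,1,3)])
  have "L \<subseteq> localization B ?p"
  proof
    fix k assume "k \<in> L"
    from assms(4)[OF this] show "k \<in> localization B ?p" by (auto intro: localizationI)
  qed
  moreover have "localization B ?p \<subseteq> L" by (rule localization_subset[OF assms(2,3)]) auto
  ultimately show ?thesis using affineI[OF assms(1) p] by auto
qed

lemma Oring_affine:
  assumes y: "coordsys y" and G: "val b G \<noteq> 0"
  shows "Oring y b \<in> affine (Bring y (ev y G))" "Bring y (ev y G) \<subseteq> Oring y b"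
proof -
  have g: "ev y G \<in> pring y" "ev y G \<noteq> 0" using pring_mem(3) G coordsys_ev_0[OF y] by auto
  show sub: "Bring y (ev y G) \<subseteq> Oring y b"
    by (rule Bring_min[OF sring_Oring[OF y]])
       (use G place_cst(1)[OF y, where b = b] place_crd[OF y, where b = b] place_ev[OF y, where b = b] place_divide(1)[OF y place_0_1(3)[OF y], where b = b] in auto)
  show "Oring y b \<in> affine (Bring y (ev y G))"
  proof (rule affine_mem[OF sring_Bring[OF g] lring_Oring[OF y] sub])
    fix k assume "k \<in> Oring y b"
    then obtain F H where k: "k = ev y F / ev y H" "val b H \<noteq> 0" by (auto simp: Oring_def)
    have "ev y H \<notin> maxideal (Oring y b)" using k place_ev(2)[OF y, where b = b] by (simp add: maxideal_Oring[OF y])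
    then show "\<exists>a c. a \<in> Bring y (ev y G) \<and> c \<in> Bring y (ev y G) \<and> c \<notin> maxideal (Oring y b) \<and> k = a / c"
      using k pring_mem(3) pring_Bring by blast
  qed
qed

lemma pdv_affine:
  assumes y: "coordsys y" and p: "prime_elem p" and G: "\<not> p dvd G"
  shows "pdv y p \<in> affine (Bring y (ev y G))" "Bring y (ev y G) \<subseteq> pdv y p"
proof -
  interpret dvr "pdv y p" "ev y p" by (rule dvr_pdv[OF y p])
  have g: "ev y G \<in> pring y" "ev y G \<noteq> 0" using pring_mem(3) G coordsys_ev_0[OF y] by auto
  show sub: "Bring y (ev y G) \<subseteq> pdv y p"
  proof (rule Bring_min[OF sr])
    show "range cst \<subseteq> pdv y p" using ev_pdv[OF p, of y "C4 c" for c] by auto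
    show "crd y i \<in> pdv y p" if "i < 4" for i using ev_pdv[OF p, of y "X i"] that by auto
    show "1 / ev y G \<in> pdv y p" using pdvI[OF G, of y 1] by simp
  qed
  show "pdv y p \<in> affine (Bring y (ev y G))"
  proof (rule affine_mem[OF sring_Bring[OF g] lring sub])
    fix k assume "k \<in> pdv y p"
    then obtain F H where k: "k = ev y F / ev y H" "\<not> p dvd H" by (auto simp: pdv_def)
    then have "ev y H \<notin> maxideal (pdv y p)" using maxideal_pdv[OF y p] by blast
    then show "\<exists>a c. a \<in> Bring y (ev y G) \<and> c \<in> Bring y (ev y G) \<and> c \<notin> maxideal (pdv y p) \<and> k = a / c"
      using k pring_mem(3) pring_Bring by blast
  qed
qed

section \<open>Blowing up a coordinate subspace\<close>

text \<open>The center is the coordinate subspace given by \<open>I\<close>. \<open>W1\<close> asks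
  for its closed points only where \<open>G\<close> does not vanish, since the parametrizations omit
  parameters with \<open>1 + h * P = 0\<close>; the assumption that \<open>zer I G\<close> is
  nonzero keeps the remaining points dense.\<close>

locale coord_blowup =
  fixes V :: variety and y :: coords and G :: poly4 and W :: "local_ring set" and I :: "nat set" and k :: nat
  assumes y: "coordsys y" and V: "model V" and BV: "affine (Bring y (ev y G)) \<subseteq> V"
    and I: "I \<subseteq> {..<4}" "k \<in> I" and G: "zer I G \<noteq> 0"
    and W0: "\<And>S i. S \<in> W \<Longrightarrow> i \<in> I \<Longrightarrow> crd y i \<in> maxideal S"
    and W1: "\<And>b. \<forall>i\<in>I. crd b i = 0 \<Longrightarrow> val b G \<noteq> 0 \<Longrightarrow> Oring y b \<in> W"
begin

abbreviation "B \<equiv> Bring y (ev y G)"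

lemma G0: "G \<noteq> 0" using G by auto
lemma g: "ev y G \<in> pring y" "ev y G \<noteq> 0" using pring_mem(3) G0 coordsys_ev_0[OF y] by auto
lemma I4: "i \<in> I \<Longrightarrow> i < 4" using I by auto
lemma k4: "k < 4" using I by auto

definition q :: "ratfun set" where
  "q = {ev y F / ev y G ^ n | F n. zer I F = 0}"

lemma Bring_cases:
  assumes "b \<in> B"
  obtains F n where "b = ev y F / ev y G ^ n"
  using assms unfolding Bring_def pring_def by blast

lemma q_iff: "ev y F / ev y G ^ n \<in> q \<longleftrightarrow> zer I F = 0"
proof
  assume "ev y F / ev y G ^ n \<in> q"
  then obtain F' m where *: "ev y F / ev y G ^ n = ev y F' / ev y G ^ m" "zer I F' = 0" by (auto simp: q_def)
  then have "ev y (F * G ^ m - F' * G ^ n) = 0" using g(2) by (simp add: frac_eq_eq)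
  then have "F * G ^ m - F' * G ^ n = 0" using coordsys_ev_0[OF y] by blast
  then have "zer I (F * G ^ m) = zer I (F' * G ^ n)" by simp
  then show "zer I F = 0" using * G by simp
qed (auto simp: q_def)

lemma crd_neq_0: "i < 4 \<Longrightarrow> crd y i \<noteq> 0"
  using coordsys_ev_0[OF y, of "X i"] X_neq_0[of i] by simp

sublocale blowup_chart V B W "crd y ` I" q "crd y k"
proof
  show "sring B" by (rule sring_Bring[OF g])
  show "model V" "affine B \<subseteq> V" by (rule V BV)+
  show "crd y ` I \<subseteq> B" using I4 pring_mem(2) pring_Bring by blast
  show "crd y k \<in> crd y ` I" using I by blast
  show "0 \<notin> crd y ` I" using crd_neq_0 I4 by (metis imageE)
  show "x \<in> maxideal S" if "S \<in> W" "x \<in> crd y ` I" for S x using that W0 by blast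
  have sB: "sring B" by (rule sring_Bring[OF g])
  show "prm B q" unfolding prm_def
  proof (intro conjI ballI impI)
    show "q \<subseteq> B" by (auto simp: q_def Bring_def pring_def)
    show "0 \<in> q" "1 \<notin> q" using q_iff[of 0 0] q_iff[of 1 0] by simp_all
  next
    fix a b assume "a \<in> q" "b \<in> q"
    then obtain F n F' m where *: "a = ev y F / ev y G ^ n" "zer I F = 0" "b = ev y F' / ev y G ^ m" "zer I F' = 0" by (auto simp: q_def)
    have eq: "a + b = ev y (F * G ^ m + F' * G ^ n) / ev y G ^ (n + m)"
      unfolding * using g(2) by (simp add: add_frac_eq power_add)
    show "a + b \<in> q" unfolding eq q_iff using * by simp
  next
    fix a b assume "a \<in> B" "b \<in> q"
    then obtain F n F' m where *: "a = ev y F / ev y G ^ n" "b = ev y F' / ev y G ^ m" "zer I F' = 0"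
      by (auto simp: q_def elim!: Bring_cases)
    have eq: "a * b = ev y (F * F') / ev y G ^ (n + m)"
      unfolding * by (simp add: power_add)
    show "a * b \<in> q" unfolding eq q_iff using * by simp
  next
    fix a b assume ab: "a \<in> B" "b \<in> B" "a * b \<in> q"
    then obtain F n F' m where *: "a = ev y F / ev y G ^ n" "b = ev y F' / ev y G ^ m"
      by (auto elim!: Bring_cases)
    have eq: "a * b = ev y (F * F') / ev y G ^ (n + m)"
      unfolding * by (simp add: power_add)
    have "zer I (F * F') = 0" using ab(3) unfolding eq q_iff .
    then show "a \<in> q \<or> b \<in> q" using * q_iff by simp
  qed
  show "b / crd y k \<in> T" if T: "sring T" "B \<subseteq> T" "\<And>x. x \<in> crd y ` I \<Longrightarrow> x / crd y k \<in> T" "b \<in> q" for T b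
  proof -
    obtain F n where b: "b = ev y F / ev y G ^ n" "zer I F = 0" using T(4) by (auto simp: q_def)
    \<comment> \<open>This set is the fractional ideal of \<open>T\<close> generated by
      \<open>crd y k\<close>; it contains the coordinates in \<open>I\<close> by assumption on
      \<open>T\<close>.\<close>
    have "ev y (F - zer I F) \<in> {a. a / crd y k \<in> T}"
    proof (rule diff_zer_mem[OF T(1)])
      show "pring y \<subseteq> T" using T(2) pring_Bring by blast
    qed (use T sringD[OF T(1)] in \<open>auto simp: add_divide_distrib simp flip: times_divide_eq_right\<close>)
    then have "ev y F / crd y k \<in> T" using b(2) by simp
    moreover have "(1 / ev y G) ^ n \<in> T" using T(2) Bring_inverse sring_power[OF T(1)] by blast
    ultimately have "ev y F / crd y k * (1 / ev y G) ^ n \<in> T" by (rule sringD(4)[OF T(1)])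
    then show ?thesis by (simp add: b power_one_over field_simps)
  qed
  show "q \<subseteq> p" if p: "prm B p" "crd y ` I \<subseteq> p" for p
  proof
    fix b assume "b \<in> q"
    then obtain F n where b: "b = ev y F / ev y G ^ n" "zer I F = 0" by (auto simp: q_def)
    have "ev y (F - zer I F) \<in> p"
      by (rule diff_zer_mem[OF sB pring_Bring]) (use p prmD[OF p(1)] in auto)
    then have "ev y F \<in> p" using b by simp
    then have "ev y F * (1 / ev y G) ^ n \<in> p" using prmD(5)[OF p(1)] sring_power[OF sB Bring_inverse] by blast
    then show "b \<in> p" by (simp add: b power_one_over)
  qed
  show "\<exists>S\<in>V \<inter> W. B \<subseteq> S \<and> b \<notin> maxideal S" if b: "b \<in> B" "b \<notin> q" for b
  proof -
    obtain F n where F: "b = ev y F / ev y G ^ n" using b by (auto elim!: Bring_cases)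
    \<comment> \<open>A nonzero polynomial on the subspace is nonzero at some point of it; the extra
      factor \<open>G\<close> keeps that point inside the chart, where \<open>W1\<close> supplies
      it.\<close>
    then have "zer I (F * G) \<noteq> 0" using b q_iff G by simp
    then obtain c where "val c (zer I (F * G)) \<noteq> 0" using ex_val_nonzero by blast
    then have c: "val (zpt I c) F \<noteq> 0" "val (zpt I c) G \<noteq> 0" by (auto simp: val_zer)
    let ?S = "Oring y (zpt I c)"
    have "?S \<in> W" using I4 by (intro W1 c) (auto simp: crd_zpt)
    moreover have "?S \<in> V" "B \<subseteq> ?S" using Oring_affine[OF y c(2)] BV by auto
    moreover have "b \<notin> maxideal ?S" unfolding maxideal_Oring[OF y]
      using c by (simp add: F place_divide[OF y] place_power[OF y] place_ev[OF y])
    ultimately show ?thesis by blast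
  qed
qed

lemma chart_blowup:
  assumes g': "ev y G \<in> pring y'" and y1: "\<And>i. i < 4 \<Longrightarrow> crd y i \<in> pring y'"
    and y2: "\<And>i. i \<in> I \<Longrightarrow> crd y i / crd y k \<in> pring y'"
    and y3: "\<And>i. i < 4 \<Longrightarrow> crd y' i \<in> pring y \<or> (\<exists>j\<in>I. crd y' i = crd y j / crd y k)"
  shows "affine (Bring y' (ev y G)) \<subseteq> blowup V Z"
proof (rule affine_blowup)
  let ?C = "Bring y' (ev y G)"
  let ?G = "gen (B \<union> {x / crd y k | x. x \<in> crd y ` I})"
  show sC: "sring ?C" by (rule sring_Bring[OF g' g(2)])
  show "B \<subseteq> ?C" by (rule Bring_subset[OF g' g(2)]) (use y1 pring_Bring in blast)
  show "x / crd y k \<in> ?C" if "x \<in> crd y ` I" for x using that y2 pring_Bring by blast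
  fix c assume "c \<in> ?C"
  then obtain a n where a: "c = a / ev y G ^ n" "a \<in> pring y'" by (auto simp: Bring_def)
  have "pring y' \<subseteq> ?G"
  proof (rule pring_min[OF sring_gen])
    show "range cst \<subseteq> ?G" using cst_Bring gen_incl by blast
    show "crd y' i \<in> ?G" if "i < 4" for i
      using y3[OF that] pring_Bring gen_incl[of "B \<union> {x / crd y k | x. x \<in> crd y ` I}"] by blast
  qed
  then have "a \<in> ?G" "ev y G ^ n \<in> ?G" using a g' sring_power[OF sring_gen] by blast+
  moreover have "1 / ev y G ^ n \<in> ?C"
    using sring_power[OF sC Bring_inverse[of "ev y G" y'], of n] by (simp add: power_one_over)
  ultimately show "\<exists>a d. c = a / d \<and> a \<in> ?G \<and> d \<in> ?G \<and> d \<noteq> 0 \<and> 1 / d \<in> ?C"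
    using a(1) g(2) by (intro exI[of _ a] exI[of _ "ev y G ^ n"]) auto
qed

end

section \<open>Changes of coordinates\<close>

text \<open>The standard chart of a blow-up in which coordinate \<open>k\<close> generates the
  exceptional ideal. With the translations \<open>sh\<close>, which move a center to a coordinate
  subspace, and permutations, these account for every chart change in the sequence of
  blow-ups.\<close>

definition dv :: "nat \<Rightarrow> nat set \<Rightarrow> coords \<Rightarrow> coords" where
  "dv k J y = (if 0 \<in> J then crd y 0 / crd y k else crd y 0, if 1 \<in> J then crd y 1 / crd y k else crd y 1,
     if 2 \<in> J then crd y 2 / crd y k else crd y 2, if 3 \<in> J then crd y 3 / crd y k else crd y 3)"

definition sh :: "nat \<Rightarrow> 'a::plus \<Rightarrow> 'a \<times> 'a \<times> 'a \<times> 'a \<Rightarrow> 'a \<times> 'a \<times> 'a \<times> 'a" where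
  "sh i r y = (if i = 0 then crd y 0 + r else crd y 0, if i = 1 then crd y 1 + r else crd y 1,
     if i = 2 then crd y 2 + r else crd y 2, if i = 3 then crd y 3 + r else crd y 3)"

definition tup :: "(nat \<Rightarrow> 'a) \<Rightarrow> 'a \<times> 'a \<times> 'a \<times> 'a" where
  "tup f = (f 0, f 1, f 2, f 3)"

lemma crd_tup: "i < 4 \<Longrightarrow> crd (tup f) i = f i"
  by (auto simp: tup_def elim!: less4E)

lemma crd_dv: "i < 4 \<Longrightarrow> crd (dv k J y) i = (if i \<in> J then crd y i / crd y k else crd y i)"
  by (auto simp: dv_def elim!: less4E)

lemma crd_sh: "j < 4 \<Longrightarrow> crd (sh i r y) j = (if i = j then crd y j + r else crd y j)"
  by (elim less4E) (simp_all add: sh_def)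

lemma crd_neq_0:
  assumes "coordsys y" "i < 4"
  shows "crd y i \<noteq> 0"
  using coordsys_ev_0[OF assms(1), of "X i"] X_neq_0[OF assms(2)] unfolding ev4_X[OF rhom_cst assms(2)] by blast

lemma coordsysI':
  assumes y: "coordsys y"
    and gen: "\<And>i T. i < 4 \<Longrightarrow> (\<And>j. j < 4 \<Longrightarrow> crd y' j \<in> T) \<Longrightarrow> T = gfield {crd y' 0, crd y' 1, crd y' 2, crd y' 3} \<Longrightarrow> crd y i \<in> T"
    and H: "H \<noteq> 0" and pts: "\<And>b. val b H \<noteq> 0 \<Longrightarrow> \<exists>a. \<forall>i<4. crd y' i \<in> Oring y a \<and> pval y a (crd y' i) = crd b i"
  shows "coordsys y'"
proof (rule coordsysI[OF y _ H pts])
  show "crd y i \<in> gfield {crd y' 0, crd y' 1, crd y' 2, crd y' 3}" if "i < 4" for i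
    by (rule gen[OF that _ refl]) (auto intro!: gfield_mem(2) elim!: less4E)
qed

lemma coordsys_dv:
  assumes y: "coordsys y" and k: "k < 4" "k \<notin> J"
  shows "coordsys (dv k J y)"
proof (rule coordsysI'[OF y, where H = "X k"])
  show "X k \<noteq> 0" using k X_neq_0 by blast
  fix i :: nat and T assume i: "i < 4" and T: "\<And>j. j < 4 \<Longrightarrow> crd (dv k J y) j \<in> T"
    "T = gfield {crd (dv k J y) 0, crd (dv k J y) 1, crd (dv k J y) 2, crd (dv k J y) 3}"
  have "crd (dv k J y) i * crd (dv k J y) k \<in> T" using T(1)[OF i] T(1)[OF k(1)] gfield_mem(4) T(2) by blast
  then show "crd y i \<in> T" using T(1)[OF i] i k crd_neq_0[OF y k(1)] by (auto simp: crd_dv split: if_splits)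
next
  fix b assume b: "val b (X k) \<noteq> 0"
  let ?a = "tup (\<lambda>i. if i \<in> J then crd b i * crd b k else crd b i)"
  have "crd (dv k J y) i \<in> Oring y ?a \<and> pval y ?a (crd (dv k J y) i) = crd b i" if i: "i < 4" for i
    using b k i by (auto simp: crd_dv place_crd[OF y] place_divide[OF y] crd_tup)
  then show "\<exists>a. \<forall>i<4. crd (dv k J y) i \<in> Oring y a \<and> pval y a (crd (dv k J y) i) = crd b i" by blast
qed

text \<open>Since \<open>r\<close> involves only the other coordinates, its value at a point is
  unaffected when the coordinate \<open>i\<close> is corrected by that value; so the point with
  prescribed translated coordinates is explicit. \<open>H\<close> removes the poles of
  \<open>r\<close>.\<close>

lemma coordsys_sh:
  assumes y: "coordsys y" and i: "i < 4" and r: "r \<in> gfield {crd y j | j. j < 4 \<and> j \<noteq> i}"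
    and H: "H \<noteq> 0" "\<And>b. val b H \<noteq> 0 \<Longrightarrow> \<exists>z. \<forall>a. (\<forall>j<4. j \<noteq> i \<longrightarrow> crd a j = crd b j) \<longrightarrow> r \<in> Oring y a \<and> pval y a r = z"
  shows "coordsys (sh i r y)"
proof (rule coordsysI'[OF y, where H = H])
  show "H \<noteq> 0" by (rule H)
  fix j :: nat and T assume j: "j < 4" and T: "\<And>j. j < 4 \<Longrightarrow> crd (sh i r y) j \<in> T"
    "T = gfield {crd (sh i r y) 0, crd (sh i r y) 1, crd (sh i r y) 2, crd (sh i r y) 3}"
  have "gfield {crd y j | j. j < 4 \<and> j \<noteq> i} \<subseteq> T" unfolding T(2)
  proof (rule gfield_min)
    show "sring (gfield {crd (sh i r y) 0, crd (sh i r y) 1, crd (sh i r y) 2, crd (sh i r y) 3})"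
      unfolding sring_def by (auto simp: gfield_mem)
    show "{crd y j | j. j < 4 \<and> j \<noteq> i} \<subseteq> gfield {crd (sh i r y) 0, crd (sh i r y) 1, crd (sh i r y) 2, crd (sh i r y) 3}"
      using T(1) unfolding T(2) by (force simp: crd_sh)
    show "inverse a \<in> gfield {crd (sh i r y) 0, crd (sh i r y) 1, crd (sh i r y) 2, crd (sh i r y) 3}"
      if "a \<in> gfield {crd (sh i r y) 0, crd (sh i r y) 1, crd (sh i r y) 2, crd (sh i r y) 3}" for a
      using gfield_mem(6)[OF gfield_mem(8) that] by (simp add: inverse_eq_divide)
  qed (use gfield_mem(1) in blast)
  then have "r \<in> T" using r by blast
  then have "crd (sh i r y) j - r \<in> T" using T(1)[OF j] gfield_mem(5) T(2) by blast
  then show "crd y j \<in> T" using T(1)[OF j] j by (auto simp: crd_sh split: if_splits)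
next
  fix b assume "val b H \<noteq> 0"
  then obtain z where z: "\<And>a. (\<forall>j<4. j \<noteq> i \<longrightarrow> crd a j = crd b j) \<Longrightarrow> r \<in> Oring y a \<and> pval y a r = z" using H(2) by blast
  let ?a = "tup (\<lambda>j. if j = i then crd b j - z else crd b j)"
  have "r \<in> Oring y ?a \<and> pval y ?a r = z" by (rule z) (simp add: crd_tup)
  then have "crd (sh i r y) j \<in> Oring y ?a \<and> pval y ?a (crd (sh i r y) j) = crd b j" if j: "j < 4" for j
    using j by (auto simp: crd_sh place_crd[OF y] place_add[OF y] crd_tup)
  then show "\<exists>a. \<forall>j<4. crd (sh i r y) j \<in> Oring y a \<and> pval y a (crd (sh i r y) j) = crd b j" by blast
qed

lemma coordsys_perm:
  assumes y: "coordsys y" and p: "\<And>i. i < 4 \<Longrightarrow> p i < 4" "\<And>i. i < 4 \<Longrightarrow> p (p i) = i"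
  shows "coordsys (tup (\<lambda>i. crd y (p i)))"
proof (rule coordsysI'[OF y, where H = 1])
  fix i :: nat and T assume i: "i < 4" and T: "\<And>j. j < 4 \<Longrightarrow> crd (tup (\<lambda>i. crd y (p i))) j \<in> T"
    "T = gfield {crd (tup (\<lambda>i. crd y (p i))) 0, crd (tup (\<lambda>i. crd y (p i))) 1, crd (tup (\<lambda>i. crd y (p i))) 2, crd (tup (\<lambda>i. crd y (p i))) 3}"
  have "crd (tup (\<lambda>i. crd y (p i))) (p i) = crd y (p (p i))" by (rule crd_tup[OF p(1)[OF i]])
  also have "\<dots> = crd y i" by (rule arg_cong[OF p(2)[OF i]])
  finally have eq: "crd (tup (\<lambda>i. crd y (p i))) (p i) = crd y i" .
  show "crd y i \<in> T" using T(1)[OF p(1)[OF i]] unfolding eq .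
next
  fix b :: pt
  let ?a = "tup (\<lambda>j. crd b (p j))"
  have "crd (tup (\<lambda>i. crd y (p i))) j \<in> Oring y ?a \<and> pval y ?a (crd (tup (\<lambda>i. crd y (p i))) j) = crd b j" if j: "j < 4" for j
  proof -
    have "crd (tup (\<lambda>i. crd y (p i))) j = crd y (p j)" by (rule crd_tup[OF j])
    moreover have "crd ?a (p j) = crd b (p (p j))" by (rule crd_tup[OF p(1)[OF j]])
    moreover have "crd b (p (p j)) = crd b j" by (rule arg_cong[OF p(2)[OF j]])
    ultimately show ?thesis using place_crd[OF y p(1)[OF j], of ?a] by (simp only: simp_thms)
  qed
  then show "\<exists>a. \<forall>j<4. crd (tup (\<lambda>i. crd y (p i))) j \<in> Oring y a \<and> pval y a (crd (tup (\<lambda>i. crd y (p i))) j) = crd b j" by blast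
qed simp

lemma coordsys_swap: "coordsys (s, t, u, v) \<Longrightarrow> coordsys (u, v, s, t)"
  using coordsys_perm[of "(s, t, u, v)" "\<lambda>i. if i = 0 then 2 else if i = 1 then 3 else if i = 2 then 0 else 1"]
  by (auto simp: tup_def elim!: less4E)

lemma coordsys_swap_last: "coordsys (s, t, u, v) \<Longrightarrow> coordsys (s, t, v, u)"
  using coordsys_perm[of "(s, t, u, v)" "\<lambda>i. if i = 2 then 3 else if i = 3 then 2 else i"]
  by (auto simp: tup_def elim!: less4E)

lemma coordsys_inv:
  assumes y: "coordsys (s, t, u, v)"
  shows "coordsys (s, t, u / v, 1 / v)"
proof (rule coordsysI'[OF y, where H = "X 3"])
  let ?y = "(s, t, u, v)"
  show "X 3 \<noteq> 0" by (simp add: X_neq_0)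
  have v0: "v \<noteq> 0" using crd_neq_0[OF y, of 3] by simp
  fix i :: nat and T assume i: "i < 4" and T: "\<And>j. j < 4 \<Longrightarrow> crd (s, t, u / v, 1 / v) j \<in> T"
    "T = gfield {crd (s, t, u / v, 1 / v) 0, crd (s, t, u / v, 1 / v) 1, crd (s, t, u / v, 1 / v) 2, crd (s, t, u / v, 1 / v) 3}"
  have "s \<in> T" "t \<in> T" "u / v \<in> T" "1 / v \<in> T" using T(1)[of 0] T(1)[of 1] T(1)[of 2] T(1)[of 3] by auto
  moreover have "(u / v) / (1 / v) \<in> T" "1 / (1 / v) \<in> T"
    using gfield_mem(6) gfield_mem(8) calculation(3,4) unfolding T(2) by blast+
  ultimately show "crd ?y i \<in> T" using i v0 by (auto elim!: less4E)
next
  let ?y = "(s, t, u, v)"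
  fix b assume b: "val b (X 3) \<noteq> 0"
  let ?a = "(crd b 0, crd b (Suc 0), crd b 2 / crd b 3, 1 / crd b 3)"
  have c: "s \<in> Oring ?y ?a" "t \<in> Oring ?y ?a" "u \<in> Oring ?y ?a" "v \<in> Oring ?y ?a"
    "pval ?y ?a s = crd b 0" "pval ?y ?a t = crd b (Suc 0)" "pval ?y ?a u = crd b 2 / crd b 3" "pval ?y ?a v = 1 / crd b 3"
    using place_crd[OF y, of 0 ?a] place_crd[OF y, of 1 ?a] place_crd[OF y, of 2 ?a] place_crd[OF y, of 3 ?a] by auto
  have "crd (s, t, u / v, 1 / v) i \<in> Oring ?y ?a \<and> pval ?y ?a (crd (s, t, u / v, 1 / v) i) = crd b i" if "i < 4" for i
    using that b by (auto elim!: less4E simp: c place[OF y])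
  then show "\<exists>a. \<forall>i<4. crd (s, t, u / v, 1 / v) i \<in> Oring ?y a \<and> pval ?y a (crd (s, t, u / v, 1 / v) i) = crd b i" by blast
qed

section \<open>Comparison of points and rings in two coordinate systems\<close>

lemma Oring_subset:
  assumes y: "coordsys y" "coordsys y'"
    and v: "\<And>i. i < 4 \<Longrightarrow> crd y i \<in> Oring y' b' \<and> pval y' b' (crd y i) = crd b i"
  shows "Oring y b \<subseteq> Oring y' b'"
proof
  have ev: "ev y F \<in> Oring y' b' \<and> pval y' b' (ev y F) = val b F" for F
    by (induction F rule: poly4_induct) (use v in \<open>auto simp: place[OF y(2)]\<close>)
  fix k assume "k \<in> Oring y b"
  then obtain F G where "k = ev y F / ev y G" "val b G \<noteq> 0" by (auto simp: Oring_def)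
  then show "k \<in> Oring y' b'" using ev place_divide(1)[OF y(2)] by auto
qed

lemma Oring_eqI:
  assumes y: "coordsys y" "coordsys y'"
    and "\<And>i. i < 4 \<Longrightarrow> crd y i \<in> Oring y' b' \<and> pval y' b' (crd y i) = crd b i"
    and "\<And>i. i < 4 \<Longrightarrow> crd y' i \<in> Oring y b \<and> pval y b (crd y' i) = crd b' i"
  shows "Oring y b = Oring y' b'"
  by (rule subset_antisym[OF Oring_subset[OF y assms(3)] Oring_subset[OF y(2,1) assms(4)]])

lemma Oring_sh:
  assumes y: "coordsys y" "coordsys (sh i r y)" and i: "i < 4"
    and r: "r \<in> Oring y b" "pval y b r = z" "r \<in> Oring (sh i r y) (sh i z b)" "pval (sh i r y) (sh i z b) r = z"
  shows "Oring y b = Oring (sh i r y) (sh i z b)"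
proof (rule Oring_eqI[OF y])
  fix j :: nat assume j: "j < 4"
  have "crd (sh i r y) j \<in> Oring (sh i r y) (sh i z b) \<and> pval (sh i r y) (sh i z b) (crd (sh i r y) j) = crd (sh i z b) j"
    using place_crd[OF y(2) j] by blast
  note * = this
  show "crd y j \<in> Oring (sh i r y) (sh i z b) \<and> pval (sh i r y) (sh i z b) (crd y j) = crd b j"
  proof (cases "i = j")
    case True
    have "crd y j = crd (sh i r y) j - r" "crd b j = crd (sh i z b) j - z" using True j by (simp_all add: crd_sh)
    then show ?thesis using place_diff[OF y(2) conjunct1[OF *] r(3)] * r(4) by (simp only:)
  next
    case False
    have "crd y j = crd (sh i r y) j" "crd b j = crd (sh i z b) j" using False j by (simp_all add: crd_sh)
    then show ?thesis using * by (simp only:)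
  qed
  show "crd (sh i r y) j \<in> Oring y b \<and> pval y b (crd (sh i r y) j) = crd (sh i z b) j"
    using r(1,2) j by (auto simp: crd_sh place_crd[OF y(1)] place_add[OF y(1)])
qed

lemma Bring_eqI:
  assumes "g \<in> pring y" "g \<in> pring y'" "g \<noteq> 0" "\<And>i. i < 4 \<Longrightarrow> crd y i \<in> Bring y' g" "\<And>i. i < 4 \<Longrightarrow> crd y' i \<in> Bring y g"
  shows "Bring y g = Bring y' g"
  by (rule subset_antisym[OF Bring_subset[OF assms(2,3,4)] Bring_subset[OF assms(1,3,5)]])

text \<open>One step of the blow-up sequence: \<open>y\<close> are the coordinates of the previous chart, translated so
  that the centre is a coordinate subspace; \<open>y'\<close> are the coordinates of the new chart.\<close>

locale blowup_step = coord_blowup +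
  fixes G' :: poly4
  assumes G': "ev (dv k (I - {k}) y) G' = ev y G" "\<not> X k dvd G'"
begin

abbreviation "y' \<equiv> dv k (I - {k}) y"
abbreviation "g \<equiv> ev y G"
abbreviation "D \<equiv> pdv y' (X k)"

lemma y': "coordsys y'"
  by (rule coordsys_dv[OF y k4]) simp

lemma g': "g \<in> pring y'"
  unfolding G'(1)[symmetric] by (rule pring_mem(3))

lemma crd_y': "i < 4 \<Longrightarrow> i \<notin> I \<Longrightarrow> crd y' i = crd y i" "crd y' k = crd y k"
  by (simp_all add: crd_dv k4)

lemma y_pring: "i < 4 \<Longrightarrow> crd y i \<in> pring y'"
proof -
  assume i: "i < 4"
  show ?thesis
  proof (cases "i \<in> I - {k}")
    case True
    then have "crd y i = crd y' i * crd y' k" using i k4 crd_neq_0[OF k4] by (simp add: crd_dv)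
    then show ?thesis using sringD(4)[OF sring_pring pring_mem(2)[OF i, of y'] pring_mem(2)[OF k4, of y']] by (simp only:)
  next
    case False
    then have "crd y' i = crd y i" by (subst crd_dv[OF i]) auto
    then show ?thesis using pring_mem(2)[OF i, of y'] by simp
  qed
qed

lemma quot_pring: "i \<in> I \<Longrightarrow> crd y i / crd y k \<in> pring y'"
proof (cases "i = k")
  case True
  then show ?thesis using crd_neq_0[OF k4] sringD(1)[OF sring_pring] by simp
next
  case False
  assume i: "i \<in> I"
  then have "crd y i / crd y k = crd y' i" using I4[OF i] False by (simp add: crd_dv)
  then show ?thesis using pring_mem(2)[OF I4[OF i], of y'] by simp
qed

lemma chart: "affine (Bring y' g) \<subseteq> blowup V Z"
proof (rule chart_blowup[OF g' y_pring quot_pring])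
  show "crd y' i \<in> pring y \<or> (\<exists>j\<in>I. crd y' i = crd y j / crd y k)" if "i < 4" for i
    using that pring_mem(2)[OF that, of y] by (auto simp: crd_dv)
qed

lemma B_subset: "B \<subseteq> Bring y' g"
  by (rule Bring_subset[OF g' g(2)]) (use y_pring pring_Bring in blast)

text \<open>As \<open>G'\<close> is not divisible by \<open>X k\<close>, the inverted function is a
  unit along the exceptional divisor, so the shrunken chart still contains its generic
  point.\<close>

lemma D: "D \<in> blowup V Z" "Bring y' g \<subseteq> D" "dvr D (crd y k)"
  using pdv_affine[OF y' prime_elem_X[OF k4] G'(2)] chart dvr_pdv[OF y' prime_elem_X[OF k4]] k4
  by (auto simp: G'(1) crd_y'(2))

lemma total_transform_D:
  assumes "dvr U \<pi>" "Bring y' g \<subseteq> U"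
  shows "Inf {ord_at U a | a. a \<in> ideal_at Z (point_below V U) \<and> a \<noteq> 0} = ord_at U (crd y k)"
proof (rule total_transform_value[OF assms(1)])
  show "B \<subseteq> U" using B_subset assms(2) by blast
  fix x assume "x \<in> crd y ` I"
  then have "x / crd y k \<in> pring y'" using quot_pring by blast
  then show "x / crd y k \<in> U" using pring_Bring assms(2) by blast
qed

lemma model': "model (blowup V Z)"
  by (rule model_blowup[OF V])

end

lemma coord_blowup_W:
  assumes "coordsys y" "S = Oring y b" "i < 4" "crd b i = 0"
  shows "crd y i \<in> maxideal S"
  using assms by (simp add: maxideal_Oring place_crd)

lemma affine_Bring_pring:
  assumes g: "g \<in> pring y" "g \<noteq> 0"
  shows "affine (Bring y g) \<subseteq> affine (pring y)"
proof
  note sB = sring_Bring[OF g]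
  fix R assume R: "R \<in> affine (Bring y g)"
  then have l: "lring R" "Bring y g \<subseteq> R" using affine_lring[OF sB] by blast+
  note sR = lring_sring[OF l(1)]
  have pR: "pring y \<subseteq> R" using pring_Bring l(2) by blast
  show "R \<in> affine (pring y)"
  proof (rule affine_mem[OF sring_pring l(1) pR])
    fix k assume "k \<in> R"
    then have "k \<in> localization (Bring y g) (Bring y g \<inter> maxideal R)" using affine_eq[OF sB R] by simp
    then obtain a b where k: "k = a / b" "a \<in> Bring y g" "b \<in> Bring y g" "b \<notin> Bring y g \<inter> maxideal R"
      by (rule localizationE)
    obtain a' n where a: "a = a' / g ^ n" "a' \<in> pring y" using k(2) by (auto simp: Bring_def)
    obtain b' m where b: "b = b' / g ^ m" "b' \<in> pring y" using k(3) by (auto simp: Bring_def)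
    have gp: "g ^ i \<in> pring y" for i by (rule sring_power[OF sring_pring g(1)])
    have gR: "(1 / g) ^ m * (1 / g) ^ n \<in> R"
      using sringD(4)[OF sR] sring_power[OF sR] Bring_inverse l(2) by blast
    have "b' * g ^ n \<notin> maxideal R"
    proof
      assume "b' * g ^ n \<in> maxideal R"
      then have "b' * g ^ n * ((1 / g) ^ m * (1 / g) ^ n) \<in> maxideal R" using prmD(5)[OF lring_prm[OF l(1)] _ gR] by blast
      also have "b' * g ^ n * ((1 / g) ^ m * (1 / g) ^ n) = b" using g(2) b(1) by (simp add: power_one_over)
      finally show False using k(3,4) by blast
    qed
    moreover have "k = (a' * g ^ m) / (b' * g ^ n)" unfolding k(1) a(1) b(1) using g(2) by simp
    moreover have "a' * g ^ m \<in> pring y" "b' * g ^ n \<in> pring y" using a b gp sringD(4)[OF sring_pring] by blast+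
    ultimately show "\<exists>a b. a \<in> pring y \<and> b \<in> pring y \<and> b \<notin> maxideal R \<and> k = a / b" by blast
  qed
qed

lemma place_tuple [simp]:
  assumes "coordsys (s, t, u, v)"
  shows "s \<in> Oring (s, t, u, v) b" "t \<in> Oring (s, t, u, v) b" "u \<in> Oring (s, t, u, v) b" "v \<in> Oring (s, t, u, v) b"
    "pval (s, t, u, v) b s = crd b 0" "pval (s, t, u, v) b t = crd b 1" "pval (s, t, u, v) b u = crd b 2" "pval (s, t, u, v) b v = crd b 3"
  using place_crd[OF assms, of 0 b] place_crd[OF assms, of 1 b] place_crd[OF assms, of 2 b] place_crd[OF assms, of 3 b] by simp_all

lemma coordsys_shift_rational:
  assumes y: "coordsys (s, t, u, v)" and r: "r \<in> gfield {t}"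
    and "\<And>a. 1 + h * crd a 1 \<noteq> 0 \<Longrightarrow> r \<in> Oring (s, t, u, v) a \<and> pval (s, t, u, v) a r = \<rho> (crd a 1)"
  shows "coordsys (s, t, u + r, v)" "coordsys (s, t, u, v + r)"
proof -
  have H: "1 + C4 h * X 1 \<noteq> 0"
  proof
    assume "1 + C4 h * X 1 = 0"
    then have "val (0, 0, 0, 0) (1 + C4 h * X 1) = 0" by simp
    then show False by simp
  qed
  have mono: "gfield {t} \<subseteq> gfield {crd (s, t, u, v) j | j. j < 4 \<and> j \<noteq> i}" if i: "i \<in> {2, 3}" for i
  proof -
    have "t \<in> {crd (s, t, u, v) j | j. j < 4 \<and> j \<noteq> i}" using i by (intro CollectI exI[of _ 1]) auto
    then show ?thesis unfolding gfield_def by (intro Inter_anti_mono) auto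
  qed
  have *: "coordsys (sh i r (s, t, u, v))" if i: "i \<in> {2, 3}" for i
  proof (rule coordsys_sh[OF y _ _ H])
    show "r \<in> gfield {crd (s, t, u, v) j | j. j < 4 \<and> j \<noteq> i}" using r mono[OF i] by blast
    fix b assume b: "val b (1 + C4 h * X 1) \<noteq> 0"
    show "\<exists>z. \<forall>a. (\<forall>j<4. j \<noteq> i \<longrightarrow> crd a j = crd b j) \<longrightarrow> r \<in> Oring (s, t, u, v) a \<and> pval (s, t, u, v) a r = z"
    proof (intro exI allI impI)
      fix a assume "\<forall>j<4. j \<noteq> i \<longrightarrow> crd a j = crd b j"
      then have "crd a 1 = crd b 1" using i by auto
      then show "r \<in> Oring (s, t, u, v) a \<and> pval (s, t, u, v) a r = \<rho> (crd b 1)" using assms(3)[of a] b by simp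
    qed
  qed (use i in auto)
  from *[of 2] *[of 3] show "coordsys (s, t, u + r, v)" "coordsys (s, t, u, v + r)" by (simp_all add: sh_def)
qed

text \<open>The value of the total transform of a center along \<open>U\<close>, detached from the
  final variety so that it can be computed at the stage of that blow-up.\<close>

definition blowup_ord :: "variety \<Rightarrow> local_ring set \<Rightarrow> local_ring \<Rightarrow> int" where
  "blowup_ord Y W U = Inf {ord_at U a | a. a \<in> ideal_at (zariski_closure Y (Y \<inter> W)) (point_below Y U) \<and> a \<noteq> 0}"

lemma (in blowup_step) blowup_ord_D: "dvr U \<pi> \<Longrightarrow> Bring y' g \<subseteq> U \<Longrightarrow> blowup_ord V W U = ord_at U (crd y k)"
  unfolding blowup_ord_def by (rule total_transform_D)

lemma blowup_ord_kill:
  assumes "dvr V \<pi>" "model Y" "R \<in> Y" "dominates V R" "c \<in> R" "\<And>S. S \<in> W \<Longrightarrow> c \<notin> S"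
  shows "blowup_ord Y W V = 0"
  unfolding blowup_ord_def using assms by (rule total_transform_kill)

lemma maxideal_inverse: "x \<in> maxideal S \<Longrightarrow> x \<noteq> 0 \<Longrightarrow> 1 / x \<notin> S"
  by (simp add: maxideal_iff divide_inverse)

lemma image_params_cong:
  assumes "\<And>P Q. R P \<Longrightarrow> f (a P Q) = g (b P Q)"
  shows "f ` {a P Q | P Q. R P} = g ` {b P Q | P Q. R P}"
proof -
  have "f ` {a P Q | P Q. R P} = {f (a P Q) | P Q. R P}" by blast
  also have "\<dots> = {g (b P Q) | P Q. R P}" using assms by metis
  also have "\<dots> = g ` {b P Q | P Q. R P}" by blast
  finally show ?thesis .
qed

lemma poly4_neq_0: "val b F \<noteq> 0 \<Longrightarrow> F \<noteq> 0"
  by auto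

lemma point_at_Oring: "coordsys y \<Longrightarrow> point_at y = Oring y"
  by (cases y) (auto simp: fun_eq_iff point_at_eq simp del: point_at.simps)

section \<open>Five successive blow-ups over a curve\<close>

text \<open>The blow-ups 1--5 (with \<open>(x, y, z, w) = (x0, x1, z2, z3)\<close>) and 6--10 (with
  \<open>(x, y, z, w) = (x2, x3, z0, z1)\<close>) are treated simultaneously.\<close>

locale curve_blowups =
  fixes h :: complex and x y z w :: ratfun and XX :: "nat \<Rightarrow> variety" and WW :: "nat \<Rightarrow> local_ring set"
  assumes cs0: "coordsys (x, y, z, w)" and model0: "model (XX 0)" and aff0: "affine (pring (x, y, z, w)) \<subseteq> XX 0"
    and XX: "\<And>i. i < 5 \<Longrightarrow> XX (Suc i) = blowup (XX i) (zariski_closure (XX i) (XX i \<inter> WW (Suc i)))"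
    and W1_point: "WW 1 = point_at (x, y, z, w) ` {(1, P, 0, 0) | P. True}"
    and W2_point: "WW 2 = point_at (step1 (x, y, z, w)) ` {(0, P, Q, 0) | P Q. True}"
    and W3_point: "WW 3 = point_at (step2 (step1 (x, y, z, w))) ` {(0, P, - h / (1 + h * P), Q) | P Q. 1 + h * P \<noteq> 0}"
    and W4_point: "WW 4 = point_at (step3 h (step2 (step1 (x, y, z, w)))) ` {(0, P, Q, 1 / (1 + h * P)) | P Q. 1 + h * P \<noteq> 0}"
    and W5_point: "WW 5 = point_at (step4 h (step3 h (step2 (step1 (x, y, z, w))))) ` {(0, P, Q, 1 / (1 + h * P) ^ 2) | P Q. 1 + h * P \<noteq> 0}"
begin

text \<open>\<open>s\<close> is the equation of all five exceptional divisors in their charts, and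
  \<open>\<gamma>\<close> is the denominator \<open>1 + h P\<close> of the parametrizations. The
  translated coordinates \<open>a3\<close>, \<open>a4\<close>, \<open>a5\<close> vanish on the
  centers of the third to fifth blow-up; divided by \<open>s\<close> they give the new coordinates
  \<open>u3\<close>, \<open>v4\<close>, \<open>v5\<close>.\<close>

definition "s = x - 1"
definition "\<gamma> = 1 + cst h * y"
definition "u1 = z / s"
definition "v1 = w / s"
definition "v2 = v1 / s"
definition "a3 = u1 + cst h / \<gamma>"
definition "u3 = a3 / s"
definition "a4 = v2 - 1 / \<gamma>"
definition "v4 = a4 / s"
definition "a5 = v4 - 1 / \<gamma> ^ 2"
definition "v5 = a5 / s"
definition "G = 1 + C4 h * X 1"

lemma cs_a1: "coordsys (s, y, z, w)"
proof -
  have "coordsys (sh 0 (- 1) (x, y, z, w))"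
    by (rule coordsys_sh[OF cs0, where H = 1]) (auto simp: place[OF cs0] gfield_mem intro!: exI[of _ "- 1"])
  then show ?thesis by (simp add: sh_def s_def)
qed

lemma s0: "s \<noteq> 0" using crd_neq_0[OF cs_a1, of 0] by simp

lemma G_nz: "zer I G \<noteq> 0" if "1 \<notin> I"
proof (rule poly4_neq_0)
  show "val (0, 0, 0, 0) (zer I G) \<noteq> 0" using that by (simp add: G_def)
qed

lemma ev_G: "ev (a, y, b, c) G = \<gamma>"
  by (simp add: G_def \<gamma>_def)

lemma val_G: "val b G = 1 + h * crd b 1"
  by (simp add: G_def)

lemma \<gamma>0: "\<gamma> \<noteq> 0"
  using coordsys_ev_0[OF cs_a1, of G] G_nz[of "{}"] ev_G[of s z w] by auto

lemma \<gamma>_pring: "\<gamma> \<in> pring (a, y, b, c)"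
  using pring_mem(3)[of "(a, y, b, c)" G] by (simp add: ev_G)

lemma cs_c1: "coordsys (s, y, u1, v1)"
  using coordsys_dv[OF cs_a1, of 0 "{2, 3}"] by (simp add: dv_def u1_def v1_def)
lemma cs_c2: "coordsys (s, y, u1, v2)"
  using coordsys_dv[OF cs_c1, of 0 "{3}"] by (simp add: dv_def v2_def)

lemma r1: 
  assumes cs: "coordsys (a, y, b, c)" and P: "1 + h * crd p 1 \<noteq> 0"
  shows "cst d / \<gamma> \<in> Oring (a, y, b, c) p \<and> pval (a, y, b, c) p (cst d / \<gamma>) = d / (1 + h * crd p 1)"
    and "- (1 / \<gamma>) \<in> Oring (a, y, b, c) p \<and> pval (a, y, b, c) p (- (1 / \<gamma>)) = - (1 / (1 + h * crd p 1))"
    and "- (1 / \<gamma> ^ 2) \<in> Oring (a, y, b, c) p \<and> pval (a, y, b, c) p (- (1 / \<gamma> ^ 2)) = - (1 / (1 + h * crd p 1) ^ 2)"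
  using P by (simp_all add: \<gamma>_def place[OF cs] cs)

lemma r2: "cst d / \<gamma> \<in> gfield {y}" "- (1 / \<gamma>) \<in> gfield {y}" "- (1 / \<gamma> ^ 2) \<in> gfield {y}"
  unfolding \<gamma>_def by (intro gfield_mem; simp)+

lemma cs_a3: "coordsys (s, y, a3, v2)"
  using coordsys_shift_rational(1)[OF cs_c2 r2(1) r1(1)[OF cs_c2]] by (simp add: a3_def)
lemma cs_c3: "coordsys (s, y, u3, v2)"
  using coordsys_dv[OF cs_a3, of 0 "{2}"] by (simp add: dv_def u3_def)
lemma cs_a4: "coordsys (s, y, u3, a4)"
  using coordsys_shift_rational(2)[OF cs_c3 r2(2) r1(2)[OF cs_c3]] by (simp add: a4_def)
lemma cs_c4: "coordsys (s, y, u3, v4)"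
  using coordsys_dv[OF cs_a4, of 0 "{3}"] by (simp add: dv_def v4_def)
lemma cs_a5: "coordsys (s, y, u3, a5)"
  using coordsys_shift_rational(2)[OF cs_c4 r2(3) r1(3)[OF cs_c4]] by (simp add: a5_def)
lemma cs_c5: "coordsys (s, y, u3, v5)"
  using coordsys_dv[OF cs_a5, of 0 "{3}"] by (simp add: dv_def v5_def)

lemma charts:
  "step1 (x, y, z, w) = (s, y, u1, v1)" "step2 (s, y, u1, v1) = (s, y, u1, v2)"
  "step3 h (s, y, u1, v2) = (s, y, u3, v2)" "step4 h (s, y, u3, v2) = (s, y, u3, v4)"
  "step5 h (s, y, u3, v4) = (s, y, u3, v5)"
  by (simp_all add: s_def u1_def v1_def v2_def a3_def u3_def a4_def v4_def a5_def v5_def \<gamma>_def)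

lemma W1: "WW 1 = Oring (x, y, z, w) ` {(1, P, 0, 0) | P. True}"
  unfolding W1_point charts using point_at_Oring[OF cs0] by simp
lemma W2: "WW 2 = Oring (step1 (x, y, z, w)) ` {(0, P, Q, 0) | P Q. True}"
  unfolding W2_point charts using point_at_Oring[OF cs_c1] by simp
lemma W3: "WW 3 = Oring (step2 (step1 (x, y, z, w))) ` {(0, P, - h / (1 + h * P), Q) | P Q. 1 + h * P \<noteq> 0}"
  unfolding W3_point charts using point_at_Oring[OF cs_c2] by simp
lemma W4: "WW 4 = Oring (step3 h (step2 (step1 (x, y, z, w)))) ` {(0, P, Q, 1 / (1 + h * P)) | P Q. 1 + h * P \<noteq> 0}"
  unfolding W4_point charts using point_at_Oring[OF cs_c3] by simp
lemma W5: "WW 5 = Oring (step4 h (step3 h (step2 (step1 (x, y, z, w))))) ` {(0, P, Q, 1 / (1 + h * P) ^ 2) | P Q. 1 + h * P \<noteq> 0}"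
  unfolding W5_point charts using point_at_Oring[OF cs_c4] by simp

lemma W1': "WW 1 = Oring (s, y, z, w) ` {(0, P, 0, 0) | P. True}"
proof -
  have "Oring (x, y, z, w) (1, P, 0, 0) = Oring (s, y, z, w) (0, P, 0, 0)" for P
  proof -
    have m: "- 1 \<in> Oring q p" "pval q p (- 1) = - 1" if "coordsys q" for q p
      using that by (simp_all add: place[OF that])
    have e: "sh 0 (- 1) (x, y, z, w) = (s, y, z, w)" "sh 0 (- 1) (1, P, 0, 0 :: complex) = (0, P, 0, 0)" by (simp_all add: sh_def s_def)
    show ?thesis using Oring_sh[OF cs0, of 0 "- 1" "(1, P, 0, 0)" "- 1", unfolded e, OF cs_a1 _ m[OF cs0] m[OF cs_a1]] by simp
  qed
  from image_params_cong[of "\<lambda>_. True" "Oring (x, y, z, w)" "\<lambda>P Q. (1, P, 0, 0)" "Oring (s, y, z, w)" "\<lambda>P Q. (0, P, 0, 0)", OF this]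
  show ?thesis unfolding W1 by simp
qed

lemma W3': "WW 3 = Oring (s, y, a3, v2) ` {(0, P, 0, Q) | P Q. 1 + h * P \<noteq> 0}"
proof -
  have "Oring (s, y, u1, v2) (0, P, - h / (1 + h * P), Q) = Oring (s, y, a3, v2) (0, P, 0, Q)" if "1 + h * P \<noteq> 0" for P Q
    using Oring_sh[OF cs_c2, of 2 "cst h / \<gamma>" "(0, P, - h / (1 + h * P), Q)" "h / (1 + h * P)"] cs_a3
      r1(1)[OF cs_c2, of "(0, P, - h / (1 + h * P), Q)" h] r1(1)[OF cs_a3, of "(0, P, 0, Q)" h] that by (simp add: sh_def a3_def)
  then show ?thesis unfolding W3 charts by (rule image_params_cong)
qed

lemma W4': "WW 4 = Oring (s, y, u3, a4) ` {(0, P, Q, 0) | P Q. 1 + h * P \<noteq> 0}"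
proof -
  have "Oring (s, y, u3, v2) (0, P, Q, 1 / (1 + h * P)) = Oring (s, y, u3, a4) (0, P, Q, 0)" if "1 + h * P \<noteq> 0" for P Q
    using Oring_sh[OF cs_c3, of 3 "- (1 / \<gamma>)" "(0, P, Q, 1 / (1 + h * P))" "- (1 / (1 + h * P))"] cs_a4
      r1(2)[OF cs_c3, of "(0, P, Q, 1 / (1 + h * P))"] r1(2)[OF cs_a4, of "(0, P, Q, 0)"] that by (simp add: sh_def a4_def)
  then show ?thesis unfolding W4 charts by (rule image_params_cong)
qed

lemma W5': "WW 5 = Oring (s, y, u3, a5) ` {(0, P, Q, 0) | P Q. 1 + h * P \<noteq> 0}"
proof -
  have "Oring (s, y, u3, v4) (0, P, Q, 1 / (1 + h * P) ^ 2) = Oring (s, y, u3, a5) (0, P, Q, 0)" if "1 + h * P \<noteq> 0" for P Q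
    using Oring_sh[OF cs_c4, of 3 "- (1 / \<gamma> ^ 2)" "(0, P, Q, 1 / (1 + h * P) ^ 2)" "- (1 / (1 + h * P) ^ 2)"] cs_a5
      r1(3)[OF cs_c4, of "(0, P, Q, 1 / (1 + h * P) ^ 2)"] r1(3)[OF cs_a5, of "(0, P, Q, 0)"] that by (simp add: sh_def a5_def)
  then show ?thesis unfolding W5 charts by (rule image_params_cong)
qed

lemma B_a3: "Bring (s, y, u1, v2) \<gamma> = Bring (s, y, a3, v2) \<gamma>"
proof (rule Bring_eqI[OF \<gamma>_pring \<gamma>_pring \<gamma>0])
  note sB = sringD[OF sring_Bring[OF \<gamma>_pring \<gamma>0]]
  have r: "cst h / \<gamma> \<in> Bring (a, b, c, d) \<gamma>" for a b c d using BringI[OF pring_mem(1), where g = \<gamma> and n = 1] by simp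
  have p: "i < 4 \<Longrightarrow> crd q i \<in> Bring q \<gamma>" for q i using pring_mem(2) pring_Bring by blast
  show "crd (s, y, u1, v2) i \<in> Bring (s, y, a3, v2) \<gamma>" if "i < 4" for i
    using p[OF that, of "(s, y, a3, v2)"] sB(6)[OF p[of 2 "(s, y, a3, v2)"] r] that by (auto elim!: less4E simp: a3_def)
  show "crd (s, y, a3, v2) i \<in> Bring (s, y, u1, v2) \<gamma>" if "i < 4" for i
    using p[OF that, of "(s, y, u1, v2)"] sB(3)[OF p[of 2 "(s, y, u1, v2)"] r] that by (auto elim!: less4E simp: a3_def)
qed

lemma B_shift: "Bring (a, y, b, c) \<gamma> = Bring (a, y, b, c - 1 / \<gamma> ^ n) \<gamma>"
proof (rule Bring_eqI[OF \<gamma>_pring \<gamma>_pring \<gamma>0])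
  note sB = sringD[OF sring_Bring[OF \<gamma>_pring \<gamma>0]]
  have r: "1 / \<gamma> ^ n \<in> Bring q \<gamma>" for q using BringI[OF sringD(1)[OF sring_pring]] by simp
  have p: "i < 4 \<Longrightarrow> crd q i \<in> Bring q \<gamma>" for q i using pring_mem(2) pring_Bring by blast
  show "crd (a, y, b, c) i \<in> Bring (a, y, b, c - 1 / \<gamma> ^ n) \<gamma>" if "i < 4" for i
    using p[OF that, of "(a, y, b, c - 1 / \<gamma> ^ n)"] sB(3)[OF p[of 3 "(a, y, b, c - 1 / \<gamma> ^ n)"] r] that by (auto elim!: less4E)
  show "crd (a, y, b, c - 1 / \<gamma> ^ n) i \<in> Bring (a, y, b, c) \<gamma>" if "i < 4" for i
    using p[OF that, of "(a, y, b, c)"] sB(6)[OF p[of 3 "(a, y, b, c)"] r] that by (auto elim!: less4E)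
qed

lemma B_a4: "Bring (s, y, u3, v2) \<gamma> = Bring (s, y, u3, a4) \<gamma>"
  using B_shift[of s u3 v2 1] by (simp add: a4_def)
lemma B_a5: "Bring (s, y, u3, v4) \<gamma> = Bring (s, y, u3, a5) \<gamma>"
  using B_shift[of s u3 v4 2] by (simp add: a5_def)

lemma pring_a1: "pring (s, y, z, w) = pring (x, y, z, w)"
proof (rule subset_antisym)
  note sP = sringD[OF sring_pring]
  have p: "i < 4 \<Longrightarrow> crd q i \<in> pring q" for q i by (rule pring_mem)
  show "pring (s, y, z, w) \<subseteq> pring (x, y, z, w)"
    by (rule pring_min[OF sring_pring]) (use pring_mem(1) sP(6)[OF p[of 0 "(x, y, z, w)"] sP(1)] p[of 1 "(x, y, z, w)"] p[of 2 "(x, y, z, w)"] p[of 3 "(x, y, z, w)"] in \<open>auto elim!: less4E simp: s_def\<close>)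
  show "pring (x, y, z, w) \<subseteq> pring (s, y, z, w)"
    by (rule pring_min[OF sring_pring]) (use pring_mem(1) sP(3)[OF p[of 0 "(s, y, z, w)"] sP(1)] p[of 1 "(s, y, z, w)"] p[of 2 "(s, y, z, w)"] p[of 3 "(s, y, z, w)"] in \<open>auto elim!: less4E simp: s_def\<close>)
qed

lemma G_not_dvd: "\<not> X 0 dvd G"
  using G_nz[of "{0}"] by (simp add: X_dvd_iff)

lemma step_intro:
  assumes "coordsys (s, y, a, b)" "model V" "affine (Bring (s, y, a, b) \<gamma>) \<subseteq> V" "0 \<in> I" "1 \<notin> I" "I \<subseteq> {..<4}"
    and "W = Oring (s, y, a, b) ` P" "\<And>p i. p \<in> P \<Longrightarrow> i \<in> I \<Longrightarrow> crd p i = 0"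
      "\<And>p. \<forall>i\<in>I. crd p i = 0 \<Longrightarrow> 1 + h * crd p 1 \<noteq> 0 \<Longrightarrow> p \<in> P"
  shows "blowup_step V (s, y, a, b) G W I 0 G"
proof
  show "zer I G \<noteq> 0" by (rule G_nz) fact
  show "crd (s, y, a, b) i \<in> maxideal S" if "S \<in> W" "i \<in> I" for S i
    using that assms(6,7,8) coord_blowup_W[OF assms(1)] by blast
  show "Oring (s, y, a, b) p \<in> W" if "\<forall>i\<in>I. crd p i = 0" "val p G \<noteq> 0" for p
    using that assms(7,9) by (auto simp: val_G)
  have "crd (dv 0 (I - {0}) (s, y, a, b)) 1 = y" using assms(5) by (simp add: crd_dv)
  then show "ev (dv 0 (I - {0}) (s, y, a, b)) G = ev (s, y, a, b) G"
    by (simp add: G_def \<gamma>_def)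
qed (use assms ev_G G_not_dvd in auto)

section \<open>Charts and exceptional divisors over a curve\<close>

definition cc :: "nat \<Rightarrow> coords" where
  "cc i = [(s, y, z, w), (s, y, u1, v1), (s, y, u1, v2), (s, y, u3, v2), (s, y, u3, v4), (s, y, u3, v5)] ! i"

definition VV :: "nat \<Rightarrow> local_ring" where
  "VV i = pdv (cc i) (X 0)"

lemma cc_simps [simp]: "cc 0 = (s, y, z, w)" "cc (Suc 0) = (s, y, u1, v1)" "cc 2 = (s, y, u1, v2)"
  "cc 3 = (s, y, u3, v2)" "cc 4 = (s, y, u3, v4)" "cc 5 = (s, y, u3, v5)"
  by (simp_all add: cc_def numeral_eq_Suc)

lemma le5_cases: "(\<forall>i. 1 \<le> i \<and> i \<le> 5 \<longrightarrow> P i) \<longleftrightarrow> P 1 \<and> P 2 \<and> P 3 \<and> P 4 \<and> P (5::nat)"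
  by (auto simp: le_Suc_eq numeral_eq_Suc)

lemma le5E:
  assumes "1 \<le> i" "i \<le> (5::nat)"
  obtains "i = 1" | "i = 2" | "i = 3" | "i = 4" | "i = 5"
  using assms by linarith

lemma step_out:
  assumes st: "blowup_step (XX i) (s, y, a, b) G (WW (Suc i)) I 0 G" and i: "i < 5"
    and c: "dv 0 (I - {0}) (s, y, a, b) = cc (Suc i)" and B: "Bring (cc i) \<gamma> = Bring (s, y, a, b) \<gamma>"
  shows "model (XX (Suc i))" "affine (Bring (cc (Suc i)) \<gamma>) \<subseteq> XX (Suc i)" "Bring (cc i) \<gamma> \<subseteq> Bring (cc (Suc i)) \<gamma>"
    "VV (Suc i) \<in> XX (Suc i)" "Bring (cc (Suc i)) \<gamma> \<subseteq> VV (Suc i)" "dvr (VV (Suc i)) s"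
    "dvr U \<pi> \<Longrightarrow> Bring (cc (Suc i)) \<gamma> \<subseteq> U \<Longrightarrow> blowup_ord (XX i) (WW (Suc i)) U = ord_at U s"
proof -
  interpret st: blowup_step "XX i" "(s, y, a, b)" G "WW (Suc i)" I 0 G by (rule st)
  show "model (XX (Suc i))" using st.model' XX[OF i] by simp
  show "affine (Bring (cc (Suc i)) \<gamma>) \<subseteq> XX (Suc i)" using st.chart XX[OF i] c by (simp add: ev_G)
  show "Bring (cc i) \<gamma> \<subseteq> Bring (cc (Suc i)) \<gamma>" using st.B_subset c B by (simp add: ev_G)
  show "VV (Suc i) \<in> XX (Suc i)" "Bring (cc (Suc i)) \<gamma> \<subseteq> VV (Suc i)" "dvr (VV (Suc i)) s"
    using st.D XX[OF i] c by (simp_all add: ev_G VV_def)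
  show "dvr U \<pi> \<Longrightarrow> Bring (cc (Suc i)) \<gamma> \<subseteq> U \<Longrightarrow> blowup_ord (XX i) (WW (Suc i)) U = ord_at U s"
    using st.blowup_ord_D c by (simp add: ev_G)
qed

lemma st1: "blowup_step (XX 0) (s, y, z, w) G (WW 1) {0, 2, 3} 0 G"
proof (rule step_intro[OF cs_a1 model0 _ _ _ _ W1'])
  show "affine (Bring (s, y, z, w) \<gamma>) \<subseteq> XX 0"
    using affine_Bring_pring[OF \<gamma>_pring[of s z w] \<gamma>0] aff0 unfolding pring_a1 by (rule order_trans)
qed (auto simp: less4_cases)

lemma steps:
  "\<forall>i. 1 \<le> i \<and> i \<le> 5 \<longrightarrow> model (XX i) \<and> affine (Bring (cc i) \<gamma>) \<subseteq> XX i \<and> Bring (cc (i - 1)) \<gamma> \<subseteq> Bring (cc i) \<gamma> \<and>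
     VV i \<in> XX i \<and> Bring (cc i) \<gamma> \<subseteq> VV i \<and> dvr (VV i) s \<and>
     (\<forall>U \<pi>. dvr U \<pi> \<longrightarrow> Bring (cc i) \<gamma> \<subseteq> U \<longrightarrow> blowup_ord (XX (i - 1)) (WW i) U = ord_at U s)"
proof -
  have s2: "Suc 0 = 1" "Suc 1 = 2" "Suc 2 = 3" "Suc 3 = 4" "Suc 4 = 5" by auto
  have d1: "dv 0 ({0, 2, 3} - {0}) (s, y, z, w) = cc 1" by (simp add: dv_def u1_def v1_def)
  note o1 = step_out[of 0, unfolded s2, OF st1 _ d1]
  have st2: "blowup_step (XX 1) (s, y, u1, v1) G (WW 2) {0, 3} 0 G"
    by (rule step_intro[OF cs_c1 _ _ _ _ _ W2[unfolded charts]]) (use o1 in \<open>auto simp: less4_cases\<close>)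
  have d2: "dv 0 ({0, 3} - {0}) (s, y, u1, v1) = cc 2" by (simp add: dv_def v2_def)
  note o2 = step_out[of 1, unfolded s2, OF st2 _ d2]
  have st3: "blowup_step (XX 2) (s, y, a3, v2) G (WW 3) {0, 2} 0 G"
    by (rule step_intro[OF cs_a3 _ _ _ _ _ W3']) (use o2 B_a3 in \<open>auto simp: less4_cases\<close>)
  have d3: "dv 0 ({0, 2} - {0}) (s, y, a3, v2) = cc 3" by (simp add: dv_def u3_def)
  note o3 = step_out[of 2, unfolded s2, OF st3 _ d3]
  have st4: "blowup_step (XX 3) (s, y, u3, a4) G (WW 4) {0, 3} 0 G"
    by (rule step_intro[OF cs_a4 _ _ _ _ _ W4']) (use o3 B_a3 B_a4 in \<open>auto simp: less4_cases\<close>)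
  have d4: "dv 0 ({0, 3} - {0}) (s, y, u3, a4) = cc 4" by (simp add: dv_def v4_def)
  note o4 = step_out[of 3, unfolded s2, OF st4 _ d4]
  have st5: "blowup_step (XX 4) (s, y, u3, a5) G (WW 5) {0, 3} 0 G"
    by (rule step_intro[OF cs_a5 _ _ _ _ _ W5']) (use o4 B_a4 B_a5 in \<open>auto simp: less4_cases\<close>)
  have d5: "dv 0 ({0, 3} - {0}) (s, y, u3, a5) = cc 5" by (simp add: dv_def v5_def)
  note o5 = step_out[of 4, unfolded s2, OF st5 _ d5]
  show ?thesis unfolding le5_cases
    using o1 o2 o3 o4 o5 B_a3 B_a4 B_a5 by simp
qed

lemma step_facts:
  assumes "1 \<le> i" "i \<le> 5"
  shows "model (XX i)" "affine (Bring (cc i) \<gamma>) \<subseteq> XX i" "Bring (cc (i - 1)) \<gamma> \<subseteq> Bring (cc i) \<gamma>"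
    "VV i \<in> XX i" "Bring (cc i) \<gamma> \<subseteq> VV i" "dvr (VV i) s"
    "dvr U \<pi> \<Longrightarrow> Bring (cc i) \<gamma> \<subseteq> U \<Longrightarrow> blowup_ord (XX (i - 1)) (WW i) U = ord_at U s"
  using steps assms by blast+

lemma model_XX: "i \<le> 5 \<Longrightarrow> model (XX i)"
  using step_facts(1)[of i] model0 by (cases "i = 0") auto

lemma B_chain:
  assumes "i \<le> j" "j \<le> 5"
  shows "Bring (cc i) \<gamma> \<subseteq> Bring (cc j) \<gamma>"
  using assms
proof (induction j)
  case (Suc j)
  then show ?case using step_facts(3)[of "Suc j"] by (cases "i = Suc j") auto
qed simp

lemma B_VV: "i \<le> j \<Longrightarrow> 1 \<le> j \<Longrightarrow> j \<le> 5 \<Longrightarrow> Bring (cc i) \<gamma> \<subseteq> VV j"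
  using B_chain[of i j] step_facts(5)[of j] by blast

lemma pring_VV: "1 \<le> j \<Longrightarrow> j \<le> 5 \<Longrightarrow> pring (x, y, z, w) \<subseteq> VV j"
  using B_VV[of 0 j] pring_Bring[of "cc 0" \<gamma>] pring_a1 by auto

text \<open>The equation of center \<open>j + 1\<close> besides \<open>s\<close>. It is a unit along
  the divisor \<open>VV j\<close> but vanishes at all points of the later centers, so its inverse
  shows that those centers do not contain \<open>VV j\<close>. The entry 0 is a placeholder.\<close>

definition ww :: "nat \<Rightarrow> ratfun" where
  "ww i = [0, v1, a3, a4, a5] ! i"

lemma ww_simps [simp]: "ww (Suc 0) = v1" "ww 2 = a3" "ww 3 = a4" "ww 4 = a5"
  by (simp_all add: ww_def numeral_eq_Suc)

lemma W_ring:
  assumes "coordsys (s, y, a, b)" "S = Oring (s, y, a, b) p" "crd p 0 = 0"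
  shows "lring S" "s \<in> maxideal S" "pring (s, y, a, b) \<subseteq> S" "1 + h * crd p 1 \<noteq> 0 \<Longrightarrow> Bring (s, y, a, b) \<gamma> \<subseteq> S"
    "i < 4 \<Longrightarrow> crd p i = 0 \<Longrightarrow> crd (s, y, a, b) i \<in> maxideal S"
proof -
  show "lring S" using assms lring_Oring by blast
  show "s \<in> maxideal S" using assms by (simp add: maxideal_Oring)
  show "pring (s, y, a, b) \<subseteq> S" unfolding pring_def assms(2) using place_ev(1)[OF assms(1)] by blast
  show "1 + h * crd p 1 \<noteq> 0 \<Longrightarrow> Bring (s, y, a, b) \<gamma> \<subseteq> S"
    using Oring_affine(2)[OF assms(1), of p G] by (simp add: val_G ev_G assms(2))
  show "i < 4 \<Longrightarrow> crd p i = 0 \<Longrightarrow> crd (s, y, a, b) i \<in> maxideal S"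
    using coord_blowup_W[OF assms(1,2)] .
qed

lemma W_facts:
  "S \<in> WW 1 \<Longrightarrow> lring S \<and> s \<in> maxideal S \<and> pring (s, y, z, w) \<subseteq> S \<and> z \<in> maxideal S \<and> w \<in> maxideal S"
  "S \<in> WW 2 \<Longrightarrow> lring S \<and> s \<in> maxideal S \<and> pring (s, y, u1, v1) \<subseteq> S \<and> v1 \<in> maxideal S"
  "S \<in> WW 3 \<Longrightarrow> lring S \<and> s \<in> maxideal S \<and> Bring (cc 2) \<gamma> \<subseteq> S \<and> a3 \<in> maxideal S"
  "S \<in> WW 4 \<Longrightarrow> lring S \<and> s \<in> maxideal S \<and> Bring (cc 3) \<gamma> \<subseteq> S \<and> a4 \<in> maxideal S"
  "S \<in> WW 5 \<Longrightarrow> lring S \<and> s \<in> maxideal S \<and> Bring (cc 4) \<gamma> \<subseteq> S \<and> a5 \<in> maxideal S"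
proof -
  assume "S \<in> WW 1"
  then obtain p where p: "S = Oring (s, y, z, w) p" "crd p 0 = 0" "crd p 2 = 0" "crd p 3 = 0" unfolding W1' by auto
  show "lring S \<and> s \<in> maxideal S \<and> pring (s, y, z, w) \<subseteq> S \<and> z \<in> maxideal S \<and> w \<in> maxideal S"
    using W_ring(1-3)[OF cs_a1 p(1,2)] W_ring(5)[OF cs_a1 p(1,2), of 2] W_ring(5)[OF cs_a1 p(1,2), of 3] p by simp
next
  assume "S \<in> WW 2"
  then obtain p where p: "S = Oring (s, y, u1, v1) p" "crd p 0 = 0" "crd p 3 = 0" unfolding W2 charts by auto
  show "lring S \<and> s \<in> maxideal S \<and> pring (s, y, u1, v1) \<subseteq> S \<and> v1 \<in> maxideal S"
    using W_ring(1-3)[OF cs_c1 p(1,2)] W_ring(5)[OF cs_c1 p(1,2), of 3] p by simp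
next
  assume "S \<in> WW 3"
  then obtain p where p: "S = Oring (s, y, a3, v2) p" "crd p 0 = 0" "crd p 2 = 0" "1 + h * crd p 1 \<noteq> 0" unfolding W3' by auto
  show "lring S \<and> s \<in> maxideal S \<and> Bring (cc 2) \<gamma> \<subseteq> S \<and> a3 \<in> maxideal S"
    using W_ring(1,2,4)[OF cs_a3 p(1,2)] W_ring(5)[OF cs_a3 p(1,2), of 2] p B_a3 by simp
next
  assume "S \<in> WW 4"
  then obtain p where p: "S = Oring (s, y, u3, a4) p" "crd p 0 = 0" "crd p 3 = 0" "1 + h * crd p 1 \<noteq> 0" unfolding W4' by auto
  show "lring S \<and> s \<in> maxideal S \<and> Bring (cc 3) \<gamma> \<subseteq> S \<and> a4 \<in> maxideal S"
    using W_ring(1,2,4)[OF cs_a4 p(1,2)] W_ring(5)[OF cs_a4 p(1,2), of 3] p B_a4 by simp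
next
  assume "S \<in> WW 5"
  then obtain p where p: "S = Oring (s, y, u3, a5) p" "crd p 0 = 0" "crd p 3 = 0" "1 + h * crd p 1 \<noteq> 0" unfolding W5' by auto
  show "lring S \<and> s \<in> maxideal S \<and> Bring (cc 4) \<gamma> \<subseteq> S \<and> a5 \<in> maxideal S"
    using W_ring(1,2,4)[OF cs_a5 p(1,2)] W_ring(5)[OF cs_a5 p(1,2), of 3] p B_a5 by simp
qed

lemma W_lring: "1 \<le> i \<Longrightarrow> i \<le> 5 \<Longrightarrow> S \<in> WW i \<Longrightarrow> lring S \<and> s \<in> maxideal S"
  using W_facts by (elim le5E) blast+

lemma W_pring:
  assumes "i < j" "3 \<le> j" "j \<le> 5" "S \<in> WW j"
  shows "pring (cc i) \<subseteq> S"
proof -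
  have "Bring (cc (j - 1)) \<gamma> \<subseteq> S" 
  proof -
    have "j = 3 \<or> j = 4 \<or> j = 5" using assms by auto
    then show ?thesis using assms(4) W_facts(3-5) by (elim disjE) auto
  qed
  moreover have "Bring (cc i) \<gamma> \<subseteq> Bring (cc (j - 1)) \<gamma>" using assms by (intro B_chain) auto
  ultimately show ?thesis using pring_Bring by blast
qed

lemma s_mult: "lring S \<Longrightarrow> s \<in> maxideal S \<Longrightarrow> a \<in> S \<Longrightarrow> s * a \<in> maxideal S"
  using prmD(5)[OF lring_prm] by blast

lemma W_zw:
  assumes "1 \<le> i" "i \<le> 5" "S \<in> WW i"
  shows "z \<in> maxideal S" "w \<in> maxideal S" "pring (s, y, z, w) \<subseteq> S"
proof -
  have "z \<in> maxideal S \<and> w \<in> maxideal S \<and> pring (s, y, z, w) \<subseteq> S"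
  proof (cases "i = 1")
    case True
    then show ?thesis using W_facts(1) assms by blast
  next
    case False
    have p: "pring (s, y, u1, v1) \<subseteq> S"
      using W_facts(2) W_pring[of 1 i S] assms False by (cases "i = 2") auto
    then have uv: "u1 \<in> S" "v1 \<in> S" "s \<in> S" "y \<in> S" "range cst \<subseteq> S"
      using pring_mem(2)[of _ "(s, y, u1, v1)"] pring_mem(2)[of 0 "(s, y, u1, v1)"] pring_mem(2)[of 1 "(s, y, u1, v1)"] 
        pring_mem(2)[of 2 "(s, y, u1, v1)"] pring_mem(2)[of 3 "(s, y, u1, v1)"] pring_mem(1)[of _ "(s, y, u1, v1)"] by auto
    have l: "lring S" "s \<in> maxideal S" using W_lring assms by blast+
    have zw: "z \<in> maxideal S" "w \<in> maxideal S" using s_mult[OF l uv(1)] s_mult[OF l uv(2)] s0 by (simp_all add: u1_def v1_def)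
    have "pring (s, y, z, w) \<subseteq> S"
      by (rule pring_min[OF lring_sring[OF l(1)] uv(5)]) (use zw uv in \<open>auto elim!: less4E simp: maxideal_iff\<close>)
    then show ?thesis using zw by blast
  qed
  then show "z \<in> maxideal S" "w \<in> maxideal S" "pring (s, y, z, w) \<subseteq> S" by auto
qed

text \<open>The function \<open>x\<close> has value 1 on the centers, hence is a unit there, while
  \<open>z\<close> vanishes. For the first curve the quotient is \<open>u11\<close>, for the second
  curve its inverse; it separates the two curves above the point 11.\<close>

lemma W_zyx:
  assumes "1 \<le> i" "i \<le> 5" "S \<in> WW i"
  shows "z * y / x \<in> maxideal S"
proof -
  have l: "lring S" "s \<in> maxideal S" using W_lring assms by blast+
  note p = prmD[OF lring_prm[OF l(1)]]
  have yx: "y \<in> S" "x \<in> S" using pring_mem(2)[of 1 "(x, y, z, w)"] pring_mem(2)[of 0 "(x, y, z, w)"] W_zw(3)[OF assms] pring_a1 by auto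
  have "x \<notin> maxideal S"
  proof
    assume "x \<in> maxideal S"
    moreover have "(- 1) * s \<in> maxideal S"
      by (rule p(4)[OF sringD(5)[OF lring_sring[OF l(1)] sringD(1)[OF lring_sring[OF l(1)]]] l(2)])
    ultimately have "x + (- 1) * s \<in> maxideal S" by (rule p(3))
    then show False using p(6) by (simp add: s_def)
  qed
  then have "y * (1 / x) \<in> S" by (intro sringD(4)[OF lring_sring[OF l(1)] yx(1)] lring_units(3)[OF l(1) yx(2)])
  from p(5)[OF W_zw(1)[OF assms] this] show ?thesis by simp
qed

lemma ww_eq: "v1 = s * v2" "a3 = s * u3" "a4 = s * v4" "a5 = s * v5"
  using s0 by (simp_all add: v2_def u3_def v4_def v5_def)

lemma ww_maxideal:
  assumes "1 \<le> j" "j < i" "i \<le> 5" "S \<in> WW i"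
  shows "ww j \<in> maxideal S"
proof (cases "i = Suc j")
  case True
  have "j = 1 \<or> j = 2 \<or> j = 3 \<or> j = 4" using assms True by auto
  then show ?thesis using assms(4) W_facts(2-5) True by (elim disjE) (auto simp: numeral_2_eq_2[symmetric])
next
  case False
  have l: "lring S" "s \<in> maxideal S" using W_lring[of i S] assms by auto
  have "pring (cc (Suc j)) \<subseteq> S" by (rule W_pring) (use assms False in auto)
  then have c: "crd (cc (Suc j)) 2 \<in> S" "crd (cc (Suc j)) 3 \<in> S"
    using pring_mem(2)[of 2 "cc (Suc j)"] pring_mem(2)[of 3 "cc (Suc j)"] by auto
  have j: "1 \<le> j" "j \<le> 5" "j \<noteq> 4" "j \<noteq> 5" using assms False by auto
  show ?thesis
    using j(1,2)
  proof (cases rule: le5E)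
    case 1 then show ?thesis using s_mult[OF l c(2)] ww_eq by (simp add: numeral_2_eq_2[symmetric])
  next
    case 2 then show ?thesis using s_mult[OF l c(1)] ww_eq by simp
  next
    case 3 then show ?thesis using s_mult[OF l c(2)] ww_eq by simp
  qed (use j in auto)
qed

lemma ww_units:
  assumes "1 \<le> j" "j \<le> 4"
  shows "ww j \<in> units_in (VV j)"
proof -
  have 1: "v1 \<in> units_in (VV 1)"
    using Oring_units_pdv(2)[OF cs_c1, of 0 "(0, 0, 0, 1)" v1] cs_c1 by (simp add: VV_def)
  \<comment> \<open>The point is chosen to give \<open>a3\<close> the value
    \<open>(1 - h) + h = 1\<close>; in the two following cases the value is
    \<open>2 - 1 = 1\<close>.\<close>
  have 2: "a3 \<in> units_in (VV 2)"
    using Oring_units_pdv(2)[OF cs_c2, of 0 "(0, 0, 1 - h, 0)" a3] cs_c2 r1(1)[OF cs_c2, of "(0, 0, 1 - h, 0)" h]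
    by (simp add: VV_def a3_def place)
  have 3: "a4 \<in> units_in (VV 3)"
    using Oring_units_pdv(2)[OF cs_c3, of 0 "(0, 0, 0, 2)" a4] cs_c3 r1(2)[OF cs_c3, of "(0, 0, 0, 2)"]
      place_add[OF cs_c3, of v2 "(0, 0, 0, 2)" "- (1 / \<gamma>)"] by (simp add: VV_def a4_def)
  have 4: "a5 \<in> units_in (VV 4)"
    using Oring_units_pdv(2)[OF cs_c4, of 0 "(0, 0, 0, 2)" a5] cs_c4 r1(3)[OF cs_c4, of "(0, 0, 0, 2)"]
      place_add[OF cs_c4, of v4 "(0, 0, 0, 2)" "- (1 / \<gamma> ^ 2)"] by (simp add: VV_def a5_def)
  have "j \<le> 5" using assms by simp
  from assms(1) this show ?thesis by (cases rule: le5E) (use 1 2 3 4 assms in auto)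
qed

lemma w0: "w \<noteq> 0"
  using crd_neq_0[OF cs0, of 3] by simp

lemma VV_stays:
  assumes "1 \<le> j" "j \<le> i" "i \<le> 5"
  shows "VV j \<in> XX i"
  using assms(2,3)
proof (induction i rule: dec_induct)
  case base
  then show ?case using step_facts(4)[of j] assms by auto
next
  case (step i)
  have "1 / w \<notin> S" if "S \<in> WW (Suc i)" for S
    by (rule maxideal_inverse[OF W_zw(2)[OF _ _ that] w0]) (use step in auto)
  then have "VV j \<in> blowup (XX i) (zariski_closure (XX i) (XX i \<inter> WW (Suc i)))"
    using step(1-3) assms step_facts(6)[of j] w0 by (intro dvr_stays[OF model_XX, where c = "1 / w"]) auto
  then show ?case using XX[of i] step by simp
qed

text \<open>For \<open>i \<le> j\<close> the ring \<open>VV j\<close> contains chart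
  \<open>i\<close>, where the total transform has the equation \<open>s\<close>, a uniformizer of
  every \<open>VV j\<close>. For \<open>i > j\<close> the inverse of \<open>ww j\<close> shows that
  center \<open>i\<close> misses \<open>VV j\<close>.\<close>

lemma VV_ord:
  assumes "1 \<le> i" "i \<le> 5" "1 \<le> j" "j \<le> 5"
  shows "blowup_ord (XX (i - 1)) (WW i) (VV j) = (if i \<le> j then 1 else 0)"
proof (cases "i \<le> j")
  case True
  interpret dvr "VV j" s by (rule step_facts(6)[OF assms(3,4)])
  have "blowup_ord (XX (i - 1)) (WW i) (VV j) = ord_at (VV j) s"
    by (rule step_facts(7)[OF assms(1,2) dvr_axioms B_VV[OF True assms(3,4)]])
  then show ?thesis using True ord_pi by simp
next
  case False
  have u: "ww j \<in> units_in (VV j)" by (rule ww_units) (use assms False in auto)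
  have "blowup_ord (XX (i - 1)) (WW i) (VV j) = 0"
  proof (rule blowup_ord_kill[OF step_facts(6)[OF assms(3,4)] model_XX _ dominates_refl, of _ "1 / ww j"])
    show "i - 1 \<le> 5" using assms by simp
    show "VV j \<in> XX (i - 1)" by (rule VV_stays) (use assms False in auto)
    show "1 / ww j \<in> VV j" using u by (simp add: units_in_def divide_inverse)
    show "1 / ww j \<notin> S" if "S \<in> WW i" for S
      by (rule maxideal_inverse[OF ww_maxideal[OF _ _ _ that]]) (use assms False u in \<open>auto simp: units_in_def\<close>)
  qed
  then show ?thesis using False by simp
qed

end

section \<open>The blow-ups over the intersection of the two curves\<close>

lemma pring_eqI:
  assumes "\<And>i. i < 4 \<Longrightarrow> crd y i \<in> pring y'" "\<And>i. i < 4 \<Longrightarrow> crd y' i \<in> pring y"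
  shows "pring y = pring y'"
proof (rule subset_antisym)
  have c: "range cst \<subseteq> pring q" for q using pring_mem(1) by blast
  show "pring y \<subseteq> pring y'" by (rule pring_min[OF sring_pring c assms(1)])
  show "pring y' \<subseteq> pring y" by (rule pring_min[OF sring_pring c assms(2)])
qed

lemma pring_tuple:
  "a \<in> pring (a, b, c, d)" "b \<in> pring (a, b, c, d)" "c \<in> pring (a, b, c, d)" "d \<in> pring (a, b, c, d)"
  using pring_mem(2)[of 0 "(a, b, c, d)"] pring_mem(2)[of 1 "(a, b, c, d)"] pring_mem(2)[of 2 "(a, b, c, d)"] pring_mem(2)[of 3 "(a, b, c, d)"]
  by simp_all

lemma pring_ops:
  "a \<in> pring y \<Longrightarrow> b \<in> pring y \<Longrightarrow> a + b \<in> pring y" "a \<in> pring y \<Longrightarrow> b \<in> pring y \<Longrightarrow> a - b \<in> pring y"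
  "a \<in> pring y \<Longrightarrow> b \<in> pring y \<Longrightarrow> a * b \<in> pring y" "1 \<in> pring y" "numeral n \<in> pring y"
  using sringD[OF sring_pring] pring_mem(1)[of "numeral n"] by (auto simp: cst_numeral)

lemma Bring_cong: "pring y = pring y' \<Longrightarrow> Bring y g = Bring y' g"
  by (simp add: Bring_def)

lemma coordsys_shift_linear:
  assumes y: "coordsys (s, t, u, v)"
  shows "coordsys (s, t, u + (cst a * s + cst b), v)" "coordsys (s, t, u, v + (cst a * s + cst c * u + cst b))"
proof -
  have "coordsys (sh 2 (cst a * s + cst b) (s, t, u, v))"
  proof (rule coordsys_sh[OF y, where H = 1])
    have "s \<in> {crd (s, t, u, v) j | j. j < 4 \<and> j \<noteq> 2}" by (intro CollectI exI[of _ 0]) simp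
    then show "cst a * s + cst b \<in> gfield {crd (s, t, u, v) j | j. j < 4 \<and> j \<noteq> 2}" by (intro gfield_mem)
    show "\<exists>z. \<forall>p. (\<forall>j<4. j \<noteq> 2 \<longrightarrow> crd p j = crd q j) \<longrightarrow>
        cst a * s + cst b \<in> Oring (s, t, u, v) p \<and> pval (s, t, u, v) p (cst a * s + cst b) = z" for q
      by (rule exI[of _ "a * crd q 0 + b"]) (simp add: y place[OF y])
  qed auto
  then show "coordsys (s, t, u + (cst a * s + cst b), v)" by (simp add: sh_def)
  have "coordsys (sh 3 (cst a * s + cst c * u + cst b) (s, t, u, v))"
  proof (rule coordsys_sh[OF y, where H = 1])
    have "s \<in> {crd (s, t, u, v) j | j. j < 4 \<and> j \<noteq> 3}" "u \<in> {crd (s, t, u, v) j | j. j < 4 \<and> j \<noteq> 3}"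
      by (intro CollectI exI[of _ 0]; simp) (intro CollectI exI[of _ 2]; simp)
    then show "cst a * s + cst c * u + cst b \<in> gfield {crd (s, t, u, v) j | j. j < 4 \<and> j \<noteq> 3}" by (intro gfield_mem)
    show "\<exists>z. \<forall>p. (\<forall>j<4. j \<noteq> 3 \<longrightarrow> crd p j = crd q j) \<longrightarrow>
        cst a * s + cst c * u + cst b \<in> Oring (s, t, u, v) p \<and> pval (s, t, u, v) p (cst a * s + cst c * u + cst b) = z" for q
      by (rule exI[of _ "a * crd q 0 + c * crd q 2 + b"]) (simp add: y place[OF y])
  qed auto
  then show "coordsys (s, t, u, v + (cst a * s + cst c * u + cst b))" by (simp add: sh_def)
qed

lemma Oring_shift_linear:
  assumes y: "coordsys (s, t, u, v)"
  shows "Oring (s, t, u, v) (p, q, r, k) = Oring (s, t, u + (cst a * s + cst b), v) (p, q, r + (a * p + b), k)"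
    "Oring (s, t, u, v) (p, q, r, k) = Oring (s, t, u, v + (cst a * s + cst c * u + cst b)) (p, q, r, k + (a * p + c * r + b))"
proof -
  note cs = coordsys_shift_linear[OF y]
  show "Oring (s, t, u, v) (p, q, r, k) = Oring (s, t, u + (cst a * s + cst b), v) (p, q, r + (a * p + b), k)"
    using Oring_sh[OF y, of 2 "cst a * s + cst b" "(p, q, r, k)" "a * p + b"] cs(1)[of a b]
    by (simp add: sh_def y place[OF y] place[OF cs(1)])
  show "Oring (s, t, u, v) (p, q, r, k) = Oring (s, t, u, v + (cst a * s + cst c * u + cst b)) (p, q, r, k + (a * p + c * r + b))"
    using Oring_sh[OF y, of 3 "cst a * s + cst c * u + cst b" "(p, q, r, k)" "a * p + c * r + b"] cs(2)[of a c b]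
    by (simp add: sh_def y place[OF y] place[OF cs(2)])
qed

lemma pring_shift_linear:
  "pring (s, t, u, v) = pring (s, t, u + (cst a * s + cst b), v)"
  "pring (s, t, u, v) = pring (s, t, u, v + (cst a * s + cst c * u + cst b))"
proof -
  have 1: "cst a * s + cst b \<in> pring (s, t, x, v)" for x by (intro pring_ops pring_mem(1) pring_tuple)
  have 2: "cst a * s + cst c * u + cst b \<in> pring (s, t, u, x)" for x by (intro pring_ops pring_mem(1) pring_tuple)
  show "pring (s, t, u, v) = pring (s, t, u + (cst a * s + cst b), v)"
  proof (rule pring_eqI)
    show "i < 4 \<Longrightarrow> crd (s, t, u, v) i \<in> pring (s, t, u + (cst a * s + cst b), v)" for i
      using pring_ops(2)[OF pring_tuple(3) 1, of "u + (cst a * s + cst b)"] by (auto elim!: less4E simp: pring_tuple)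
    show "i < 4 \<Longrightarrow> crd (s, t, u + (cst a * s + cst b), v) i \<in> pring (s, t, u, v)" for i
      using pring_ops(1)[OF pring_tuple(3) 1, of u] by (auto elim!: less4E simp: pring_tuple)
  qed
  show "pring (s, t, u, v) = pring (s, t, u, v + (cst a * s + cst c * u + cst b))"
  proof (rule pring_eqI)
    show "i < 4 \<Longrightarrow> crd (s, t, u, v) i \<in> pring (s, t, u, v + (cst a * s + cst c * u + cst b))" for i
      using pring_ops(2)[OF pring_tuple(4) 2, of "v + (cst a * s + cst c * u + cst b)"] by (auto elim!: less4E simp: pring_tuple)
    show "i < 4 \<Longrightarrow> crd (s, t, u, v + (cst a * s + cst c * u + cst b)) i \<in> pring (s, t, u, v)" for i
      using pring_ops(1)[OF pring_tuple(4) 2, of v] by (auto elim!: less4E simp: pring_tuple)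
  qed
qed

lemma Oring_swap_last:
  assumes y: "coordsys (s, t, u, v)"
  shows "Oring (s, t, u, v) (p, q, r, k) = Oring (s, t, v, u) (p, q, k, r)"
  by (rule Oring_eqI[OF y coordsys_swap_last[OF y]])
     (auto elim!: less4E simp: y coordsys_swap_last[OF y])

lemma pring_swap_last: "pring (s, t, u, v) = pring (s, t, v, u)"
  by (rule pring_eqI) (auto elim!: less4E simp: pring_tuple)

text \<open>Blow-ups 12 to 17, numbered 1 to 6. The translations are affine linear here, so no
  denominators arise; but above the point 11 the initial chart is available only where
  \<open>u\<close> is invertible, away from the proper transforms of the two curves. Nothing is
  lost, as the first center lies at \<open>u = 1\<close>.\<close>

locale diag_blowups =
  fixes h :: complex and s t u v :: ratfun and XX :: "nat \<Rightarrow> variety" and WW :: "nat \<Rightarrow> local_ring set"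
  assumes h0: "h \<noteq> 0" and cs0: "coordsys (s, t, u, v)" and model0: "model (XX 0)" and aff0: "affine (Bring (s, t, u, v) u) \<subseteq> XX 0"
    and XX: "\<And>i. i < 6 \<Longrightarrow> XX (Suc i) = blowup (XX i) (zariski_closure (XX i) (XX i \<inter> WW (Suc i)))"
    and W1_point: "WW 1 = point_at (s, t, u, v) ` {(P, 0, 1, 0) | P. True}"
    and W2_point: "WW 2 = point_at (step12 (s, t, u, v)) ` {(P, 0, Q, - 1) | P Q. True}"
    and W3_point: "WW 3 = point_at (step13 (step12 (s, t, u, v))) ` {(0, 0, 1 + h, 0)}"
    and W4_point: "WW 4 = point_at (step14 h (step13 (step12 (s, t, u, v)))) ` {(P, 0, - 2 * Q - P / h, Q) | P Q. True}"
    and W5_point: "WW 5 = point_at (step15 h (step14 h (step13 (step12 (s, t, u, v))))) ` {(P, 0, - P / h, Q) | P Q. True}"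
    and W6_point: "WW 6 = point_at (step16 h (step15 h (step14 h (step13 (step12 (s, t, u, v)))))) ` {(P, 0, Q, Q / 2 + (1 + h) / h * P) | P Q. True}"
begin

definition "p = (u - 1) / t"
definition "v1 = v / t"
text \<open>\<open>e2\<close> to \<open>e6\<close> are the translated coordinates vanishing on the
  second to sixth center; their quotients by \<open>t\<close> are the coordinates \<open>r\<close>,
  \<open>q\<close>, \<open>m\<close>, \<open>n\<close>, \<open>l\<close> of the following
  charts.\<close>

definition "e2 = v1 + 1"
definition "r = e2 / t"
definition "e3 = p - 1 - cst h"
definition "s3 = s / t"
definition "q = e3 / t"
definition "r3 = r / t"
definition "e4 = q + 2 * r3 + s3 / cst h"
definition "m = e4 / t"
definition "e5 = r3 + s3 / cst h"
definition "n = e5 / t"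
definition "e6 = m - n / 2 - cst ((1 + h) / h) * s3"
definition "l = e6 / t"

lemma half: "x / 2 = cst (1 / 2) * x" "x / cst h = cst (1 / h) * x"
  using h0 by (simp_all add: cst_divide cst_numeral)

lemma cs_a1: "coordsys (s, t, u - 1, v)"
  using coordsys_shift_linear(1)[OF cs0, of 0 "- 1"] by (simp add: cst_hom)
lemma t0: "t \<noteq> 0" using crd_neq_0[OF cs0, of 1] by simp
lemma cs_c1: "coordsys (s, t, p, v1)"
  using coordsys_dv[OF cs_a1, of 1 "{2, 3}"] by (simp add: dv_def p_def v1_def)
lemma cs_a2: "coordsys (s, t, p, e2)"
  using coordsys_shift_linear(2)[OF cs_c1, of 0 0 1] by (simp add: e2_def)
lemma cs_c2: "coordsys (s, t, p, r)"
  using coordsys_dv[OF cs_a2, of 1 "{3}"] by (simp add: dv_def r_def)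
lemma e3_eq: "e3 = p + (cst 0 * s + cst (- (1 + h)))" by (simp add: e3_def cst_hom)
lemma cs_a3: "coordsys (s, t, e3, r)"
  using coordsys_shift_linear(1)[OF cs_c2, of 0 "- (1 + h)"] unfolding e3_eq .
lemma cs_c3: "coordsys (s3, t, q, r3)"
  using coordsys_dv[OF cs_a3, of 1 "{0, 2, 3}"] by (simp add: dv_def s3_def q_def r3_def)
lemma e4_eq: "e4 = q + (cst (1 / h) * s3 + cst 2 * r3 + cst 0)" by (simp add: e4_def half cst_numeral)
lemma cs_a4: "coordsys (s3, t, r3, e4)"
  using coordsys_shift_linear(2)[OF coordsys_swap_last[OF cs_c3], of "1 / h" 2 0] unfolding e4_eq .
lemma cs_c4: "coordsys (s3, t, r3, m)"
  using coordsys_dv[OF cs_a4, of 1 "{3}"] by (simp add: dv_def m_def)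
lemma e5_eq: "e5 = r3 + (cst (1 / h) * s3 + cst 0)" by (simp add: e5_def half)
lemma cs_a5: "coordsys (s3, t, e5, m)"
  using coordsys_shift_linear(1)[OF cs_c4, of "1 / h" 0] unfolding e5_eq .
lemma cs_c5: "coordsys (s3, t, n, m)"
  using coordsys_dv[OF cs_a5, of 1 "{2}"] by (simp add: dv_def n_def)
lemma e6_eq: "e6 = m + (cst (- ((1 + h) / h)) * s3 + cst (- (1 / 2)) * n + cst 0)" by (simp add: e6_def half cst_hom)
lemma cs_a6: "coordsys (s3, t, n, e6)"
  using coordsys_shift_linear(2)[OF cs_c5, of "- ((1 + h) / h)" "- (1 / 2)" 0] unfolding e6_eq .
lemma cs_c6: "coordsys (s3, t, n, l)"
  using coordsys_dv[OF cs_a6, of 1 "{3}"] by (simp add: dv_def l_def)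

lemma charts:
  "step12 (s, t, u, v) = (s, t, p, v1)" "step13 (s, t, p, v1) = (s, t, p, r)"
  "step14 h (s, t, p, r) = (s3, t, q, r3)" "step15 h (s3, t, q, r3) = (s3, t, r3, m)" "step16 h (s3, t, r3, m) = (s3, t, n, m)"
  by (simp_all add: p_def v1_def e2_def r_def e3_def s3_def q_def r3_def e4_def m_def e5_def n_def)

lemma P_a1: "pring (s, t, u, v) = pring (s, t, u - 1, v)"
  using pring_shift_linear(1)[of s t u v 0 "- 1"] by (simp add: cst_hom)
lemma P_a2: "pring (s, t, p, v1) = pring (s, t, p, e2)"
  using pring_shift_linear(2)[of s t p v1 0 0 1] by (simp add: e2_def)
lemma P_a3: "pring (s, t, p, r) = pring (s, t, e3, r)"
  unfolding e3_eq by (rule pring_shift_linear)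
lemma P_a4: "pring (s3, t, q, r3) = pring (s3, t, r3, e4)"
  unfolding e4_eq by (subst pring_swap_last) (rule pring_shift_linear)
lemma P_a5: "pring (s3, t, r3, m) = pring (s3, t, e5, m)"
  unfolding e5_eq by (rule pring_shift_linear)
lemma P_a6: "pring (s3, t, n, m) = pring (s3, t, n, e6)"
  unfolding e6_eq by (rule pring_shift_linear)

lemma W1: "WW 1 = Oring (s, t, u, v) ` {(P, 0, 1, 0) | P. True}"
  unfolding W1_point charts using point_at_Oring[OF cs0] by simp
lemma W2: "WW 2 = Oring (step12 (s, t, u, v)) ` {(P, 0, Q, - 1) | P Q. True}"
  unfolding W2_point charts using point_at_Oring[OF cs_c1] by simp
lemma W3: "WW 3 = Oring (step13 (step12 (s, t, u, v))) ` {(0, 0, 1 + h, 0)}"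
  unfolding W3_point charts using point_at_Oring[OF cs_c2] by simp
lemma W4: "WW 4 = Oring (step14 h (step13 (step12 (s, t, u, v)))) ` {(P, 0, - 2 * Q - P / h, Q) | P Q. True}"
  unfolding W4_point charts using point_at_Oring[OF cs_c3] by simp
lemma W5: "WW 5 = Oring (step15 h (step14 h (step13 (step12 (s, t, u, v))))) ` {(P, 0, - P / h, Q) | P Q. True}"
  unfolding W5_point charts using point_at_Oring[OF cs_c4] by simp
lemma W6: "WW 6 = Oring (step16 h (step15 h (step14 h (step13 (step12 (s, t, u, v)))))) ` {(P, 0, Q, Q / 2 + (1 + h) / h * P) | P Q. True}"
  unfolding W6_point charts using point_at_Oring[OF cs_c5] by simp

lemma W1': "WW 1 = Oring (s, t, u - 1, v) ` {(P, 0, 0, 0) | P. True}"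
proof -
  have "Oring (s, t, u, v) (P, 0, 1, 0) = Oring (s, t, u - 1, v) (P, 0, 0, 0)" for P
    using Oring_shift_linear(1)[OF cs0, of P 0 1 0 0 "- 1"] by (simp add: cst_hom)
  from image_params_cong[of "\<lambda>_. True" "Oring (s, t, u, v)" "\<lambda>P Q. (P, 0, 1, 0)" _ "\<lambda>P Q. (P, 0, 0, 0)", OF this]
  show ?thesis unfolding W1 by simp
qed
lemma W2': "WW 2 = Oring (s, t, p, e2) ` {(P, 0, Q, 0) | P Q. True}"
proof -
  have "Oring (s, t, p, v1) (P, 0, Q, - 1) = Oring (s, t, p, e2) (P, 0, Q, 0)" for P Q
    using Oring_shift_linear(2)[OF cs_c1, of P 0 Q "- 1" 0 0 1] by (simp add: e2_def)
  then show ?thesis unfolding W2 charts by (rule image_params_cong)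
qed
lemma W3': "WW 3 = Oring (s, t, e3, r) ` {(0, 0, 0, 0)}"
  using Oring_shift_linear(1)[OF cs_c2, of 0 0 "1 + h" 0 0 "- (1 + h)"] unfolding W3 charts e3_eq by simp
lemma W4': "WW 4 = Oring (s3, t, r3, e4) ` {(P, 0, Q, 0) | P Q. True}"
proof -
  have "Oring (s3, t, q, r3) (P, 0, - 2 * Q - P / h, Q) = Oring (s3, t, r3, e4) (P, 0, Q, 0)" for P Q
    using Oring_shift_linear(2)[OF coordsys_swap_last[OF cs_c3], of P 0 Q "- 2 * Q - P / h" "1 / h" 2 0]
      Oring_swap_last[OF cs_c3, of P 0 "- 2 * Q - P / h" Q] unfolding e4_eq by simp
  then show ?thesis unfolding W4 charts by (rule image_params_cong)
qed
lemma W5': "WW 5 = Oring (s3, t, e5, m) ` {(P, 0, 0, Q) | P Q. True}"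
proof -
  have "Oring (s3, t, r3, m) (P, 0, - P / h, Q) = Oring (s3, t, e5, m) (P, 0, 0, Q)" for P Q
    using Oring_shift_linear(1)[OF cs_c4, of P 0 "- P / h" Q "1 / h" 0] unfolding e5_eq by simp
  then show ?thesis unfolding W5 charts by (rule image_params_cong)
qed
lemma W6': "WW 6 = Oring (s3, t, n, e6) ` {(P, 0, Q, 0) | P Q. True}"
proof -
  have "Oring (s3, t, n, m) (P, 0, Q, Q / 2 + (1 + h) / h * P) = Oring (s3, t, n, e6) (P, 0, Q, 0)" for P Q
    using Oring_shift_linear(2)[OF cs_c5, of P 0 Q "Q / 2 + (1 + h) / h * P" "- ((1 + h) / h)" "- (1 / 2)" 0] unfolding e6_eq
    by (simp add: algebra_simps)
  then show ?thesis unfolding W6 charts by (rule image_params_cong)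
qed

section \<open>Charts and exceptional divisors of the last six blow-ups\<close>

definition cc :: "nat \<Rightarrow> coords" where
  "cc i = [(s, t, u, v), (s, t, p, v1), (s, t, p, r), (s3, t, q, r3), (s3, t, r3, m), (s3, t, n, m), (s3, t, n, l)] ! i"

definition VV :: "nat \<Rightarrow> local_ring" where
  "VV i = pdv (cc i) (X 1)"

lemma cc_simps [simp]: "cc 0 = (s, t, u, v)" "cc (Suc 0) = (s, t, p, v1)" "cc 2 = (s, t, p, r)"
  "cc 3 = (s3, t, q, r3)" "cc 4 = (s3, t, r3, m)" "cc 5 = (s3, t, n, m)" "cc 6 = (s3, t, n, l)"
  by (simp_all add: cc_def numeral_eq_Suc)

lemma le6_cases: "(\<forall>i. 1 \<le> i \<and> i \<le> 6 \<longrightarrow> P i) \<longleftrightarrow> P 1 \<and> P 2 \<and> P 3 \<and> P 4 \<and> P 5 \<and> P (6::nat)"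
  by (auto simp: le_Suc_eq numeral_eq_Suc)

lemma le6E:
  assumes "1 \<le> i" "i \<le> (6::nat)"
  obtains "i = 1" | "i = 2" | "i = 3" | "i = 4" | "i = 5" | "i = 6"
  using assms by linarith

lemma u_p: "1 + t * p = u"
  using t0 by (simp add: p_def)

definition chart_facts :: "nat \<Rightarrow> bool" where
  "chart_facts i \<longleftrightarrow> model (XX i) \<and> affine (Bring (cc i) u) \<subseteq> XX i \<and> pring (cc (i - 1)) \<subseteq> pring (cc i) \<and>
     Bring (cc (i - 1)) u \<subseteq> Bring (cc i) u \<and> VV i \<in> XX i \<and> Bring (cc i) u \<subseteq> VV i \<and> dvr (VV i) t \<and>
     (\<forall>U \<pi>. dvr U \<pi> \<longrightarrow> Bring (cc i) u \<subseteq> U \<longrightarrow> blowup_ord (XX (i - 1)) (WW i) U = ord_at U t) \<and> p \<in> pring (cc i)"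

lemma step_out:
  assumes cs: "coordsys (\<sigma>, t, a, b)" and V: "model (XX i)" "affine (Bring (cc i) u) \<subseteq> XX i"
    and i: "i < 6" and W: "WW (Suc i) = Oring (\<sigma>, t, a, b) ` P" "\<And>x j. x \<in> P \<Longrightarrow> j \<in> I \<Longrightarrow> crd x j = 0"
      "\<And>x. \<forall>j\<in>I. crd x j = 0 \<Longrightarrow> x \<in> P"
    and I: "1 \<in> I" "I \<subseteq> {..<4}" and c: "dv 1 (I - {1}) (\<sigma>, t, a, b) = cc (Suc i)"
    and B: "pring (cc i) = pring (\<sigma>, t, a, b)"
    and up: "if i = 0 then 2 \<in> I \<and> a = u - 1 else p \<in> pring (cc i)"
  shows "chart_facts (Suc i)"
proof -
  \<comment> \<open>The inverted function \<open>u\<close> is 1 plus a multiple of an equation of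
    the center: \<open>u - 1\<close> is itself such an equation in the first blow-up, and it equals
    \<open>t * p\<close> in the later ones. So \<open>u\<close> restricts to 1 on every center and
    every exceptional divisor.\<close>
  obtain j F where F: "j \<in> I" "ev (\<sigma>, t, a, b) (1 + X j * F) = u"
  proof (cases "i = 0")
    case True
    then have "ev (\<sigma>, t, a, b) (1 + X 2 * 1) = u" using up by simp
    moreover have "2 \<in> I" using up True by simp
    ultimately show ?thesis by (rule that[rotated])
  next
    case False
    then obtain F where F: "p = ev (\<sigma>, t, a, b) F" using up B by (auto simp: pring_def)
    have "ev (\<sigma>, t, a, b) (1 + X 1 * F) = 1 + t * p" unfolding F by simp
    then have "ev (\<sigma>, t, a, b) (1 + X 1 * F) = u" unfolding u_p .
    then show ?thesis by (rule that[OF I(1)])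
  qed
  define G where "G = 1 + X j * F"
  have j: "j < 4" using F I by auto
  have G: "ev (\<sigma>, t, a, b) G = u" "zer I G = 1" using F j by (simp_all add: G_def)
  have cb: "coord_blowup (XX i) (\<sigma>, t, a, b) G (WW (Suc i)) I 1"
  proof
    show "affine (Bring (\<sigma>, t, a, b) (ev (\<sigma>, t, a, b) G)) \<subseteq> XX i" using V(2) Bring_cong[OF B] G(1) by simp
    show "zer I G \<noteq> 0" using G by simp
    show "crd (\<sigma>, t, a, b) j \<in> maxideal S" if "S \<in> WW (Suc i)" "j \<in> I" for S j
    proof -
      from that(1) obtain x where "x \<in> P" "S = Oring (\<sigma>, t, a, b) x" unfolding W(1) by (rule imageE)
      then show ?thesis using coord_blowup_W[OF cs, of S x j] W(2)[of x j] that(2) I(2) by auto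
    qed
    show "Oring (\<sigma>, t, a, b) x \<in> WW (Suc i)" if "\<forall>j\<in>I. crd x j = 0" "val x G \<noteq> 0" for x
      unfolding W(1) by (rule imageI[OF W(3)[OF that(1)]])
  qed (use cs V I in auto)
  have sub: "pring (cc i) \<subseteq> pring (cc (Suc i))"
  proof -
    have cs': "coordsys (cc (Suc i))" unfolding c[symmetric] by (rule coordsys_dv[OF cs]) auto
    have "crd (\<sigma>, t, a, b) k \<in> pring (cc (Suc i))" if k: "k < 4" for k
    proof (cases "k \<in> I - {1}")
      case True
      have *: "crd (cc (Suc i)) k = crd (\<sigma>, t, a, b) k / t" and **: "crd (cc (Suc i)) 1 = t"
        unfolding c[symmetric] using True k by (simp_all add: crd_dv)
      have eq: "crd (cc (Suc i)) k * crd (cc (Suc i)) 1 = crd (\<sigma>, t, a, b) k"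
        unfolding ** by (rule nonzero_eq_divide_eq[OF t0, THEN iffD1, OF *])
      have "crd (cc (Suc i)) k * crd (cc (Suc i)) 1 \<in> pring (cc (Suc i))"
        by (intro pring_ops pring_mem(2)) (use k in simp_all)
      then show ?thesis unfolding eq .
    next
      case False
      have "crd (\<sigma>, t, a, b) k = crd (cc (Suc i)) k" unfolding c[symmetric] crd_dv[OF k] using False by auto
      then show ?thesis using pring_mem(2)[OF k, of "cc (Suc i)"] by (simp only:)
    qed
    moreover have "range cst \<subseteq> pring (cc (Suc i))" using pring_mem(1) by blast
    ultimately show ?thesis unfolding B by (intro pring_min[OF sring_pring])
  qed
  have pc: "p \<in> pring (cc (Suc i))"
    using up sub pring_tuple(3)[of p s t v1] by (cases "i = 0") auto
  then obtain F' where F': "p = ev (cc (Suc i)) F'" by (auto simp: pring_def)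
  have crd1: "crd (cc (Suc i)) 1 = t" unfolding c[symmetric] by (subst crd_dv) auto
  have st: "blowup_step (XX i) (\<sigma>, t, a, b) G (WW (Suc i)) I 1 (1 + X 1 * F')"
  proof (rule blowup_step.intro[OF cb], unfold_locales)
    show "ev (dv 1 (I - {1}) (\<sigma>, t, a, b)) (1 + X 1 * F') = ev (\<sigma>, t, a, b) G"
      using crd1 F' u_p unfolding c G(1) by simp
    show "\<not> X 1 dvd 1 + X 1 * F'"
      by (simp add: X_dvd_iff)
  qed
  interpret st: blowup_step "XX i" "(\<sigma>, t, a, b)" G "WW (Suc i)" I 1 "1 + X 1 * F'" by (rule st)
  have "Bring (cc i) u = Bring (\<sigma>, t, a, b) u" by (rule Bring_cong[OF B])
  then show ?thesis
    using st.model' st.chart st.B_subset st.D st.blowup_ord_D sub pc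
    unfolding c G(1) XX[OF i, symmetric] VV_def chart_facts_def by simp
qed

lemma steps:
  assumes "1 \<le> i" "i \<le> 6"
  shows "chart_facts i"
proof -
  have s2: "Suc 0 = 1" "Suc 1 = 2" "Suc 2 = 3" "Suc 3 = 4" "Suc 4 = 5" "Suc 5 = 6" by auto
  note out = step_out[where i = 0] step_out[where i = 1] step_out[where i = 2] step_out[where i = 3] step_out[where i = 4] step_out[where i = 5]
  note out = out[unfolded s2]
  have V: "model (XX i)" "affine (Bring (cc i) u) \<subseteq> XX i" "p \<in> pring (cc i)" if "chart_facts i" for i
    using that by (auto simp: chart_facts_def)
  have d1: "dv 1 ({1, 2, 3} - {1}) (s, t, u - 1, v) = cc 1" by (simp add: dv_def p_def v1_def)
  have a0: "affine (Bring (cc 0) u) \<subseteq> XX 0" using aff0 by simp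
  have o1: "chart_facts 1"
    by (rule out(1)[OF cs_a1 model0 a0 _ W1' _ _ _ _ d1]) (use P_a1 in \<open>auto simp: less4_cases\<close>)
  have d2: "dv 1 ({1, 3} - {1}) (s, t, p, e2) = cc 2" by (simp add: dv_def r_def)
  have o2: "chart_facts 2"
    by (rule out(2)[OF cs_a2 V(1,2)[OF o1] _ W2' _ _ _ _ d2]) (use P_a2 V(3)[OF o1] in \<open>auto simp: less4_cases\<close>)
  have d3: "dv 1 ({0, 1, 2, 3} - {1}) (s, t, e3, r) = cc 3" by (simp add: dv_def s3_def q_def r3_def)
  have o3: "chart_facts 3"
    by (rule out(3)[OF cs_a3 V(1,2)[OF o2] _ W3' _ _ _ _ d3]) (use P_a3 V(3)[OF o2] in \<open>auto simp: less4_cases\<close>)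
  have d4: "dv 1 ({1, 3} - {1}) (s3, t, r3, e4) = cc 4" by (simp add: dv_def m_def)
  have o4: "chart_facts 4"
    by (rule out(4)[OF cs_a4 V(1,2)[OF o3] _ W4' _ _ _ _ d4]) (use P_a4 V(3)[OF o3] in \<open>auto simp: less4_cases\<close>)
  have d5: "dv 1 ({1, 2} - {1}) (s3, t, e5, m) = cc 5" by (simp add: dv_def n_def)
  have o5: "chart_facts 5"
    by (rule out(5)[OF cs_a5 V(1,2)[OF o4] _ W5' _ _ _ _ d5]) (use P_a5 V(3)[OF o4] in \<open>auto simp: less4_cases\<close>)
  have d6: "dv 1 ({1, 3} - {1}) (s3, t, n, e6) = cc 6" by (simp add: dv_def l_def)
  have o6: "chart_facts 6"
    by (rule out(6)[OF cs_a6 V(1,2)[OF o5] _ W6' _ _ _ _ d6]) (use P_a6 V(3)[OF o5] in \<open>auto simp: less4_cases\<close>)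
  show ?thesis using assms by (cases rule: le6E) (use o1 o2 o3 o4 o5 o6 in simp_all)
qed

lemma step_facts:
  assumes "1 \<le> i" "i \<le> 6"
  shows "model (XX i)" "pring (cc (i - 1)) \<subseteq> pring (cc i)" "Bring (cc (i - 1)) u \<subseteq> Bring (cc i) u"
    "VV i \<in> XX i" "Bring (cc i) u \<subseteq> VV i" "dvr (VV i) t"
    "dvr U \<pi> \<Longrightarrow> Bring (cc i) u \<subseteq> U \<Longrightarrow> blowup_ord (XX (i - 1)) (WW i) U = ord_at U t"
  using steps[OF assms] unfolding chart_facts_def by blast+

lemma model_XX: "i \<le> 6 \<Longrightarrow> model (XX i)"
  using step_facts(1)[of i] model0 by (cases "i = 0") auto

lemma chain:
  assumes "i \<le> j" "j \<le> 6"
  shows "Bring (cc i) u \<subseteq> Bring (cc j) u" "pring (cc i) \<subseteq> pring (cc j)"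
proof -
  have "Bring (cc i) u \<subseteq> Bring (cc j) u \<and> pring (cc i) \<subseteq> pring (cc j)"
    using assms
  proof (induction j)
    case (Suc j)
    then show ?case using step_facts(2,3)[of "Suc j"] by (cases "i = Suc j") auto
  qed simp
  then show "Bring (cc i) u \<subseteq> Bring (cc j) u" "pring (cc i) \<subseteq> pring (cc j)" by auto
qed

lemma B_VV: "i \<le> j \<Longrightarrow> 1 \<le> j \<Longrightarrow> j \<le> 6 \<Longrightarrow> Bring (cc i) u \<subseteq> VV j"
  using chain(1)[of i j] step_facts(5)[of j] by blast

text \<open>An equation of center \<open>j + 1\<close>, here counted from 0. It vanishes on all
  later centers too, and for \<open>j \<ge> 1\<close> it is a unit along \<open>VV j\<close>, which
  gives the functions regular nowhere on the later centers.\<close>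

definition ww :: "nat \<Rightarrow> ratfun" where
  "ww i = [v, e2, r, e4, e5, e6] ! i"

lemma ww_simps [simp]: "ww 0 = v" "ww (Suc 0) = e2" "ww 2 = r" "ww 3 = e4" "ww 4 = e5" "ww 5 = e6"
  by (simp_all add: ww_def numeral_eq_Suc)

lemma W_ring:
  assumes "coordsys (\<sigma>, t, a, b)" "S = Oring (\<sigma>, t, a, b) x" "crd x 1 = 0" "pring c = pring (\<sigma>, t, a, b)"
  shows "lring S \<and> t \<in> maxideal S \<and> pring c \<subseteq> S"
    "i < 4 \<Longrightarrow> crd x i = 0 \<Longrightarrow> crd (\<sigma>, t, a, b) i \<in> maxideal S"
proof -
  have "pring (\<sigma>, t, a, b) \<subseteq> S" unfolding pring_def assms(2) using place_ev(1)[OF assms(1)] by blast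
  then show "lring S \<and> t \<in> maxideal S \<and> pring c \<subseteq> S" using assms lring_Oring by (simp add: maxideal_Oring)
  show "i < 4 \<Longrightarrow> crd x i = 0 \<Longrightarrow> crd (\<sigma>, t, a, b) i \<in> maxideal S"
    using coord_blowup_W[OF assms(1,2)] .
qed

lemma W_facts:
  assumes i: "1 \<le> i" "i \<le> 6" and S: "S \<in> WW i"
  shows "lring S \<and> t \<in> maxideal S \<and> pring (cc (i - 1)) \<subseteq> S \<and> ww (i - 1) \<in> maxideal S"
  using i
proof (cases rule: le6E)
  case 1
  then obtain x where x: "S = Oring (s, t, u - 1, v) x" "crd x 1 = 0" "crd x 3 = 0" using S W1' by auto
  show ?thesis using W_ring(1)[OF cs_a1 x(1,2) P_a1] W_ring(2)[OF cs_a1 x(1,2) P_a1, of 3] x 1 by simp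
next
  case 2
  then obtain x where x: "S = Oring (s, t, p, e2) x" "crd x 1 = 0" "crd x 3 = 0" using S W2' by auto
  show ?thesis using W_ring(1)[OF cs_a2 x(1,2) P_a2] W_ring(2)[OF cs_a2 x(1,2) P_a2, of 3] x 2 by simp
next
  case 3
  then obtain x where x: "S = Oring (s, t, e3, r) x" "crd x 1 = 0" "crd x 3 = 0" using S W3' by auto
  show ?thesis using W_ring(1)[OF cs_a3 x(1,2) P_a3] W_ring(2)[OF cs_a3 x(1,2) P_a3, of 3] x 3 by simp
next
  case 4
  then obtain x where x: "S = Oring (s3, t, r3, e4) x" "crd x 1 = 0" "crd x 3 = 0" using S W4' by auto
  show ?thesis using W_ring(1)[OF cs_a4 x(1,2) P_a4] W_ring(2)[OF cs_a4 x(1,2) P_a4, of 3] x 4 by simp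
next
  case 5
  then obtain x where x: "S = Oring (s3, t, e5, m) x" "crd x 1 = 0" "crd x 2 = 0" using S W5' by auto
  show ?thesis using W_ring(1)[OF cs_a5 x(1,2) P_a5] W_ring(2)[OF cs_a5 x(1,2) P_a5, of 2] x 5 by simp
next
  case 6
  then obtain x where x: "S = Oring (s3, t, n, e6) x" "crd x 1 = 0" "crd x 3 = 0" using S W6' by auto
  show ?thesis using W_ring(1)[OF cs_a6 x(1,2) P_a6] W_ring(2)[OF cs_a6 x(1,2) P_a6, of 3] x 6 by simp
qed

lemma W_pring:
  assumes "j < i" "i \<le> 6" "S \<in> WW i"
  shows "pring (cc j) \<subseteq> S"
proof -
  have "pring (cc j) \<subseteq> pring (cc (i - 1))" by (rule chain(2)) (use assms in auto)
  moreover have "pring (cc (i - 1)) \<subseteq> S" using W_facts[of i S] assms by auto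
  ultimately show ?thesis by blast
qed

lemma t_mult: "lring S \<Longrightarrow> t \<in> maxideal S \<Longrightarrow> a \<in> S \<Longrightarrow> t * a \<in> maxideal S"
  using prmD(5)[OF lring_prm] by blast

lemma ww_eq: "t * v1 = v" "e2 = t * r" "r = t * r3" "e4 = t * m" "e5 = t * n"
  using t0 by (simp_all add: v1_def r_def r3_def m_def n_def)

lemma ww_maxideal:
  assumes "j < i" "i \<le> 6" "S \<in> WW i"
  shows "ww j \<in> maxideal S"
proof (cases "i = Suc j")
  case True
  then show ?thesis using W_facts[of i S] assms by auto
next
  case False
  have l: "lring S" "t \<in> maxideal S" using W_facts[of i S] assms by auto
  have sub: "pring (cc (Suc j)) \<subseteq> S" by (rule W_pring) (use assms False in auto)
  then have c: "crd (cc (Suc j)) 2 \<in> S" "crd (cc (Suc j)) 3 \<in> S"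
    using pring_mem(2)[of 2 "cc (Suc j)"] pring_mem(2)[of 3 "cc (Suc j)"] by auto
  have j: "j < 5" using assms False by auto
  then consider "j = 0" | "j = 1" | "j = 2" | "j = 3" | "j = 4" by linarith
  then show ?thesis
  proof cases
    case 1 then show ?thesis using t_mult[OF l c(2)] ww_eq by simp
  next
    case 2 then show ?thesis using t_mult[OF l c(2)] ww_eq by (simp add: numeral_2_eq_2[symmetric])
  next
    case 3 then show ?thesis using t_mult[OF l c(2)] ww_eq by simp
  next
    case 4 then show ?thesis using t_mult[OF l c(2)] ww_eq by simp
  next
    case 5 then show ?thesis using t_mult[OF l c(1)] ww_eq by simp
  qed
qed

text \<open>In the original coordinates \<open>t\<close>, \<open>s * t\<close> and
  \<open>s * v\<close> are the inverses of \<open>x0\<close>, \<open>x1\<close> and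
  \<open>x3\<close>, so these three coordinates are regular nowhere on the centers 12 to 17.\<close>

lemma W_tsv:
  assumes "1 \<le> i" "i \<le> 6" "S \<in> WW i"
  shows "t \<in> maxideal S" "s * t \<in> maxideal S" "s * v \<in> maxideal S"
proof -
  have l: "lring S" "t \<in> maxideal S" using W_facts[OF assms] by auto
  have "pring (cc 0) \<subseteq> S" by (rule W_pring[OF _ assms(2,3)]) (use assms in auto)
  then have s: "s \<in> S" using pring_tuple(1)[of s t u v] by auto
  have v: "v \<in> maxideal S" using ww_maxideal[of 0 i S] assms by simp
  show "t \<in> maxideal S" "s * t \<in> maxideal S" "s * v \<in> maxideal S"
    using prmD(4)[OF lring_prm[OF l(1)] s] l(2) v by blast+
qed

lemma ww_units:
  assumes "1 \<le> j" "j \<le> 5"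
  shows "ww j \<in> units_in (VV j)"
proof -
  have 1: "e2 \<in> units_in (VV 1)"
    using Oring_units_pdv(2)[OF cs_c1, of 1 "(0, 0, 0, 0)" e2] cs_c1 by (simp add: VV_def e2_def place)
  have 2: "r \<in> units_in (VV 2)"
    using Oring_units_pdv(2)[OF cs_c2, of 1 "(0, 0, 0, 1)" r] cs_c2 by (simp add: VV_def place)
  have 3: "e4 \<in> units_in (VV 3)" unfolding e4_eq
    using Oring_units_pdv(2)[OF cs_c3, of 1 "(0, 0, 1, 0)"] cs_c3 by (simp add: VV_def place)
  have 4: "e5 \<in> units_in (VV 4)" unfolding e5_eq
    using Oring_units_pdv(2)[OF cs_c4, of 1 "(0, 0, 1, 0)"] cs_c4 by (simp add: VV_def place)
  have 5: "e6 \<in> units_in (VV 5)" unfolding e6_eq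
    using Oring_units_pdv(2)[OF cs_c5, of 1 "(0, 0, 0, 1)"] cs_c5 by (simp add: VV_def place)
  have "j \<le> 6" using assms by simp
  from assms(1) this show ?thesis by (cases rule: le6E) (use 1 2 3 4 5 assms in auto)
qed

lemma VV_stays:
  assumes "1 \<le> j" "j \<le> i" "i \<le> 6"
  shows "VV j \<in> XX i"
  using assms(2,3)
proof (induction i rule: dec_induct)
  case base
  then show ?case using step_facts(4)[of j] assms by auto
next
  case (step i)
  have "1 / t \<notin> S" if "S \<in> WW (Suc i)" for S
    by (rule maxideal_inverse[OF W_tsv(1)[OF _ _ that] t0]) (use step in auto)
  then have "VV j \<in> blowup (XX i) (zariski_closure (XX i) (XX i \<inter> WW (Suc i)))"
    using step(1-3) assms step_facts(6)[of j] t0 by (intro dvr_stays[OF model_XX, where c = "1 / t"]) auto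
  then show ?case using XX[of i] step by simp
qed

lemma VV_ord:
  assumes "1 \<le> i" "i \<le> 6" "1 \<le> j" "j \<le> 6"
  shows "blowup_ord (XX (i - 1)) (WW i) (VV j) = (if i \<le> j then 1 else 0)"
proof (cases "i \<le> j")
  case True
  interpret dvr "VV j" t by (rule step_facts(6)[OF assms(3,4)])
  have "blowup_ord (XX (i - 1)) (WW i) (VV j) = ord_at (VV j) t"
    by (rule step_facts(7)[OF assms(1,2) dvr_axioms B_VV[OF True assms(3,4)]])
  then show ?thesis using True ord_pi by simp
next
  case False
  have u: "ww j \<in> units_in (VV j)" by (rule ww_units) (use assms False in auto)
  have "blowup_ord (XX (i - 1)) (WW i) (VV j) = 0"
  proof (rule blowup_ord_kill[OF step_facts(6)[OF assms(3,4)] model_XX _ dominates_refl, of _ "1 / ww j"])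
    show "i - 1 \<le> 6" using assms by simp
    show "VV j \<in> XX (i - 1)" by (rule VV_stays) (use assms False in auto)
    show "1 / ww j \<in> VV j" using u by (simp add: units_in_def divide_inverse)
    show "1 / ww j \<notin> S" if "S \<in> WW i" for S
      by (rule maxideal_inverse[OF ww_maxideal[OF _ _ that]]) (use assms False u in \<open>auto simp: units_in_def\<close>)
  qed
  then show ?thesis using False by simp
qed

text \<open>The first two centers are not contained in \<open>s = 0\<close>; the third is a point of
  it, after which \<open>s = t * s3\<close>. This is why row 11 of \<open>Emat\<close> is nonzero
  only from column 14 on, apart from the diagonal.\<close>

lemma ord_s:
  assumes "1 \<le> j" "j \<le> 6"
  shows "ord_at (VV j) s = (if j \<le> 2 then 0 else 1)"
proof -
  have 1: "ord_at (VV 1) s = 0" using ord_pdv(1)[OF cs_c1, of 1 "(1, 0, 0, 0)" s 0 s] cs_c1 by (simp add: VV_def)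
  have 2: "ord_at (VV 2) s = 0" using ord_pdv(1)[OF cs_c2, of 1 "(1, 0, 0, 0)" s 0 s] cs_c2 by (simp add: VV_def)
  have e: "t * s3 = s" using t0 by (simp add: s3_def)
  have *: "ord_at (pdv (s3, t, a, b) (X 1)) s = 1" if "coordsys (s3, t, a, b)" for a b
    using ord_pdv(1)[OF that, of 1 "(1, 0, 0, 0)" s 1 s3] that e by simp
  from assms show ?thesis
    by (cases rule: le6E) (use 1 2 *[OF cs_c3] *[OF cs_c4] *[OF cs_c5] *[OF cs_c6] in \<open>simp_all add: VV_def\<close>)
qed

end

section \<open>The product of two projective planes\<close>

lemma coordsys_pair:
  assumes "coordsys (s, t, u, v)" "(c, d) \<in> {(u, v), (u / v, 1 / v), (1 / u, v / u)}"
  shows "coordsys (s, t, c, d)"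
  using assms coordsys_inv[OF assms(1)] coordsys_swap_last[OF coordsys_inv[OF coordsys_swap_last[OF assms(1)]]] by auto

lemma coordsys_pairs:
  assumes "(a, b) \<in> {(x0, x1), (x0 / x1, 1 / x1), (1 / x0, x1 / x0)}" "(c, d) \<in> {(x2, x3), (x2 / x3, 1 / x3), (1 / x2, x3 / x2)}"
  shows "coordsys (a, b, c, d)"
  using coordsys_pair[OF coordsys_swap[OF coordsys_pair[OF coordsys_swap[OF coordsys_std] assms(1)]] assms(2)] .

lemma x_neq_0: "x0 \<noteq> 0" "x1 \<noteq> 0" "x2 \<noteq> 0" "x3 \<noteq> 0"
  using crd_neq_0[OF coordsys_std, of 0] crd_neq_0[OF coordsys_std, of 1]
    crd_neq_0[OF coordsys_std, of 2] crd_neq_0[OF coordsys_std, of 3] by simp_all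

lemma affine_P2xP2:
  assumes "(a, b) \<in> {(x0, x1), (x0 / x1, 1 / x1), (1 / x0, x1 / x0)}" "(c, d) \<in> {(x2, x3), (x2 / x3, 1 / x3), (1 / x2, x3 / x2)}"
  shows "affine (pring (a, b, c, d)) \<subseteq> P2xP2"
proof -
  have "{a, b} \<in> P2_charts x0 x1" "{c, d} \<in> P2_charts x2 x3" using assms by (auto simp: P2_charts_def)
  then have "affine (polyring ({a, b} \<union> {c, d})) \<subseteq> P2xP2" unfolding P2xP2_def by (intro subsetI UN_I)
  moreover have "{a, b} \<union> {c, d} = {a, b, c, d}" by auto
  ultimately show ?thesis unfolding pring_def polyring_eq[symmetric] by (simp only:)
qed

text \<open>The homogeneous coordinate \<open>w\<close> of the plane does not vanish at the point
  with ring \<open>T\<close>. This matches the side condition in \<open>line_ideal\<close> and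
  replaces the three charts by one condition.\<close>

definition proj_regular :: "ratfun \<Rightarrow> ratfun \<Rightarrow> ratfun \<Rightarrow> ratfun set \<Rightarrow> bool" where
  "proj_regular x y w T \<longleftrightarrow> w \<in> {x, y, 1} \<and> {x / w, y / w, 1 / w} \<subseteq> T"

lemma proj_regular_chart:
  assumes "G \<in> P2_charts x y" "x \<noteq> 0" "y \<noteq> 0"
  shows "\<exists>w. \<forall>T. sring T \<longrightarrow> (G \<subseteq> T \<longleftrightarrow> proj_regular x y w T)"
proof -
  consider "G = {x, y}" | "G = {x / y, 1 / y}" | "G = {1 / x, y / x}" using assms by (auto simp: P2_charts_def)
  then show ?thesis
  proof cases
    case 1 then show ?thesis by (intro exI[of _ 1]) (auto simp: proj_regular_def sringD)
  next
    case 2 then show ?thesis using assms by (intro exI[of _ y]) (auto simp: proj_regular_def sringD)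
  next
    case 3 then show ?thesis using assms by (intro exI[of _ x]) (auto simp: proj_regular_def sringD)
  qed
qed

text \<open>The quotient \<open>w' / w\<close> is regular at \<open>R\<close> and invertible in
  \<open>V\<close>, hence a unit of \<open>R\<close>; a homogeneous coordinate that does not vanish
  at \<open>V\<close> does not vanish at the point below either.\<close>

lemma proj_regular_transfer:
  assumes "lring R" "dominates V R" "proj_regular x y w R" "proj_regular x y w' V" "x \<noteq> 0" "y \<noteq> 0"
  shows "proj_regular x y w' R"
proof -
  have w: "w \<noteq> 0" "w' \<noteq> 0" using assms by (auto simp: proj_regular_def)
  have "w' / w \<in> R" using assms(3,4) by (auto simp: proj_regular_def)
  moreover have "w / w' \<in> V" using assms(3,4) by (auto simp: proj_regular_def)
  then have "inverse (w' / w) \<in> V" by simp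
  ultimately have i: "inverse (w' / w) \<in> R" using w by (intro dominates_unit[OF assms(1,2)]) auto
  have "a / w' \<in> R" if "a / w \<in> R" for a
  proof -
    have "a / w * inverse (w' / w) \<in> R" by (rule sringD(4)[OF lring_sring[OF assms(1)] that i])
    then show ?thesis using w by simp
  qed
  then show ?thesis using assms(3,4) by (auto simp: proj_regular_def)
qed

lemma P2xP2_cases:
  assumes "R \<in> P2xP2"
  obtains G H w w' where "R \<in> affine (polyring (G \<union> H))" "lring R" "range cst \<subseteq> R"
    "proj_regular x0 x1 w R" "proj_regular x2 x3 w' R"
    "\<forall>T. sring T \<and> range cst \<subseteq> T \<and> proj_regular x0 x1 w T \<and> proj_regular x2 x3 w' T \<longrightarrow> polyring (G \<union> H) \<subseteq> T"
proof -
  obtain G H where GH: "G \<in> P2_charts x0 x1" "H \<in> P2_charts x2 x3" "R \<in> affine (polyring (G \<union> H))"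
    using assms by (auto simp: P2xP2_def)
  obtain w where w: "\<And>T. sring T \<Longrightarrow> (G \<subseteq> T \<longleftrightarrow> proj_regular x0 x1 w T)" using proj_regular_chart[OF GH(1)] x_neq_0 by blast
  obtain w' where w': "\<And>T. sring T \<Longrightarrow> (H \<subseteq> T \<longleftrightarrow> proj_regular x2 x3 w' T)" using proj_regular_chart[OF GH(2)] x_neq_0 by blast
  have R: "lring R" "polyring (G \<union> H) \<subseteq> R" using affine_lring[OF sring_polyring GH(3)] by auto
  have c: "range cst \<subseteq> R" using R polyring_cst by blast
  have g: "G \<subseteq> R" "H \<subseteq> R" using R polyring_gen by blast+
  show thesis
  proof (rule that[OF GH(3) R(1) c])
    show "proj_regular x0 x1 w R" "proj_regular x2 x3 w' R"
      using w[OF lring_sring[OF R(1)]] w'[OF lring_sring[OF R(1)]] g by auto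
    have "polyring (G \<union> H) \<subseteq> T" if "sring T" "range cst \<subseteq> T" "proj_regular x0 x1 w T" "proj_regular x2 x3 w' T" for T
      using w[OF that(1)] w'[OF that(1)] that(3,4) by (intro polyring_min[OF that(1,2)]) auto
    then show "\<forall>T. sring T \<and> range cst \<subseteq> T \<and> proj_regular x0 x1 w T \<and> proj_regular x2 x3 w' T \<longrightarrow> polyring (G \<union> H) \<subseteq> T"
      by blast
  qed
qed

text \<open>The homogeneous coordinates nonzero at \<open>R'\<close> are nonzero at
  \<open>V\<close>, and by domination at \<open>R\<close>. So \<open>R\<close> contains the chart
  ring of \<open>R'\<close>, and exchanging the roles gives equality.\<close>

lemma model_P2xP2: "model P2xP2"
  unfolding model_def
proof (intro conjI ballI allI impI)
  fix R assume "R \<in> P2xP2"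
  then show "lring R" "range cst \<subseteq> R" by (auto elim: P2xP2_cases)
next
  have half: "R' \<subseteq> R" if V: "lring V" and R: "R \<in> P2xP2" "R' \<in> P2xP2" "dominates V R" "dominates V R'" for V R R'
  proof -
    obtain G H w w' where 1: "R \<in> affine (polyring (G \<union> H))" "lring R" "range cst \<subseteq> R"
      "proj_regular x0 x1 w R" "proj_regular x2 x3 w' R"
      "\<forall>T. sring T \<and> range cst \<subseteq> T \<and> proj_regular x0 x1 w T \<and> proj_regular x2 x3 w' T \<longrightarrow> polyring (G \<union> H) \<subseteq> T"
      by (rule P2xP2_cases[OF R(1)])
    obtain G' H' v v' where 2: "R' \<in> affine (polyring (G' \<union> H'))" "lring R'" "range cst \<subseteq> R'"
      "proj_regular x0 x1 v R'" "proj_regular x2 x3 v' R'"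
      "\<forall>T. sring T \<and> range cst \<subseteq> T \<and> proj_regular x0 x1 v T \<and> proj_regular x2 x3 v' T \<longrightarrow> polyring (G' \<union> H') \<subseteq> T"
      by (rule P2xP2_cases[OF R(2)])
    have RV: "R' \<subseteq> V" using dominatesD(1)[OF R(4)] .
    have "proj_regular x0 x1 v V" "proj_regular x2 x3 v' V" using 2(4,5) RV by (auto simp: proj_regular_def)
    then have "proj_regular x0 x1 v R" "proj_regular x2 x3 v' R"
      using proj_regular_transfer[OF 1(2) R(3)] 1(4,5) x_neq_0 by blast+
    then have sub: "polyring (G' \<union> H') \<subseteq> R" using 2(6) lring_sring[OF 1(2)] 1(3) by blast
    obtain p where p: "prm (polyring (G \<union> H)) p" "R = localization (polyring (G \<union> H)) p" by (rule affineE[OF 1(1) sring_polyring])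
    obtain q where q: "prm (polyring (G' \<union> H')) q" "R' = localization (polyring (G' \<union> H')) q" by (rule affineE[OF 2(1) sring_polyring])
    show ?thesis using localization_subset_of_dominates[OF V sring_polyring p(1) sring_polyring q(1)] R(3,4) sub p(2) q(2) by simp
  qed
  show "R = R'" if "lring V" "R \<in> P2xP2" "R' \<in> P2xP2" "dominates V R" "dominates V R'" for V R R'
    using half that by blast
qed

lemma dvr_subset_eq:
  assumes "dvr V \<pi>" "dvr V' \<pi>'" "V \<subseteq> V'"
  shows "V = V'"
proof -
  interpret dvr V \<pi> by (rule assms)
  interpret V': dvr V' \<pi>' by (rule assms)
  show ?thesis using overring[OF V'.sr assms(3)] V'.pi(3) by blast
qed

text \<open>No denominator occurring in \<open>V\<close> is divisible by \<open>X i\<close>, so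
  \<open>V\<close> is contained in the valuation ring of the hyperplane, and inclusion of valuation
  rings is equality. Along one hyperplane no other coordinate vanishes.\<close>

lemma dvr_affine_coord:
  assumes y: "coordsys y" and V: "dvr V \<pi>" "V \<in> P2xP2" "pring y \<subseteq> V" and a: "affine (pring y) \<subseteq> P2xP2"
    and i: "i < 4" "crd y i \<in> maxideal V"
  shows "V = pdv y (X i)" "j < 4 \<Longrightarrow> j \<noteq> i \<Longrightarrow> crd y j \<notin> maxideal V"
proof -
  interpret dvr V \<pi> by (rule V)
  let ?p = "pring y \<inter> maxideal V"
  have p: "prm (pring y) ?p" by (rule prm_contract[OF lring sring_pring V(3)])
  have "localization (pring y) ?p \<in> P2xP2" using a affineI[OF sring_pring p] by blast
  then have eq: "V = localization (pring y) ?p"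
    using modelD(3)[OF model_P2xP2 lring V(2) _ dominates_refl dominates_localization[OF lring sring_pring V(3)]] by blast
  note pe = prime_elem_X[OF i(1)]
  have "V \<subseteq> pdv y (X i)"
  proof
    fix k assume "k \<in> V"
    then have "k \<in> localization (pring y) ?p" using eq by simp
    then obtain a b where k: "k = a / b" "a \<in> pring y" "b \<in> pring y" "b \<notin> ?p" by (rule localizationE)
    obtain F G where FG: "a = ev y F" "b = ev y G" using k(2,3) by (auto simp: pring_def)
    have "\<not> X i dvd G"
    proof
      assume "X i dvd G"
      then obtain G' where "G = X i * G'" by (rule dvdE)
      then have "b = crd y i * ev y G'" using FG i by simp
      moreover have "ev y G' \<in> V" using V(3) pring_mem(3) by blast
      ultimately have "b \<in> maxideal V" using prmD(5)[OF lring_prm[OF lring] i(2)] by simp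
      then show False using k by blast
    qed
    then show "k \<in> pdv y (X i)" unfolding k(1) FG by (rule pdvI)
  qed
  then show Veq: "V = pdv y (X i)" by (rule dvr_subset_eq[OF V(1) dvr_pdv[OF y pe]])
  show "crd y j \<notin> maxideal V" if "j < 4" "j \<noteq> i"
  proof -
    have "\<not> X i dvd X j" using that i by (simp add: X_dvd_iff X_neq_0)
    then show ?thesis using maxideal_pdv[OF y pe, of "X j"] that unfolding Veq by simp
  qed
qed

section \<open>Prime divisors of the product of planes\<close>

definition Vinf_a :: local_ring where "Vinf_a = pdv (x0 / x1, 1 / x1, x2, x3) (X 1)"
definition Vinf_b :: local_ring where "Vinf_b = pdv (x0, x1, x2 / x3, 1 / x3) (X 3)"

text \<open>In a valuation ring one of three projective coordinates has minimal order.\<close>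

lemma dvr_chart_cases:
  assumes V: "dvr V \<pi>" and x: "x \<noteq> 0" "y \<noteq> 0"
  obtains "x \<in> V" "y \<in> V" | "x / y \<in> V" "1 / y \<in> maxideal V" | "1 / x \<in> maxideal V" "y / x \<in> maxideal V"
proof -
  interpret dvr V \<pi> by (rule V)
  have o: "ord_at V (x / y) = ord_at V x - ord_at V y" "ord_at V (1 / y) = - ord_at V y"
    "ord_at V (y / x) = ord_at V y - ord_at V x" "ord_at V (1 / x) = - ord_at V x"
    using x by (simp_all add: ord_divide ord_1)
  note ord_nonneg_iff[of x] ord_nonneg_iff[of y] ord_nonneg_iff[of "x / y"] ord_pos_iff[of "1 / y"] ord_pos_iff[of "1 / x"] ord_pos_iff[of "y / x"]
  then have *: "ord_at V x \<ge> 0 \<longleftrightarrow> x \<in> V" "ord_at V y \<ge> 0 \<longleftrightarrow> y \<in> V" "ord_at V (x / y) \<ge> 0 \<longleftrightarrow> x / y \<in> V"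
    "ord_at V (1 / y) > 0 \<longleftrightarrow> 1 / y \<in> maxideal V" "ord_at V (1 / x) > 0 \<longleftrightarrow> 1 / x \<in> maxideal V" "ord_at V (y / x) > 0 \<longleftrightarrow> y / x \<in> maxideal V"
    using x by simp_all
  consider "ord_at V x \<ge> 0" "ord_at V y \<ge> 0" | "ord_at V x \<ge> ord_at V y" "ord_at V y < 0" | "ord_at V x < ord_at V y" "ord_at V x < 0"
    by linarith
  then show thesis
  proof cases
    case 1 then show ?thesis using that(1) * by blast
  next
    case 2 then show ?thesis using that(2) * o by auto
  next
    case 3 then show ?thesis using that(3) * o by auto
  qed
qed

lemma maxideal_subset: "maxideal V \<subseteq> V"
  by (auto simp: maxideal_iff)

text \<open>Only one coordinate of a chart can vanish along a divisor. This excludes being at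
  infinity in both factors, and it excludes the third chart altogether, where the strict
  inequalities behind \<open>dvr_chart_cases\<close> would make two coordinates vanish.\<close>

lemma P2xP2_dvr_cases:
  assumes V: "dvr V \<pi>" "V \<in> P2xP2"
  obtains "{x0, x1, x2, x3} \<subseteq> V" | "V = Vinf_a" | "V = Vinf_b"
proof -
  have sr: "sring V" and cV: "range cst \<subseteq> V" using V modelD(2)[OF model_P2xP2 V(2)] by (auto simp: dvr_def)
  have key: "V = pdv (a, b, c, d) (X i) \<and> (j < 4 \<longrightarrow> j \<noteq> i \<longrightarrow> crd (a, b, c, d) j \<notin> maxideal V)"
    if "(a, b) \<in> {(x0, x1), (x0 / x1, 1 / x1), (1 / x0, x1 / x0)}" "(c, d) \<in> {(x2, x3), (x2 / x3, 1 / x3), (1 / x2, x3 / x2)}"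
      "a \<in> V" "b \<in> V" "c \<in> V" "d \<in> V" "i < 4" "crd (a, b, c, d) i \<in> maxideal V" for a b c d i j
  proof -
    have "pring (a, b, c, d) \<subseteq> V" by (rule pring_min[OF sr cV]) (use that(3-6) in \<open>auto elim!: less4E\<close>)
    from dvr_affine_coord[OF coordsys_pairs[OF that(1,2)] V this affine_P2xP2[OF that(1,2)] that(7,8)] show ?thesis by blast
  qed
  note m = subsetD[OF maxideal_subset]
  show thesis
  proof (cases rule: dvr_chart_cases[OF V(1) x_neq_0(1,2)])
    case 1
    show ?thesis
    proof (cases rule: dvr_chart_cases[OF V(1) x_neq_0(3,4)])
      case 1 then show ?thesis using that(1) \<open>x0 \<in> V\<close> \<open>x1 \<in> V\<close> by auto
    next
      case 2 then show ?thesis using that(3) key[of x0 x1 "x2 / x3" "1 / x3" 3 0] 1 m by (simp add: Vinf_b_def)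
    next
      case 3 then show ?thesis using key[of x0 x1 "1 / x2" "x3 / x2" 2 3] 1 m by auto
    qed
  next
    case 2
    show ?thesis
    proof (cases rule: dvr_chart_cases[OF V(1) x_neq_0(3,4)])
      case 1 then show ?thesis using that(2) key[of "x0 / x1" "1 / x1" x2 x3 1 0] 2 m by (simp add: Vinf_a_def)
    next
      case 2 then show ?thesis using key[of "x0 / x1" "1 / x1" "x2 / x3" "1 / x3" 1 3] \<open>x0 / x1 \<in> V\<close> \<open>1 / x1 \<in> maxideal V\<close> m by auto
    next
      case 3 then show ?thesis using key[of "x0 / x1" "1 / x1" "1 / x2" "x3 / x2" 1 3] 2 m by auto
    qed
  next
    case 3
    show ?thesis
    proof (cases rule: dvr_chart_cases[OF V(1) x_neq_0(3,4)])
      case 1 then show ?thesis using key[of "1 / x0" "x1 / x0" x2 x3 0 1] 3 m by auto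
    next
      case 2 then show ?thesis using key[of "1 / x0" "x1 / x0" "x2 / x3" "1 / x3" 0 1] 3 m by auto
    next
      case 3 then show ?thesis using key[of "1 / x0" "x1 / x0" "1 / x2" "x3 / x2" 0 1] \<open>1 / x0 \<in> maxideal V\<close> \<open>x1 / x0 \<in> maxideal V\<close> m by auto
    qed
  qed
qed

lemma pdv_P2xP2:
  assumes "(a, b) \<in> {(x0, x1), (x0 / x1, 1 / x1), (1 / x0, x1 / x0)}" "(c, d) \<in> {(x2, x3), (x2 / x3, 1 / x3), (1 / x2, x3 / x2)}"
    "prime_elem p"
  shows "pdv (a, b, c, d) p \<in> P2xP2"
  using pdv_affine(1)[OF coordsys_pairs[OF assms(1,2)] assms(3), of 1] affine_P2xP2[OF assms(1,2)] assms(3)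
  by (auto simp: Bring_1 prime_elem_def)

lemma Vinf_P2xP2: "Vinf_a \<in> P2xP2" "Vinf_b \<in> P2xP2"
  unfolding Vinf_a_def Vinf_b_def by (intro pdv_P2xP2; simp add: prime_elem_X)+

lemma dvr_Vinf: "dvr Vinf_a (1 / x1)" "dvr Vinf_b (1 / x3)"
  using dvr_pdv[OF coordsys_pairs prime_elem_X[of 1], of "x0 / x1" "1 / x1" x2 x3]
    dvr_pdv[OF coordsys_pairs prime_elem_X[of 3], of x0 x1 "x2 / x3" "1 / x3"]
  by (simp_all add: Vinf_a_def Vinf_b_def)

lemma unit_poly4:
  assumes "F dvd (1 :: poly4)"
  shows "\<exists>c. F = C4 c"
proof -
  obtain F1 where 1: "F = [:F1:]" "F1 dvd 1" using assms by (auto simp: is_unit_poly_iff)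
  obtain F2 where 2: "F1 = [:F2:]" "F2 dvd 1" using 1(2) by (auto simp: is_unit_poly_iff)
  obtain F3 where 3: "F2 = [:F3:]" "F3 dvd 1" using 2(2) by (auto simp: is_unit_poly_iff)
  obtain c where 4: "F3 = [:c:]" using 3(2) by (auto simp: is_unit_poly_iff)
  show ?thesis using 1 2 3 4 by (auto simp: C4_def)
qed

text \<open>Written in lowest terms over the factorial polynomial ring, a prime factor of the
  numerator or denominator would give a nonzero order; so both are units, that is,
  constants.\<close>

lemma constant_of_ord_zero:
  assumes g: "g \<noteq> 0" and o: "\<And>p. prime_elem p \<Longrightarrow> ord_at (pdv (x0, x1, x2, x3) p) g = 0"
  shows "\<exists>c. c \<noteq> 0 \<and> g = cst c"
proof -
  let ?y = "(x0, x1, x2, x3)"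
  obtain F G where FG: "ev ?y G \<noteq> 0" "g = ev ?y F / ev ?y G" using coordsys_std unfolding coordsys_def by blast
  have nz: "F \<noteq> 0" "G \<noteq> 0" using g FG by auto
  define d where "d = gcd F G"
  have d0: "d \<noteq> 0" using nz by (simp add: d_def)
  obtain F' G' where FG': "F = d * F'" "G = d * G'" by (metis d_def gcd_dvd1 gcd_dvd2 dvdE)
  have cop: "coprime F' G'"
  proof -
    have "gcd F' G' = 1"
    proof -
      have "F' = F div d" "G' = G div d" using FG' d0 by simp_all
      then show ?thesis using div_gcd_coprime[of F G] nz by (simp add: d_def)
    qed
    then show ?thesis by (rule gcd_eq_1_imp_coprime)
  qed
  have g': "g = ev ?y F' / ev ?y G'" using FG FG' d0 coordsys_ev_0[OF coordsys_std] by simp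
  have nz': "ev ?y F' \<noteq> 0" "ev ?y G' \<noteq> 0" using nz FG' coordsys_ev_0[OF coordsys_std] by auto
  have no_prime: "\<not> p dvd F' \<and> \<not> p dvd G'" if p: "prime_elem p" for p
  proof -
    interpret dvr "pdv ?y p" "ev ?y p" by (rule dvr_pdv[OF coordsys_std p])
    have nu: "\<not> is_unit p" using p by (simp add: prime_elem_def)
    have pos: "ord_at (pdv ?y p) (ev ?y H) > 0 \<longleftrightarrow> p dvd H" "ord_at (pdv ?y p) (ev ?y H) \<ge> 0" if "ev ?y H \<noteq> 0" for H
      using ord_pos_iff[OF that] maxideal_pdv[OF coordsys_std p] ord_nonneg_iff[OF that] ev_pdv[OF p] by auto
    have "ord_at (pdv ?y p) (ev ?y F') = ord_at (pdv ?y p) (ev ?y G')"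
      using o[OF p] nz' unfolding g' by (simp add: ord_divide)
    then have "p dvd F' \<longleftrightarrow> p dvd G'" using pos(1) nz' by metis
    moreover have "\<not> (p dvd F' \<and> p dvd G')" using cop nu coprime_common_divisor by blast
    ultimately show ?thesis by blast
  qed
  have unit: "H dvd 1" if "H \<noteq> 0" "\<And>p. prime_elem p \<Longrightarrow> \<not> p dvd H" for H :: poly4
    using prime_divisor_exists[of H] that by (metis prime_def)
  have "F' dvd 1" "G' dvd 1" using unit[of F'] unit[of G'] no_prime nz FG' by auto
  then obtain a b where "F' = C4 a" "G' = C4 b" using unit_poly4 by metis
  then have "g = cst (a / b)" using g' by (simp add: cst_divide)
  moreover have "a / b \<noteq> 0" using g calculation by auto
  ultimately show ?thesis by blast
qed

section \<open>Pull-backs of lines\<close>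

lemma line_neq_0:
  assumes "(c, d, e) \<noteq> (0, 0, 0)" "(x, y) \<in> {(x0, x1), (x2, x3)}"
  shows "cst c * x + cst d * y + cst e \<noteq> 0"
proof -
  have gen: "cst c * crd (x0, x1, x2, x3) i + cst d * crd (x0, x1, x2, x3) (Suc i) + cst e \<noteq> 0" if i: "i \<in> {0, 2}" for i
  proof
    assume "cst c * crd (x0, x1, x2, x3) i + cst d * crd (x0, x1, x2, x3) (Suc i) + cst e = 0"
    then have "ev (x0, x1, x2, x3) (C4 c * X i + C4 d * X (Suc i) + C4 e) = 0" using i by auto
    then have "C4 c * X i + C4 d * X (Suc i) + C4 e = 0" using coordsys_ev_0[OF coordsys_std] by blast
    then have v: "val b (C4 c * X i + C4 d * X (Suc i) + C4 e) = 0" for b by simp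
    have v: "c * crd b i + d * crd b (Suc i) + e = 0" for b using v[of b] i by auto
    from v[of "(0, 0, 0, 0)"] v[of "(1, 0, 1, 0)"] v[of "(0, 1, 0, 1)"] show False
      using i assms(1) by (auto simp: numeral_eq_Suc crd.simps)
  qed
  from gen[of 0] gen[of 2] assms(2) show ?thesis by (auto simp: numeral_3_eq_3[symmetric])
qed

text \<open>\<open>line_ideal\<close> runs over all admissible homogeneous coordinates
  \<open>w'\<close>. Passing from \<open>w\<close> to \<open>w'\<close> multiplies the local
  equation by the regular function \<open>w / w'\<close>, so the minimum is attained at any one
  admissible \<open>w\<close>.\<close>

lemma line_ord:
  assumes V: "dvr V \<pi>" and R: "R \<in> P2xP2" "dominates V R" and w: "proj_regular x y w R"
    and xy: "(x, y) \<in> {(x0, x1), (x2, x3)}" and l: "(c, d, e) \<noteq> (0, 0, 0)"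
  shows "Inf {ord_at V a | a. a \<in> line_ideal x y (c, d, e) (point_below P2xP2 V) \<and> a \<noteq> 0} =
    ord_at V (cst c * x + cst d * y + cst e) - ord_at V w"
proof -
  interpret dvr V \<pi> by (rule V)
  let ?L = "cst c * x + cst d * y + cst e"
  have L: "?L \<noteq> 0" by (rule line_neq_0[OF l xy])
  have xy0: "x \<noteq> 0" "y \<noteq> 0" using xy x_neq_0 by auto
  have w0: "w \<noteq> 0" using w xy0 by (auto simp: proj_regular_def)
  have pb: "point_below P2xP2 V = R" by (rule point_below_eq[OF model_P2xP2 lring R])
  have sR: "sring R" "R \<subseteq> V" using modelD(1)[OF model_P2xP2 R(1)] lring_sring dominatesD(1)[OF R(2)] by auto
  show ?thesis unfolding pb
  proof (rule cInf_eq_minimum)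
    have "1 * (?L / w) \<in> line_ideal x y (c, d, e) R"
      unfolding line_ideal.simps mem_Collect_eq
      by (intro exI[of _ 1] exI[of _ w] conjI refl) (use w sringD(1)[OF sR(1)] in \<open>auto simp: proj_regular_def\<close>)
    moreover have "ord_at V (1 * (?L / w)) = ord_at V ?L - ord_at V w" using L w0 by (simp add: ord_divide)
    moreover have "1 * (?L / w) \<noteq> 0" using L w0 by simp
    ultimately show "ord_at V ?L - ord_at V w \<in> {ord_at V a | a. a \<in> line_ideal x y (c, d, e) R \<and> a \<noteq> 0}" by force
  next
    fix n assume "n \<in> {ord_at V a | a. a \<in> line_ideal x y (c, d, e) R \<and> a \<noteq> 0}"
    then obtain a where a: "n = ord_at V a" "a \<in> line_ideal x y (c, d, e) R" "a \<noteq> 0" by blast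
    obtain r w' where r: "a = r * (?L / w')" "r \<in> R" "w' \<in> {x, y, 1}" "{x / w', y / w', 1 / w'} \<subseteq> R"
      using a(2) by auto
    have "w / w' \<in> R" using w r by (auto simp: proj_regular_def)
    then have m: "r * (w / w') \<in> V" using r(2) sR sringD(4)[OF sR(1)] by blast
    have w'0: "w' \<noteq> 0" using r xy0 by auto
    have r0: "r \<noteq> 0" using a r by auto
    have eq: "a = r * (w / w') * (?L / w)" using w0 by (simp add: r(1))
    have "ord_at V a = ord_at V (r * (w / w')) + (ord_at V ?L - ord_at V w)"
      unfolding eq using r0 w0 w'0 L by (subst ord_mult) (auto simp: ord_divide)
    moreover have "ord_at V (r * (w / w')) \<ge> 0" using m r0 w0 w'0 by (subst ord_nonneg_iff) auto
    ultimately show "ord_at V ?L - ord_at V w \<le> n" using a(1) by simp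
  qed
qed

section \<open>The seventeen blow-ups\<close>

lemma affine_stays_upto:
  assumes step: "\<And>n. m \<le> n \<Longrightarrow> n < k \<Longrightarrow> YY (Suc n) = blowup (YY n) (zariski_closure (YY n) (YY n \<inter> WW n))"
    and model: "\<And>n. model (YY n)" and B: "sring B" "affine B \<subseteq> YY m"
    and c: "\<And>n. m \<le> n \<Longrightarrow> n < k \<Longrightarrow> \<exists>c\<in>B. \<forall>S\<in>WW n. c \<notin> S" and l: "m \<le> l" "l \<le> k"
  shows "affine B \<subseteq> YY l"
  using l
proof (induction l rule: dec_induct)
  case base
  then show ?case using B by simp
next
  case (step n)
  then obtain c where "c \<in> B" "\<forall>S\<in>WW n. c \<notin> S" using c[of n] by auto
  then have "affine B \<subseteq> blowup (YY n) (zariski_closure (YY n) (YY n \<inter> WW n))"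
    using step by (intro affine_stays[OF model _ B(1)]) auto
  then show ?case using assms(1)[of n] step by simp
qed

definition WW :: "complex \<Rightarrow> nat \<Rightarrow> local_ring set" where
  "WW h i = (case center_data h ! (i - 1) of (c, Z) \<Rightarrow> point_at c ` Z)"

lemma center_WW: "center h i Y = zariski_closure Y (Y \<inter> WW h i)"
  by (simp add: center_def WW_def split: prod.splits)

lemma stage_Suc: "stage h (Suc n) = blowup (stage h n) (zariski_closure (stage h n) (stage h n \<inter> WW h (blowup_order ! n)))"
  by (simp add: center_WW)

declare stage.simps(2) [simp del]

lemma model_stage: "model (stage h n)"
  by (induction n) (auto simp: model_P2xP2 stage_Suc model_blowup)

lemma stage_below:
  assumes "S \<in> stage h n"
  shows "\<exists>R \<in> P2xP2. dominates S R"
  using assms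
proof (induction n arbitrary: S)
  case 0
  then show ?case using dominates_refl by auto
next
  case (Suc n)
  then obtain R where "R \<in> stage h n" "dominates S R" unfolding stage_Suc by (auto elim: blowupE)
  then show ?case using Suc.IH dominates_trans by blast
qed

lemma order: "i < 10 \<Longrightarrow> blowup_order ! Suc i = Suc i" "11 \<le> i \<Longrightarrow> i < 17 \<Longrightarrow> blowup_order ! i = Suc i" "blowup_order ! 0 = 11"
proof -
  have "\<forall>i<10. blowup_order ! Suc i = Suc i" by (simp add: blowup_order_def numeral_eq_Suc less_Suc_eq all_conj_distrib)
  then show "i < 10 \<Longrightarrow> blowup_order ! Suc i = Suc i" by simp
  have "\<forall>i<17. 11 \<le> i \<longrightarrow> blowup_order ! i = Suc i" by (simp add: blowup_order_def numeral_eq_Suc less_Suc_eq all_conj_distrib imp_conjR)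
  then show "11 \<le> i \<Longrightarrow> i < 17 \<Longrightarrow> blowup_order ! i = Suc i" by simp
qed (simp add: blowup_order_def)

section \<open>The two curves and their intersection point as instances of the chains\<close>

abbreviation "z0 \<equiv> x0 / x1"
abbreviation "z1 \<equiv> 1 / x1"
abbreviation "z2 \<equiv> x2 / x3"
abbreviation "z3 \<equiv> 1 / x3"

lemma cs_xz: "coordsys (x0, x1, z2, z3)" and cs_zx: "coordsys (z0, z1, x2, x3)" and cs_zz: "coordsys (z0, z1, z2, z3)"
  and cs_zx': "coordsys (x2, x3, z0, z1)"
  using coordsys_pairs[of x0 x1 z2 z3] coordsys_pairs[of z0 z1 x2 x3] coordsys_pairs[of z0 z1 z2 z3]
    coordsys_swap[OF coordsys_pairs[of z0 z1 x2 x3]] by auto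

lemma WW_11: "WW h 11 = {Oring (z0, z1, z2, z3) (0, 0, 0, 0)}"
  using point_at_Oring[OF cs_zz] by (simp add: WW_def center_data_def chart_zz_def)

lemma WW_11_facts:
  assumes "S \<in> WW h 11"
  shows "z0 \<in> maxideal S" "z1 \<in> maxideal S" "z2 \<in> maxideal S" "z3 \<in> maxideal S"
  using assms coord_blowup_W[OF cs_zz, of S "(0, 0, 0, 0)" 0] coord_blowup_W[OF cs_zz, of S "(0, 0, 0, 0)" 1]
    coord_blowup_W[OF cs_zz, of S "(0, 0, 0, 0)" 2] coord_blowup_W[OF cs_zz, of S "(0, 0, 0, 0)" 3]
  by (simp_all add: WW_11)

lemma z_kill: "1 / a \<in> maxideal S \<Longrightarrow> a \<noteq> 0 \<Longrightarrow> a \<notin> S"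
  using maxideal_inverse[of "1 / a" S] by simp

lemma pring_swap: "pring (s, t, u, v) = pring (u, v, s, t)"
  by (rule pring_eqI) (auto elim!: less4E simp: pring_tuple)

lemma Oring_swap:
  assumes y: "coordsys (s, t, u, v)"
  shows "Oring (s, t, u, v) (a, b, c, d) = Oring (u, v, s, t) (c, d, a, b)"
  by (rule Oring_eqI[OF y coordsys_swap[OF y]]) (auto elim!: less4E simp: y coordsys_swap[OF y])

lemma affine_xz_0: "affine (pring (x0, x1, z2, z3)) \<subseteq> P2xP2" and affine_zx_0: "affine (pring (x2, x3, z0, z1)) \<subseteq> P2xP2"
  and affine_zz_0: "affine (pring (z0, z1, z2, z3)) \<subseteq> P2xP2"
  using affine_P2xP2[of x0 x1 z2 z3] affine_P2xP2[of z0 z1 x2 x3] affine_P2xP2[of z0 z1 z2 z3] pring_swap[of z0 z1 x2 x3] by simp_all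

lemma affine_xz_1: "affine (pring (x0, x1, z2, z3)) \<subseteq> stage h (Suc 0)"
  unfolding stage_Suc order(3)
proof (rule affine_stays[OF model_stage _ sring_pring])
  show "affine (pring (x0, x1, z2, z3)) \<subseteq> stage h 0" using affine_xz_0 by simp
  show "x1 \<in> pring (x0, x1, z2, z3)" by (rule pring_tuple)
  show "x1 \<notin> S" if "S \<in> WW h 11" for S using WW_11_facts(2)[OF that] z_kill x_neq_0 by blast
qed

text \<open>Stages are shifted by one because the point 11 is blown up first; the chart
  \<open>(x0, x1, z2, z3)\<close> is untouched by that, since \<open>x1\<close> is regular on it but
  not at the point.\<close>

lemma curve1: "curve_blowups h x0 x1 z2 z3 (\<lambda>i. stage h (i + 1)) (WW h)"
proof
  show "coordsys (x0, x1, z2, z3)" by (rule cs_xz)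
  show "model (stage h (0 + 1))" by (rule model_stage)
  show "affine (pring (x0, x1, z2, z3)) \<subseteq> stage h (0 + 1)" using affine_xz_1 by simp
  show "stage h (Suc i + 1) = blowup (stage h (i + 1)) (zariski_closure (stage h (i + 1)) (stage h (i + 1) \<inter> WW h (Suc i)))" if "i < 5" for i
    using stage_Suc[of h "i + 1"] order(1)[of i] that by simp
qed (simp_all add: WW_def center_data_def chart_xz_def chart1_def chart2_def chart3_def chart4_def del: step1.simps step2.simps step3.simps step4.simps)

interpretation A: curve_blowups h x0 x1 z2 z3 "\<lambda>i. stage h (i + 1)" "WW h" for h
  by (rule curve1)

text \<open>\<open>z3\<close> vanishes on the centers 11 and 1 to 5, so its inverse
  \<open>x3\<close>, a coordinate of this chart, is regular at none of their points.\<close>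

lemma affine_zx: "l \<le> 6 \<Longrightarrow> affine (pring (x2, x3, z0, z1)) \<subseteq> stage h l"
proof (rule affine_stays_upto[where m = 0 and k = 6 and YY = "stage h" and WW = "\<lambda>n. WW h (blowup_order ! n)"])
  show "affine (pring (x2, x3, z0, z1)) \<subseteq> stage h 0" using affine_zx_0 by simp
  fix n :: nat assume n: "n < 6"
  have "z3 \<in> maxideal S" if "S \<in> WW h (blowup_order ! n)" for S
  proof (cases n)
    case 0
    then show ?thesis using that WW_11_facts(4) order(3) by simp
  next
    case (Suc i)
    then show ?thesis using that order(1)[of i] n A.W_zw(2)[of n S h] by simp
  qed
  then show "\<exists>c\<in>pring (x2, x3, z0, z1). \<forall>S\<in>WW h (blowup_order ! n). c \<notin> S"
    using z_kill x_neq_0 pring_tuple(2) by blast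
qed (auto simp: stage_Suc model_stage sring_pring)

text \<open>The same chain with the factors interchanged: six blow-ups precede it, whereas the
  centers are shifted by five only.\<close>

lemma curve2: "curve_blowups h x2 x3 z0 z1 (\<lambda>i. stage h (i + 6)) (\<lambda>i. WW h (i + 5))"
proof
  show "coordsys (x2, x3, z0, z1)" by (rule cs_zx')
  show "model (stage h (0 + 6))" by (rule model_stage)
  show "affine (pring (x2, x3, z0, z1)) \<subseteq> stage h (0 + 6)" using affine_zx by simp
  show "stage h (Suc i + 6) = blowup (stage h (i + 6)) (zariski_closure (stage h (i + 6)) (stage h (i + 6) \<inter> WW h (Suc i + 5)))" if "i < 5" for i
    using stage_Suc[of h "Suc (i + 5)"] order(1)[of "i + 5"] that by (simp add: add.commute)
  have "WW h 6 = Oring (z0, z1, x2, x3) ` {(0, 0, 1, P) | P. True}"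
    using point_at_Oring[OF cs_zx] by (simp add: WW_def center_data_def chart_zx_def)
  also have "\<dots> = Oring (x2, x3, z0, z1) ` {(1, P, 0, 0) | P. True}"
    using image_params_cong[of "\<lambda>_. True" "Oring (z0, z1, x2, x3)" "\<lambda>P Q. (0, 0, 1, P)" "Oring (x2, x3, z0, z1)" "\<lambda>P Q. (1, P, 0, 0)"]
      Oring_swap[OF cs_zx] by simp
  finally show "WW h (1 + 5) = point_at (x2, x3, z0, z1) ` {(1, P, 0, 0) | P. True}"
    using point_at_Oring[OF cs_zx'] by simp
qed (simp_all add: WW_def center_data_def chart_zx_def chart6_def chart7_def chart8_def chart9_def del: step1.simps step2.simps step3.simps step4.simps)

interpretation A': curve_blowups h x2 x3 z0 z1 "\<lambda>i. stage h (i + 6)" "\<lambda>i. WW h (i + 5)" for h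
  by (rule curve2)

abbreviation "u11 \<equiv> z2 / z0"
abbreviation "ch11 \<equiv> (z0, z1 / z0, u11, z3 / z0)"

lemma z_neq_0: "z0 \<noteq> 0" "z1 \<noteq> 0" "z2 \<noteq> 0" "z3 \<noteq> 0" "u11 \<noteq> 0"
  using x_neq_0 by auto

lemma step11: "blowup_step P2xP2 (z0, z1, z2, z3) 1 (WW h 11) {0, 1, 2, 3} 0 1"
proof
  show "affine (Bring (z0, z1, z2, z3) (ev (z0, z1, z2, z3) 1)) \<subseteq> P2xP2" using affine_zz_0 by (simp add: Bring_1)
  show "crd (z0, z1, z2, z3) i \<in> maxideal S" if "S \<in> WW h 11" "i \<in> {0, 1, 2, 3}" for S i
    using that WW_11_facts[OF that(1)] by auto
  show "Oring (z0, z1, z2, z3) b \<in> WW h 11" if "\<forall>i\<in>{0, 1, 2, 3}. crd b i = 0" "val b 1 \<noteq> 0" for b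
    using that(1) by (cases b) (simp add: WW_11)
  show "\<not> X 0 dvd 1" by (simp add: X_dvd_iff)
qed (auto simp: cs_zz model_P2xP2)

interpretation Z: blowup_step P2xP2 "(z0, z1, z2, z3)" 1 "WW h 11" "{0, 1, 2, 3}" 0 1 for h
  by (rule step11)

lemma ch11_eq: "dv 0 ({0, 1, 2, 3} - {0}) (z0, z1, z2, z3) = ch11"
  by (simp add: dv_def)

lemma cs_11: "coordsys ch11"
  using coordsys_dv[OF cs_zz, of 0 "{0, 1, 2, 3} - {0}"] unfolding ch11_eq by simp

definition V11 :: local_ring where "V11 = pdv ch11 (X 0)"

lemma stage_1: "stage h (Suc 0) = blowup P2xP2 (zariski_closure P2xP2 (P2xP2 \<inter> WW h 11))"
  unfolding stage_Suc order(3) by simp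

lemma V11: "V11 \<in> stage h (Suc 0)" "dvr V11 z0" "pring ch11 \<subseteq> V11"
  using Z.D(1)[of h] Z.D(2,3) unfolding ch11_eq stage_1 V11_def by (simp_all add: Bring_1)

lemma u11_pring: "u11 \<in> pring ch11" by (rule pring_tuple)

lemma W_u11: "1 \<le> i \<Longrightarrow> i \<le> 5 \<Longrightarrow> S \<in> WW h i \<Longrightarrow> u11 \<in> maxideal S"
  using A.W_zyx[of i S h] by (simp add: field_simps)

lemma W_u11': "6 \<le> i \<Longrightarrow> i \<le> 10 \<Longrightarrow> S \<in> WW h i \<Longrightarrow> 1 / u11 \<in> maxideal S"
  using A'.W_zyx[of "i - 5" S h] by (simp add: field_simps)

text \<open>\<open>u11\<close> vanishes on the centers 1 to 5 and has a pole on 6 to 10. Where it is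
  invertible the chart avoids both groups: its inverse serves as test function for the first and
  \<open>u11\<close> itself for the second.\<close>

lemma affine_11:
  assumes "1 \<le> l" "l \<le> 11"
  shows "affine (Bring ch11 u11) \<subseteq> stage h l"
proof (rule affine_stays_upto[where m = 1 and k = 11 and YY = "stage h" and WW = "\<lambda>n. WW h (blowup_order ! n)"])
  have "affine (Bring ch11 1) \<subseteq> stage h 1" using Z.chart[of h] unfolding ch11_eq using stage_1[of h] by simp
  then show "affine (Bring ch11 u11) \<subseteq> stage h 1"
    using affine_Bring_pring[OF u11_pring z_neq_0(5)] by (simp add: Bring_1)
  fix n :: nat assume n: "1 \<le> n" "n < 11"
  then obtain i where i: "n = Suc i" "i < 10" by (cases n) auto
  show "\<exists>c\<in>Bring ch11 u11. \<forall>S\<in>WW h (blowup_order ! n). c \<notin> S"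
  proof (cases "n \<le> 5")
    case True
    have "1 / u11 \<notin> S" if "S \<in> WW h (blowup_order ! n)" for S
    proof -
      have "u11 \<in> maxideal S" using that W_u11[of n S h] i True by (simp add: order)
      then show ?thesis by (rule maxideal_inverse) (rule z_neq_0)
    qed
    then show ?thesis using Bring_inverse by blast
  next
    case False
    have "u11 \<notin> S" if "S \<in> WW h (blowup_order ! n)" for S
    proof -
      have "1 / u11 \<in> maxideal S" using that W_u11'[of n S h] i False n by (simp add: order del: divide_divide_eq_right)
      then show ?thesis by (rule z_kill) (rule z_neq_0)
    qed
    then show ?thesis using pring_Bring u11_pring by blast
  qed
qed (use assms u11_pring z_neq_0 in \<open>auto simp: stage_Suc model_stage intro: sring_Bring\<close>)


text \<open>For a divisor that is not yet a point of \<open>Y\<close>: the point below it is found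
  on the chart \<open>B\<close>, and the test function has to be regular there. When the divisor
  already belongs to \<open>Y\<close>, \<open>kill_self\<close> applies.\<close>

lemma kill_chart:
  assumes V: "dvr V \<pi>" and Y: "model Y" "affine B \<subseteq> Y" "sring B" "B \<subseteq> V" and c: "c \<in> B" "\<And>S. S \<in> W \<Longrightarrow> c \<notin> S"
  shows "blowup_ord Y W V = 0"
proof -
  have l: "lring V" using V by (rule dvr.lring)
  let ?p = "B \<inter> maxideal V"
  have p: "prm B ?p" by (rule prm_contract[OF l Y(3,4)])
  have "localization B ?p \<in> Y" using Y(2) affineI[OF Y(3) p] by blast
  then show ?thesis
    by (rule blowup_ord_kill[OF V Y(1) _ dominates_localization[OF l Y(3,4)] subsetD[OF lring_localization(2)[OF Y(3) p] c(1)] c(2)])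
qed

lemma kill_self:
  assumes V: "dvr V \<pi>" and Y: "model Y" "V \<in> Y" and c: "c \<in> V" "\<And>S. S \<in> W \<Longrightarrow> c \<notin> S"
  shows "blowup_ord Y W V = 0"
  by (rule blowup_ord_kill[OF V Y dominates_refl c])

lemma E_eq: "E h i V = (if V \<in> prime_divisors (var_X h) then blowup_ord (stage_before h i) (WW h i) V else 0)"
  by (simp add: E_def total_transform_def blowup_ord_def center_WW)

lemma model_before: "model (stage_before h i)"
  by (simp add: stage_before_def model_stage)

locale seventeen_blowups =
  fixes h :: complex
  assumes h0: "h \<noteq> 0"
begin

lemma diag: "diag_blowups h z0 (z1 / z0) u11 (z3 / z0) (\<lambda>i. stage h (i + 11)) (\<lambda>i. WW h (i + 11))"
proof
  show "h \<noteq> 0" by (rule h0)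
  show "coordsys ch11" by (rule cs_11)
  show "model (stage h (0 + 11))" by (rule model_stage)
  show "affine (Bring ch11 u11) \<subseteq> stage h (0 + 11)" by (rule affine_11) simp_all
  show "stage h (Suc i + 11) = blowup (stage h (i + 11)) (zariski_closure (stage h (i + 11)) (stage h (i + 11) \<inter> WW h (Suc i + 11)))" if "i < 6" for i
    using stage_Suc[of h "i + 11"] order(2)[of "i + 11"] that by simp
qed (simp_all add: WW_def center_data_def chart_zz_def chart11_def chart12_def chart13_def chart14_def chart15_def chart16_def del: step12.simps step13.simps step14.simps step15.simps step16.simps)

sublocale C: diag_blowups h z0 "z1 / z0" u11 "z3 / z0" "\<lambda>i. stage h (i + 11)" "\<lambda>i. WW h (i + 11)"
  by (rule diag)

lemma W_group1:
  assumes "i \<in> {1..5}" "S \<in> WW h i"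
  shows "z2 \<in> maxideal S" "z3 \<in> maxideal S" "x3 \<notin> S" "1 / u11 \<notin> S"
proof -
  show z: "z2 \<in> maxideal S" "z3 \<in> maxideal S" using A.W_zw(1,2)[of i S h] assms by auto
  show "x3 \<notin> S" using z_kill[OF z(2)] x_neq_0 by simp
  have "u11 \<in> maxideal S" using W_u11[of i S h] assms by auto
  then show "1 / u11 \<notin> S" by (rule maxideal_inverse) (rule z_neq_0)
qed

lemma W_group2:
  assumes "i \<in> {6..10}" "S \<in> WW h i"
  shows "z0 \<in> maxideal S" "z1 \<in> maxideal S" "x1 \<notin> S" "u11 \<notin> S"
proof -
  show z: "z0 \<in> maxideal S" "z1 \<in> maxideal S" using A'.W_zw(1,2)[of "i - 5" S h] assms by auto
  show "x1 \<notin> S" using z_kill[OF z(2)] x_neq_0 by simp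
  have "1 / u11 \<in> maxideal S" using W_u11'[of i S h] assms by auto
  then show "u11 \<notin> S" by (rule z_kill) (rule z_neq_0)
qed

lemma W_group0:
  assumes "S \<in> WW h 11"
  shows "x1 \<notin> S" "x3 \<notin> S"
  using WW_11_facts[OF assms] z_kill x_neq_0 by auto

lemma W_group3:
  assumes "i \<in> {12..17}" "S \<in> WW h i"
  shows "z1 \<in> maxideal S" "z3 \<in> maxideal S" "x1 \<notin> S" "x3 \<notin> S" "x0 \<notin> S"
proof -
  have "z1 / z0 \<in> maxideal S" "z0 * (z1 / z0) \<in> maxideal S" "z0 * (z3 / z0) \<in> maxideal S"
    using C.W_tsv[of "i - 11" S] assms by auto
  then have z: "1 / x0 \<in> maxideal S" "1 / x1 \<in> maxideal S" "1 / x3 \<in> maxideal S" using x_neq_0 by simp_all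
  show "z1 \<in> maxideal S" "z3 \<in> maxideal S" by (fact z)+
  show "x1 \<notin> S" "x3 \<notin> S" "x0 \<notin> S" using z z_kill x_neq_0 by blast+
qed

lemma WW_kill:
  assumes "i \<in> {1..17}"
  shows "\<exists>c. c \<noteq> 0 \<and> (\<forall>S \<in> WW h i. c \<notin> S)"
proof -
  consider "i \<in> {1..5}" | "i \<in> {6..10}" | "i = 11" | "i \<in> {12..17}" using assms by force
  then show ?thesis
  proof cases
    case 1 then show ?thesis using W_group1(3) x_neq_0 by blast
  next
    case 2 then show ?thesis using W_group2(3) x_neq_0 by blast
  next
    case 3 then show ?thesis using W_group0(1) x_neq_0 by blast
  next
    case 4 then show ?thesis using W_group3(3) x_neq_0 by blast
  qed
qed

lemma order_range: "n < 17 \<Longrightarrow> blowup_order ! n \<in> {1..17}"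
proof -
  assume n: "n < 17"
  consider "n = 0" | i where "n = Suc i" "i < 10" | "11 \<le> n" using n by (cases n) force+
  then show ?thesis by cases (use n order in auto)
qed

lemma stage_mono:
  assumes V: "dvr V \<pi>" and m: "n \<le> m" "m \<le> 17" and "V \<in> stage h n"
  shows "V \<in> stage h m"
  using m
proof (induction m rule: dec_induct)
  case base
  then show ?case using assms by simp
next
  case (step k)
  obtain c where "c \<noteq> 0" "\<forall>S \<in> WW h (blowup_order ! k). c \<notin> S" using WW_kill[OF order_range[of k]] step by auto
  then show ?case unfolding stage_Suc by (intro dvr_stays[OF model_stage _ V]) (use step in auto)
qed

section \<open>The seventeen exceptional divisors and the orders along them\<close>

definition exc :: "nat \<Rightarrow> local_ring" where
  "exc j = (if j \<le> 5 then A.VV h j else if j \<le> 10 then A'.VV h (j - 5) else if j = 11 then V11 else C.VV (j - 11))"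

definition unif :: "nat \<Rightarrow> ratfun" where
  "unif j = (if j \<le> 5 then x0 - 1 else if j \<le> 10 then x2 - 1 else if j = 11 then z0 else z1 / z0)"

lemma range_cases:
  assumes "j \<in> {1..17::nat}"
  obtains "j \<in> {1..5}" | "j \<in> {6..10}" | "j = 11" | "j \<in> {12..17}"
  using assms by force

lemma exc_simps:
  "j \<in> {1..5} \<Longrightarrow> exc j = A.VV h j" "j \<in> {6..10} \<Longrightarrow> exc j = A'.VV h (j - 5)" "exc 11 = V11" "j \<in> {12..17} \<Longrightarrow> exc j = C.VV (j - 11)"
  by (auto simp: exc_def)

lemma dvr_exc:
  assumes "j \<in> {1..17}"
  shows "dvr (exc j) (unif j)"
  using assms
proof (cases rule: range_cases)
  case 1 then show ?thesis using A.step_facts(6)[of j h] by (simp add: exc_def unif_def curve_blowups.s_def[OF curve1])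
next
  case 2
  then have "1 \<le> j - 5" "j - 5 \<le> 5" by auto
  then show ?thesis using 2 A'.step_facts(6)[of "j - 5" h] by (simp add: exc_def unif_def curve_blowups.s_def[OF curve2])
next
  case 3 then show ?thesis using V11(2) by (simp add: exc_def unif_def)
next
  case 4
  then have "1 \<le> j - 11" "j - 11 \<le> 6" by auto
  then show ?thesis using 4 C.step_facts(6)[of "j - 11"] by (simp add: exc_def unif_def)
qed

text \<open>The number of the stage in which the divisor first appears; the extra 1 for the divisors
  up to 10 is due to blowing up the point 11 first.\<close>

definition born :: "nat \<Rightarrow> nat" where
  "born j = (if j \<le> 10 then j + 1 else if j = 11 then 1 else j)"

lemma exc_stage:
  assumes "j \<in> {1..17}" "born j \<le> m" "m \<le> 17"
  shows "exc j \<in> stage h m"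
proof (rule stage_mono[OF dvr_exc[OF assms(1)] assms(2,3)])
  show "exc j \<in> stage h (born j)"
    using assms(1)
  proof (cases rule: range_cases)
    case 1 then show ?thesis using A.VV_stays[of j j h] by (simp add: exc_def born_def)
  next
    case 2
    then have "1 \<le> j - 5" "j - 5 \<le> 5" by auto
    then show ?thesis using 2 A'.VV_stays[of "j - 5" "j - 5" h] by (simp add: exc_def born_def)
  next
    case 3 then show ?thesis using V11(1) by (simp add: exc_def born_def)
  next
    case 4
    then have "1 \<le> j - 11" "j - 11 \<le> 6" by auto
    then show ?thesis using 4 C.VV_stays[of "j - 11" "j - 11"] by (simp add: exc_def born_def)
  qed
qed

lemma dvr_prime_divisor: "dvr V \<pi> \<Longrightarrow> V \<in> prime_divisors Y \<longleftrightarrow> V \<in> Y"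
  by (auto simp: prime_divisors_def is_dvr_dvr)

lemma exc_prime: "j \<in> {1..17} \<Longrightarrow> exc j \<in> prime_divisors (var_X h)"
  using dvr_prime_divisor[OF dvr_exc] exc_stage[of j 17] by (auto simp: var_X_def born_def)

lemma P2xP2_prime: "dvr V \<pi> \<Longrightarrow> V \<in> P2xP2 \<Longrightarrow> V \<in> prime_divisors (var_X h)"
  using dvr_prime_divisor stage_mono[of V \<pi> 0 17] by (auto simp: var_X_def)

lemma exc_rings:
  "j \<in> {1..5} \<Longrightarrow> pring (x0, x1, z2, z3) \<subseteq> exc j" "j \<in> {6..10} \<Longrightarrow> pring (x2, x3, z0, z1) \<subseteq> exc j"
  "pring ch11 \<subseteq> exc 11" "j \<in> {12..17} \<Longrightarrow> Bring ch11 u11 \<subseteq> exc j"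
proof -
  show "j \<in> {1..5} \<Longrightarrow> pring (x0, x1, z2, z3) \<subseteq> exc j" using A.pring_VV[of j h] by (simp add: exc_simps)
  show "j \<in> {6..10} \<Longrightarrow> pring (x2, x3, z0, z1) \<subseteq> exc j"
  proof -
    assume j: "j \<in> {6..10}"
    then have "1 \<le> j - 5" "j - 5 \<le> 5" by auto
    then show ?thesis using j A'.pring_VV[of "j - 5" h] by (simp add: exc_simps)
  qed
  show "pring ch11 \<subseteq> exc 11" using V11(3) by (simp add: exc_simps)
  show "j \<in> {12..17} \<Longrightarrow> Bring ch11 u11 \<subseteq> exc j"
  proof -
    assume j: "j \<in> {12..17}"
    then have "1 \<le> j - 11" "j - 11 \<le> 6" by auto
    then have "Bring (C.cc 0) u11 \<subseteq> C.VV (j - 11)" using C.B_VV[of 0 "j - 11"] by blast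
    then show ?thesis unfolding exc_simps(4)[OF j] C.cc_simps(1) .
  qed
qed

lemma V11_units: "x0 \<in> V11" "1 / u11 \<in> V11" "u11 \<in> V11"
proof -
  interpret dvr V11 z0 by (rule V11)
  have "ord_at V11 (z1 / z0) = 0" "ord_at V11 u11 = 0"
    using ord_pdv(1)[OF cs_11, of 0 "(0, 1, 1, 1)" "z1 / z0" 0 "z1 / z0"] ord_pdv(1)[OF cs_11, of 0 "(0, 1, 1, 1)" u11 0 u11]
      cs_11 place_crd[OF cs_11, of 1 "(0, 1, 1, 1)"] place_crd[OF cs_11, of 2 "(0, 1, 1, 1)"] by (simp_all add: V11_def del: divide_divide_eq_right divide_divide_eq_left)
  then show "x0 \<in> V11" "1 / u11 \<in> V11" "u11 \<in> V11"
    using ord_nonneg_iff[of x0] ord_nonneg_iff[of "1 / u11"] ord_nonneg_iff[of u11] ord_inverse[of "z1 / z0"] ord_inverse[of u11] x_neq_0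
    by (simp_all add: inverse_eq_divide)
qed

text \<open>Upper triangular with unit diagonal. Each of the three chains contributes a full
  triangle of ones. Row 11 continues from column 14 on, because the centers 12 and 13 are not
  contained in \<open>z0 = 0\<close>, whereas center 14 is.\<close>

definition Emat :: "nat \<Rightarrow> nat \<Rightarrow> int" where
  "Emat i j = (if i \<in> {1..5} \<and> j \<in> {1..5} \<or> i \<in> {6..10} \<and> j \<in> {6..10} \<or> i \<in> {12..17} \<and> j \<in> {12..17}
     then (if i \<le> j then 1 else 0) else if i = 11 \<and> (j = 11 \<or> 14 \<le> j) then 1 else 0)"

text \<open>Within a chain the orders come from the chain itself. Across chains the divisor misses
  the center: \<open>self\<close> covers the case where the divisor already exists when the center
  is blown up, and \<open>chart\<close> the case where only the chart that will carry it exists. The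
  point 11 under the last chain is the exception; there the order is that of
  \<open>z0\<close>.\<close>

lemma E_exc:
  assumes i: "i \<in> {1..17}" and j: "j \<in> {1..17}"
  shows "E h i (exc j) = Emat i j"
proof -
  let ?B = "blowup_ord (stage_before h i) (WW h i) (exc j)"
  note dv = dvr_exc[OF j] and mb = model_before[of h i]
  have self: "?B = 0" if "born j \<le> i" "i \<noteq> 11" "i \<le> 10 \<or> born j < i" "c \<in> exc j" "\<And>S. S \<in> WW h i \<Longrightarrow> c \<notin> S" for c
    by (rule kill_self[OF dv mb _ that(4,5)]) (use that i j exc_stage[OF j, of i] exc_stage[OF j, of "i - 1"] in \<open>auto simp: stage_before_def\<close>)
  have chart: "?B = 0" if "affine B \<subseteq> stage_before h i" "sring B" "B \<subseteq> exc j" "c \<in> B" "\<And>S. S \<in> WW h i \<Longrightarrow> c \<notin> S" for B c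
    by (rule kill_chart[OF dv mb that])
  have sB: "sring (Bring ch11 u11)" by (rule sring_Bring[OF u11_pring z_neq_0(5)])
  have cB: "1 / u11 \<in> Bring ch11 u11" "u11 \<in> Bring ch11 u11" by (rule Bring_inverse) (rule subsetD[OF pring_Bring u11_pring])
  have "?B = Emat i j"
    using j
  proof (cases rule: range_cases)
    case 1
    have x1: "x1 \<in> exc j" using exc_rings(1)[OF 1] pring_tuple(2)[of x1 x0 z2 z3] by auto
    from i show ?thesis
    proof (cases rule: range_cases)
      assume "i \<in> {1..5}" then show ?thesis using A.VV_ord[of i j h] 1 by (simp add: exc_simps stage_before_def Emat_def)
    next
      assume a: "i \<in> {6..10}" then show ?thesis using self[of x1] W_group2(3)[OF a] x1 1 by (simp add: Emat_def born_def)
    next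
      assume a: "i = 11"
      have "?B = 0" by (rule chart[OF _ sring_pring exc_rings(1)[OF 1] pring_tuple(2)]) (use a affine_xz_0 W_group0(1) in \<open>auto simp: stage_before_def\<close>)
      then show ?thesis using a 1 by (simp add: Emat_def)
    next
      assume a: "i \<in> {12..17}" then show ?thesis using self[of x1] W_group3(3)[OF a] x1 1 by (simp add: Emat_def born_def)
    qed
  next
    case 2
    have x3: "x3 \<in> exc j" using exc_rings(2)[OF 2] pring_tuple(2)[of x3 x2 z0 z1] by auto
    from i show ?thesis
    proof (cases rule: range_cases)
      assume a: "i \<in> {1..5}"
      have "?B = 0" by (rule chart[OF _ sring_pring exc_rings(2)[OF 2] pring_tuple(2)]) (use a affine_zx[of i h] W_group1(3)[OF a] in \<open>auto simp: stage_before_def\<close>)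
      then show ?thesis using a 2 by (simp add: Emat_def)
    next
      assume a: "i \<in> {6..10}"
      have "blowup_ord (stage h (i - 5 - 1 + 6)) (WW h (i - 5 + 5)) (A'.VV h (j - 5)) = (if i - 5 \<le> j - 5 then 1 else 0)"
        by (rule A'.VV_ord) (use a 2 in auto)
      moreover have "i - 5 - 1 + 6 = i" "i - 5 + 5 = i" using a by auto
      ultimately have "blowup_ord (stage h i) (WW h i) (exc j) = (if i - 5 \<le> j - 5 then 1 else 0)"
        unfolding exc_simps(2)[OF 2] by simp
      then show ?thesis using a 2 by (auto simp: stage_before_def Emat_def)
    next
      assume a: "i = 11"
      have "?B = 0" by (rule chart[OF _ sring_pring exc_rings(2)[OF 2] pring_tuple(2)]) (use a affine_zx_0 W_group0(2) in \<open>auto simp: stage_before_def\<close>)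
      then show ?thesis using a 2 by (simp add: Emat_def)
    next
      assume a: "i \<in> {12..17}" then show ?thesis using self[of x3] W_group3(4)[OF a] x3 2 by (simp add: Emat_def born_def)
    qed
  next
    case 3
    from i show ?thesis
    proof (cases rule: range_cases)
      assume a: "i \<in> {1..5}" then show ?thesis using self[of "1 / u11"] W_group1(4)[OF a] V11_units(2) 3 by (simp add: Emat_def born_def exc_simps del: divide_divide_eq_right divide_divide_eq_left)
    next
      assume a: "i \<in> {6..10}" then show ?thesis using self[of u11] W_group2(4)[OF a] V11_units(3) 3 by (simp add: Emat_def born_def exc_simps del: divide_divide_eq_right divide_divide_eq_left)
    next
      assume a: "i = 11"
      have "?B = ord_at V11 z0" using Z.blowup_ord_D[OF V11(2), of h] V11(3) a 3 unfolding ch11_eq by (simp add: Bring_1 exc_simps stage_before_def)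
      then show ?thesis using a 3 dvr.ord_pi[OF V11(2)] by (simp add: Emat_def)
    next
      assume a: "i \<in> {12..17}" then show ?thesis using self[of x0] W_group3(5)[OF a] V11_units(1) 3 by (simp add: Emat_def born_def exc_simps)
    qed
  next
    case 4
    from i show ?thesis
    proof (cases rule: range_cases)
      assume a: "i \<in> {1..5}"
      have "?B = 0" by (rule chart[OF _ sB exc_rings(4)[OF 4] cB(1)]) (use a affine_11[of i h] W_group1(4)[OF a] in \<open>auto simp: stage_before_def\<close>)
      then show ?thesis using a 4 by (simp add: Emat_def)
    next
      assume a: "i \<in> {6..10}"
      have "?B = 0" by (rule chart[OF _ sB exc_rings(4)[OF 4] cB(2)]) (use a affine_11[of i h] W_group2(4)[OF a] in \<open>auto simp: stage_before_def\<close>)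
      then show ?thesis using a 4 by (simp add: Emat_def)
    next
      assume a: "i = 11"
      have "pring ch11 \<subseteq> exc j" using exc_rings(4)[OF 4] pring_Bring[of ch11 u11] by blast
      then have "blowup_ord P2xP2 (WW h 11) (exc j) = ord_at (exc j) (crd (z0, z1, z2, z3) 0)"
        using Z.blowup_ord_D[OF dv, of h] unfolding ch11_eq ev_hom Bring_1 by blast
      then have "?B = ord_at (exc j) z0" unfolding a stage_before_def by simp
      moreover have jj: "1 \<le> j - 11" "j - 11 \<le> 6" using 4 by auto
      have "ord_at (exc j) z0 = (if j - 11 \<le> 2 then 0 else 1)"
        using C.ord_s[OF jj] unfolding exc_simps(4)[OF 4] .
      ultimately show ?thesis using a 4 by (auto simp: Emat_def)
    next
      assume a: "i \<in> {12..17}"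
      have ij: "1 \<le> i - 11" "i - 11 \<le> 6" "1 \<le> j - 11" "j - 11 \<le> 6" using 4 a by auto
      note C.VV_ord[OF ij]
      moreover have "i - 11 - 1 + 11 = i - 1" "i - 11 + 11 = i" using a by auto
      ultimately have "blowup_ord (stage h (i - 1)) (WW h i) (exc j) = (if i - 11 \<le> j - 11 then 1 else 0)"
        unfolding exc_simps(4)[OF 4] by (simp only:)
      then show ?thesis using a 4 by (auto simp: stage_before_def Emat_def)
    qed
  qed
  then show ?thesis using exc_prime[OF j] by (simp add: E_eq)
qed

lemma Vinf_kill: "x2 \<in> Vinf_a" "x3 \<in> Vinf_a" "x0 \<in> Vinf_b" "x1 \<in> Vinf_b"
proof -
  have "pring (z0, z1, x2, x3) \<subseteq> Vinf_a" "pring (x0, x1, z2, z3) \<subseteq> Vinf_b"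
    using pdv_affine(2)[OF cs_zx prime_elem_X[of 1], of 1] pdv_affine(2)[OF cs_xz prime_elem_X[of 3], of 1]
    by (auto simp: Vinf_a_def Vinf_b_def Bring_1 X_dvd_iff)
  then show "x2 \<in> Vinf_a" "x3 \<in> Vinf_a" "x0 \<in> Vinf_b" "x1 \<in> Vinf_b" using pring_tuple by blast+
qed

text \<open>For divisors meeting affine 4-space, \<open>x1\<close> or \<open>x3\<close> is the test
  function. Along \<open>Vinf_a\<close> the function \<open>x1\<close> has a pole, but
  \<open>z0\<close> is a unit there and vanishes on the centers 6 to 10; symmetrically
  \<open>z2\<close> serves for \<open>Vinf_b\<close> and the centers 1 to 5.\<close>

lemma E_P2xP2:
  assumes V: "dvr V \<pi>" "V \<in> P2xP2" and i: "i \<in> {1..17}"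
  shows "E h i V = 0"
proof -
  interpret dvr V \<pi> by (rule V)
  have st: "V \<in> stage_before h i" using stage_mono[OF V(1), of 0] V(2) i by (auto simp: stage_before_def)
  note kill = kill_self[OF V(1) model_before st]
  have "\<exists>c\<in>V. \<forall>S \<in> WW h i. c \<notin> S"
    using V
  proof (cases rule: P2xP2_dvr_cases)
    case 1
    then have x: "x1 \<in> V" "x3 \<in> V" by auto
    show ?thesis by (rule range_cases[OF i]) (use x W_group1(3) W_group2(3) W_group0(1) W_group3(3) in \<open>blast+\<close>)
  next
    case 2
    have z1: "z1 \<noteq> 0" "z0 \<noteq> 0" using x_neq_0 by auto
    have "1 / z0 \<in> V"
    proof -
      have "ord_at V z0 = 0" using ord_pdv(1)[OF cs_zx, of 1 "(1, 0, 0, 0)" z0 0 z0] cs_zx 2 place_crd[OF cs_zx, of 0 "(1, 0, 0, 0)"] by (simp add: Vinf_a_def)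
      then show ?thesis using ord_nonneg_iff[of "1 / z0"] ord_inverse[of z0] z1 by (simp add: inverse_eq_divide)
    qed
    moreover have "1 / z0 \<notin> S" if "i \<in> {6..10}" "S \<in> WW h i" for S
      by (rule maxideal_inverse[OF W_group2(1)[OF that] z1(2)])
    moreover have "x3 \<in> V" using Vinf_kill 2 by simp
    ultimately show ?thesis using i W_group1(3)[of i] W_group0(2) W_group3(4)[of i] by (metis range_cases)
  next
    case 3
    have z1: "z2 \<noteq> 0" using x_neq_0 by auto
    have "1 / z2 \<in> V"
    proof -
      have "ord_at V z2 = 0" using ord_pdv(1)[OF cs_xz, of 3 "(0, 0, 1, 0)" z2 0 z2] cs_xz 3 place_crd[OF cs_xz, of 2 "(0, 0, 1, 0)"] by (simp add: Vinf_b_def)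
      then show ?thesis using ord_nonneg_iff[of "1 / z2"] ord_inverse[of z2] z1 by (simp add: inverse_eq_divide)
    qed
    moreover have "1 / z2 \<notin> S" if "i \<in> {1..5}" "S \<in> WW h i" for S
      by (rule maxideal_inverse[OF W_group1(1)[OF that] z1])
    moreover have "x1 \<in> V" using Vinf_kill 3 by simp
    ultimately show ?thesis using i W_group2(3)[of i] W_group0(1) W_group3(3)[of i] by (metis range_cases)
  qed
  then show ?thesis using kill by (auto simp: E_eq)
qed

lemma exc_not_P2xP2: "j \<in> {1..17} \<Longrightarrow> exc j \<notin> P2xP2"
  using E_P2xP2[OF dvr_exc, of j j] E_exc[of j j] by (auto simp: Emat_def split: if_splits)

end

section \<open>Prime divisors and divisor classes\<close>

lemma (in dvr) ord_powi: "a \<noteq> 0 \<Longrightarrow> ord_at V (a powi n) = n * ord_at V a"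
  by (cases n rule: int_cases2) (simp_all add: power_int_minus ord_power ord_inverse)

lemma div_class_eq:
  "div_class Y D = div_class Y D' \<longleftrightarrow> (\<exists>g. g \<noteq> 0 \<and> D = (\<lambda>V. D' V + div_of Y g V))"
proof -
  have cl: "div_class Y C = {(\<lambda>V. div_of Y g V + C V) | g. g \<noteq> 0}" for C
    by (auto simp: div_class_def r_coset_def Div_def principal_divisors_def)
  have o1: "div_of Y 1 V = 0" for V
  proof (cases "V \<in> prime_divisors Y")
    case True
    then obtain \<pi> where "dvr V \<pi>" by (auto simp: prime_divisors_def is_dvr_dvr)
    then show ?thesis by (simp add: div_of_def dvr.ord_1)
  qed (simp add: div_of_def)
  have om: "div_of Y (g * k) V = div_of Y g V + div_of Y k V" "div_of Y (g / k) V = div_of Y g V - div_of Y k V"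
    if "g \<noteq> 0" "k \<noteq> 0" for g k V
  proof -
    have "div_of Y (g * k) V = div_of Y g V + div_of Y k V \<and> div_of Y (g / k) V = div_of Y g V - div_of Y k V"
    proof (cases "V \<in> prime_divisors Y")
      case True
      then obtain \<pi> where "dvr V \<pi>" by (auto simp: prime_divisors_def is_dvr_dvr)
      then show ?thesis using that by (simp add: div_of_def dvr.ord_mult dvr.ord_divide)
    qed (simp add: div_of_def)
    then show "div_of Y (g * k) V = div_of Y g V + div_of Y k V" "div_of Y (g / k) V = div_of Y g V - div_of Y k V" by auto
  qed
  show ?thesis
  proof
    assume "div_class Y D = div_class Y D'"
    moreover have "D \<in> div_class Y D" unfolding cl using o1 by (auto intro!: exI[of _ 1])
    ultimately show "\<exists>g. g \<noteq> 0 \<and> D = (\<lambda>V. D' V + div_of Y g V)" unfolding cl by (auto simp: add.commute)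
  next
    assume "\<exists>g. g \<noteq> 0 \<and> D = (\<lambda>V. D' V + div_of Y g V)"
    then obtain g where g: "g \<noteq> 0" "D = (\<lambda>V. D' V + div_of Y g V)" by blast
    have "(\<lambda>V. div_of Y k V + D V) = (\<lambda>V. div_of Y (k * g) V + D' V)" if "k \<noteq> 0" for k
      using om(1)[OF that g(1)] g(2) by (auto simp: fun_eq_iff)
    moreover have "(\<lambda>V. div_of Y k V + D' V) = (\<lambda>V. div_of Y (k / g) V + D V)" if "k \<noteq> 0" for k
      using om(2)[OF that g(1)] g(2) by (auto simp: fun_eq_iff)
    moreover have "k * g \<noteq> 0" "k / g \<noteq> 0" if "k \<noteq> 0" for k using that g(1) by auto
    ultimately have "\<exists>l. (\<lambda>V. div_of Y k V + D V) = (\<lambda>V. div_of Y l V + D' V) \<and> l \<noteq> 0"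
      "\<exists>l. (\<lambda>V. div_of Y k V + D' V) = (\<lambda>V. div_of Y l V + D V) \<and> l \<noteq> 0" if "k \<noteq> 0" for k using that by meson+
    then show "div_class Y D = div_class Y D'" unfolding cl by auto
  qed
qed

fun line :: "ratfun \<Rightarrow> ratfun \<Rightarrow> complex \<times> complex \<times> complex \<Rightarrow> ratfun" where
  "line x y (c, d, e) = cst c * x + cst d * y + cst e"

lemma proj_regularI:
  assumes "sring V"
  shows "{x, y} \<subseteq> V \<Longrightarrow> proj_regular x y 1 V" "y \<noteq> 0 \<Longrightarrow> {x / y, 1 / y} \<subseteq> V \<Longrightarrow> proj_regular x y y V"
  using sringD(1)[OF assms] by (auto simp: proj_regular_def)

lemma Vinf_ord: "ord_at Vinf_a x1 = - 1" "ord_at Vinf_b x3 = - 1"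
  using dvr.ord_pi[OF dvr_Vinf(1)] dvr.ord_inverse[OF dvr_Vinf(1), of x1] dvr.ord_pi[OF dvr_Vinf(2)] dvr.ord_inverse[OF dvr_Vinf(2), of x3] x_neq_0
  by (simp_all add: inverse_eq_divide)

lemma Vinf_mem: "{z0, z1, x2, x3} \<subseteq> Vinf_a" "{x0, x1, z2, z3} \<subseteq> Vinf_b"
proof -
  have "pring (z0, z1, x2, x3) \<subseteq> Vinf_a" "pring (x0, x1, z2, z3) \<subseteq> Vinf_b"
    using pdv_affine(2)[OF cs_zx prime_elem_X[of 1], of 1] pdv_affine(2)[OF cs_xz prime_elem_X[of 3], of 1]
    by (auto simp: Vinf_a_def Vinf_b_def Bring_1 X_dvd_iff)
  then show "{z0, z1, x2, x3} \<subseteq> Vinf_a" "{x0, x1, z2, z3} \<subseteq> Vinf_b" using pring_tuple by blast+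
qed

lemma pdv_std:
  assumes "prime_elem p"
  shows "dvr (pdv (x0, x1, x2, x3) p) (ev (x0, x1, x2, x3) p)" "pdv (x0, x1, x2, x3) p \<in> P2xP2" "{x0, x1, x2, x3} \<subseteq> pdv (x0, x1, x2, x3) p"
proof -
  show "dvr (pdv (x0, x1, x2, x3) p) (ev (x0, x1, x2, x3) p)" by (rule dvr_pdv[OF coordsys_std assms])
  show "pdv (x0, x1, x2, x3) p \<in> P2xP2" by (rule pdv_P2xP2) (use assms in auto)
  show "{x0, x1, x2, x3} \<subseteq> pdv (x0, x1, x2, x3) p"
    using ev_pdv[OF assms, of "(x0, x1, x2, x3)" "X 0"] ev_pdv[OF assms, of "(x0, x1, x2, x3)" "X 1"]
      ev_pdv[OF assms, of "(x0, x1, x2, x3)" "X 2"] ev_pdv[OF assms, of "(x0, x1, x2, x3)" "X 3"] by simp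
qed

lemma ord_cst:
  assumes "dvr V \<pi>" "range cst \<subseteq> V" "c \<noteq> 0"
  shows "ord_at V (cst c) = 0"
proof -
  interpret dvr V \<pi> by (rule assms)
  have "cst c \<noteq> 0" "cst c \<in> V" "inverse (cst c) \<in> V" using assms(2,3) using subsetD[OF assms(2) rangeI[of cst "1 / c"]] by (auto simp: cst_divide cst_hom inverse_eq_divide)
  then show ?thesis using ord_nonneg_iff[of "cst c"] ord_nonneg_iff[of "inverse (cst c)"] ord_inverse[of "cst c"] by simp
qed

section \<open>Divisor classes as prescribed orders\<close>

locale lines_setting = seventeen_blowups h for h +
  fixes la lb :: "complex \<times> complex \<times> complex"
  assumes la: "la \<noteq> (0, 0, 0)" and lb: "lb \<noteq> (0, 0, 0)"
begin

definition "La = line x0 x1 la"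
definition "Lb = line x2 x3 lb"

lemma L_neq_0: "La \<noteq> 0" "Lb \<noteq> 0"
proof -
  obtain a b c a' b' c' where l: "la = (a, b, c)" "lb = (a', b', c')" by (cases la, cases lb)
  have "line x0 x1 la \<noteq> 0" "line x2 x3 lb \<noteq> 0"
    using line_neq_0[of a b c x0 x1] line_neq_0[of a' b' c' x2 x3] la[unfolded l] lb[unfolded l] by (simp_all add: l)
  then show "La \<noteq> 0" "Lb \<noteq> 0" by (simp_all add: La_def Lb_def)
qed

definition comb :: "int \<Rightarrow> int \<Rightarrow> (nat \<Rightarrow> int) \<Rightarrow> divisor" where
  "comb a b e V = a * H_a h la V + b * H_b h lb V + (\<Sum>i = 1..17. e i * E h i V)"

lemma H_val:
  assumes V: "dvr V \<pi>" "V \<in> var_X h"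
  shows "proj_regular x0 x1 w V \<Longrightarrow> H_a h la V = ord_at V La - ord_at V w"
    "proj_regular x2 x3 w V \<Longrightarrow> H_b h lb V = ord_at V Lb - ord_at V w"
proof -
  obtain R where R: "R \<in> P2xP2" "dominates V R" using stage_below V(2) unfolding var_X_def by blast
  obtain w1 w2 where l: "lring R" and w: "proj_regular x0 x1 w1 R" "proj_regular x2 x3 w2 R" by (rule P2xP2_cases[OF R(1)])
  have pd: "V \<in> prime_divisors (var_X h)" using V by (auto simp: prime_divisors_def is_dvr_dvr)
  obtain a b c a' b' c' where l': "la = (a, b, c)" "lb = (a', b', c')" by (cases la, cases lb)
  show "H_a h la V = ord_at V La - ord_at V w" if "proj_regular x0 x1 w V"
    unfolding H_a_def total_transform_def La_def
    using line_ord[OF V(1) R proj_regular_transfer[OF l R(2) w(1) that], of a b c] x_neq_0 la pd unfolding l' by simp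
  show "H_b h lb V = ord_at V Lb - ord_at V w" if "proj_regular x2 x3 w V"
    unfolding H_b_def total_transform_def Lb_def
    using line_ord[OF V(1) R proj_regular_transfer[OF l R(2) w(2) that], of a' b' c'] x_neq_0 lb pd unfolding l' by simp
qed

lemma comb_affine:
  assumes V: "dvr V \<pi>" "V \<in> P2xP2" "{x0, x1, x2, x3} \<subseteq> V"
  shows "comb a b e V = a * ord_at V La + b * ord_at V Lb"
proof -
  have X: "V \<in> var_X h" using P2xP2_prime[OF V(1,2)] by (simp add: prime_divisors_def)
  have s: "sring V" using V(1) by (rule dvr.sr)
  have "H_a h la V = ord_at V La" "H_b h lb V = ord_at V Lb"
    using H_val(1)[OF V(1) X proj_regularI(1)[OF s]] H_val(2)[OF V(1) X proj_regularI(1)[OF s]] V(3) dvr.ord_1[OF V(1)] by auto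
  then show ?thesis using E_P2xP2[OF V(1,2)] by (simp add: comb_def)
qed

lemma comb_Vinf:
  "comb a b e Vinf_a = a * (ord_at Vinf_a La + 1) + b * ord_at Vinf_a Lb"
  "comb a b e Vinf_b = a * ord_at Vinf_b La + b * (ord_at Vinf_b Lb + 1)"
proof -
  have X: "Vinf_a \<in> var_X h" "Vinf_b \<in> var_X h" using P2xP2_prime[OF dvr_Vinf(1) Vinf_P2xP2(1)] P2xP2_prime[OF dvr_Vinf(2) Vinf_P2xP2(2)] by (simp_all add: prime_divisors_def)
  note s = dvr.sr[OF dvr_Vinf(1)] dvr.sr[OF dvr_Vinf(2)]
  have "H_a h la Vinf_a = ord_at Vinf_a La + 1" "H_b h lb Vinf_a = ord_at Vinf_a Lb"
    using H_val(1)[OF dvr_Vinf(1) X(1) proj_regularI(2)[OF s(1) x_neq_0(2)]] H_val(2)[OF dvr_Vinf(1) X(1) proj_regularI(1)[OF s(1)]]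
      Vinf_mem Vinf_ord dvr.ord_1[OF dvr_Vinf(1)] by auto
  then show "comb a b e Vinf_a = a * (ord_at Vinf_a La + 1) + b * ord_at Vinf_a Lb"
    using E_P2xP2[OF dvr_Vinf(1) Vinf_P2xP2(1)] by (simp add: comb_def)
  have "H_a h la Vinf_b = ord_at Vinf_b La" "H_b h lb Vinf_b = ord_at Vinf_b Lb + 1"
    using H_val(1)[OF dvr_Vinf(2) X(2) proj_regularI(1)[OF s(2)]] H_val(2)[OF dvr_Vinf(2) X(2) proj_regularI(2)[OF s(2) x_neq_0(4)]]
      Vinf_mem Vinf_ord dvr.ord_1[OF dvr_Vinf(2)] by auto
  then show "comb a b e Vinf_b = a * ord_at Vinf_b La + b * (ord_at Vinf_b Lb + 1)"
    using E_P2xP2[OF dvr_Vinf(2) Vinf_P2xP2(2)] by (simp add: comb_def)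
qed

text \<open>A homogeneous coordinate of the first factor that does not vanish at the generic point
  of \<open>exc j\<close>; \<open>wb\<close> is the same for the second factor. The divisors 1 to 5
  lie over the affine part of the first plane, 6 to 10 over that of the second, and the others over
  infinity in both.\<close>

definition wa :: "nat \<Rightarrow> ratfun" where "wa j = (if j \<le> 5 then 1 else x1)"
definition wb :: "nat \<Rightarrow> ratfun" where "wb j = (if 6 \<le> j \<and> j \<le> 10 then 1 else x3)"

lemma exc_proj:
  assumes j: "j \<in> {1..17}"
  shows "proj_regular x0 x1 (wa j) (exc j)" "proj_regular x2 x3 (wb j) (exc j)"
proof -
  note s = dvr.sr[OF dvr_exc[OF j]]
  note D = sringD[OF s]
  have "proj_regular x0 x1 (wa j) (exc j) \<and> proj_regular x2 x3 (wb j) (exc j)"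
    using j
  proof (cases rule: range_cases)
    case 1
    have "{x0, x1, z2, z3} \<subseteq> exc j" using exc_rings(1)[OF 1] pring_tuple by blast
    then show ?thesis using 1 proj_regularI(1)[OF s, of x0 x1] proj_regularI(2)[OF s, of x3 x2] x_neq_0 by (simp add: wa_def wb_def)
  next
    case 2
    have "{x2, x3, z0, z1} \<subseteq> exc j" using exc_rings(2)[OF 2] pring_tuple by blast
    then show ?thesis using 2 proj_regularI(1)[OF s, of x2 x3] proj_regularI(2)[OF s, of x1 x0] x_neq_0 by (simp add: wa_def wb_def)
  next
    case 3
    have "z0 \<in> exc j" "z1 / z0 \<in> exc j" "u11 \<in> exc j" "z3 / z0 \<in> exc j" using exc_rings(3) 3 pring_tuple by blast+
    then have "z0 \<in> exc j" "z0 * (z1 / z0) \<in> exc j" "z0 * u11 \<in> exc j" "z0 * (z3 / z0) \<in> exc j" using D(4) by blast+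
    then have "{z0, z1, z2, z3} \<subseteq> exc j" using x_neq_0 by simp
    then show ?thesis using 3 proj_regularI(2)[OF s, of x1 x0] proj_regularI(2)[OF s, of x3 x2] x_neq_0 by (simp add: wa_def wb_def)
  next
    case 4
    have "pring ch11 \<subseteq> exc j" using exc_rings(4)[OF 4] pring_Bring by blast
    then have "z0 \<in> exc j" "z1 / z0 \<in> exc j" "u11 \<in> exc j" "z3 / z0 \<in> exc j" using pring_tuple by blast+
    then have "z0 \<in> exc j" "z0 * (z1 / z0) \<in> exc j" "z0 * u11 \<in> exc j" "z0 * (z3 / z0) \<in> exc j" using D(4) by blast+
    then have "{z0, z1, z2, z3} \<subseteq> exc j" using x_neq_0 by simp
    then show ?thesis using 4 proj_regularI(2)[OF s, of x1 x0] proj_regularI(2)[OF s, of x3 x2] x_neq_0 by (simp add: wa_def wb_def)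
  qed
  then show "proj_regular x0 x1 (wa j) (exc j)" "proj_regular x2 x3 (wb j) (exc j)" by auto
qed

lemma comb_exc:
  assumes j: "j \<in> {1..17}"
  shows "comb a b e (exc j) = a * (ord_at (exc j) La - ord_at (exc j) (wa j)) + b * (ord_at (exc j) Lb - ord_at (exc j) (wb j))
    + (\<Sum>i = 1..17. e i * Emat i j)"
proof -
  have X: "exc j \<in> var_X h" using exc_prime[OF j] by (simp add: prime_divisors_def)
  have "(\<Sum>i = 1..17. e i * E h i (exc j)) = (\<Sum>i = 1..17. e i * Emat i j)" by (intro sum.cong) (auto simp: E_exc[OF _ j])
  then show ?thesis using H_val[OF dvr_exc[OF j] X] exc_proj[OF j] by (simp add: comb_def)
qed

lemma list17: "[1..<18] = [1, 2, 3, 4, 5, 6, 7, 8, 9, 10, 11, 12, 13, 14, 15, 16, 17 :: nat]"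
  by (simp add: upt_rec)

lemma set17: "{1..17} = set [1..<18 :: nat]"
  by auto

text \<open>The matrix is triangular with unit diagonal, so the seventeen equations, written out,
  are solved by successive substitution.\<close>

lemma Emat_inj:
  assumes "\<And>j. j \<in> {1..17} \<Longrightarrow> (\<Sum>i = 1..17. e i * Emat i j) = 0" "i \<in> {1..17}"
  shows "e i = 0"
proof -
  have s: "(\<Sum>i = 1..17. e i * Emat i j) = e 1 * Emat 1 j + e 2 * Emat 2 j + e 3 * Emat 3 j + e 4 * Emat 4 j + e 5 * Emat 5 j
     + e 6 * Emat 6 j + e 7 * Emat 7 j + e 8 * Emat 8 j + e 9 * Emat 9 j + e 10 * Emat 10 j + e 11 * Emat 11 j + e 12 * Emat 12 j
     + e 13 * Emat 13 j + e 14 * Emat 14 j + e 15 * Emat 15 j + e 16 * Emat 16 j + e 17 * Emat 17 j" for j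
    unfolding set17 by (simp only: sum_set_upt_conv_sum_list_nat list17 list.map sum_list.Cons sum_list.Nil) simp
  note a = assms(1)[unfolded s, of 1] assms(1)[unfolded s, of 2] assms(1)[unfolded s, of 3] assms(1)[unfolded s, of 4] assms(1)[unfolded s, of 5]
    assms(1)[unfolded s, of 6] assms(1)[unfolded s, of 7] assms(1)[unfolded s, of 8] assms(1)[unfolded s, of 9] assms(1)[unfolded s, of 10]
    assms(1)[unfolded s, of 11] assms(1)[unfolded s, of 12] assms(1)[unfolded s, of 13] assms(1)[unfolded s, of 14] assms(1)[unfolded s, of 15]
    assms(1)[unfolded s, of 16] assms(1)[unfolded s, of 17]
  have z: "e 1 = 0 \<and> e 2 = 0 \<and> e 3 = 0 \<and> e 4 = 0 \<and> e 5 = 0 \<and> e 6 = 0 \<and> e 7 = 0 \<and> e 8 = 0 \<and> e 9 = 0 \<and> e 10 = 0 \<and> e 11 = 0 \<and> e 12 = 0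
    \<and> e 13 = 0 \<and> e 14 = 0 \<and> e 15 = 0 \<and> e 16 = 0 \<and> e 17 = 0"
    using a[simplified Emat_def, simplified] by (intro conjI; simp)
  then have "list_all (\<lambda>i. e i = 0) [1..<18]" unfolding list17 by (simp only: list.pred_inject simp_thms)
  then show ?thesis using assms(2) unfolding set17 list_all_iff by blast
qed

lemma cst_mem:
  assumes "V \<in> var_X h"
  shows "range cst \<subseteq> V"
  using modelD(2)[OF model_stage] assms by (auto simp: var_X_def)

text \<open>Without zeros and poles on affine 4-space, \<open>g\<close> is a constant, and a
  constant has order 0 along every divisor of the blown-up variety.\<close>

lemma constant_on_affine:
  assumes g: "g \<noteq> 0" and o: "\<And>V \<pi>. dvr V \<pi> \<Longrightarrow> V \<in> P2xP2 \<Longrightarrow> {x0, x1, x2, x3} \<subseteq> V \<Longrightarrow> ord_at V g = 0"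
    and V: "dvr V \<pi>" "V \<in> var_X h"
  shows "ord_at V g = 0"
proof -
  obtain c where "c \<noteq> 0" "g = cst c" using constant_of_ord_zero[OF g] o pdv_std by blast
  then show ?thesis using ord_cst[OF V(1) cst_mem[OF V(2)]] by simp
qed

text \<open>Suppose \<open>U\<close> were a further prime divisor. Surjectivity of the basis map
  writes it as \<open>comb a b e\<close> plus the divisor of some \<open>g\<close>. On affine
  4-space this says that \<open>k\<close>, the product of \<open>g\<close> with the powers of the
  two line equations, has neither zeros nor poles, so \<open>k\<close> is constant. The orders at
  the two divisors at infinity then give \<open>a = b = 0\<close>, and those at the
  \<open>exc j\<close> give \<open>e = 0\<close>. Hence the right-hand side vanishes at
  \<open>U\<close>, where the left-hand side is 1.\<close>

lemma prime_divisor_cases: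
  assumes basis: "Pic_free_basis h la lb" and U: "U \<in> prime_divisors (var_X h)" "U \<notin> P2xP2"
  shows "U \<in> exc ` {1..17}"
proof (rule ccontr)
  assume U': "U \<notin> exc ` {1..17}"
  obtain \<pi> where dU: "dvr U \<pi>" and UX: "U \<in> var_X h" using U(1) by (auto simp: prime_divisors_def is_dvr_dvr)
  let ?D = "\<lambda>V. if V = U then 1 else 0 :: int"
  have "{V. ?D V \<noteq> 0} = {U}" by auto
  then have "?D \<in> carrier (Div (var_X h))" using U(1) by (simp add: Div_def)
  then have "div_class (var_X h) ?D \<in> carrier (Pic (var_X h))"
    by (auto simp: Pic_def FactGroup_def RCOSETS_def div_class_def)
  then have "div_class (var_X h) ?D \<in> (\<lambda>(a, b, e). div_class (var_X h) (\<lambda>V. a * H_a h la V + b * H_b h lb V + (\<Sum>i = 1..17. e i * E h i V)))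
       ` (UNIV \<times> UNIV \<times> {e. \<forall>i. i \<notin> {1..17} \<longrightarrow> e i = 0})"
    using basis unfolding Pic_free_basis_def bij_betw_def by blast
  then obtain a b e where "div_class (var_X h) ?D = div_class (var_X h) (comb a b e)" by (auto simp: comb_def[abs_def])
  then obtain g where g: "g \<noteq> 0" "?D = (\<lambda>V. comb a b e V + div_of (var_X h) g V)" unfolding div_class_eq by blast
  have D: "?D V = comb a b e V + ord_at V g" if "dvr V \<pi>'" "V \<in> var_X h" for V \<pi>'
    using fun_cong[OF g(2), of V] that by (auto simp: div_of_def prime_divisors_def is_dvr_dvr)
  have DP: "0 = comb a b e V + ord_at V g" if "dvr V \<pi>'" "V \<in> P2xP2" for V \<pi>'
  proof -
    have "V \<in> var_X h" using P2xP2_prime[OF that] by (simp add: prime_divisors_def)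
    then show ?thesis using D[OF that(1)] that(2) U(2) by (auto split: if_splits)
  qed
  define k where "k = La powi a * Lb powi b * g"
  have k0: "k \<noteq> 0" using g(1) L_neq_0 by (simp add: k_def)
  have ok: "ord_at V k = a * ord_at V La + b * ord_at V Lb + ord_at V g" if "dvr V \<pi>'" for V \<pi>'
    using L_neq_0 g(1) by (simp add: k_def dvr.ord_mult[OF that] dvr.ord_powi[OF that])
  have k: "ord_at V k = 0" if "dvr V \<pi>'" "V \<in> var_X h" for V \<pi>'
  proof (rule constant_on_affine[OF k0 _ that])
    show "ord_at W k = 0" if "dvr W \<pi>''" "W \<in> P2xP2" "{x0, x1, x2, x3} \<subseteq> W" for W \<pi>''
      using DP[OF that(1,2)] comb_affine[OF that, of a b e] ok[OF that(1)] by simp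
  qed
  have PX: "Vinf_a \<in> var_X h" "Vinf_b \<in> var_X h"
    using P2xP2_prime[OF dvr_Vinf(1) Vinf_P2xP2(1)] P2xP2_prime[OF dvr_Vinf(2) Vinf_P2xP2(2)] by (simp_all add: prime_divisors_def)
  have a0: "a = 0"
    using DP[OF dvr_Vinf(1) Vinf_P2xP2(1)] k[OF dvr_Vinf(1) PX(1)] ok[OF dvr_Vinf(1)] unfolding comb_Vinf distrib_left by linarith
  have b0: "b = 0"
    using DP[OF dvr_Vinf(2) Vinf_P2xP2(2)] k[OF dvr_Vinf(2) PX(2)] ok[OF dvr_Vinf(2)] unfolding comb_Vinf distrib_left by linarith
  have gz: "ord_at V g = 0" if "dvr V \<pi>'" "V \<in> var_X h" for V \<pi>'
    using k[OF that] ok[OF that(1)] a0 b0 by simp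
  have "(\<Sum>i = 1..17. e i * Emat i j) = 0" if j: "j \<in> {1..17}" for j
  proof -
    have X: "exc j \<in> var_X h" using exc_prime[OF j] by (simp add: prime_divisors_def)
    have "exc j \<noteq> U" using U' j by blast
    then show ?thesis using D[OF dvr_exc[OF j] X] gz[OF dvr_exc[OF j] X] comb_exc[OF j, of a b e] a0 b0 by simp
  qed
  then have "e i = 0" if "i \<in> {1..17}" for i by (rule Emat_inj[OF _ that])
  then have "comb a b e U = 0" using a0 b0 by (simp add: comb_def)
  then show False using D[OF dU UX] gz[OF dU UX] by simp
qed

text \<open>If the two divisors differ by the divisor of \<open>g\<close>, the affine part forces
  \<open>g\<close> to equal \<open>f / (La^2 * Lb^2)\<close> up to a constant. What remains is to
  compare coefficients at the two divisors at infinity and at the \<open>exc j\<close>, where the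
  proper transform has coefficient 0; the contributions of the lines cancel. As \<open>g\<close> is
  known only up to a constant, \<open>main\<close> is stated for every \<open>g\<close> with the
  orders of \<open>g0\<close>.\<close>

lemma class_iff:
  assumes basis: "Pic_free_basis h la lb" and f: "f \<noteq> 0"
  shows "div_class (var_X h) (proper_transform (var_X h) P2xP2 (hypersurface f)) = div_class (var_X h) (comb 2 2 (\<lambda>i. - m i)) \<longleftrightarrow>
    ord_at Vinf_a f = - 2 \<and> ord_at Vinf_b f = - 2 \<and>
    (\<forall>j \<in> {1..17}. ord_at (exc j) f = 2 * ord_at (exc j) (wa j) + 2 * ord_at (exc j) (wb j) + (\<Sum>i = 1..17. m i * Emat i j))"
    (is "div_class ?X ?D = div_class ?X ?C \<longleftrightarrow> ?R")
proof -
  have pt_aff: "?D V = ord_at V f" if "dvr V \<pi>" "V \<in> P2xP2" "{x0, x1, x2, x3} \<subseteq> V" for V \<pi>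
    using P2xP2_prime[OF that(1,2)] dvr_prime_divisor[OF that(1), of P2xP2] that by (simp add: proper_transform_def hypersurface_def)
  have "x1 \<notin> Vinf_a" "x3 \<notin> Vinf_b"
    using dvr.ord_nonneg_iff[OF dvr_Vinf(1), of x1] dvr.ord_nonneg_iff[OF dvr_Vinf(2), of x3] Vinf_ord x_neq_0 by auto
  then have pt_inf: "?D Vinf_a = 0" "?D Vinf_b = 0" by (auto simp: proper_transform_def hypersurface_def)
  have pt_exc: "?D (exc j) = 0" if "j \<in> {1..17}" for j
    using exc_not_P2xP2[OF that] by (simp add: proper_transform_def prime_divisors_def)
  have pt_0: "?D V = 0" if "V \<notin> prime_divisors ?X" for V using that by (simp add: proper_transform_def)
  have C_0: "?C V = 0" if "V \<notin> prime_divisors ?X" for V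
    using that by (simp add: comb_def H_a_def H_b_def E_def total_transform_def)
  note PX = P2xP2_prime[OF dvr_Vinf(1) Vinf_P2xP2(1)] P2xP2_prime[OF dvr_Vinf(2) Vinf_P2xP2(2)]
  have e: "(\<Sum>i = 1..17. - m i * Emat i j) = - (\<Sum>i = 1..17. m i * Emat i j)" for j by (simp add: sum_negf)
  define g0 where "g0 = f / (La ^ 2 * Lb ^ 2)"
  have g0: "g0 \<noteq> 0" using f L_neq_0 by (simp add: g0_def)
  have og0: "ord_at V g0 = ord_at V f - 2 * ord_at V La - 2 * ord_at V Lb" if "dvr V \<pi>" for V \<pi>
    using f L_neq_0 by (simp add: g0_def dvr.ord_divide[OF that] dvr.ord_mult[OF that] dvr.ord_power[OF that])
  have main: "?R \<longleftrightarrow> (\<forall>V. ?D V = ?C V + div_of ?X g V)"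
    if g: "\<And>V \<pi>. dvr V \<pi> \<Longrightarrow> V \<in> var_X h \<Longrightarrow> ord_at V g = ord_at V g0" for g
  proof
    have og: "div_of ?X g V = ord_at V f - 2 * ord_at V La - 2 * ord_at V Lb" if "dvr V \<pi>" "V \<in> prime_divisors ?X" for V \<pi>
      using g[OF that(1)] og0[OF that(1)] that(2) by (simp add: div_of_def prime_divisors_def)
    show "?R \<Longrightarrow> \<forall>V. ?D V = ?C V + div_of ?X g V"
    proof
      fix V assume R: ?R
      show "?D V = ?C V + div_of ?X g V"
      proof (cases "V \<in> prime_divisors ?X")
        case False
        then show ?thesis using pt_0 C_0 by (simp add: div_of_def)
      next
        case True
        then obtain \<pi> where dV: "dvr V \<pi>" by (auto simp: prime_divisors_def is_dvr_dvr)
        show ?thesis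
        proof (cases "V \<in> P2xP2")
          case P: True
          from dV P show ?thesis
          proof (cases rule: P2xP2_dvr_cases)
            case 1
            then show ?thesis using pt_aff[OF dV P 1] comb_affine[OF dV P 1] og[OF dV True] by simp
          next
            case 2
            then show ?thesis using pt_inf comb_Vinf(1)[of 2 2 "\<lambda>i. - m i"] og[OF dvr_Vinf(1) PX(1)] R by simp
          next
            case 3
            then show ?thesis using pt_inf comb_Vinf(2)[of 2 2 "\<lambda>i. - m i"] og[OF dvr_Vinf(2) PX(2)] R by simp
          qed
        next
          case False
          then obtain j where j: "j \<in> {1..17}" "V = exc j" using prime_divisor_cases[OF basis True] by blast
          show ?thesis using pt_exc[OF j(1)] comb_exc[OF j(1), of 2 2 "\<lambda>i. - m i"] og[OF dvr_exc[OF j(1)] exc_prime[OF j(1)]] R j unfolding e by simp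
        qed
      qed
    qed
    show "\<forall>V. ?D V = ?C V + div_of ?X g V \<Longrightarrow> ?R"
    proof (intro conjI ballI)
      assume a: "\<forall>V. ?D V = ?C V + div_of ?X g V"
      show "ord_at Vinf_a f = - 2" using a[rule_format, of Vinf_a] pt_inf comb_Vinf(1)[of 2 2 "\<lambda>i. - m i"] og[OF dvr_Vinf(1) PX(1)] by simp
      show "ord_at Vinf_b f = - 2" using a[rule_format, of Vinf_b] pt_inf comb_Vinf(2)[of 2 2 "\<lambda>i. - m i"] og[OF dvr_Vinf(2) PX(2)] by simp
      fix j :: nat assume j: "j \<in> {1..17}"
      show "ord_at (exc j) f = 2 * ord_at (exc j) (wa j) + 2 * ord_at (exc j) (wb j) + (\<Sum>i = 1..17. m i * Emat i j)"
        using a[rule_format, of "exc j"] pt_exc[OF j] comb_exc[OF j, of 2 2 "\<lambda>i. - m i"] og[OF dvr_exc[OF j] exc_prime[OF j]] unfolding e by simp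
    qed
  qed
  show ?thesis
  proof
    assume "div_class ?X ?D = div_class ?X ?C"
    then obtain g where g: "g \<noteq> 0" "?D = (\<lambda>V. ?C V + div_of ?X g V)" unfolding div_class_eq by blast
    have o: "ord_at V g = ord_at V g0" if V: "dvr V \<pi>" "V \<in> P2xP2" "{x0, x1, x2, x3} \<subseteq> V" for V \<pi>
      using fun_cong[OF g(2), of V] pt_aff[OF V] comb_affine[OF V] og0[OF V(1)] P2xP2_prime[OF V(1,2)] by (simp add: div_of_def)
    have gg: "g / g0 \<noteq> 0" using g(1) g0 by simp
    have "ord_at V g = ord_at V g0" if V: "dvr V \<pi>" "V \<in> var_X h" for V \<pi>
    proof -
      have "ord_at V (g / g0) = 0"
        by (rule constant_on_affine[OF gg _ V]) (use o in \<open>simp add: dvr.ord_divide g(1) g0\<close>)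
      then show ?thesis using dvr.ord_divide[OF V(1) g(1) g0] by simp
    qed
    moreover have "\<forall>V. ?D V = ?C V + div_of ?X g V" using fun_cong[OF g(2)] by (rule allI)
    ultimately show ?R by (intro iffD2[OF main])
  next
    assume ?R
    then have "\<forall>V. ?D V = ?C V + div_of ?X g0 V" using main[of g0] by blast
    then have "?D = (\<lambda>V. ?C V + div_of ?X g0 V)" by (intro ext) (rule spec)
    then show "div_class ?X ?D = div_class ?X ?C" unfolding div_class_eq using g0 by blast
  qed
qed

end

section \<open>Orders of the invariants along the exceptional divisors\<close>

text \<open>\<open>I1\<close> and, in \<open>J2\<close>, \<open>I2\<close> as expressions over an
  arbitrary ring, so that they can be evaluated in any chart and also read as polynomials. Both are
  symmetric under interchange of the two factors, which spares a separate computation for the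
  divisors 6 to 10.\<close>

definition J1 :: "'a::comm_ring_1 \<Rightarrow> 'a \<Rightarrow> 'a \<Rightarrow> 'a" where
  "J1 k a c = - k * a^2 - k * a * c + k^2 * a * c + k * a^2 * c - k * c^2 + k * a * c^2"

definition J2 :: "'a::comm_ring_1 \<Rightarrow> 'a \<Rightarrow> 'a \<Rightarrow> 'a \<Rightarrow> 'a \<Rightarrow> 'a" where
  "J2 k a b c d = 2 * k * a + a^2 - 2 * k * a * b + 2 * k * c + a * c - k * b * c + k^2 * b * c
     + 2 * k * a * b * c + c^2 + k * b * c^2 - k * a * d + k^2 * a * d + k * a^2 * d
     - 2 * k * c * d + 2 * k * a * c * d"

lemma J_sym: "J1 k a b = J1 k b a" "J2 k a b c d = J2 k c d a b"
  by (simp_all add: J1_def J2_def algebra_simps)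

lemma curve_identities:
  fixes s y z w x u1 v1 v2 u3 v4 v5 g k :: "'a::field"
  assumes w: "w \<noteq> 0" and x: "x = 1 + s"
  defines "A \<equiv> 2 * k * x + x^2 - 2 * k * x * y" and "B \<equiv> 2 * k + x - k * y + k^2 * y + 2 * k * x * y"
  defines "T1 \<equiv> x * u1 * v1 * (k + s) + s * u1^2 - x^2 * v1^2"
    and "T1' \<equiv> x * u1 * v2 * (k + s) + u1^2 - s * x^2 * v2^2"
    and "T1'' \<equiv> u1 * (u3 + k * v4) + u1 * v2 * (1 + k + s) - x^2 * v2^2"
    and "T2 \<equiv> k^2 * x * v1 + s * (k * x * v1 + 2 * k * u1 + A * v1^2 + B * u1 * v1 + (1 + k * y) * u1^2)"
    and "T2' \<equiv> k^2 * x * v2 + s * k * x * v2 + 2 * k * u1 + s^2 * A * v2^2 + s * B * u1 * v2 + (1 + k * y) * u1^2"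
    and "T2'' \<equiv> k * (k * v4 + u3) + k^2 * v2 + k * x * v2 + (1 + k * y) * u1 * u3 + s * A * v2^2 + B * u1 * v2"
    and "T3 \<equiv> k^2 * v5 + (k^2 + k) * v4 + k * v2 + (1 + k * y) * u3^2 + A * v2^2 + (1 + 2 * k * y) * u1 * v2
      + ((1 + k) * (1 + k * y) + k) * (u3 * g - k * v4 * g + s * u3 * v4)"
  shows "z = s * u1 \<Longrightarrow> w = s * v1 \<Longrightarrow> J1 k x (z / w) * w^2 = s^2 * (k * T1)"
    "z = s * u1 \<Longrightarrow> w = s * v1 \<Longrightarrow> J2 k x y (z / w) (1 / w) * w^2 = s * T2"
    "v1 = s * v2 \<Longrightarrow> T1 = s * T1'" "v1 = s * v2 \<Longrightarrow> T2 = s * T2'"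
    "u1 = s * u3 - k * g \<Longrightarrow> v2 = s * v4 + g \<Longrightarrow> (1 + k * y) * g = 1 \<Longrightarrow> T1' = s * T1''"
    "u1 = s * u3 - k * g \<Longrightarrow> v2 = s * v4 + g \<Longrightarrow> (1 + k * y) * g = 1 \<Longrightarrow> T2' = s * T2''"
    "u1 = s * u3 - k * g \<Longrightarrow> v2 = s * v4 + g \<Longrightarrow> v4 = s * v5 + g^2 \<Longrightarrow> (1 + k * y) * g = 1 \<Longrightarrow> T2'' = s * T3"
proof -
  have J1: "J1 k x (z / w) * w^2 = k * (x * z * w * (k + s) + s * z^2 - x^2 * w^2)"
    using w unfolding J1_def x by (simp add: field_simps power2_eq_square)
  have J2: "J2 k x y (z / w) (1 / w) * w^2 = k^2 * x * w + k * x * s * w + 2 * k * s * z + A * w^2 + B * z * w + (1 + k * y) * z^2"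
    using w unfolding J2_def A_def B_def x by (simp add: field_simps power2_eq_square)
  show "z = s * u1 \<Longrightarrow> w = s * v1 \<Longrightarrow> J1 k x (z / w) * w^2 = s^2 * (k * T1)"
    unfolding J1 T1_def by (simp add: algebra_simps power2_eq_square)
  show "z = s * u1 \<Longrightarrow> w = s * v1 \<Longrightarrow> J2 k x y (z / w) (1 / w) * w^2 = s * T2"
    unfolding J2 T2_def by (simp add: algebra_simps power2_eq_square)
  show "v1 = s * v2 \<Longrightarrow> T1 = s * T1'" "v1 = s * v2 \<Longrightarrow> T2 = s * T2'"
    unfolding T1_def T1'_def T2_def T2'_def by (simp_all add: algebra_simps power2_eq_square)
  show "T1' = s * T1''" if "u1 = s * u3 - k * g" "v2 = s * v4 + g" "(1 + k * y) * g = 1"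
    unfolding T1'_def T1''_def x that(1,2) by (simp add: algebra_simps power2_eq_square)
  show "u1 = s * u3 - k * g \<Longrightarrow> v2 = s * v4 + g \<Longrightarrow> (1 + k * y) * g = 1 \<Longrightarrow> T2' = s * T2''"
  proof -
    assume u: "u1 = s * u3 - k * g" "v2 = s * v4 + g" and g: "(1 + k * y) * g = 1"
    \<comment> \<open>Divisibility holds only modulo the relation defining \<open>g\<close>, so the
      difference is exhibited as a multiple of that relation; the last division below is done in the
      same way.\<close>
    have "T2' - s * T2'' = - k * u1 * ((1 + k * y) * g - 1)"
      unfolding T2'_def T2''_def A_def B_def x u by (simp add: algebra_simps power2_eq_square)
    then show ?thesis using g by simp
  qed
  show "u1 = s * u3 - k * g \<Longrightarrow> v2 = s * v4 + g \<Longrightarrow> v4 = s * v5 + g^2 \<Longrightarrow> (1 + k * y) * g = 1 \<Longrightarrow> T2'' = s * T3"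
  proof -
    assume u: "u1 = s * u3 - k * g" "v2 = s * v4 + g" "v4 = s * v5 + g^2" and g: "(1 + k * y) * g = 1"
    have "T2'' - s * T3 = - k * (u3 + (1 + k) * g) * ((1 + k * y) * g - 1)"
      unfolding T2''_def T3_def A_def B_def x u by (simp add: algebra_simps power2_eq_square)
    then show ?thesis using g by simp
  qed
qed

text \<open>\<open>J\<close> belongs to \<open>J1\<close>; \<open>J2\<close> splits into a part
  \<open>N\<close> with factor \<open>s^4\<close> and a part \<open>L\<close> with factor
  \<open>s^3\<close>. These are divided by \<open>t\<close> separately until
  \<open>s = s3 * t\<close> is substituted: then both parts carry exactly \<open>t^6\<close>, and
  only the combination \<open>L3 + s3 * N'\<close> is divisible further. The letter \<open>c\<close>
  stands for \<open>1 / h\<close>.\<close>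

lemma diag_identities:
  fixes s t u v p v1 r q r3 m n l s3 k c :: "'a::field"
  assumes nz: "s \<noteq> 0" "t \<noteq> 0" "v \<noteq> 0"
  defines "J \<equiv> - (v^2) + (k - 1) * t * u * v + u * v - t^2 * u^2 + t * u^2"
    and "J' \<equiv> u * v1 + u^2 + t * (- (v1^2) + (k - 1) * u * v1 - u^2)"
    and "J'' \<equiv> u * (p + r) - v1^2 + (k - 1) * u * v1 - u^2"
    and "J3 \<equiv> u * (q + r3) + t * (- (p^2) + 2 * r3 + (k - 1) * u * r3 - t^2 * r3^2)"
    and "J4 \<equiv> u * (m - n) - p^2 + 2 * r3 + (k - 1) * u * r3 - t^2 * r3^2"
    and "N \<equiv> 2 * k * t * v^2 + v^2 + 2 * k * t^2 * u * v + t * u * v + t^2 * u^2"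
    and "N' \<equiv> 2 * k * t * v1^2 + v1^2 + 2 * k * t * u * v1 + u * v1 + u^2"
    and "N3 \<equiv> p + t * (p^2 - r3) + t^2 * p * r3 + t^3 * r3^2 + 2 * k * t * v1 * (p + t * r3)"
    and "L \<equiv> - 2 * k * v^2 + (k^2 - k) * t * u * v + 2 * k * u * v + k * t * u^2 + (k^2 - k) * t * v + k * v - 2 * k * t^2 * u + 2 * k * t * u"
    and "L1 \<equiv> - 2 * k * t * v1^2 + (k^2 - k) * t * u * v1 + 2 * k * u * v1 + k * u^2 + (k^2 - k) * t * v1 + k * v1 - 2 * k * t * u + 2 * k * u"
    and "L2 \<equiv> 2 * k * u * r + k * (r + 2 * p + t * p^2) - 2 * k * v1^2 + (k^2 - k) * u * v1 + (k^2 - k) * v1 - 2 * k * u"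
    and "L3 \<equiv> k * (2 * u * r3 + r3 + 2 * q + p * t * q + 4 * t * r3 - 2 * t^3 * r3^2 + (k - 1) * (u + 1) * t * r3)"
  defines "L4 \<equiv> k * (2 * m - n) + k * (2 * p * r3 + p * q + 4 * r3 - 2 * t^2 * r3^2 + (k - 1) * (u + 1) * r3) + s3 * N3"
    and "L5 \<equiv> 2 * k * l + k * (2 * q * r3 + q^2 - 2 * t * r3^2 + (k - 1) * p * r3) + k * (1 + k) * (m + 2 * n)
      + s3 * (q + (p^2 - r3) + t * p * r3 + t^2 * r3^2 + 2 * k * v1 * (p + t * r3))"
  shows "J1 k (1 / t) (u / v) * (s^2 * t * v)^2 = s^4 * (k * J)"
    "J2 k (1 / t) (1 / (s * t)) (u / v) (1 / (s * v)) * (s^2 * t * v)^2 = s^4 * N + s^3 * L"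
    "v = t * v1 \<Longrightarrow> J = t * J'" "v = t * v1 \<Longrightarrow> N = t^2 * N'" "v = t * v1 \<Longrightarrow> L = t * L1"
    "u = 1 + t * p \<Longrightarrow> v1 = - 1 + t * r \<Longrightarrow> J' = t * J''" "u = 1 + t * p \<Longrightarrow> v1 = - 1 + t * r \<Longrightarrow> L1 = t * L2"
    "u = 1 + t * p \<Longrightarrow> v1 = - 1 + t * r \<Longrightarrow> r = t * r3 \<Longrightarrow> p = 1 + k + t * q \<Longrightarrow> J'' = t * J3"
    "u = 1 + t * p \<Longrightarrow> v1 = - 1 + t * r \<Longrightarrow> r = t * r3 \<Longrightarrow> p = 1 + k + t * q \<Longrightarrow> L2 = t * L3"
    "q = - 2 * r3 - s3 * c + t * m \<Longrightarrow> r3 = - s3 * c + t * n \<Longrightarrow> J3 = t * J4"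
    "u = 1 + t * p \<Longrightarrow> v1 = - 1 + t * r \<Longrightarrow> r = t * r3 \<Longrightarrow> q = - 2 * r3 - s3 * c + t * m \<Longrightarrow> r3 = - s3 * c + t * n \<Longrightarrow> k * c = 1 \<Longrightarrow> L3 + s3 * N' = t * L4"
    "u = 1 + t * p \<Longrightarrow> p = 1 + k + t * q \<Longrightarrow> q = - 2 * r3 - s3 * c + t * m \<Longrightarrow> r3 = - s3 * c + t * n \<Longrightarrow> 2 * m = n + 2 * ((1 + k) * c) * s3 + 2 * t * l
      \<Longrightarrow> k * c = 1 \<Longrightarrow> L4 = t * L5"
proof -
  show "J1 k (1 / t) (u / v) * (s^2 * t * v)^2 = s^4 * (k * J)"
    using nz unfolding J1_def J_def by (simp add: field_simps power2_eq_square power4_eq_xxxx)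
  show "J2 k (1 / t) (1 / (s * t)) (u / v) (1 / (s * v)) * (s^2 * t * v)^2 = s^4 * N + s^3 * L"
    using nz unfolding J2_def N_def L_def by (simp add: field_simps power2_eq_square power4_eq_xxxx power3_eq_cube)
  show "v = t * v1 \<Longrightarrow> J = t * J'" "v = t * v1 \<Longrightarrow> N = t^2 * N'" "v = t * v1 \<Longrightarrow> L = t * L1"
    unfolding J_def J'_def N_def N'_def L_def L1_def by (simp_all add: algebra_simps power2_eq_square)
  show "J' = t * J''" if "u = 1 + t * p" "v1 = - 1 + t * r"
    unfolding J'_def J''_def that by (simp add: algebra_simps power2_eq_square)
  show "L1 = t * L2" if "u = 1 + t * p" "v1 = - 1 + t * r"
    unfolding L1_def L2_def that by (simp_all add: algebra_simps power2_eq_square)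
  show "J'' = t * J3" if "u = 1 + t * p" "v1 = - 1 + t * r" "r = t * r3" "p = 1 + k + t * q"
    unfolding J''_def J3_def that by (simp add: algebra_simps power2_eq_square)
  show "L2 = t * L3" if "u = 1 + t * p" "v1 = - 1 + t * r" "r = t * r3" "p = 1 + k + t * q"
    unfolding L2_def L3_def that by (simp add: algebra_simps power2_eq_square power3_eq_cube)
  show "J3 = t * J4" if "q = - 2 * r3 - s3 * c + t * m" "r3 = - s3 * c + t * n"
    unfolding J3_def J4_def that by (simp add: algebra_simps power2_eq_square)
  show "u = 1 + t * p \<Longrightarrow> v1 = - 1 + t * r \<Longrightarrow> r = t * r3 \<Longrightarrow> q = - 2 * r3 - s3 * c + t * m \<Longrightarrow> r3 = - s3 * c + t * n \<Longrightarrow> k * c = 1 \<Longrightarrow> L3 + s3 * N' = t * L4"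
  proof -
    assume u: "u = 1 + t * p" "v1 = - 1 + t * r" "r = t * r3" and q: "q = - 2 * r3 - s3 * c + t * m" and r3: "r3 = - s3 * c + t * n" and c: "k * c = 1"
    \<comment> \<open>Modulo \<open>t\<close>, \<open>L3\<close> is \<open>k\<close> times this
      expression, hence \<open>- s3\<close> as \<open>k * c = 1\<close>; it cancels against
      \<open>s3 * N'\<close> because \<open>N'\<close> is 1 modulo \<open>t\<close>.\<close>
    have e: "3 * r3 + 2 * q = - (s3 * c) + t * (2 * m - n)" unfolding q by (subst (1 2) r3) (simp add: algebra_simps)
    have e': "k * (3 * r3 + 2 * q) = - s3 * (k * c) + k * t * (2 * m - n)" unfolding e by (simp add: algebra_simps)
    have L3: "L3 = k * (3 * r3 + 2 * q) + k * t * (2 * p * r3 + p * q + 4 * r3 - 2 * t^2 * r3^2 + (k - 1) * (u + 1) * r3)"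
      unfolding L3_def u by (simp add: algebra_simps power2_eq_square power3_eq_cube)
    have N': "N' = 1 + t * N3" unfolding N'_def N3_def u by (simp add: algebra_simps power2_eq_square power3_eq_cube)
    show ?thesis unfolding L3 e' N' c L4_def by (simp add: algebra_simps)
  qed
  show "u = 1 + t * p \<Longrightarrow> p = 1 + k + t * q \<Longrightarrow> q = - 2 * r3 - s3 * c + t * m \<Longrightarrow> r3 = - s3 * c + t * n \<Longrightarrow> 2 * m = n + 2 * ((1 + k) * c) * s3 + 2 * t * l
      \<Longrightarrow> k * c = 1 \<Longrightarrow> L4 = t * L5"
  proof -
    assume u: "u = 1 + t * p" and p: "p = 1 + k + t * q" and q: "q = - 2 * r3 - s3 * c + t * m" and r3: "r3 = - s3 * c + t * n"
      and m: "2 * m = n + 2 * ((1 + k) * c) * s3 + 2 * t * l" and c: "k * c = 1"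
    \<comment> \<open>Modulo \<open>t\<close> the three contributions to \<open>L4\<close> are 2, -3
      and 1 times \<open>(1 + k) * s3\<close>. The first comes from the relation for
      \<open>2 * m\<close>, so this cancellation explains the coefficient \<open>(1 + h) / h\<close>
      in the last center.\<close>
    have e: "4 * r3 + q = - 3 * (s3 * c) + t * (m + 2 * n)" unfolding q by (subst (1 2) r3) (simp add: algebra_simps)
    have e1: "k * (1 + k) * (4 * r3 + q) = - 3 * (1 + k) * s3 * (k * c) + k * (1 + k) * t * (m + 2 * n)" unfolding e by (simp add: algebra_simps)
    have e2: "k * (2 * m - n) = 2 * (1 + k) * s3 * (k * c) + 2 * k * t * l" unfolding m by (simp add: algebra_simps)
    have L4: "L4 = k * (2 * m - n) + k * (1 + k) * (4 * r3 + q) + s3 * (1 + k) + t * (L5 - 2 * k * l - k * (1 + k) * (m + 2 * n))"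
      unfolding L4_def L5_def N3_def u p by (simp add: algebra_simps power2_eq_square power3_eq_cube)
    show ?thesis unfolding L4 e1 e2 c by (simp add: algebra_simps)
  qed
qed

text \<open>The factor \<open>w ^ 2\<close> clears the poles that a polynomial of degree two has at
  infinity; a nonzero value \<open>c\<close> at the single point \<open>b\<close> of the divisor
  then certifies the order of the cofactor.\<close>

lemma ord_pdv_at:
  assumes y: "coordsys y" and i: "i < 4" "crd b i = 0" and W: "W = pdv y (X i)"
    and \<sigma>: "crd y i = \<sigma>" and k: "F * w ^ 2 = \<sigma> ^ n * k'" "k' \<in> Oring y b \<and> pval y b k' = c" "c \<noteq> 0" and w: "w \<noteq> 0"
  shows "F \<noteq> 0 \<and> ord_at W F = int n - 2 * ord_at W w"
proof -
  note o = ord_pdv[OF y i k(1)[folded \<sigma>]]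
  have k': "k' \<in> Oring y b" "pval y b k' \<noteq> 0" using k by auto
  have F: "F \<noteq> 0" using o(2)[OF k'] by auto
  have "ord_at W (F * w ^ 2) = ord_at W F + 2 * ord_at W w"
    using dvr.ord_mult[OF dvr_pdv[OF y prime_elem_X[OF i(1)]], of F "w ^ 2"] dvr.ord_power[OF dvr_pdv[OF y prime_elem_X[OF i(1)]], of w 2] F w by (simp add: W)
  then show ?thesis using o(1)[OF k'] F by (simp add: W)
qed

text \<open>For witness points with a free coordinate \<open>d\<close>, in which the cofactor is
  affine: some value of \<open>d\<close> avoids cancellation, whatever the constants
  \<open>C0\<close> and \<open>C1\<close> are.\<close>

lemma ex_affine_nonzero: "a \<noteq> 0 \<Longrightarrow> \<exists>d::complex. b + a * d \<noteq> 0"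
  by (rule exI[of _ "(1 - b) / a"]) simp

definition FF :: "complex \<Rightarrow> complex \<Rightarrow> complex \<Rightarrow> complex \<Rightarrow> ratfun \<Rightarrow> ratfun \<Rightarrow> ratfun \<Rightarrow> ratfun \<Rightarrow> ratfun" where
  "FF h C0 C1 C2 a b c d = cst C0 + cst C1 * J1 (cst h) a c + cst C2 * J2 (cst h) a b c d"

lemma regroup:
  fixes s :: "'a::comm_ring_1"
  shows "a * (s^2 * A) + b * (s^2 * B) + c * (s * C) = s^2 * (a * A + b * B) + s * (c * C)"
    "a * (s^4 * A) + b * (s^2 * (k * (s * B))) + c * (s * (s * C)) = s^4 * (a * A) + s^3 * (b * (k * B)) + s^2 * (c * C)"
    "a * (s^4 * A) + b * (s^2 * (k * (s * (s * B)))) + c * (s * (s * (s * C))) = s^4 * (a * A + b * (k * B)) + s^3 * (c * C)"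
    "a * (s^4 * A) + b * (s^2 * (k * (s * (s * B)))) + c * (s * (s * (s * (s * C)))) = s^4 * (a * A + b * (k * B) + c * C)"
    "s^4 * A + s^3 * B + s^2 * (0 * C) = s^3 * (s * A + B)" "s^2 * A + s * B = s^1 * (s * A + B)"
    "s^4 * A + s^3 * B + s^2 * C = s^2 * (s^2 * A + s * B + C)" "s^4 * A + s^3 * B = s^3 * (s * A + B)"
  by (simp_all add: algebra_simps power2_eq_square power3_eq_cube power4_eq_xxxx)

section \<open>Orders of the invariants along the divisors 1 to 10\<close>

context curve_blowups
begin

abbreviation "f C0 C1 C2 \<equiv> FF h C0 C1 C2 x y (z / w) (1 / w)"

lemma chart_eqs:
  shows "x = 1 + s" "z = s * u1" "w = s * v1" "v1 = s * v2" "u1 = s * u3 - cst h * (1 / \<gamma>)" "v2 = s * v4 + 1 / \<gamma>" "v4 = s * v5 + (1 / \<gamma>)^2"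
    "(1 + cst h * y) * (1 / \<gamma>) = 1"
  using s0 \<gamma>0 by (simp_all add: s_def u1_def v1_def v2_def u3_def a3_def v4_def a4_def v5_def a5_def power_divide) (simp add: \<gamma>_def)

abbreviation "iA \<equiv> 2 * cst h * x + x^2 - 2 * cst h * x * y"
abbreviation "iB \<equiv> 2 * cst h + x - cst h * y + (cst h)^2 * y + 2 * cst h * x * y"
abbreviation "iT1 \<equiv> x * u1 * v1 * (cst h + s) + s * u1^2 - x^2 * v1^2"
abbreviation "iT1' \<equiv> x * u1 * v2 * (cst h + s) + u1^2 - s * x^2 * v2^2"
abbreviation "iT1'' \<equiv> u1 * (u3 + cst h * v4) + u1 * v2 * (1 + cst h + s) - x^2 * v2^2"
abbreviation "iT2 \<equiv> (cst h)^2 * x * v1 + s * (cst h * x * v1 + 2 * cst h * u1 + iA * v1^2 + iB * u1 * v1 + (1 + cst h * y) * u1^2)"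
abbreviation "iT2' \<equiv> (cst h)^2 * x * v2 + s * cst h * x * v2 + 2 * cst h * u1 + s^2 * iA * v2^2 + s * iB * u1 * v2 + (1 + cst h * y) * u1^2"
abbreviation "iT2'' \<equiv> cst h * (cst h * v4 + u3) + (cst h)^2 * v2 + cst h * x * v2 + (1 + cst h * y) * u1 * u3 + s * iA * v2^2 + iB * u1 * v2"
abbreviation "iT3 \<equiv> (cst h)^2 * v5 + ((cst h)^2 + cst h) * v4 + cst h * v2 + (1 + cst h * y) * u3^2 + iA * v2^2 + (1 + 2 * cst h * y) * u1 * v2
      + ((1 + cst h) * (1 + cst h * y) + cst h) * (u3 * (1 / \<gamma>) - cst h * v4 * (1 / \<gamma>) + s * u3 * v4)"

lemma f_eqs:
  "f C0 C1 C2 * w^2 = s^2 * (cst C0 * v1^2 + cst C1 * (cst h * iT1)) + s * (cst C2 * iT2)"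
  "f C0 C1 C2 * w^2 = s^4 * (cst C0 * v2^2) + s^3 * (cst C1 * (cst h * iT1')) + s^2 * (cst C2 * iT2')"
  "f C0 C1 C2 * w^2 = s^4 * (cst C0 * v2^2 + cst C1 * (cst h * iT1'')) + s^3 * (cst C2 * iT2'')"
  "f C0 C1 C2 * w^2 = s^4 * (cst C0 * v2^2 + cst C1 * (cst h * iT1'') + cst C2 * iT3)"
proof -
  note I = curve_identities[where k = "cst h", OF w0 chart_eqs(1)]
  have "f C0 C1 C2 * w^2 = cst C0 * w^2 + cst C1 * (J1 (cst h) x (z / w) * w^2) + cst C2 * (J2 (cst h) x y (z / w) (1 / w) * w^2)"
    by (simp add: FF_def algebra_simps)
  then have 0: "f C0 C1 C2 * w^2 = cst C0 * w^2 + cst C1 * (s^2 * (cst h * iT1)) + cst C2 * (s * iT2)"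
    unfolding I(1)[OF chart_eqs(2,3)] I(2)[OF chart_eqs(2,3)] .
  have w: "w^2 = s^2 * v1^2" using chart_eqs(3) by (metis power_mult_distrib)
  have w': "w^2 = s^4 * v2^2" unfolding w chart_eqs(4) by (simp add: power2_eq_square power4_eq_xxxx)
  show "f C0 C1 C2 * w^2 = s^2 * (cst C0 * v1^2 + cst C1 * (cst h * iT1)) + s * (cst C2 * iT2)"
    by (subst 0, subst w, rule regroup)
  have 1: "f C0 C1 C2 * w^2 = cst C0 * (s^4 * v2^2) + cst C1 * (s^2 * (cst h * (s * iT1'))) + cst C2 * (s * (s * iT2'))"
    using 0 unfolding I(3)[OF chart_eqs(4)] I(4)[OF chart_eqs(4)] w' .
  show "f C0 C1 C2 * w^2 = s^4 * (cst C0 * v2^2) + s^3 * (cst C1 * (cst h * iT1')) + s^2 * (cst C2 * iT2')"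
    unfolding 1 by (rule regroup)
  have 2: "f C0 C1 C2 * w^2 = cst C0 * (s^4 * v2^2) + cst C1 * (s^2 * (cst h * (s * (s * iT1'')))) + cst C2 * (s * (s * (s * iT2'')))"
    using 1 unfolding I(5)[OF chart_eqs(5,6,8)] I(6)[OF chart_eqs(5,6,8)] .
  show "f C0 C1 C2 * w^2 = s^4 * (cst C0 * v2^2 + cst C1 * (cst h * iT1'')) + s^3 * (cst C2 * iT2'')"
    unfolding 2 by (rule regroup)
  have 3: "f C0 C1 C2 * w^2 = cst C0 * (s^4 * v2^2) + cst C1 * (s^2 * (cst h * (s * (s * iT1'')))) + cst C2 * (s * (s * (s * (s * iT3))))"
    using 2 unfolding I(7)[OF chart_eqs(5-8)] .
  show "f C0 C1 C2 * w^2 = s^4 * (cst C0 * v2^2 + cst C1 * (cst h * iT1'') + cst C2 * iT3)"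
    unfolding 3 by (rule regroup)
qed

lemma place_chart:
  assumes cs: "coordsys (s, y, a, b)"
  shows "s \<in> Oring (s, y, a, b) (0, 0, c, d)" "pval (s, y, a, b) (0, 0, c, d) s = 0"
    "y \<in> Oring (s, y, a, b) (0, 0, c, d)" "pval (s, y, a, b) (0, 0, c, d) y = 0"
    "a \<in> Oring (s, y, a, b) (0, 0, c, d)" "pval (s, y, a, b) (0, 0, c, d) a = c"
    "b \<in> Oring (s, y, a, b) (0, 0, c, d)" "pval (s, y, a, b) (0, 0, c, d) b = d"
    "x \<in> Oring (s, y, a, b) (0, 0, c, d)" "pval (s, y, a, b) (0, 0, c, d) x = 1"
    "1 / \<gamma> \<in> Oring (s, y, a, b) (0, 0, c, d)" "pval (s, y, a, b) (0, 0, c, d) (1 / \<gamma>) = 1"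
    "\<gamma> \<in> Oring (s, y, a, b) (0, 0, c, d)" "pval (s, y, a, b) (0, 0, c, d) \<gamma> = 1"
proof -
  note P = place_crd[OF cs, of 0 "(0, 0, c, d)"] place_crd[OF cs, of 1 "(0, 0, c, d)"] place_crd[OF cs, of 2 "(0, 0, c, d)"] place_crd[OF cs, of 3 "(0, 0, c, d)"]
  show s: "s \<in> Oring (s, y, a, b) (0, 0, c, d)" "pval (s, y, a, b) (0, 0, c, d) s = 0"
    and y: "y \<in> Oring (s, y, a, b) (0, 0, c, d)" "pval (s, y, a, b) (0, 0, c, d) y = 0"
    and "a \<in> Oring (s, y, a, b) (0, 0, c, d)" "pval (s, y, a, b) (0, 0, c, d) a = c"
    "b \<in> Oring (s, y, a, b) (0, 0, c, d)" "pval (s, y, a, b) (0, 0, c, d) b = d" using P by simp_all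
  show "x \<in> Oring (s, y, a, b) (0, 0, c, d)" "pval (s, y, a, b) (0, 0, c, d) x = 1"
    using s place_add[OF cs place_0_1(3)[OF cs] s(1)] place_0_1(4)[OF cs, of "(0, 0, c, d)"] unfolding chart_eqs(1)[symmetric] by simp_all
  show "1 / \<gamma> \<in> Oring (s, y, a, b) (0, 0, c, d)" "pval (s, y, a, b) (0, 0, c, d) (1 / \<gamma>) = 1"
    "\<gamma> \<in> Oring (s, y, a, b) (0, 0, c, d)" "pval (s, y, a, b) (0, 0, c, d) \<gamma> = 1"
    unfolding \<gamma>_def using y by (simp_all add: place[OF cs])
qed

lemma place_3:
  assumes cs: "coordsys (s, y, u3, b)"
  shows "u1 \<in> Oring (s, y, u3, b) (0, 0, c, d)" "pval (s, y, u3, b) (0, 0, c, d) u1 = - h"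
  unfolding chart_eqs(5) using place_chart[OF cs, of c d] by (simp_all only: place[OF cs]) simp_all

lemma place_4:
  "v2 \<in> Oring (s, y, u3, v4) (0, 0, c, d)" "pval (s, y, u3, v4) (0, 0, c, d) v2 = 1"
  unfolding chart_eqs(6) using place_chart[OF cs_c4, of c d] by (simp_all only: place[OF cs_c4]) simp_all

lemma place_5:
  "v4 \<in> Oring (s, y, u3, v5) (0, 0, c, d)" "pval (s, y, u3, v5) (0, 0, c, d) v4 = 1"
  "v2 \<in> Oring (s, y, u3, v5) (0, 0, c, d)" "pval (s, y, u3, v5) (0, 0, c, d) v2 = 1"
proof -
  show v4: "v4 \<in> Oring (s, y, u3, v5) (0, 0, c, d)" "pval (s, y, u3, v5) (0, 0, c, d) v4 = 1"
    unfolding chart_eqs(7) using place_chart[OF cs_c5, of c d] by (simp_all only: place[OF cs_c5]) simp_all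
  show "v2 \<in> Oring (s, y, u3, v5) (0, 0, c, d)" "pval (s, y, u3, v5) (0, 0, c, d) v2 = 1"
    unfolding chart_eqs(6) using place_chart[OF cs_c5, of c d] v4 by (simp_all only: place[OF cs_c5]) simp_all
qed

lemma VV_cc: "VV 1 = pdv (s, y, u1, v1) (X 0)" "VV 2 = pdv (s, y, u1, v2) (X 0)" "VV 3 = pdv (s, y, u3, v2) (X 0)"
  "VV 4 = pdv (s, y, u3, v4) (X 0)" "VV 5 = pdv (s, y, u3, v5) (X 0)"
  by (simp_all add: VV_def)

lemma f_pow:
  "f C0 C1 0 * w^2 = s^2 * (cst C0 * v1^2 + cst C1 * (cst h * iT1))"
  "f C0 C1 0 * w^2 = s^3 * (s * (cst C0 * v2^2) + cst C1 * (cst h * iT1'))"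
  "f C0 C1 0 * w^2 = s^4 * (cst C0 * v2^2 + cst C1 * (cst h * iT1''))"
  "f C0 C1 C2 * w^2 = s^1 * (s * (cst C0 * v1^2 + cst C1 * (cst h * iT1)) + cst C2 * iT2)"
  "f C0 C1 C2 * w^2 = s^2 * (s^2 * (cst C0 * v2^2) + s * (cst C1 * (cst h * iT1')) + cst C2 * iT2')"
  "f C0 C1 C2 * w^2 = s^3 * (s * (cst C0 * v2^2 + cst C1 * (cst h * iT1'')) + cst C2 * iT2'')"
proof -
  have z: "cst 0 = 0" by simp
  show "f C0 C1 0 * w^2 = s^2 * (cst C0 * v1^2 + cst C1 * (cst h * iT1))"
    unfolding f_eqs(1) z by (simp only: mult_zero_left mult_zero_right add_0_right)
  show "f C0 C1 0 * w^2 = s^3 * (s * (cst C0 * v2^2) + cst C1 * (cst h * iT1'))"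
    unfolding f_eqs(2) z by (rule regroup)
  show "f C0 C1 0 * w^2 = s^4 * (cst C0 * v2^2 + cst C1 * (cst h * iT1''))"
    unfolding f_eqs(3) z by (simp only: mult_zero_left mult_zero_right add_0_right)
  show "f C0 C1 C2 * w^2 = s^1 * (s * (cst C0 * v1^2 + cst C1 * (cst h * iT1)) + cst C2 * iT2)"
    unfolding f_eqs(1) by (rule regroup)
  show "f C0 C1 C2 * w^2 = s^2 * (s^2 * (cst C0 * v2^2) + s * (cst C1 * (cst h * iT1')) + cst C2 * iT2')"
    unfolding f_eqs(2) by (rule regroup)
  show "f C0 C1 C2 * w^2 = s^3 * (s * (cst C0 * v2^2 + cst C1 * (cst h * iT1'')) + cst C2 * iT2'')"
    unfolding f_eqs(3) by (rule regroup)
qed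

lemma ord_C1:
  assumes h: "h \<noteq> 0" and C1: "C1 \<noteq> 0"
  shows "f C0 C1 0 \<noteq> 0" "1 \<le> j \<Longrightarrow> j \<le> 5 \<Longrightarrow> ord_at (VV j) (f C0 C1 0) = [0, 2, 3, 3, 4, 4] ! j - 2 * ord_at (VV j) w"
proof -
  \<comment> \<open>The third coordinate solves \<open>C0 + C1 * h * (h * u1 - 1) = 1\<close>, which
    gives the cofactor the value 1. The witness points for the fourth and fifth divisor are likewise
    solutions of the equation that the cofactor be 1.\<close>
  have 1: "f C0 C1 0 \<noteq> 0 \<and> ord_at (VV 1) (f C0 C1 0) = int 2 - 2 * ord_at (VV 1) w"
    by (rule ord_pdv_at[OF cs_c1 _ _ VV_cc(1), where b = "(0, 0, ((1 - C0) / (C1 * h) + 1) / h, 1)" and c = 1, OF _ _ _ f_pow(1) _ _ w0])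
      (use h C1 place_chart[OF cs_c1, of "((1 - C0) / (C1 * h) + 1) / h" 1] in \<open>simp_all add: place[OF cs_c1] field_simps\<close>)
  have 2: "f C0 C1 0 \<noteq> 0 \<and> ord_at (VV 2) (f C0 C1 0) = int 3 - 2 * ord_at (VV 2) w"
    by (rule ord_pdv_at[OF cs_c2 _ _ VV_cc(2), where b = "(0, 0, 1, 0)" and c = "C1 * h", OF _ _ _ f_pow(2) _ _ w0])
      (use h C1 place_chart[OF cs_c2, of 1 0] in \<open>simp_all add: place[OF cs_c2]\<close>)
  have 3: "f C0 C1 0 \<noteq> 0 \<and> ord_at (VV 3) (f C0 C1 0) = int 3 - 2 * ord_at (VV 3) w"
    by (rule ord_pdv_at[OF cs_c3 _ _ VV_cc(3), where b = "(0, 0, 0, 0)" and c = "C1 * h^3", OF _ _ _ f_pow(2) _ _ w0])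
      (use h C1 place_chart[OF cs_c3, of 0 0] place_3[OF cs_c3, of 0 0] in \<open>simp_all add: place[OF cs_c3] power2_eq_square power3_eq_cube\<close>)
  have 4: "f C0 C1 0 \<noteq> 0 \<and> ord_at (VV 4) (f C0 C1 0) = int 4 - 2 * ord_at (VV 4) w"
    by (rule ord_pdv_at[OF cs_c4 _ _ VV_cc(4), where b = "(0, 0, ((C0 - 1) / (C1 * h) - 1) / h - 1 - h, 0)" and c = 1, OF _ _ _ f_pow(3) _ _ w0])
      (use h C1 place_chart[OF cs_c4, of "((C0 - 1) / (C1 * h) - 1) / h - 1 - h" 0] place_3[OF cs_c4, of "((C0 - 1) / (C1 * h) - 1) / h - 1 - h" 0]
        place_4[of "((C0 - 1) / (C1 * h) - 1) / h - 1 - h" 0] in \<open>simp_all add: place[OF cs_c4] field_simps\<close>)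
  have 5: "f C0 C1 0 \<noteq> 0 \<and> ord_at (VV 5) (f C0 C1 0) = int 4 - 2 * ord_at (VV 5) w"
    by (rule ord_pdv_at[OF cs_c5 _ _ VV_cc(5), where b = "(0, 0, ((C0 - 1) / (C1 * h) - 1) / h - 1 - h - h, 0)" and c = 1, OF _ _ _ f_pow(3) _ _ w0])
      (use h C1 place_chart[OF cs_c5, of "((C0 - 1) / (C1 * h) - 1) / h - 1 - h - h" 0] place_3[OF cs_c5, of "((C0 - 1) / (C1 * h) - 1) / h - 1 - h - h" 0]
        place_5[of "((C0 - 1) / (C1 * h) - 1) / h - 1 - h - h" 0] in \<open>simp_all add: place[OF cs_c5] field_simps\<close>)
  show "f C0 C1 0 \<noteq> 0" using 1 by blast
  show "1 \<le> j \<Longrightarrow> j \<le> 5 \<Longrightarrow> ord_at (VV j) (f C0 C1 0) = [0, 2, 3, 3, 4, 4] ! j - 2 * ord_at (VV j) w"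
    using le5_cases[of "\<lambda>j. ord_at (VV j) (f C0 C1 0) = [0, 2, 3, 3, 4, 4] ! j - 2 * ord_at (VV j) w"] 1 2 3 4 5 by simp
qed

lemma ord_C2:
  assumes h: "h \<noteq> 0" and C2: "C2 \<noteq> 0"
  shows "f C0 C1 C2 \<noteq> 0" "1 \<le> j \<Longrightarrow> j \<le> 5 \<Longrightarrow> ord_at (VV j) (f C0 C1 C2) = [0, 1, 2, 2, 3, 4] ! j - 2 * ord_at (VV j) w"
proof -
  have 1: "f C0 C1 C2 \<noteq> 0 \<and> ord_at (VV 1) (f C0 C1 C2) = int 1 - 2 * ord_at (VV 1) w"
    by (rule ord_pdv_at[OF cs_c1 _ _ VV_cc(1), where b = "(0, 0, 0, 1)" and c = "C2 * h^2", OF _ _ _ f_pow(4) _ _ w0])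
      (use h C2 place_chart[OF cs_c1, of 0 1] in \<open>simp_all add: place[OF cs_c1]\<close>)
  have 2: "f C0 C1 C2 \<noteq> 0 \<and> ord_at (VV 2) (f C0 C1 C2) = int 2 - 2 * ord_at (VV 2) w"
    by (rule ord_pdv_at[OF cs_c2 _ _ VV_cc(2), where b = "(0, 0, 0, 1)" and c = "C2 * h^2", OF _ _ _ f_pow(5) _ _ w0])
      (use h C2 place_chart[OF cs_c2, of 0 1] in \<open>simp_all add: place[OF cs_c2]\<close>)
  have 3: "f C0 C1 C2 \<noteq> 0 \<and> ord_at (VV 3) (f C0 C1 C2) = int 2 - 2 * ord_at (VV 3) w"
    by (rule ord_pdv_at[OF cs_c3 _ _ VV_cc(3), where b = "(0, 0, 0, 0)" and c = "- C2 * h^2", OF _ _ _ f_pow(5) _ _ w0])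
      (use h C2 place_chart[OF cs_c3, of 0 0] place_3[OF cs_c3, of 0 0] in \<open>simp_all add: place[OF cs_c3] power2_eq_square\<close>)
  have 4: "f C0 C1 C2 \<noteq> 0 \<and> ord_at (VV 4) (f C0 C1 C2) = int 3 - 2 * ord_at (VV 4) w"
    by (rule ord_pdv_at[OF cs_c4 _ _ VV_cc(4), where b = "(0, 0, 0, 0)" and c = "- C2 * h^2", OF _ _ _ f_pow(6) _ _ w0])
      (use h C2 place_chart[OF cs_c4, of 0 0] place_3[OF cs_c4, of 0 0] place_4[of 0 0] in \<open>simp_all add: place[OF cs_c4] power2_eq_square algebra_simps\<close>)
  have 5: "f C0 C1 C2 \<noteq> 0 \<and> ord_at (VV 5) (f C0 C1 C2) = int 4 - 2 * ord_at (VV 5) w"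
  proof -
    \<comment> \<open>The value of the cofactor at \<open>y = u3 = v5 = 0\<close>; moving
      \<open>v5\<close> to \<open>d\<close> adds \<open>C2 * h^2 * d\<close>.\<close>
    let ?K = "C0 + C1 * (h * (- h * h - h * (1 + h) - 1)) + C2 * (1 + 2 * h - h^2)"
    obtain d where d: "?K + (C2 * h^2) * d \<noteq> 0" using ex_affine_nonzero[of "C2 * h^2" ?K] h C2 by auto
    show ?thesis
      by (rule ord_pdv_at[OF cs_c5 _ _ VV_cc(5), where b = "(0, 0, 0, d)" and c = "?K + (C2 * h^2) * d", OF _ _ _ f_eqs(4) _ d w0])
        ((use place_chart[OF cs_c5, of 0 d] place_3[OF cs_c5, of 0 d] place_5[of 0 d] in \<open>simp_all add: place[OF cs_c5]\<close>), simp add: algebra_simps power2_eq_square)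
  qed
  show "f C0 C1 C2 \<noteq> 0" using 1 by blast
  show "1 \<le> j \<Longrightarrow> j \<le> 5 \<Longrightarrow> ord_at (VV j) (f C0 C1 C2) = [0, 1, 2, 2, 3, 4] ! j - 2 * ord_at (VV j) w"
    using le5_cases[of "\<lambda>j. ord_at (VV j) (f C0 C1 C2) = [0, 1, 2, 2, 3, 4] ! j - 2 * ord_at (VV j) w"] 1 2 3 4 5 by simp
qed

end

section \<open>Monomials\<close>

fun mon :: "nat \<times> nat \<times> nat \<times> nat \<Rightarrow> poly4" where
  "mon (i, j, k, l) = X 0 ^ i * X 1 ^ j * X 2 ^ k * X 3 ^ l"

fun mcoeff :: "poly4 \<Rightarrow> nat \<times> nat \<times> nat \<times> nat \<Rightarrow> complex" where
  "mcoeff F (i, j, k, l) = poly.coeff (poly.coeff (poly.coeff (poly.coeff F l) k) j) i"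

lemma mcoeff_X:
  "mcoeff (X 0 * F) (i, j, k, l) = (case i of 0 \<Rightarrow> 0 | Suc i \<Rightarrow> mcoeff F (i, j, k, l))"
  "mcoeff (X 1 * F) (i, j, k, l) = (case j of 0 \<Rightarrow> 0 | Suc j \<Rightarrow> mcoeff F (i, j, k, l))"
  "mcoeff (X 2 * F) (i, j, k, l) = (case k of 0 \<Rightarrow> 0 | Suc k \<Rightarrow> mcoeff F (i, j, k, l))"
  "mcoeff (X 3 * F) (i, j, k, l) = (case l of 0 \<Rightarrow> 0 | Suc l \<Rightarrow> mcoeff F (i, j, k, l))"
  by (auto simp: X4_def coeff_pCons split: nat.splits)

lemma mcoeff_X_power:
  "mcoeff (X 0 ^ a * F) (i, j, k, l) = (if a \<le> i then mcoeff F (i - a, j, k, l) else 0)"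
  "mcoeff (X 1 ^ a * F) (i, j, k, l) = (if a \<le> j then mcoeff F (i, j - a, k, l) else 0)"
  "mcoeff (X 2 ^ a * F) (i, j, k, l) = (if a \<le> k then mcoeff F (i, j, k - a, l) else 0)"
  "mcoeff (X 3 ^ a * F) (i, j, k, l) = (if a \<le> l then mcoeff F (i, j, k, l - a) else 0)"
proof -
  show "mcoeff (X 0 ^ a * F) (i, j, k, l) = (if a \<le> i then mcoeff F (i - a, j, k, l) else 0)"
    by (induction a arbitrary: i) (auto simp only: power_Suc mult.assoc mcoeff_X power_0 mult_1 split: nat.splits, auto)
  show "mcoeff (X 1 ^ a * F) (i, j, k, l) = (if a \<le> j then mcoeff F (i, j - a, k, l) else 0)"
    by (induction a arbitrary: j) (auto simp only: power_Suc mult.assoc mcoeff_X power_0 mult_1 split: nat.splits, auto)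
  show "mcoeff (X 2 ^ a * F) (i, j, k, l) = (if a \<le> k then mcoeff F (i, j, k - a, l) else 0)"
    by (induction a arbitrary: k) (auto simp only: power_Suc mult.assoc mcoeff_X power_0 mult_1 split: nat.splits, auto)
  show "mcoeff (X 3 ^ a * F) (i, j, k, l) = (if a \<le> l then mcoeff F (i, j, k, l - a) else 0)"
    by (induction a arbitrary: l) (auto simp only: power_Suc mult.assoc mcoeff_X power_0 mult_1 split: nat.splits, auto)
qed

lemma mcoeff_1: "mcoeff 1 (i, j, k, l) = (if i = 0 \<and> j = 0 \<and> k = 0 \<and> l = 0 then 1 else 0)"
  by (auto simp: one_pCons coeff_pCons split: nat.splits)

lemma mcoeff_mon: "mcoeff (mon m') m = (if m = m' then 1 else 0)"
proof -
  obtain i j k l a b c d where m: "m = (i, j, k, l)" "m' = (a, b, c, d)" by (cases m, cases m')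
  have "mon m' = X 0 ^ a * (X 1 ^ b * (X 2 ^ c * (X 3 ^ d * 1)))" by (simp add: m mult.assoc)
  then show ?thesis unfolding m by (simp only: mcoeff_X_power mcoeff_1) auto
qed

lemma mcoeff_linear: "mcoeff (F + G) m = mcoeff F m + mcoeff G m" "mcoeff (C4 c * F) m = c * mcoeff F m" "mcoeff 0 m = 0"
  by (cases m; simp add: C4_def)+

lemma mcoeff_sum: "finite I \<Longrightarrow> mcoeff (\<Sum>m\<in>I. F m) n = (\<Sum>m\<in>I. mcoeff (F m) n)"
  by (induction I rule: finite_induct) (simp_all add: mcoeff_linear del: mcoeff.simps)

lemma mcoeff_dvd:
  assumes "X e ^ n dvd F" "e < 4" "crd m e < n"
  shows "mcoeff F m = 0"
proof -
  obtain G where G: "F = X e ^ n * G" using assms(1) by (auto elim: dvdE)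
  obtain i j k l where m: "m = (i, j, k, l)" by (cases m)
  have e: "e = 0 \<or> e = 1 \<or> e = 2 \<or> e = 3" using assms(2) by auto
  then show ?thesis using assms(3) unfolding G m by (elim disjE) (simp_all only: mcoeff_X_power, auto)
qed

text \<open>\<open>\<phi>\<close> records how exponents change under a change of chart. Injectivity
  keeps distinct monomials distinct, so a divisibility of the sum kills each coefficient whose
  monomial is not itself divisible.\<close>

lemma mon_coeff_zero:
  assumes I: "finite I" "inj_on \<phi> I" "m \<in> I" and dvd: "X e ^ n dvd (\<Sum>m\<in>I. C4 (c m) * mon (\<phi> m))" "e < 4" "crd (\<phi> m) e < n"
  shows "c m = 0"
proof -
  have "0 = mcoeff (\<Sum>m\<in>I. C4 (c m) * mon (\<phi> m)) (\<phi> m)" using mcoeff_dvd[OF dvd] by simp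
  also have "\<dots> = (\<Sum>m'\<in>I. if m' = m then c m' else 0)"
    unfolding mcoeff_sum[OF I(1)] using I(2,3) by (intro sum.cong) (auto simp only: mcoeff_linear mcoeff_mon inj_on_eq_iff, auto)
  also have "\<dots> = c m" using I by simp
  finally show ?thesis by simp
qed

lemma mon_span: "\<exists>I c. finite I \<and> F = (\<Sum>m\<in>I. C4 (c m) * mon m)"
proof -
  define S where "S = {F. \<exists>I c. finite I \<and> F = (\<Sum>m\<in>I. C4 (c m) * mon m)}"
  have C4_0: "C4 0 = 0" "C4 1 = 1" "C4 (a + b) = C4 a + C4 b" "C4 (a * b) = C4 a * C4 b" for a b by (simp_all add: C4_def one_pCons)
  have mono: "C4 a * mon m \<in> S" for a m
    unfolding S_def by (intro CollectI exI[of _ "{m}"] exI[of _ "\<lambda>_. a"]) simp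
  have add: "F + G \<in> S" if "F \<in> S" "G \<in> S" for F G
  proof -
    obtain I c J d where I: "finite I" "F = (\<Sum>m\<in>I. C4 (c m) * mon m)" and J: "finite J" "G = (\<Sum>m\<in>J. C4 (d m) * mon m)"
      using \<open>F \<in> S\<close> \<open>G \<in> S\<close> unfolding S_def by blast
    have F: "F = (\<Sum>m\<in>I \<union> J. C4 (if m \<in> I then c m else 0) * mon m)"
      unfolding I(2) using I(1) J(1) C4_0(1) by (intro sum.mono_neutral_cong_left) auto
    have G: "G = (\<Sum>m\<in>I \<union> J. C4 (if m \<in> J then d m else 0) * mon m)"
      unfolding J(2) using I(1) J(1) C4_0(1) by (intro sum.mono_neutral_cong_left) auto
    have FG: "F + G = (\<Sum>m\<in>I \<union> J. C4 ((if m \<in> I then c m else 0) + (if m \<in> J then d m else 0)) * mon m)"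
      unfolding F G sum.distrib[symmetric] by (intro sum.cong) (simp_all only: C4_0 distrib_right)
    have "finite (I \<union> J)" using I(1) J(1) by simp
    with FG have "finite (I \<union> J) \<and> F + G = (\<Sum>m\<in>I \<union> J. C4 ((\<lambda>m. (if m \<in> I then c m else 0) + (if m \<in> J then d m else 0)) m) * mon m)" by (intro conjI)
    then show ?thesis unfolding S_def by (intro CollectI exI)
  qed
  have S0: "0 \<in> S" unfolding S_def by (intro CollectI exI[of _ "{}"]) simp
  have sum2: "(\<Sum>i\<in>A. f i) \<in> S" if "\<And>i. f i \<in> S" for A :: "(nat \<times> nat \<times> nat \<times> nat) set" and f :: "nat \<times> nat \<times> nat \<times> nat \<Rightarrow> poly4"
    by (induction A rule: infinite_finite_induct) (simp_all add: S0 add that)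
  have mm: "(C4 a * mon m) * (C4 b * mon m') \<in> S" for a b m m'
  proof -
    obtain i j k l i' j' k' l' where m: "m = (i, j, k, l)" "m' = (i', j', k', l')" by (cases m, cases m')
    have "(C4 a * mon m) * (C4 b * mon m') = C4 (a * b) * mon (i + i', j + j', k + k', l + l')"
      unfolding m mon.simps C4_0 power_add by (simp only: mult_ac)
    then show ?thesis using mono by (simp only:)
  qed
  have mult: "F * G \<in> S" if "F \<in> S" "G \<in> S" for F G
  proof -
    obtain I c J d where I: "finite I" "F = (\<Sum>m\<in>I. C4 (c m) * mon m)" and J: "finite J" "G = (\<Sum>m\<in>J. C4 (d m) * mon m)"
      using \<open>F \<in> S\<close> \<open>G \<in> S\<close> unfolding S_def by blast
    show ?thesis unfolding I(2) J(2) sum_product by (intro sum2 mm)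
  qed
  have "F \<in> S"
  proof (induction F rule: poly4_induct)
    case (1 c)
    have "C4 c = C4 c * mon (0, 0, 0, 0)" by simp
    then show ?case using mono[of c "(0, 0, 0, 0)"] by (simp only:)
  next
    case (2 i)
    then have "i = 0 \<or> i = 1 \<or> i = 2 \<or> i = 3" by auto
    moreover have "X 0 = C4 1 * mon (1, 0, 0, 0)" "X 1 = C4 1 * mon (0, 1, 0, 0)" "X 2 = C4 1 * mon (0, 0, 1, 0)" "X 3 = C4 1 * mon (0, 0, 0, 1)"
      by (simp_all only: C4_0 mon.simps power_0 power_one_right mult_1 mult_1_right)
    ultimately show ?case using mono by metis
  next
    case (3 F G)
    then show ?case by (rule add)
  next
    case (4 F G)
    then show ?case by (rule mult)
  qed
  then show ?thesis unfolding S_def by blast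
qed

lemma dvd_of_ord:
  assumes y: "coordsys y" and i: "i < 4" and F: "F \<noteq> 0" "int n \<le> ord_at (pdv y (X i)) (ev y F)"
  shows "X i ^ n dvd F"
  using F
proof (induction n arbitrary: F)
  case (Suc n)
  interpret dvr "pdv y (X i)" "ev y (X i)" by (rule dvr_pdv[OF y prime_elem_X[OF i]])
  have e: "ev y F \<noteq> 0" using Suc.prems(1) coordsys_ev_0[OF y] by blast
  have "ev y F \<in> maxideal (pdv y (X i))" using ord_pos_iff[OF e] Suc.prems(2) by simp
  then have "X i dvd F" using maxideal_pdv[OF y prime_elem_X[OF i]] by blast
  then obtain G where G: "F = X i * G" by (auto elim: dvdE)
  have G0: "G \<noteq> 0" "X i \<noteq> 0" using G Suc.prems(1) by auto
  have eG: "ev y G \<noteq> 0" "ev y (X i) \<noteq> 0" using G0 coordsys_ev_0[OF y] by blast+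
  have "ev y F = ev y (X i) * ev y G" unfolding G by simp
  then have "ord_at (pdv y (X i)) (ev y F) = 1 + ord_at (pdv y (X i)) (ev y G)" using ord_mult[OF eG(2,1)] ord_pi by simp
  then have "X i ^ n dvd G" using Suc.IH[OF G0(1)] Suc.prems(2) by simp
  then show ?case unfolding G power_Suc by (rule mult_dvd_mono[OF dvd_refl])
qed simp

section \<open>Restriction to test curves\<close>

lemma val_poly:
  "\<exists>A. \<forall>\<epsilon>. val (\<epsilon>, b, c, d) F = poly A \<epsilon>" "\<exists>A. \<forall>\<epsilon>. val (a, \<epsilon>, c, d) F = poly A \<epsilon>"
proof -
  have X4: "val (\<epsilon>, b, c, d) (X i) = (if i = 0 then \<epsilon> else crd (0, b, c, d) i)" "val (a, \<epsilon>, c, d) (X i) = (if i = 1 then \<epsilon> else crd (a, 0, c, d) i)" if "i < 4" for i \<epsilon>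
    using that by (auto elim!: less4E)
  show "\<exists>A. \<forall>\<epsilon>. val (\<epsilon>, b, c, d) F = poly A \<epsilon>"
  proof (induction F rule: poly4_induct)
    case (1 e) show ?case by (intro exI[of _ "[:e:]"]) simp
  next
    case (2 i) show ?case by (intro exI[of _ "if i = 0 then [:0, 1:] else [:crd (0, b, c, d) i:]"]) (use X4(1)[OF 2] in simp)
  next
    case (3 F G) then obtain A B where "\<forall>\<epsilon>. val (\<epsilon>, b, c, d) F = poly A \<epsilon>" "\<forall>\<epsilon>. val (\<epsilon>, b, c, d) G = poly B \<epsilon>" by blast
    then show ?case by (intro exI[of _ "A + B"]) simp
  next
    case (4 F G) then obtain A B where "\<forall>\<epsilon>. val (\<epsilon>, b, c, d) F = poly A \<epsilon>" "\<forall>\<epsilon>. val (\<epsilon>, b, c, d) G = poly B \<epsilon>" by blast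
    then show ?case by (intro exI[of _ "A * B"]) simp
  qed
  show "\<exists>A. \<forall>\<epsilon>. val (a, \<epsilon>, c, d) F = poly A \<epsilon>"
  proof (induction F rule: poly4_induct)
    case (1 e) show ?case by (intro exI[of _ "[:e:]"]) simp
  next
    case (2 i) show ?case by (intro exI[of _ "if i = 1 then [:0, 1:] else [:crd (a, 0, c, d) i:]"]) (use X4(2)[OF 2] in simp)
  next
    case (3 F G) then obtain A B where "\<forall>\<epsilon>. val (a, \<epsilon>, c, d) F = poly A \<epsilon>" "\<forall>\<epsilon>. val (a, \<epsilon>, c, d) G = poly B \<epsilon>" by blast
    then show ?case by (intro exI[of _ "A + B"]) simp
  next
    case (4 F G) then obtain A B where "\<forall>\<epsilon>. val (a, \<epsilon>, c, d) F = poly A \<epsilon>" "\<forall>\<epsilon>. val (a, \<epsilon>, c, d) G = poly B \<epsilon>" by blast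
    then show ?case by (intro exI[of _ "A * B"]) simp
  qed
qed

lemma val_dvd:
  "X 0 ^ n dvd F \<Longrightarrow> \<exists>A. \<forall>\<epsilon>. val (\<epsilon>, b, c, d) F = \<epsilon> ^ n * poly A \<epsilon>"
  "X 1 ^ n dvd F \<Longrightarrow> \<exists>A. \<forall>\<epsilon>. val (a, \<epsilon>, c, d) F = \<epsilon> ^ n * poly A \<epsilon>"
proof -
  assume "X 0 ^ n dvd F"
  then obtain G where G: "F = X 0 ^ n * G" by (auto elim: dvdE)
  obtain A where A: "\<forall>\<epsilon>. val (\<epsilon>, b, c, d) G = poly A \<epsilon>" using val_poly(1) by blast
  show "\<exists>A. \<forall>\<epsilon>. val (\<epsilon>, b, c, d) F = \<epsilon> ^ n * poly A \<epsilon>" by (rule exI[of _ A]) (simp add: G A)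
next
  assume "X 1 ^ n dvd F"
  then obtain G where G: "F = X 1 ^ n * G" by (auto elim: dvdE)
  obtain A where A: "\<forall>\<epsilon>. val (a, \<epsilon>, c, d) G = poly A \<epsilon>" using val_poly(2) by blast
  show "\<exists>A. \<forall>\<epsilon>. val (a, \<epsilon>, c, d) F = \<epsilon> ^ n * poly A \<epsilon>" by (rule exI[of _ A]) (simp add: G A)
qed

text \<open>Cancels the power of \<open>\<epsilon>\<close> and then the factor \<open>W\<close>:
  having nonzero constant term, \<open>W\<close> is a unit among power series, so divisibility of
  \<open>W * B\<close> by the n-th power passes to \<open>B\<close>.\<close>

lemma low_coeffs:
  fixes W B A :: "complex poly"
  assumes eq: "\<And>\<epsilon>. \<epsilon> ^ m * (poly W \<epsilon> * poly B \<epsilon>) = \<epsilon> ^ (m + n) * poly A \<epsilon>" and W: "poly.coeff W 0 \<noteq> 0" and k: "k < n"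
  shows "poly.coeff B k = 0"
proof -
  have "poly (Polynomial.monom 1 m * (W * B)) = poly (Polynomial.monom 1 (m + n) * A)"
    by (rule ext) (use eq in \<open>simp add: poly_monom\<close>)
  then have P: "Polynomial.monom 1 m * (W * B) = Polynomial.monom 1 (m + n) * A" unfolding poly_eq_poly_eq_iff .
  have WB: "poly.coeff (W * B) j = 0" if "j < n" for j
    using arg_cong[OF P, of "\<lambda>p. poly.coeff p (m + j)"] that by (simp add: coeff_monom_mult)
  show ?thesis using k
  proof (induction k rule: less_induct)
    case (less k)
    have "0 = (\<Sum>i\<le>k. poly.coeff W i * poly.coeff B (k - i))" using WB[OF less.prems] by (simp add: coeff_mult)
    also have "\<dots> = (\<Sum>i\<le>k. if i = 0 then poly.coeff W 0 * poly.coeff B k else 0)"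
      by (intro sum.cong refl) (use less in auto)
    also have "\<dots> = poly.coeff W 0 * poly.coeff B k" by simp
    finally show ?case using W by simp
  qed
qed

text \<open>The polynomials of degree at most one in \<open>x1\<close>, \<open>x3\<close> jointly. The coefficient of \<open>x0\<^sup>i x2\<^sup>k\<close> carries the index
  with the decimal digits \<open>i + 2\<close>, \<open>k + 2\<close>.\<close>

definition hf :: "(complex \<Rightarrow> 'a::comm_ring_1) \<Rightarrow> (nat \<Rightarrow> complex) \<Rightarrow> (nat \<Rightarrow> complex) \<Rightarrow> (nat \<Rightarrow> complex) \<Rightarrow> 'a \<Rightarrow> 'a \<Rightarrow> 'a \<Rightarrow> 'a \<Rightarrow> 'a \<Rightarrow> 'a" where
  "hf e p q r x y Z W G =
     (e (p 22) + e (p 32) * x + e (p 42) * x^2) * W^2 + (e (p 23) + e (p 33) * x + e (p 43) * x^2) * (Z * W)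
       + (e (p 24) + e (p 34) * x + e (p 44) * x^2) * Z^2
     + y * ((e (q 22) + e (q 32) * x) * W^2 + (e (q 23) + e (q 33) * x) * (Z * W) + (e (q 24) + e (q 34) * x) * Z^2)
     + G * ((e (r 22) + e (r 32) * x + e (r 42) * x^2) * W + (e (r 23) + e (r 33) * x + e (r 43) * x^2) * Z)"

text \<open>The arguments \<open>(Z, W, G)\<close> are homogeneous coordinates of the second plane,
  proportional to \<open>(x2, 1, x3)\<close>, and the form is quadratic in them; this is how chart
  denominators are cleared.\<close>

lemma hf_scale: "hf e p q r x y (l * Z) (l * W) (l * G) = l^2 * hf e p q r x y Z W G"
proof -
  have "P0 * (l * W)^2 + P1 * (l * Z * (l * W)) + P2 * (l * Z)^2 + y * (Q0 * (l * W)^2 + Q1 * (l * Z * (l * W)) + Q2 * (l * Z)^2)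
      + l * G * (R0 * (l * W) + R1 * (l * Z))
    = l^2 * (P0 * W^2 + P1 * (Z * W) + P2 * Z^2 + y * (Q0 * W^2 + Q1 * (Z * W) + Q2 * Z^2) + G * (R0 * W + R1 * Z))" for P0 P1 P2 Q0 Q1 Q2 R0 R1
    by (simp add: algebra_simps power2_eq_square)
  then show ?thesis unfolding hf_def by blast
qed

lemma ev_hf: "ev y (hf C4 p q r a b c d e) = hf cst p q r (ev y a) (ev y b) (ev y c) (ev y d) (ev y e)"
  and val_hf: "val v (hf C4 p q r a b c d e) = hf (\<lambda>x. x) p q r (val v a) (val v b) (val v c) (val v d) (val v e)"
  by (simp_all add: hf_def)

section \<open>Test curves through the divisors 5 and 10\<close>

context curve_blowups
begin

text \<open>The curve runs in the fifth chart with constant \<open>y = \<tau>\<close>, constant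
  \<open>u3\<close> and \<open>v5 = 0\<close>, with \<open>s = \<epsilon>\<close> as parameter.
  \<open>\<Psi>\<close> is the equation times \<open>(\<gamma>^2 * w)^2\<close>, a polynomial in the
  coordinates of that chart. Order at least four, of which one is absorbed by an explicit factor
  \<open>\<epsilon>\<close>, leaves three vanishing coefficients.\<close>

lemma curve_equations_at:
  assumes h: "h \<noteq> 0" and f: "F = hf cst p q r x y (z / w) 1 (1 / w)" "F \<noteq> 0" and o: "ord_at (VV 5) F = 4 - 2 * ord_at (VV 5) w"
    and g: "g = 1 + h * \<tau>" "g \<noteq> 0"
  shows "r 23 + r 33 + r 43 = 0"
    "h^2 * (p 24 + p 34 + p 44 + \<tau> * (q 24 + q 34)) + g * (r 22 + r 32 + r 42 - h * (r 33 + 2 * r 43)) = 0"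
    "h^2 * (p 24 + p 34 + p 44 + \<tau> * (q 24 + q 34)) + g * (h^2 * (p 34 + 2 * p 44) - h * (p 23 + p 33 + p 43) + \<tau> * (h^2 * q 34 - h * (q 23 + q 33)))
       + g^2 * (r 32 + 2 * r 42 - h * r 43) = 0"
proof -
  let ?y = "(s, y, u3, v5)"
  define \<Psi> where "\<Psi> = hf C4 p q r (1 + X 0) (X 1) (X 0 * (G^2 * (X 0 * X 2) - C4 h * G)) (X 0 ^ 2 * (X 0 ^ 2 * (G^2 * X 3) + X 0 + G)) (G^2)"
  have z: "s * (\<gamma>^2 * (s * u3) - cst h * \<gamma>) = \<gamma>^2 * w * (z / w)"
  proof -
    have "\<gamma>^2 * (s * u3) - cst h * \<gamma> = \<gamma>^2 * u1" unfolding chart_eqs(5) using \<gamma>0 by (simp add: field_simps power2_eq_square)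
    then show ?thesis using chart_eqs(2) w0 by (simp add: mult.assoc mult.left_commute)
  qed
  have w: "s^2 * (s^2 * (\<gamma>^2 * v5) + s + \<gamma>) = \<gamma>^2 * w * 1"
  proof -
    have "s^2 * (\<gamma>^2 * v5) + s + \<gamma> = \<gamma>^2 * v2" unfolding chart_eqs(6) chart_eqs(7) using \<gamma>0 by (simp add: field_simps power2_eq_square)
    moreover have "w = s * (s * v2)" using chart_eqs(3,4) by metis
    ultimately show ?thesis by (simp add: power2_eq_square mult.assoc mult.left_commute)
  qed
  have G: "\<gamma>^2 = \<gamma>^2 * w * (1 / w)" using w0 by simp
  have evG: "ev ?y G = \<gamma>" by (rule ev_G)
  have "ev ?y \<Psi> = hf cst p q r (1 + s) y (s * (\<gamma>^2 * (s * u3) - cst h * \<gamma>)) (s^2 * (s^2 * (\<gamma>^2 * v5) + s + \<gamma>)) (\<gamma>^2)"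
    unfolding \<Psi>_def ev_hf by (simp add: evG)
  also have "\<dots> = hf cst p q r x y (\<gamma>^2 * w * (z / w)) (\<gamma>^2 * w * 1) (\<gamma>^2 * w * (1 / w))"
    unfolding z w chart_eqs(1)[symmetric] G[symmetric] ..
  also have "\<dots> = (\<gamma>^2 * w)^2 * F" unfolding hf_scale f ..
  finally have ev: "ev ?y \<Psi> = (\<gamma>^2 * w)^2 * F" .
  interpret dvr "VV 5" s by (rule step_facts(6)) simp_all
  have "\<gamma> \<in> VV 5" using step_facts(5)[of 5] pring_Bring[of "cc 5" \<gamma>] \<gamma>_pring[of s u3 v5] by auto
  then have og: "0 \<le> ord_at (VV 5) \<gamma>" using ord_nonneg_iff[OF \<gamma>0] by simp
  have nz: "\<gamma>^2 * w \<noteq> 0" using \<gamma>0 w0 by simp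
  have "ord_at (VV 5) (ev ?y \<Psi>) = 4 + 4 * ord_at (VV 5) \<gamma>"
    unfolding ev using ord_mult[of "(\<gamma>^2 * w)^2" F] ord_power[OF nz, of 2] ord_mult[of "\<gamma>^2" w] ord_power[OF \<gamma>0, of 2] nz f(2) o \<gamma>0 w0 by simp
  then have "int 4 \<le> ord_at (pdv ?y (X 0)) (ev ?y \<Psi>)" using og by (simp add: VV_cc)
  moreover have "\<Psi> \<noteq> 0" using ev nz f(2) by auto
  ultimately have "X 0 ^ 4 dvd \<Psi>" by (intro dvd_of_ord[OF cs_c5]) simp_all
  \<comment> \<open>With this constant value of \<open>u3\<close> the argument \<open>Z\<close>
    restricts to \<open>- h * \<epsilon> * (\<epsilon> + g)\<close> and shares the factor
    \<open>\<epsilon> + g\<close> with \<open>W\<close>; since \<open>g\<close> is nonzero that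
    factor can be cancelled.\<close>
  moreover have "g^2 * (- h / g^2) = - h" using g(2) by simp
  then obtain b where b: "g^2 * b = - h" by blast
  ultimately obtain A where A: "\<And>\<epsilon>. val (\<epsilon>, \<tau>, b, 0) \<Psi> = \<epsilon> ^ 4 * poly A \<epsilon>" using val_dvd(1) by blast
  define P0 P1 P2 where P: "P0 = [:p 22 + p 32 + p 42, p 32 + 2 * p 42, p 42:]" "P1 = [:p 23 + p 33 + p 43, p 33 + 2 * p 43, p 43:]"
    "P2 = [:p 24 + p 34 + p 44, p 34 + 2 * p 44, p 44:]"
  define Q0 Q1 Q2 where Q: "Q0 = [:q 22 + q 32, q 32:]" "Q1 = [:q 23 + q 33, q 33:]" "Q2 = [:q 24 + q 34, q 34:]"
  define R0 R1 where R: "R0 = [:r 22 + r 32 + r 42, r 32 + 2 * r 42, r 42:]" "R1 = [:r 23 + r 33 + r 43, r 33 + 2 * r 43, r 43:]"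
  define B where "B = [:0, g, 1:] * ([:0, 0, 1:] * P0 + [:0, - h:] * P1 + [:h^2:] * P2 + [:\<tau>:] * ([:0, 0, 1:] * Q0 + [:0, - h:] * Q1 + [:h^2:] * Q2))
    + [:g^2:] * ([:0, 1:] * R0 + [:- h:] * R1)"
  have pP: "poly P0 \<epsilon> = p 22 + p 32 * (1 + \<epsilon>) + p 42 * (1 + \<epsilon>)^2" "poly P1 \<epsilon> = p 23 + p 33 * (1 + \<epsilon>) + p 43 * (1 + \<epsilon>)^2"
    "poly P2 \<epsilon> = p 24 + p 34 * (1 + \<epsilon>) + p 44 * (1 + \<epsilon>)^2" "poly Q0 \<epsilon> = q 22 + q 32 * (1 + \<epsilon>)" "poly Q1 \<epsilon> = q 23 + q 33 * (1 + \<epsilon>)"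
    "poly Q2 \<epsilon> = q 24 + q 34 * (1 + \<epsilon>)" "poly R0 \<epsilon> = r 22 + r 32 * (1 + \<epsilon>) + r 42 * (1 + \<epsilon>)^2" "poly R1 \<epsilon> = r 23 + r 33 * (1 + \<epsilon>) + r 43 * (1 + \<epsilon>)^2" for \<epsilon>
    by (simp_all add: P Q R algebra_simps power2_eq_square)
  have low: "\<epsilon> ^ 1 * (poly [:g, 1:] \<epsilon> * poly B \<epsilon>) = \<epsilon> ^ (1 + 3) * poly A \<epsilon>" for \<epsilon>
  proof -
    have vG: "val (\<epsilon>, \<tau>, b, 0) G = g" by (simp add: val_G g)
    have "g^2 * (\<epsilon> * b) = \<epsilon> * - h" unfolding b[symmetric] by (rule mult.left_commute)
    then have Z: "\<epsilon> * (g^2 * (\<epsilon> * b) - h * g) = - h * (\<epsilon> * (\<epsilon> + g))" by (simp add: algebra_simps)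
    have W: "\<epsilon>^2 * (\<epsilon>^2 * (g^2 * 0) + \<epsilon> + g) = \<epsilon> * (\<epsilon> * (\<epsilon> + g))" by (simp add: power2_eq_square)
    have "\<epsilon> ^ 4 * poly A \<epsilon> = hf (\<lambda>x. x) p q r (1 + \<epsilon>) \<tau> (\<epsilon> * (g^2 * (\<epsilon> * b) - h * g)) (\<epsilon>^2 * (\<epsilon>^2 * (g^2 * 0) + \<epsilon> + g)) (g^2)"
      unfolding A[symmetric] \<Psi>_def val_hf by (simp add: vG)
    also have "\<dots> = hf (\<lambda>x. x) p q r (1 + \<epsilon>) \<tau> (- h * (\<epsilon> * (\<epsilon> + g))) (\<epsilon> * (\<epsilon> * (\<epsilon> + g))) (g^2)" unfolding Z W ..
    also have "\<dots> = \<epsilon> ^ 1 * (poly [:g, 1:] \<epsilon> * poly B \<epsilon>)"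
      unfolding hf_def pP[symmetric] B_def by (simp add: algebra_simps power2_eq_square)
    finally show ?thesis by simp
  qed
  have c: "poly.coeff B 0 = 0" "poly.coeff B 1 = 0" "poly.coeff B 2 = 0" using low_coeffs[OF low] g(2) by simp_all
  show "r 23 + r 33 + r 43 = 0" using c(1) g h by (simp add: B_def P Q R)
  have "g * (h^2 * (p 24 + p 34 + p 44 + \<tau> * (q 24 + q 34)) + g * (r 22 + r 32 + r 42 - h * (r 33 + 2 * r 43))) = 0"
    using c(2) by (simp add: B_def P Q R algebra_simps power2_eq_square)
  then show "h^2 * (p 24 + p 34 + p 44 + \<tau> * (q 24 + q 34)) + g * (r 22 + r 32 + r 42 - h * (r 33 + 2 * r 43)) = 0"
    using g(2) by simp
  show "h^2 * (p 24 + p 34 + p 44 + \<tau> * (q 24 + q 34)) + g * (h^2 * (p 34 + 2 * p 44) - h * (p 23 + p 33 + p 43) + \<tau> * (h^2 * q 34 - h * (q 23 + q 33)))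
       + g^2 * (r 32 + 2 * r 42 - h * r 43) = 0"
    using c(3) by (simp add: B_def P Q R numeral_2_eq_2 algebra_simps)
qed

end

section \<open>The test curve through the divisor 17\<close>

lemma diag_form:
  fixes s3 t u v s :: "'a::field"
  assumes nz: "s3 \<noteq> 0" "t \<noteq> 0" "v \<noteq> 0" and s: "s = s3 * t"
  shows "hf e p q r (1 / t) (1 / (s * t)) (u / v) 1 (1 / (s * v)) * (s^2 * t * v)^2 =
    (s3 * t)^3 * (s3 * t * ((e (p 22) * t^2 + e (p 32) * t + e (p 42)) * v^2 + (e (p 23) * t^2 + e (p 33) * t + e (p 43)) * (u * v)
        + (e (p 24) * t^2 + e (p 34) * t + e (p 44)) * u^2)
      + ((e (q 22) * t + e (q 32)) * v^2 + (e (q 23) * t + e (q 33)) * (u * v) + (e (q 24) * t + e (q 34)) * u^2)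
      + ((e (r 22) * t^2 + e (r 32) * t + e (r 42)) * v + (e (r 23) * t^2 + e (r 33) * t + e (r 43)) * u))"
proof -
  have 2: "a + b * (1 / t) + c * (1 / t)^2 = (a * t^2 + b * t + c) / t^2" "a + b * (1 / t) = (a * t + b) / t" for a b c
    using nz(2) by (simp_all add: field_simps power2_eq_square)
  have "(A0 / t^2 * 1^2 + A1 / t^2 * (u / v * 1) + A2 / t^2 * (u / v)^2 + 1 / (s * t) * (B0 / t * 1^2 + B1 / t * (u / v * 1) + B2 / t * (u / v)^2)
      + 1 / (s * v) * (D0 / t^2 * 1 + D1 / t^2 * (u / v))) * (s^2 * t * v)^2
    = (s3 * t)^3 * (s3 * t * (A0 * v^2 + A1 * (u * v) + A2 * u^2) + (B0 * v^2 + B1 * (u * v) + B2 * u^2) + (D0 * v + D1 * u))" for A0 A1 A2 B0 B1 B2 D0 D1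
    unfolding s using nz by (simp add: field_simps power2_eq_square power3_eq_cube)
  then show ?thesis unfolding hf_def 2(1) unfolding 2(2) .
qed

definition dform where "dform e cp cq cr T S U V = S * T * ((e (cp 22) * T^2 + e (cp 32) * T + e (cp 42)) * V^2 + (e (cp 23) * T^2 + e (cp 33) * T + e (cp 43)) * (U * V)
        + (e (cp 24) * T^2 + e (cp 34) * T + e (cp 44)) * U^2)
      + ((e (cq 22) * T + e (cq 32)) * V^2 + (e (cq 23) * T + e (cq 33)) * (U * V) + (e (cq 24) * T + e (cq 34)) * U^2)
      + ((e (cr 22) * T^2 + e (cr 32) * T + e (cr 42)) * V + (e (cr 23) * T^2 + e (cr 33) * T + e (cr 43)) * U)"
  for cp cq cr :: "nat \<Rightarrow> complex" and T :: "'a::comm_ring_1"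

lemma val_dform: "val v (dform C4 p q r T S U V) = dform (\<lambda>x. x) p q r (val v T) (val v S) (val v U) (val v V)"
  by (simp add: dform_def)

context diag_blowups
begin

lemma chart_polys:
  "v = t * (t * (t * r3) - 1)" "u = 1 + t * (1 + cst h + t * q)" "q = - 2 * r3 - s3 * cst (1 / h) + t * m" "r3 = - s3 * cst (1 / h) + t * n"
  "m = cst (1 / 2) * n + cst ((1 + h) / h) * s3 + t * l" "s = s3 * t"
  using t0 h0 by (simp_all add: v1_def p_def e2_def r_def r3_def e3_def q_def s3_def e4_def m_def e5_def n_def e6_def l_def cst_divide cst_hom cst_numeral field_simps)

text \<open>The earlier coordinates as polynomials in those of the last chart,
  \<open>(s3, t, n, l)\<close>: \<open>dR\<close>, \<open>dM\<close>, \<open>dQ\<close>,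
  \<open>dU\<close>, \<open>dV\<close> stand for \<open>r3\<close>, \<open>m\<close>,
  \<open>q\<close>, \<open>u\<close>, \<open>v\<close>.\<close>

definition "dR = C4 (- 1 / h) * X 0 + X 1 * X 2"
definition "dM = C4 (1 / 2) * X 2 + C4 ((1 + h) / h) * X 0 + X 1 * X 3"
definition "dQ = C4 (- 2) * dR + C4 (- 1 / h) * X 0 + X 1 * dM"
definition "dU = 1 + X 1 * (C4 (1 + h) + X 1 * dQ)"
definition "dV = X 1 * (X 1 * (X 1 * dR) - 1)"

lemma ev_d: "ev (s3, t, n, l) dU = u" "ev (s3, t, n, l) dV = v"
proof -
  have R: "ev (s3, t, n, l) dR = r3" unfolding chart_polys(4) by (simp add: dR_def cst_hom cst_divide)
  have M: "ev (s3, t, n, l) dM = m" unfolding chart_polys(5) by (simp add: dM_def)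
  have "ev (s3, t, n, l) dQ = - 2 * r3 - s3 * cst (1 / h) + t * m" by (simp add: dQ_def R M cst_hom cst_divide cst_numeral)
  then have Q: "ev (s3, t, n, l) dQ = q" unfolding chart_polys(3)[symmetric] .
  have "ev (s3, t, n, l) dU = 1 + t * (1 + cst h + t * q)" by (simp add: dU_def Q cst_hom)
  then show "ev (s3, t, n, l) dU = u" unfolding chart_polys(2)[symmetric] .
  have "ev (s3, t, n, l) dV = t * (t * (t * r3) - 1)" by (simp add: dV_def R)
  then show "ev (s3, t, n, l) dV = v" unfolding chart_polys(1)[symmetric] .
qed

text \<open>On the curve \<open>s3 = h * \<sigma>\<close>, \<open>n = l = 0\<close> with parameter
  \<open>t = \<epsilon>\<close> one gets \<open>r3 = - \<sigma>\<close> and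
  \<open>q = \<sigma> + \<epsilon> * \<eta> * \<sigma>\<close>. Hence \<open>u\<close> and
  \<open>v\<close> become \<open>1 + \<eta> * \<epsilon>\<close> and \<open>- \<epsilon>\<close>
  times the common factor \<open>1 + \<sigma> * \<epsilon>^2\<close>. Order eight minus the explicit
  factor of order three leaves five vanishing coefficients; \<open>P0\<close> to \<open>R3\<close>
  are the coefficients of the three blocks in \<open>\<epsilon>\<close>.\<close>

lemma diag_equations_at:
  assumes f: "F = hf cst cp cq cr (1 / t) (1 / (s * t)) (u / v) 1 (1 / (s * v))" "F \<noteq> 0"
    and o: "ord_at (VV 6) F = 8 - 2 * ord_at (VV 6) (s^2 * t * v)" and \<sigma>: "\<sigma> \<noteq> 0" and \<eta>: "\<eta> = 1 + h"
    and P: "P0 = cp 44" "P1 = - cp 43 + cp 34 + 2 * \<eta> * cp 44" "P2 = cp 42 - cp 33 - \<eta> * cp 43 + cp 24 + 2 * \<eta> * cp 34 + \<eta>^2 * cp 44"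
      "P3 = cp 32 - cp 23 - \<eta> * cp 33 + 2 * \<eta> * cp 24 + \<eta>^2 * cp 34"
    and Q: "Q0 = cq 34" "Q1 = - cq 33 + cq 24 + 2 * \<eta> * cq 34" "Q2 = cq 32 - cq 23 - \<eta> * cq 33 + 2 * \<eta> * cq 24 + \<eta>^2 * cq 34" "Q3 = cq 22 - \<eta> * cq 23 + \<eta>^2 * cq 24"
    and R: "R0 = cr 43" "R1 = - cr 42 + cr 33 + \<eta> * cr 43" "R2 = - cr 32 + cr 23 + \<eta> * cr 33" "R3 = - cr 22 + \<eta> * cr 23"
  shows "Q0 + R0 = 0" "h * \<sigma> * P0 + Q1 + R1 = 0" "h * \<sigma> * P1 + Q2 + \<sigma> * Q0 + R2 = 0" "h * \<sigma> * (P2 + \<sigma> * P0) + Q3 + \<sigma> * Q1 + R3 = 0"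
    "h * (P3 + \<sigma> * P1) + Q2 = 0"
proof -
  let ?y = "(s3, t, n, l)"
  define \<Psi> where "\<Psi> = (X 0 * X 1)^3 * dform C4 cp cq cr (X 1) (X 0) dU dV"
  have nz: "s3 \<noteq> 0" "v \<noteq> 0" "s \<noteq> 0" using crd_neq_0[OF cs_c6, of 0] crd_neq_0[OF cs0, of 3] crd_neq_0[OF cs0, of 0] by simp_all
  have zz: "s^2 * t * v \<noteq> 0" using nz t0 by simp
  have evf: "ev ?y (dform C4 cp cq cr (X 1) (X 0) dU dV) = dform cst cp cq cr t s3 u v"
    unfolding dform_def by (simp add: ev_d)
  have "ev ?y \<Psi> = (s3 * t)^3 * dform cst cp cq cr t s3 u v" unfolding \<Psi>_def ev_hom evf by simp
  also have "\<dots> = F * (s^2 * t * v)^2"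
    unfolding f(1) dform_def by (rule diag_form[OF nz(1) t0 nz(2) chart_polys(6), symmetric])
  finally have ev: "ev ?y \<Psi> = F * (s^2 * t * v)^2" .
  interpret dvr "VV 6" t by (rule step_facts(6)) simp_all
  have VV: "VV 6 = pdv ?y (X 1)" by (simp add: VV_def)
  have "ord_at (VV 6) (F * (s^2 * t * v)^2) = 8" using ord_mult[of F "(s^2 * t * v)^2"] ord_power[OF zz, of 2] zz f(2) o by simp
  then have o8: "int 8 \<le> ord_at (pdv ?y (X 1)) (ev ?y \<Psi>)" unfolding ev VV by simp
  have "\<Psi> \<noteq> 0" using ev zz f(2) by auto
  then have "X 1 ^ 8 dvd \<Psi>" by (intro dvd_of_ord[OF cs_c6 _ _ o8]) simp_all
  then obtain A where A: "\<And>\<epsilon>. val (h * \<sigma>, \<epsilon>, 0, 0) \<Psi> = \<epsilon> ^ 8 * poly A \<epsilon>" using val_dvd(2) by blast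
  define B where "B = [:0, h * \<sigma>:] * [:1, 0, \<sigma>:] * [:P0, P1, P2, P3, cp 22 - \<eta> * cp 23 + \<eta>^2 * cp 24:] + [:1, 0, \<sigma>:] * [:Q0, Q1, Q2, Q3:] + [:R0, R1, R2, R3:]"
  have low: "\<epsilon> ^ 3 * (poly [:(h * \<sigma>)^3, 0, (h * \<sigma>)^3 * \<sigma>:] \<epsilon> * poly B \<epsilon>) = \<epsilon> ^ (3 + 5) * poly A \<epsilon>" for \<epsilon>
  proof -
    let ?v = "(h * \<sigma>, \<epsilon>, 0, 0)"
    define w a where wa: "w = 1 + \<sigma> * \<epsilon>^2" "a = 1 + \<eta> * \<epsilon>"
    have dR: "val ?v dR = - \<sigma>" using h0 by (simp add: dR_def)
    have dM: "val ?v dM = \<eta> * \<sigma>" using h0 by (simp add: dM_def \<eta>)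
    have dQ: "val ?v dQ = \<sigma> + \<epsilon> * (\<eta> * \<sigma>)" using h0 by (simp add: dQ_def dR dM)
    have "val ?v dU = 1 + \<epsilon> * ((1 + h) + \<epsilon> * (\<sigma> + \<epsilon> * (\<eta> * \<sigma>)))" by (simp add: dU_def dQ)
    also have "\<dots> = w * a" unfolding wa \<eta> by (simp add: algebra_simps power2_eq_square)
    finally have dU: "val ?v dU = w * a" .
    have "val ?v dV = \<epsilon> * (\<epsilon> * (\<epsilon> * - \<sigma>) - 1)" by (simp add: dV_def dR)
    also have "\<dots> = - (\<epsilon> * w)" unfolding wa by (simp add: algebra_simps power2_eq_square)
    finally have dV: "val ?v dV = - (\<epsilon> * w)" .
    have "\<epsilon> ^ 8 * poly A \<epsilon> = (h * \<sigma> * \<epsilon>)^3 * dform (\<lambda>x. x) cp cq cr \<epsilon> (h * \<sigma>) (w * a) (- (\<epsilon> * w))"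
      unfolding A[symmetric] \<Psi>_def by (simp add: val_dform dU dV)
    also have "dform (\<lambda>x. x) cp cq cr \<epsilon> (h * \<sigma>) (w * a) (- (\<epsilon> * w)) = w *
       (h * \<sigma> * \<epsilon> * w * ((cp 22 * \<epsilon>^2 + cp 32 * \<epsilon> + cp 42) * \<epsilon>^2 - (cp 23 * \<epsilon>^2 + cp 33 * \<epsilon> + cp 43) * (a * \<epsilon>) + (cp 24 * \<epsilon>^2 + cp 34 * \<epsilon> + cp 44) * a^2)
        + w * ((cq 22 * \<epsilon> + cq 32) * \<epsilon>^2 - (cq 23 * \<epsilon> + cq 33) * (a * \<epsilon>) + (cq 24 * \<epsilon> + cq 34) * a^2)
        + (- (cr 22 * \<epsilon>^2 + cr 32 * \<epsilon> + cr 42) * \<epsilon> + (cr 23 * \<epsilon>^2 + cr 33 * \<epsilon> + cr 43) * a))"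
    proof -
      have "h * \<sigma> * \<epsilon> * (A0 * (- (\<epsilon> * w))^2 + A1 * (w * a * - (\<epsilon> * w)) + A2 * (w * a)^2) + (B0 * (- (\<epsilon> * w))^2 + B1 * (w * a * - (\<epsilon> * w)) + B2 * (w * a)^2)
          + (D0 * - (\<epsilon> * w) + D1 * (w * a))
        = w * (h * \<sigma> * \<epsilon> * w * (A0 * \<epsilon>^2 - A1 * (a * \<epsilon>) + A2 * a^2) + w * (B0 * \<epsilon>^2 - B1 * (a * \<epsilon>) + B2 * a^2) + (- D0 * \<epsilon> + D1 * a))" for A0 A1 A2 B0 B1 B2 D0 D1
        by (simp add: algebra_simps power2_eq_square)
      then show ?thesis unfolding dform_def .
    qed
    also have "(cp 22 * \<epsilon>^2 + cp 32 * \<epsilon> + cp 42) * \<epsilon>^2 - (cp 23 * \<epsilon>^2 + cp 33 * \<epsilon> + cp 43) * (a * \<epsilon>) + (cp 24 * \<epsilon>^2 + cp 34 * \<epsilon> + cp 44) * a^2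
        = poly [:P0, P1, P2, P3, cp 22 - \<eta> * cp 23 + \<eta>^2 * cp 24:] \<epsilon>" by (simp add: P wa algebra_simps power2_eq_square)
    also have "(cq 22 * \<epsilon> + cq 32) * \<epsilon>^2 - (cq 23 * \<epsilon> + cq 33) * (a * \<epsilon>) + (cq 24 * \<epsilon> + cq 34) * a^2 = poly [:Q0, Q1, Q2, Q3:] \<epsilon>"
      by (simp add: Q wa algebra_simps power2_eq_square)
    also have "- (cr 22 * \<epsilon>^2 + cr 32 * \<epsilon> + cr 42) * \<epsilon> + (cr 23 * \<epsilon>^2 + cr 33 * \<epsilon> + cr 43) * a = poly [:R0, R1, R2, R3:] \<epsilon>"
      by (simp add: R wa algebra_simps power2_eq_square)
    also have "(h * \<sigma> * \<epsilon>)^3 * (w * (h * \<sigma> * \<epsilon> * w * poly [:P0, P1, P2, P3, cp 22 - \<eta> * cp 23 + \<eta>^2 * cp 24:] \<epsilon> + w * poly [:Q0, Q1, Q2, Q3:] \<epsilon> + poly [:R0, R1, R2, R3:] \<epsilon>))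
        = \<epsilon> ^ 3 * (poly [:(h * \<sigma>)^3, 0, (h * \<sigma>)^3 * \<sigma>:] \<epsilon> * poly B \<epsilon>)"
    proof -
      have pw: "poly [:(h * \<sigma>)^3, 0, (h * \<sigma>)^3 * \<sigma>:] \<epsilon> = (h * \<sigma>)^3 * w" "poly [:1, 0, \<sigma>:] \<epsilon> = w" "poly [:0, h * \<sigma>:] \<epsilon> = h * \<sigma> * \<epsilon>"
        by (simp_all add: wa algebra_simps power2_eq_square)
      show ?thesis unfolding B_def poly_add poly_mult pw unfolding power_mult_distrib by (simp only: mult_ac)
    qed
    finally show ?thesis by simp
  qed
  have c: "poly.coeff B k = 0" if "k < 5" for k by (rule low_coeffs[OF low _ that]) (use h0 \<sigma> in simp)
  have B: "B = [:Q0 + R0, h * \<sigma> * P0 + Q1 + R1, h * \<sigma> * P1 + Q2 + \<sigma> * Q0 + R2, h * \<sigma> * (P2 + \<sigma> * P0) + Q3 + \<sigma> * Q1 + R3, h * \<sigma> * (P3 + \<sigma> * P1) + \<sigma> * Q2,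
      h * \<sigma> * (cp 22 - \<eta> * cp 23 + \<eta>^2 * cp 24 + \<sigma> * P2) + \<sigma> * Q3, h * \<sigma> * \<sigma> * P3, h * \<sigma> * \<sigma> * (cp 22 - \<eta> * cp 23 + \<eta>^2 * cp 24):]"
    unfolding B_def by (simp add: distrib_left distrib_right mult.assoc add.assoc)
  have s: "\<sigma> * (h * (P3 + \<sigma> * P1) + Q2) = 0" using c[of 4] unfolding B by (simp add: eval_nat_numeral distrib_left distrib_right mult_ac)
  then show "h * (P3 + \<sigma> * P1) + Q2 = 0" using \<sigma> by simp
  show "Q0 + R0 = 0" using c[of 0] unfolding B by simp
  show "h * \<sigma> * P0 + Q1 + R1 = 0" using c[of 1] unfolding B by simp
  show "h * \<sigma> * P1 + Q2 + \<sigma> * Q0 + R2 = 0" using c[of 2] unfolding B by (simp add: eval_nat_numeral)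
  show "h * \<sigma> * (P2 + \<sigma> * P0) + Q3 + \<sigma> * Q1 + R3 = 0" using c[of 3] unfolding B by (simp add: eval_nat_numeral)
qed

end

context curve_blowups
begin

text \<open>Two values of \<open>\<tau>\<close> separate the equations, \<open>\<tau> = 0\<close>
  with \<open>g = 1\<close> and \<open>\<tau> = 1 / h\<close> with \<open>g = 2\<close>; for both,
  \<open>1 + h * \<tau>\<close> is nonzero for every \<open>h\<close>.\<close>

lemma curve_equations:
  assumes h: "h \<noteq> 0" and f: "F = hf cst p q r x y (z / w) 1 (1 / w)" "F \<noteq> 0" and o: "ord_at (VV 5) F = 4 - 2 * ord_at (VV 5) w"
  shows "r 23 + r 33 + r 43 = 0" "h^2 * (p 24 + p 34 + p 44) + (r 22 + r 32 + r 42 - h * (r 33 + 2 * r 43)) = 0"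
    "h * (q 24 + q 34) + (r 22 + r 32 + r 42 - h * (r 33 + 2 * r 43)) = 0"
    "h^2 * (p 24 + p 34 + p 44) + (h^2 * (p 34 + 2 * p 44) - h * (p 23 + p 33 + p 43)) + (r 32 + 2 * r 42 - h * r 43) = 0"
    "h * q 34 - (q 23 + q 33) + (r 32 + 2 * r 42 - h * r 43) = 0"
proof -
  note a = curve_equations_at[OF h f o, of 1 0, simplified] and b = curve_equations_at[OF h f o, of 2 "1 / h"]
  have g: "(2 :: complex) = 1 + h * (1 / h)" "(2 :: complex) \<noteq> 0" using h by simp_all
  have e: "h^2 * (P + 1 / h * Q) = h^2 * P + h * Q" "1 / h * (h^2 * P - h * Q) = h * P - Q" for P Q :: complex
    using h by (simp_all add: distrib_left right_diff_distrib power2_eq_square)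
  define T1 T2 U S W where d: "T1 = r 22 + r 32 + r 42 - h * (r 33 + 2 * r 43)" "T2 = r 32 + 2 * r 42 - h * r 43" "U = h^2 * (p 24 + p 34 + p 44)"
    "S = h^2 * (p 34 + 2 * p 44) - h * (p 23 + p 33 + p 43)" "W = h * q 34 - (q 23 + q 33)"
  have a2: "U + T1 = 0" and a3: "U + S + T2 = 0" using a(2,3) unfolding d by simp_all
  have b2: "U + h * (q 24 + q 34) + 2 * T1 = 0" using b(2)[OF g] unfolding d e .
  have b3: "U + h * (q 24 + q 34) + 2 * (S + W) + 2^2 * T2 = 0" using b(3)[OF g] unfolding d e .
  show "r 23 + r 33 + r 43 = 0" using a(1) .
  show "h^2 * (p 24 + p 34 + p 44) + (r 22 + r 32 + r 42 - h * (r 33 + 2 * r 43)) = 0" using a2 unfolding d .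
  have "h * (q 24 + q 34) + T1 = (U + h * (q 24 + q 34) + 2 * T1) - (U + T1)" by simp
  then have "h * (q 24 + q 34) + T1 = 0" unfolding a2 b2 by simp
  then show "h * (q 24 + q 34) + (r 22 + r 32 + r 42 - h * (r 33 + 2 * r 43)) = 0" unfolding d .
  show "h^2 * (p 24 + p 34 + p 44) + (h^2 * (p 34 + 2 * p 44) - h * (p 23 + p 33 + p 43)) + (r 32 + 2 * r 42 - h * r 43) = 0" using a3 unfolding d .
  have "2 * (W + T2) = (U + h * (q 24 + q 34) + 2 * (S + W) + 2^2 * T2) - (U + h * (q 24 + q 34) + 2 * T1) - 2 * (U + S + T2) + 2 * (U + T1)"
    by (simp add: algebra_simps)
  then have "2 * (W + T2) = 0" unfolding a2 a3 b2 b3 by (simp only: mult_zero_right diff_zero add_0_right)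
  then have "W + T2 = 0" by (simp only: mult_eq_0_iff) simp
  then show "h * q 34 - (q 23 + q 33) + (r 32 + 2 * r 42 - h * r 43) = 0" unfolding d .
qed

end

section \<open>The linear system for the coefficients\<close>

lemma plus_minus_zero: "a + b = 0 \<Longrightarrow> - a + b = 0 \<Longrightarrow> a = 0 \<and> b = (0::complex)"
proof -
  assume "a + b = 0" "- a + b = 0"
  moreover have "2 * b = (a + b) + (- a + b)" by simp
  ultimately have "b = 0" by simp
  then show "a = 0 \<and> b = 0" using \<open>a + b = 0\<close> by simp
qed

text \<open>The equations \<open>E\<close> come from divisor 5, \<open>F\<close> from divisor 10,
  \<open>G\<close> and \<open>H\<close> from divisor 17. Here \<open>A\<close> is the coefficient of
  \<open>x0^2 * x3\<close>, \<open>B\<close> that of \<open>x1 * x2^2\<close>, and \<open>c\<close>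
  the common coefficient of \<open>x0^2 * x2\<close> and \<open>x0 * x2^2\<close>. Each elimination
  step writes its target as an explicit combination of the equations; in the end everything is
  expressed by \<open>A\<close> and \<open>c\<close>.\<close>

lemma solve_system:
  fixes h :: complex
  assumes h: "h \<noteq> 0"
    and E1: "r23 + r33 = 0" and E2: "h^2 * (p24 + c) + (r22 + r32 + A - h * r33) = 0" and E3: "h * B + (r22 + r32 + A - h * r33) = 0"
    and E4: "h^2 * (p24 + c) + (h^2 * c - h * (p23 + p33 + c)) + (r32 + 2 * A) = 0" and E5: "- (q23 + q33) + (r32 + 2 * A) = 0"
    and F1: "q32 + q33 = 0" and F2: "h^2 * (p42 + c) + (q22 + q23 + B - h * q33) = 0" and F3: "h * A + (q22 + q23 + B - h * q33) = 0"
    and F4: "h^2 * (p42 + c) + (h^2 * c - h * (p32 + p33 + c)) + (q23 + 2 * B) = 0" and F5: "- (r32 + r33) + (q23 + 2 * B) = 0"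
    and G1: "- q33 + B - A + r33 = 0" and G2: "q32 - q23 - (1 + h) * q33 + 2 * (1 + h) * B - r32 + r23 + (1 + h) * r33 = 0"
    and G3: "q22 - (1 + h) * q23 + (1 + h)^2 * B - r22 + (1 + h) * r23 = 0"
    and H2: "h * (p42 - p33 - (1 + h) * c + p24 + 2 * (1 + h) * c) - q33 + B = 0"
    and H3: "h * (p32 - p23 - (1 + h) * p33 + 2 * (1 + h) * p24 + (1 + h)^2 * c) + (q32 - q23 - (1 + h) * q33 + 2 * (1 + h) * B) = 0"
  shows "B = A" "p32 = 2 * A" "p23 = 2 * A" "h * p42 = A - h * c" "h * p24 = A - h * c" "h * p33 = A + (h^2 - h) * c" "q33 = 2 * A" "r33 = 2 * A"
    "q32 = - 2 * A" "r23 = - 2 * A" "q23 = (h - 1) * A" "r32 = (h - 1) * A" "q22 = 0" "r22 = 0"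
proof -
  have "h * (h * p42 - A + h * c) = (h^2 * (p42 + c) + (q22 + q23 + B - h * q33)) - (h * A + (q22 + q23 + B - h * q33))"
    by (simp add: algebra_simps power2_eq_square)
  then have X42: "h * p42 - A + h * c = 0" unfolding F2 F3 using h by simp
  have "h * (h * p24 - B + h * c) = (h^2 * (p24 + c) + (r22 + r32 + A - h * r33)) - (h * B + (r22 + r32 + A - h * r33))"
    by (simp add: algebra_simps power2_eq_square)
  then have X24: "h * p24 - B + h * c = 0" unfolding E2 E3 using h by simp
  have "2 * r33 - 3 * A - B = (- q33 + B - A + r33) - (- (q23 + q33) + (r32 + 2 * A)) - (- (r32 + r33) + (q23 + 2 * B))" by simp
  then have z1: "2 * r33 - 3 * A - B = 0" unfolding G1 E5 F5 by simp
  have "2 * q33 - A - 3 * B = - ((- q33 + B - A + r33) + (- (q23 + q33) + (r32 + 2 * A)) + (- (r32 + r33) + (q23 + 2 * B)))" by simp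
  then have z2: "2 * q33 - A - 3 * B = 0" unfolding G1 E5 F5 by simp
  have "2 * (q23 + r32) - (2 * h - 2) * (A + B) = - 2 * ((q32 - q23 - (1 + h) * q33 + 2 * (1 + h) * B - r32 + r23 + (1 + h) * r33) - (q32 + q33) - (r23 + r33))
    - (2 + h) * (2 * q33 - A - 3 * B) + h * (2 * r33 - 3 * A - B)" by (simp add: algebra_simps)
  then have z3: "2 * (q23 + r32) - (2 * h - 2) * (A + B) = 0" unfolding G2 F1 E1 z1 z2 by simp
  have "2 * (q23 - r32) - 3 * (A - B) = - 2 * (- (q23 + q33) + (r32 + 2 * A)) - (2 * q33 - A - 3 * B)" by (simp add: algebra_simps)
  then have z4: "2 * (q23 - r32) - 3 * (A - B) = 0" unfolding E5 z2 by simp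
  have "2 * (h * p33) - (A + B) - 2 * (h^2 - h) * c = - 2 * (h * (p42 - p33 - (1 + h) * c + p24 + 2 * (1 + h) * c) - q33 + B)
    + 2 * (h * p42 - A + h * c) + 2 * (h * p24 - B + h * c) - (2 * q33 - A - 3 * B)" by (simp add: algebra_simps power2_eq_square)
  then have z6: "2 * (h * p33) - (A + B) - 2 * (h^2 - h) * c = 0" unfolding H2 X42 X24 z2 by simp
  have "(A - B) * (2 * h + 9) = - 4 * (h * (p32 - p23 - (1 + h) * p33 + 2 * (1 + h) * p24 + (1 + h)^2 * c) + (q32 - q23 - (1 + h) * q33 + 2 * (1 + h) * B))
    - 4 * (h^2 * (p42 + c) + (h^2 * c - h * (p32 + p33 + c)) + (q23 + 2 * B)) + 4 * (h^2 * (p24 + c) + (h^2 * c - h * (p23 + p33 + c)) + (r32 + 2 * A))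
    + 4 * h * (h * p42 - A + h * c) - 4 * h * (h * p24 - B + h * c) - 2 * (1 + h) * (2 * (h * p33) - (A + B) - 2 * (h^2 - h) * c)
    + 8 * (1 + h) * (h * p24 - B + h * c) + 4 * (q32 + q33) - 2 * (2 + h) * (2 * q33 - A - 3 * B) - (2 * (q23 + r32) - (2 * h - 2) * (A + B)) + (2 * (q23 - r32) - 3 * (A - B))"
    by (simp add: algebra_simps power2_eq_square)
  then have e1: "(A - B) * (2 * h + 9) = 0" unfolding H3 F4 E4 X42 X24 z6 F1 z2 z3 z4 by simp
  have "(A - B) * (2 * h^2 + 17 * h + 9) = - 4 * (q22 - (1 + h) * q23 + (1 + h)^2 * B - r22 + (1 + h) * r23) + 4 * (h * A + (q22 + q23 + B - h * q33))
    - 4 * (h * B + (r22 + r32 + A - h * r33)) + 4 * (1 + h) * (r23 + r33) - (2 + h) * ((2 * (q23 + r32) - (2 * h - 2) * (A + B)) + (2 * (q23 - r32) - 3 * (A - B)))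
    + ((2 * (q23 + r32) - (2 * h - 2) * (A + B)) - (2 * (q23 - r32) - 3 * (A - B))) - 2 * (1 + 2 * h) * (2 * r33 - 3 * A - B) + 2 * h * (2 * q33 - A - 3 * B)"
    by (simp add: algebra_simps power2_eq_square)
  then have e2: "(A - B) * (2 * h^2 + 17 * h + 9) = 0" unfolding G3 F3 E3 E1 z1 z2 z3 z4 by simp
  \<comment> \<open>Either factor may vanish for a special \<open>h\<close>, but the two have no
    common root: \<open>(h + 4) * (2 * h + 9)\<close> exceeds the quadratic by 27. So
    \<open>A = B\<close> without restriction on \<open>h\<close>.\<close>
  have "27 * (A - B) = (h + 4) * ((A - B) * (2 * h + 9)) - (A - B) * (2 * h^2 + 17 * h + 9)" by (simp add: algebra_simps power2_eq_square)
  then have "A - B = 0" unfolding e1 e2 by simp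
  then show B: "B = A" by simp
  show q33: "q33 = 2 * A" and r33: "r33 = 2 * A" using z1 z2 unfolding B by simp_all
  show q32: "q32 = - 2 * A" and r23: "r23 = - 2 * A" using F1 E1 unfolding q33 r33 by (simp_all add: eq_neg_iff_add_eq_0)
  have "4 * q23 = 4 * ((h - 1) * A)" "4 * r32 = 4 * ((h - 1) * A)" using z3 z4 unfolding B by (simp_all add: algebra_simps)
  then show q23: "q23 = (h - 1) * A" and r32: "r32 = (h - 1) * A" by simp_all
  show "h * p42 = A - h * c" "h * p24 = A - h * c" using X42 X24 unfolding B by (simp_all add: algebra_simps)
  have "2 * (h * p33) = 2 * (A + (h^2 - h) * c)" using z6 unfolding B by (simp add: algebra_simps)
  then show p33: "h * p33 = A + (h^2 - h) * c" by (simp only: mult_cancel_left) simp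
  have "q22 = (h * A + (q22 + q23 + B - h * q33)) - (h * A + (q23 + B - h * q33))" by simp
  then show "q22 = 0" unfolding F3 unfolding q23 B q33 by (simp add: algebra_simps)
  have "r22 = (h * B + (r22 + r32 + A - h * r33)) - (h * B + (r32 + A - h * r33))" by simp
  then show "r22 = 0" unfolding E3 unfolding r32 B r33 by (simp add: algebra_simps)
  have "h * p23 = h * (h * p24 - B + h * c) + h * B + h^2 * c - h * p33 - h * c + (r32 + 2 * A)
      - (h^2 * (p24 + c) + (h^2 * c - h * (p23 + p33 + c)) + (r32 + 2 * A))" by (simp add: algebra_simps power2_eq_square)
  then have "h * p23 = h * (2 * A)" unfolding E4 X24 unfolding p33 r32 B by (simp add: algebra_simps power2_eq_square)
  then show "p23 = 2 * A" using h by simp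
  have "h * p32 = h * (h * p42 - A + h * c) + h * A + h^2 * c - h * p33 - h * c + (q23 + 2 * B)
      - (h^2 * (p42 + c) + (h^2 * c - h * (p32 + p33 + c)) + (q23 + 2 * B))" by (simp add: algebra_simps power2_eq_square)
  then have "h * p32 = h * (2 * A)" unfolding F4 X42 unfolding p33 q23 B by (simp add: algebra_simps power2_eq_square)
  then show "p32 = 2 * A" using h by simp
qed

section \<open>Orders of the invariants along the divisors 11 to 17\<close>

lemma diag_regroup:
  fixes s t :: "'a::comm_ring_1"
  shows "a * (s^2 * t * v)^2 + b * (s^4 * B) + c * (s^4 * C + s^3 * D) = s^4 * (a * (t * v)^2 + b * B + c * C) + s^3 * (c * D)"
    "s^4 * A + s^3 * B = s^3 * (s * A + B)"
    "s^4 * (a * (t * (t * v))^2 + b * (k * (t * B)) + c * (t^2 * C)) + s^3 * (c * (t * D))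
      = t^1 * (s^4 * (t * (a * (t * v)^2 + c * C) + b * (k * B)) + s^3 * (c * D))"
    "t^1 * (s^4 * (t * (a * (t * v)^2 + c * C) + b * (k * (t * B))) + s^3 * (c * (t * D)))
      = t^2 * (s^4 * (a * (t * v)^2 + b * (k * B) + c * C) + s^3 * (c * D))"
    "t^2 * ((s3 * t)^4 * (a * (t * v)^2 + b * (k * (t * B)) + c * C) + (s3 * t)^3 * (c * (t * D)))
      = t^6 * (s3^4 * (t * (a * t * v^2 + b * (k * B))) + s3^3 * (c * (D + s3 * C)))"
    "t^6 * (s3^4 * (t * (a * t * v^2 + b * (k * (t * B)))) + s3^3 * (c * (t * D)))
      = t^7 * (s3^4 * (t * (a * v^2 + b * (k * B))) + s3^3 * (c * D))"
    "t^7 * (s3^4 * (t * (a * v^2 + b * (k * B))) + s3^3 * (c * (t * D)))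
      = t^8 * (s3^4 * (a * v^2 + b * (k * B)) + s3^3 * (c * D))"
    "t^6 * (s3^4 * (t * A) + s3^3 * (0 * B)) = t^7 * (s3^4 * A)" "t^7 * (s3^4 * (t * A) + s3^3 * (0 * B)) = t^8 * (s3^4 * A)"
proof -
  have p: "t^6 = t * t * t * t * t * t" "t^7 = t * t * t * t * t * t * t" "t^8 = t * t * t * t * t * t * t * t"
    by (simp_all add: eval_nat_numeral)
  show "a * (s^2 * t * v)^2 + b * (s^4 * B) + c * (s^4 * C + s^3 * D) = s^4 * (a * (t * v)^2 + b * B + c * C) + s^3 * (c * D)"
    "s^4 * A + s^3 * B = s^3 * (s * A + B)"
    "s^4 * (a * (t * (t * v))^2 + b * (k * (t * B)) + c * (t^2 * C)) + s^3 * (c * (t * D))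
      = t^1 * (s^4 * (t * (a * (t * v)^2 + c * C) + b * (k * B)) + s^3 * (c * D))"
    "t^1 * (s^4 * (t * (a * (t * v)^2 + c * C) + b * (k * (t * B))) + s^3 * (c * (t * D)))
      = t^2 * (s^4 * (a * (t * v)^2 + b * (k * B) + c * C) + s^3 * (c * D))"
    "t^2 * ((s3 * t)^4 * (a * (t * v)^2 + b * (k * (t * B)) + c * C) + (s3 * t)^3 * (c * (t * D)))
      = t^6 * (s3^4 * (t * (a * t * v^2 + b * (k * B))) + s3^3 * (c * (D + s3 * C)))"
    by (simp_all add: p algebra_simps power2_eq_square power3_eq_cube power4_eq_xxxx)
  show "t^6 * (s3^4 * (t * (a * t * v^2 + b * (k * (t * B)))) + s3^3 * (c * (t * D)))
      = t^7 * (s3^4 * (t * (a * v^2 + b * (k * B))) + s3^3 * (c * D))"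
    "t^7 * (s3^4 * (t * (a * v^2 + b * (k * B))) + s3^3 * (c * (t * D)))
      = t^8 * (s3^4 * (a * v^2 + b * (k * B)) + s3^3 * (c * D))"
    "t^6 * (s3^4 * (t * A) + s3^3 * (0 * B)) = t^7 * (s3^4 * A)" "t^7 * (s3^4 * (t * A) + s3^3 * (0 * B)) = t^8 * (s3^4 * A)"
    by (simp_all add: p algebra_simps)
qed

context diag_blowups
begin

abbreviation "f C0 C1 C2 \<equiv> FF h C0 C1 C2 (1 / t) (1 / (s * t)) (u / v) (1 / (s * v))"
abbreviation "zz \<equiv> s^2 * t * v"

lemma nz: "s \<noteq> 0" "v \<noteq> 0"
  using crd_neq_0[OF cs0, of 0] crd_neq_0[OF cs0, of 3] by simp_all

lemma zz0: "zz \<noteq> 0" using nz t0 by simp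

lemma eqs: "v = t * v1" "u = 1 + t * p" "v1 = - 1 + t * r" "r = t * r3" "p = 1 + cst h + t * q" "s = s3 * t"
  "q = - 2 * r3 - s3 * cst (1 / h) + t * m" "r3 = - s3 * cst (1 / h) + t * n"
  "m = n / 2 + (1 + cst h) * cst (1 / h) * s3 + t * l" "cst h * cst (1 / h) = 1"
  using t0 h0 by (simp_all add: v1_def p_def e2_def r_def r3_def e3_def q_def s3_def e4_def m_def e5_def n_def e6_def l_def cst_divide cst_hom field_simps)

lemma m_eq: "2 * m = n + 2 * ((1 + cst h) * cst (1 / h)) * s3 + 2 * t * l"
proof -
  have "(2 :: ratfun) \<noteq> 0" using cst_eq_0[of 2] unfolding cst_numeral by simp
  then show ?thesis unfolding eqs(9) by (simp add: algebra_simps)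
qed

abbreviation "jJ \<equiv> - (v^2) + (cst h - 1) * t * u * v + u * v - t^2 * u^2 + t * u^2"
abbreviation "jJ' \<equiv> u * v1 + u^2 + t * (- (v1^2) + (cst h - 1) * u * v1 - u^2)"
abbreviation "jJ'' \<equiv> u * (p + r) - v1^2 + (cst h - 1) * u * v1 - u^2"
abbreviation "jJ3 \<equiv> u * (q + r3) + t * (- (p^2) + 2 * r3 + (cst h - 1) * u * r3 - t^2 * r3^2)"
abbreviation "jJ4 \<equiv> u * (m - n) - p^2 + 2 * r3 + (cst h - 1) * u * r3 - t^2 * r3^2"
abbreviation "jN \<equiv> 2 * cst h * t * v^2 + v^2 + 2 * cst h * t^2 * u * v + t * u * v + t^2 * u^2"
abbreviation "jN' \<equiv> 2 * cst h * t * v1^2 + v1^2 + 2 * cst h * t * u * v1 + u * v1 + u^2"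
abbreviation "jN3 \<equiv> p + t * (p^2 - r3) + t^2 * p * r3 + t^3 * r3^2 + 2 * cst h * t * v1 * (p + t * r3)"
abbreviation "jL \<equiv> - 2 * cst h * v^2 + ((cst h)^2 - cst h) * t * u * v + 2 * cst h * u * v + cst h * t * u^2 + ((cst h)^2 - cst h) * t * v + cst h * v - 2 * cst h * t^2 * u + 2 * cst h * t * u"
abbreviation "jL1 \<equiv> - 2 * cst h * t * v1^2 + ((cst h)^2 - cst h) * t * u * v1 + 2 * cst h * u * v1 + cst h * u^2 + ((cst h)^2 - cst h) * t * v1 + cst h * v1 - 2 * cst h * t * u + 2 * cst h * u"
abbreviation "jL2 \<equiv> 2 * cst h * u * r + cst h * (r + 2 * p + t * p^2) - 2 * cst h * v1^2 + ((cst h)^2 - cst h) * u * v1 + ((cst h)^2 - cst h) * v1 - 2 * cst h * u"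
abbreviation "jL3 \<equiv> cst h * (2 * u * r3 + r3 + 2 * q + p * t * q + 4 * t * r3 - 2 * t^3 * r3^2 + (cst h - 1) * (u + 1) * t * r3)"
abbreviation "jL4 \<equiv> cst h * (2 * m - n) + cst h * (2 * p * r3 + p * q + 4 * r3 - 2 * t^2 * r3^2 + (cst h - 1) * (u + 1) * r3) + s3 * jN3"
abbreviation "jL5 \<equiv> 2 * cst h * l + cst h * (2 * q * r3 + q^2 - 2 * t * r3^2 + (cst h - 1) * p * r3) + cst h * (1 + cst h) * (m + 2 * n)
      + s3 * (q + (p^2 - r3) + t * p * r3 + t^2 * r3^2 + 2 * cst h * v1 * (p + t * r3))"

lemma f_eqs:
  "f C0 C1 C2 * zz^2 = s^4 * (cst C0 * (t * v)^2 + cst C1 * (cst h * jJ) + cst C2 * jN) + s^3 * (cst C2 * jL)"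
  "f C0 C1 C2 * zz^2 = t^1 * (s^4 * (t * (cst C0 * (t * v1)^2 + cst C2 * jN') + cst C1 * (cst h * jJ')) + s^3 * (cst C2 * jL1))"
  "f C0 C1 C2 * zz^2 = t^2 * (s^4 * (cst C0 * (t * v1)^2 + cst C1 * (cst h * jJ'') + cst C2 * jN') + s^3 * (cst C2 * jL2))"
  "f C0 C1 C2 * zz^2 = t^6 * (s3^4 * (t * (cst C0 * t * v1^2 + cst C1 * (cst h * jJ3))) + s3^3 * (cst C2 * (jL3 + s3 * jN')))"
  "f C0 C1 C2 * zz^2 = t^7 * (s3^4 * (t * (cst C0 * v1^2 + cst C1 * (cst h * jJ4))) + s3^3 * (cst C2 * jL4))"
  "f C0 C1 C2 * zz^2 = t^8 * (s3^4 * (cst C0 * v1^2 + cst C1 * (cst h * jJ4)) + s3^3 * (cst C2 * jL5))"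
proof -
  note I = diag_identities[where k = "cst h", OF nz(1) t0 nz(2)]
  have "f C0 C1 C2 * zz^2 = cst C0 * zz^2 + cst C1 * (J1 (cst h) (1 / t) (u / v) * zz^2) + cst C2 * (J2 (cst h) (1 / t) (1 / (s * t)) (u / v) (1 / (s * v)) * zz^2)"
    by (simp add: FF_def distrib_right mult.assoc)
  then have 0: "f C0 C1 C2 * zz^2 = cst C0 * zz^2 + cst C1 * (s^4 * (cst h * jJ)) + cst C2 * (s^4 * jN + s^3 * jL)"
    unfolding I(1) I(2) .
  then show 1: "f C0 C1 C2 * zz^2 = s^4 * (cst C0 * (t * v)^2 + cst C1 * (cst h * jJ) + cst C2 * jN) + s^3 * (cst C2 * jL)"
    unfolding diag_regroup(1) .
  have tv: "t * v = t * (t * v1)" using eqs(1) by simp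
  show 2: "f C0 C1 C2 * zz^2 = t^1 * (s^4 * (t * (cst C0 * (t * v1)^2 + cst C2 * jN') + cst C1 * (cst h * jJ')) + s^3 * (cst C2 * jL1))"
    using 1[unfolded I(3)[OF eqs(1)] I(4)[OF eqs(1)] I(5)[OF eqs(1)] tv diag_regroup(3)] .
  show 3: "f C0 C1 C2 * zz^2 = t^2 * (s^4 * (cst C0 * (t * v1)^2 + cst C1 * (cst h * jJ'') + cst C2 * jN') + s^3 * (cst C2 * jL2))"
    using 2[unfolded I(6)[OF eqs(2,3)] I(7)[OF eqs(2,3)] diag_regroup(4)] .
  have "f C0 C1 C2 * zz^2 = t^2 * (s^4 * (cst C0 * (t * v1)^2 + cst C1 * (cst h * (t * jJ3)) + cst C2 * jN') + s^3 * (cst C2 * (t * jL3)))"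
    using 3[unfolded I(8)[OF eqs(2-5)] I(9)[OF eqs(2-5)]] .
  also have "\<dots> = t^2 * ((s3 * t)^4 * (cst C0 * (t * v1)^2 + cst C1 * (cst h * (t * jJ3)) + cst C2 * jN') + (s3 * t)^3 * (cst C2 * (t * jL3)))"
    by (rule arg_cong[where f = "\<lambda>x. t^2 * (x^4 * (cst C0 * (t * v1)^2 + cst C1 * (cst h * (t * jJ3)) + cst C2 * jN') + x^3 * (cst C2 * (t * jL3)))", OF eqs(6)])
  finally show 4: "f C0 C1 C2 * zz^2 = t^6 * (s3^4 * (t * (cst C0 * t * v1^2 + cst C1 * (cst h * jJ3))) + s3^3 * (cst C2 * (jL3 + s3 * jN')))"
    unfolding diag_regroup(5) .
  show 5: "f C0 C1 C2 * zz^2 = t^7 * (s3^4 * (t * (cst C0 * v1^2 + cst C1 * (cst h * jJ4))) + s3^3 * (cst C2 * jL4))"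
    using 4[unfolded I(10)[OF eqs(7,8)] I(11)[OF eqs(2,3,4,7,8,10)] diag_regroup(6)] .
  show "f C0 C1 C2 * zz^2 = t^8 * (s3^4 * (cst C0 * v1^2 + cst C1 * (cst h * jJ4)) + s3^3 * (cst C2 * jL5))"
    using 5[unfolded I(12)[OF eqs(2,5,7,8) m_eq eqs(10)] diag_regroup(7)] .
qed

lemma place_0:
  assumes cs: "coordsys (a, t, b, c)"
  shows "a \<in> Oring (a, t, b, c) (a', 0, b', c')" "pval (a, t, b, c) (a', 0, b', c') a = a'"
    "t \<in> Oring (a, t, b, c) (a', 0, b', c')" "pval (a, t, b, c) (a', 0, b', c') t = 0"
    "b \<in> Oring (a, t, b, c) (a', 0, b', c')" "pval (a, t, b, c) (a', 0, b', c') b = b'"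
    "c \<in> Oring (a, t, b, c) (a', 0, b', c')" "pval (a, t, b, c) (a', 0, b', c') c = c'"
  using place_crd[OF cs, of 0 "(a', 0, b', c')"] place_crd[OF cs, of 1 "(a', 0, b', c')"] place_crd[OF cs, of 2 "(a', 0, b', c')"]
    place_crd[OF cs, of 3 "(a', 0, b', c')"] by simp_all

lemma place_u:
  assumes cs: "coordsys (a, t, b, c)" and p: "p \<in> Oring (a, t, b, c) (a', 0, b', c')"
  shows "u \<in> Oring (a, t, b, c) (a', 0, b', c')" "pval (a, t, b, c) (a', 0, b', c') u = 1"
proof -
  have "1 + t * p \<in> Oring (a, t, b, c) (a', 0, b', c') \<and> pval (a, t, b, c) (a', 0, b', c') (1 + t * p) = 1"
    using p place_0[OF cs, of a' b' c'] by (simp add: place[OF cs])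
  then show "u \<in> Oring (a, t, b, c) (a', 0, b', c')" "pval (a, t, b, c) (a', 0, b', c') u = 1"
    unfolding eqs(2)[symmetric] by auto
qed

lemma place_v1:
  assumes cs: "coordsys (a, t, b, c)" and r: "r \<in> Oring (a, t, b, c) (a', 0, b', c')"
  shows "v1 \<in> Oring (a, t, b, c) (a', 0, b', c')" "pval (a, t, b, c) (a', 0, b', c') v1 = - 1"
  unfolding eqs(3) using r place_0[OF cs, of a' b' c'] by (simp_all add: place[OF cs])

lemma place_q:
  assumes cs: "coordsys (a, t, b, c)" and r3: "r3 \<in> Oring (a, t, b, c) (a', 0, b', c')" and q: "q \<in> Oring (a, t, b, c) (a', 0, b', c')"
  shows "p \<in> Oring (a, t, b, c) (a', 0, b', c')" "pval (a, t, b, c) (a', 0, b', c') p = 1 + h"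
    "r \<in> Oring (a, t, b, c) (a', 0, b', c')" "pval (a, t, b, c) (a', 0, b', c') r = 0"
  unfolding eqs(4) eqs(5) using r3 q place_0[OF cs, of a' b' c'] by (simp_all add: place[OF cs])

lemma place_4:
  assumes cs: "coordsys (s3, t, r3, m)"
  shows "q \<in> Oring (s3, t, r3, m) (a', 0, b', c')" "pval (s3, t, r3, m) (a', 0, b', c') q = - 2 * b' - a' / h"
  unfolding eqs(7) using place_0[OF cs, of a' b' c'] by (simp_all add: place[OF cs] inverse_eq_divide)

lemma place_r3:
  assumes cs: "coordsys (s3, t, n, c)"
  shows "r3 \<in> Oring (s3, t, n, c) (a', 0, b', c')" "pval (s3, t, n, c) (a', 0, b', c') r3 = - a' * inverse h"
  unfolding eqs(8) using place_0[OF cs, of a' b' c'] by (simp_all add: place[OF cs] inverse_eq_divide)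

lemma place_q':
  assumes cs: "coordsys (s3, t, n, c)" and m: "m \<in> Oring (s3, t, n, c) (a', 0, b', c')"
  shows "q \<in> Oring (s3, t, n, c) (a', 0, b', c')" "pval (s3, t, n, c) (a', 0, b', c') q = a' * inverse h"
  unfolding eqs(7) using place_0[OF cs, of a' b' c'] place_r3[OF cs, of a' b' c'] m by (simp_all add: place[OF cs] inverse_eq_divide)

lemma place_6:
  assumes cs: "coordsys (s3, t, n, l)"
  shows "m \<in> Oring (s3, t, n, l) (a', 0, b', c')" "pval (s3, t, n, l) (a', 0, b', c') m = b' / 2 + (1 + h) * inverse h * a'"
  unfolding eqs(9) using place_0[OF cs, of a' b' c'] by (simp_all add: place[OF cs] inverse_eq_divide)

lemma f_eqs':
  "f C0 C1 0 * zz^2 = s^4 * (cst C0 * (t * v)^2 + cst C1 * (cst h * jJ))"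
  "f C0 C1 C2 * zz^2 = s^3 * (s * (cst C0 * (t * v)^2 + cst C1 * (cst h * jJ) + cst C2 * jN) + cst C2 * jL)"
  "f C0 C1 0 * zz^2 = t^7 * (s3^4 * (cst C0 * t * v1^2 + cst C1 * (cst h * jJ3)))"
  "f C0 C1 0 * zz^2 = t^8 * (s3^4 * (cst C0 * v1^2 + cst C1 * (cst h * jJ4)))"
proof -
  have z: "cst 0 = 0" by simp
  show "f C0 C1 0 * zz^2 = s^4 * (cst C0 * (t * v)^2 + cst C1 * (cst h * jJ))"
    unfolding f_eqs(1) z by (simp only: mult_zero_left mult_zero_right add_0_right)
  show "f C0 C1 C2 * zz^2 = s^3 * (s * (cst C0 * (t * v)^2 + cst C1 * (cst h * jJ) + cst C2 * jN) + cst C2 * jL)"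
    unfolding f_eqs(1) by (rule diag_regroup)
  show "f C0 C1 0 * zz^2 = t^7 * (s3^4 * (cst C0 * t * v1^2 + cst C1 * (cst h * jJ3)))"
    unfolding f_eqs(4) z by (rule diag_regroup)
  show "f C0 C1 0 * zz^2 = t^8 * (s3^4 * (cst C0 * v1^2 + cst C1 * (cst h * jJ4)))"
    unfolding f_eqs(5) z by (rule diag_regroup)
qed

lemma VV_cc: "VV 1 = pdv (s, t, p, v1) (X 1)" "VV 2 = pdv (s, t, p, r) (X 1)" "VV 3 = pdv (s3, t, q, r3) (X 1)"
  "VV 4 = pdv (s3, t, r3, m) (X 1)" "VV 5 = pdv (s3, t, n, m) (X 1)" "VV 6 = pdv (s3, t, n, l) (X 1)"
  by (simp_all add: VV_def)

lemma ord_C1: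
  assumes C1: "C1 \<noteq> 0"
  shows "f C0 C1 0 \<noteq> 0" "ord_at (pdv (s, t, u, v) (X 0)) (f C0 C1 0) = 4 - 2 * ord_at (pdv (s, t, u, v) (X 0)) zz"
    "1 \<le> j \<Longrightarrow> j \<le> 6 \<Longrightarrow> ord_at (VV j) (f C0 C1 0) = [0, 1, 2, 7, 7, 8, 8] ! j - 2 * ord_at (VV j) zz"
proof -
  have 0: "f C0 C1 0 \<noteq> 0 \<and> ord_at (pdv (s, t, u, v) (X 0)) (f C0 C1 0) = int 4 - 2 * ord_at (pdv (s, t, u, v) (X 0)) zz"
    by (rule ord_pdv_at[OF cs0 _ _ refl, where b = "(0, 0, 2, 1)" and c = "C1 * h", OF _ _ _ f_eqs'(1) _ _ zz0])
      (use h0 C1 place_0[OF cs0, of 0 2 1] in \<open>simp_all add: place[OF cs0]\<close>)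
  have 1: "f C0 C1 0 \<noteq> 0 \<and> ord_at (VV 1) (f C0 C1 0) = int 1 - 2 * ord_at (VV 1) zz"
    by (rule ord_pdv_at[OF cs_c1 _ _ VV_cc(1), where b = "(1, 0, 0, 0)" and c = "C1 * h", OF _ _ _ f_eqs(2) _ _ zz0])
      (use h0 C1 place_0[OF cs_c1, of 1 0 0] place_u[OF cs_c1, of 1 0 0] in \<open>simp_all add: place[OF cs_c1]\<close>)
  have 2: "f C0 C1 0 \<noteq> 0 \<and> ord_at (VV 2) (f C0 C1 0) = int 2 - 2 * ord_at (VV 2) zz"
    by (rule ord_pdv_at[OF cs_c2 _ _ VV_cc(2), where b = "(1, 0, 2 + h, 0)" and c = "C1 * h", OF _ _ _ f_eqs(3) _ _ zz0])
      (use h0 C1 place_0[OF cs_c2, of 1 "2 + h" 0] place_u[OF cs_c2, of 1 "2 + h" 0] place_v1[OF cs_c2, of 1 "2 + h" 0] in \<open>simp_all add: place[OF cs_c2]\<close>)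
  \<comment> \<open>The jump from 2 to 7 is due to blowing up a point of \<open>s = 0\<close>:
    \<open>s = s3 * t\<close> turns \<open>s^4\<close> into a multiple of \<open>t^4\<close>, and
    \<open>jJ''\<close> is divisible by \<open>t\<close> once more.\<close>
  have 3: "f C0 C1 0 \<noteq> 0 \<and> ord_at (VV 3) (f C0 C1 0) = int 7 - 2 * ord_at (VV 3) zz"
    by (rule ord_pdv_at[OF cs_c3 _ _ VV_cc(3), where b = "(1, 0, 1, 0)" and c = "C1 * h", OF _ _ _ f_eqs'(3) _ _ zz0])
      (use h0 C1 place_0[OF cs_c3, of 1 1 0] place_q[OF cs_c3, of 1 1 0] place_u[OF cs_c3, of 1 1 0] place_v1[OF cs_c3, of 1 1 0] in \<open>simp_all add: place[OF cs_c3]\<close>)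
  have 4: "f C0 C1 0 \<noteq> 0 \<and> ord_at (VV 4) (f C0 C1 0) = int 7 - 2 * ord_at (VV 4) zz"
    by (rule ord_pdv_at[OF cs_c4 _ _ VV_cc(4), where b = "(h, 0, 0, 0)" and c = "- C1 * h ^ 5", OF _ _ _ f_eqs'(3) _ _ zz0])
      (use h0 C1 place_0[OF cs_c4, of h 0 0] place_4[OF cs_c4, of h 0 0] place_q[OF cs_c4, of h 0 0] place_u[OF cs_c4, of h 0 0] place_v1[OF cs_c4, of h 0 0] in
        \<open>simp_all add: place[OF cs_c4] eval_nat_numeral\<close>)
  obtain e where e: "inverse h = e" by blast
  have 5: "f C0 C1 0 \<noteq> 0 \<and> ord_at (VV 5) (f C0 C1 0) = int 8 - 2 * ord_at (VV 5) zz"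
  proof -
    let ?K = "C0 + C1 * (h * (- ((1 + h)^2) - 2 * e - (h - 1) * e))"
    obtain d where d: "?K + (C1 * h) * d \<noteq> 0" using ex_affine_nonzero[of "C1 * h" ?K] h0 C1 by auto
    show ?thesis
      by (rule ord_pdv_at[OF cs_c5 _ _ VV_cc(5), where b = "(1, 0, 0, d)" and c = "?K + (C1 * h) * d", OF _ _ _ f_eqs'(4) _ d zz0])
        ((use place_0[OF cs_c5, of 1 0 d] place_r3[OF cs_c5, of 1 0 d] place_q'[OF cs_c5, of 1 0 d] place_q[OF cs_c5, of 1 0 d] place_u[OF cs_c5, of 1 0 d]
          place_v1[OF cs_c5, of 1 0 d] in \<open>simp_all add: place[OF cs_c5] e\<close>), (simp add: algebra_simps power2_eq_square)?)
  qed
  have 6: "f C0 C1 0 \<noteq> 0 \<and> ord_at (VV 6) (f C0 C1 0) = int 8 - 2 * ord_at (VV 6) zz"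
  proof -
    let ?K = "C0 + C1 * (h * ((1 + h) * e - (1 + h)^2 - 2 * e - (h - 1) * e))"
    obtain d where d: "?K + (- C1 * h) * d \<noteq> 0" using ex_affine_nonzero[of "- C1 * h" ?K] h0 C1 by auto
    show ?thesis
      by (rule ord_pdv_at[OF cs_c6 _ _ VV_cc(6), where b = "(1, 0, 2 * d, 0)" and c = "?K + (- C1 * h) * d", OF _ _ _ f_eqs'(4) _ d zz0])
        ((use place_0[OF cs_c6, of 1 "2 * d" 0] place_6[OF cs_c6, of 1 "2 * d" 0] place_r3[OF cs_c6, of 1 "2 * d" 0] place_q'[OF cs_c6, of 1 "2 * d" 0] place_q[OF cs_c6, of 1 "2 * d" 0]
          place_u[OF cs_c6, of 1 "2 * d" 0] place_v1[OF cs_c6, of 1 "2 * d" 0] in \<open>simp_all add: place[OF cs_c6] e\<close>), (simp add: algebra_simps power2_eq_square)?)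
  qed
  show "f C0 C1 0 \<noteq> 0" "ord_at (pdv (s, t, u, v) (X 0)) (f C0 C1 0) = 4 - 2 * ord_at (pdv (s, t, u, v) (X 0)) zz" using 0 by auto
  show "1 \<le> j \<Longrightarrow> j \<le> 6 \<Longrightarrow> ord_at (VV j) (f C0 C1 0) = [0, 1, 2, 7, 7, 8, 8] ! j - 2 * ord_at (VV j) zz"
    using le6_cases[of "\<lambda>j. ord_at (VV j) (f C0 C1 0) = [0, 1, 2, 7, 7, 8, 8] ! j - 2 * ord_at (VV j) zz"] 1 2 3 4 5 6 by simp
qed

lemma ord_C2:
  assumes C2: "C2 \<noteq> 0"
  shows "f C0 C1 C2 \<noteq> 0" "ord_at (pdv (s, t, u, v) (X 0)) (f C0 C1 C2) = 3 - 2 * ord_at (pdv (s, t, u, v) (X 0)) zz"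
    "1 \<le> j \<Longrightarrow> j \<le> 6 \<Longrightarrow> ord_at (VV j) (f C0 C1 C2) = [0, 1, 2, 6, 6, 7, 8] ! j - 2 * ord_at (VV j) zz"
proof -
  have 0: "f C0 C1 C2 \<noteq> 0 \<and> ord_at (pdv (s, t, u, v) (X 0)) (f C0 C1 C2) = int 3 - 2 * ord_at (pdv (s, t, u, v) (X 0)) zz"
    by (rule ord_pdv_at[OF cs0 _ _ refl, where b = "(0, 0, 1, 1)" and c = "C2 * h", OF _ _ _ f_eqs'(2) _ _ zz0])
      (use h0 C2 place_0[OF cs0, of 0 1 1] in \<open>simp_all add: place[OF cs0]\<close>)
  have 1: "f C0 C1 C2 \<noteq> 0 \<and> ord_at (VV 1) (f C0 C1 C2) = int 1 - 2 * ord_at (VV 1) zz"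
  proof -
    \<comment> \<open>At \<open>s = a\<close> the cofactor is
      \<open>a^3 * h * (C1 * a + 3 * C2)\<close>; since \<open>C2\<close> is nonzero, one of the two
      values 1 and 2 avoids its zero.\<close>
    define a :: complex where "a = (if C1 + 3 * C2 = 0 then 2 else 1)"
    have "C1 * a + 3 * C2 \<noteq> 0"
    proof (cases "C1 + 3 * C2 = 0")
      case True
      then have "C1 * a + 3 * C2 = C1" by (simp add: a_def algebra_simps)
      moreover have "C1 \<noteq> 0" using True C2 by auto
      ultimately show ?thesis by simp
    qed (simp add: a_def)
    moreover have "a \<noteq> 0" by (simp add: a_def)
    ultimately have d: "a^3 * h * (C1 * a + 3 * C2) \<noteq> 0" using h0 by simp
    show ?thesis
      by (rule ord_pdv_at[OF cs_c1 _ _ VV_cc(1), where b = "(a, 0, 0, 0)" and c = "a^3 * h * (C1 * a + 3 * C2)", OF _ _ _ f_eqs(2) _ d zz0])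
        ((use place_0[OF cs_c1, of a 0 0] place_u[OF cs_c1, of a 0 0] in \<open>simp_all add: place[OF cs_c1]\<close>),
          simp add: algebra_simps power3_eq_cube power4_eq_xxxx)
  qed
  \<comment> \<open>At \<open>p = 1 + h\<close>, the value of \<open>p\<close> in center 14, both
    \<open>jJ''\<close> and \<open>jL2\<close> vanish and \<open>jN'\<close> is 1, so only
    \<open>C2\<close> is left.\<close>
  have 2: "f C0 C1 C2 \<noteq> 0 \<and> ord_at (VV 2) (f C0 C1 C2) = int 2 - 2 * ord_at (VV 2) zz"
    by (rule ord_pdv_at[OF cs_c2 _ _ VV_cc(2), where b = "(1, 0, 1 + h, 0)" and c = "C2", OF _ _ _ f_eqs(3) _ C2 zz0])
      ((use place_0[OF cs_c2, of 1 "1 + h" 0] place_u[OF cs_c2, of 1 "1 + h" 0] place_v1[OF cs_c2, of 1 "1 + h" 0] in \<open>simp_all add: place[OF cs_c2]\<close>),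
        simp add: algebra_simps power2_eq_square)
  have 3: "f C0 C1 C2 \<noteq> 0 \<and> ord_at (VV 3) (f C0 C1 C2) = int 6 - 2 * ord_at (VV 3) zz"
    by (rule ord_pdv_at[OF cs_c3 _ _ VV_cc(3), where b = "(1, 0, 0, 0)" and c = "C2", OF _ _ _ f_eqs(4) _ C2 zz0])
      (use place_0[OF cs_c3, of 1 0 0] place_q[OF cs_c3, of 1 0 0] place_u[OF cs_c3, of 1 0 0] place_v1[OF cs_c3, of 1 0 0] in \<open>simp_all add: place[OF cs_c3]\<close>)
  have 4: "f C0 C1 C2 \<noteq> 0 \<and> ord_at (VV 4) (f C0 C1 C2) = int 6 - 2 * ord_at (VV 4) zz"
    by (rule ord_pdv_at[OF cs_c4 _ _ VV_cc(4), where b = "(1, 0, 0, 0)" and c = "- C2", OF _ _ _ f_eqs(4) _ _ zz0])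
      (use h0 C2 place_0[OF cs_c4, of 1 0 0] place_4[OF cs_c4, of 1 0 0] place_q[OF cs_c4, of 1 0 0] place_u[OF cs_c4, of 1 0 0] place_v1[OF cs_c4, of 1 0 0] in
        \<open>simp_all add: place[OF cs_c4]\<close>)
  obtain e where e: "inverse h = e" by blast
  have 5: "f C0 C1 C2 \<noteq> 0 \<and> ord_at (VV 5) (f C0 C1 C2) = int 7 - 2 * ord_at (VV 5) zz"
  proof -
    let ?K = "C2 * (h * (- 2 * (1 + h) * e + (1 + h) * e - 4 * e - 2 * (h - 1) * e) + 1 + h)"
    obtain d where d: "?K + (2 * C2 * h) * d \<noteq> 0" using ex_affine_nonzero[of "2 * C2 * h" ?K] h0 C2 by auto
    show ?thesis
      by (rule ord_pdv_at[OF cs_c5 _ _ VV_cc(5), where b = "(1, 0, 0, d)" and c = "?K + (2 * C2 * h) * d", OF _ _ _ f_eqs(5) _ d zz0])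
        ((use place_0[OF cs_c5, of 1 0 d] place_r3[OF cs_c5, of 1 0 d] place_q'[OF cs_c5, of 1 0 d] place_q[OF cs_c5, of 1 0 d] place_u[OF cs_c5, of 1 0 d]
          place_v1[OF cs_c5, of 1 0 d] in \<open>simp_all add: place[OF cs_c5] e\<close>), (simp add: algebra_simps power2_eq_square)?)
  qed
  have 6: "f C0 C1 C2 \<noteq> 0 \<and> ord_at (VV 6) (f C0 C1 C2) = int 8 - 2 * ord_at (VV 6) zz"
  proof -
    let ?J = "h * ((1 + h) * e - (1 + h)^2 - 2 * e - (h - 1) * e)"
    let ?L = "h * (- 2 * e^2 + e^2 - (h - 1) * (1 + h) * e) + h * (1 + h) * ((1 + h) * e) + (e + (1 + h)^2 + e - 2 * h * (1 + h))"
    let ?K = "C0 + C1 * ?J + C2 * ?L"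
    obtain d where d: "?K + (2 * C2 * h) * d \<noteq> 0" using ex_affine_nonzero[of "2 * C2 * h" ?K] h0 C2 by auto
    show ?thesis
      by (rule ord_pdv_at[OF cs_c6 _ _ VV_cc(6), where b = "(1, 0, 0, d)" and c = "?K + (2 * C2 * h) * d", OF _ _ _ f_eqs(6) _ d zz0])
        ((use place_0[OF cs_c6, of 1 0 d] place_6[OF cs_c6, of 1 0 d] place_r3[OF cs_c6, of 1 0 d] place_q'[OF cs_c6, of 1 0 d] place_q[OF cs_c6, of 1 0 d]
          place_u[OF cs_c6, of 1 0 d] place_v1[OF cs_c6, of 1 0 d] in \<open>simp_all add: place[OF cs_c6] e\<close>), (simp add: algebra_simps power2_eq_square)?)
  qed
  show "f C0 C1 C2 \<noteq> 0" "ord_at (pdv (s, t, u, v) (X 0)) (f C0 C1 C2) = 3 - 2 * ord_at (pdv (s, t, u, v) (X 0)) zz" using 0 by auto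
  show "1 \<le> j \<Longrightarrow> j \<le> 6 \<Longrightarrow> ord_at (VV j) (f C0 C1 C2) = [0, 1, 2, 6, 6, 7, 8] ! j - 2 * ord_at (VV j) zz"
    using le6_cases[of "\<lambda>j. ord_at (VV j) (f C0 C1 C2) = [0, 1, 2, 6, 6, 7, 8] ! j - 2 * ord_at (VV j) zz"] 1 2 3 4 5 6 by simp
qed

end

section \<open>The two families of hypersurfaces\<close>

text \<open>Exchanges the two decimal digits. Interchanging the planes swaps the exponents of
  \<open>x0\<close> and \<open>x2\<close> and the roles of \<open>q\<close> and \<open>r\<close>,
  which lets divisor 10 reuse the equations of divisor 5.\<close>

definition swap_index :: "nat \<Rightarrow> nat" where
  "swap_index n = 10 * (n mod 10) + n div 10"

lemma hf_swap:
  "hf cst p q r a b c 1 d = hf cst (\<lambda>n. p (swap_index n)) (\<lambda>n. r (swap_index n)) (\<lambda>n. q (swap_index n)) c d a 1 b"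
  unfolding hf_def by (simp add: swap_index_def algebra_simps)

lemma ev_sum: "ev y (\<Sum>m\<in>I. F m) = (\<Sum>m\<in>I. ev y (F m))"
  by (induction I rule: infinite_finite_induct) simp_all

fun xmon :: "nat \<times> nat \<times> nat \<times> nat \<Rightarrow> ratfun" where
  "xmon (i, j, k, l) = x0 ^ i * x1 ^ j * x2 ^ k * x3 ^ l"

lemma power_inverse_shift:
  fixes a b :: "'a::field"
  assumes "b \<noteq> 0" "i + j \<le> N"
  shows "(a / b) ^ i * (1 / b) ^ (N - i - j) = (1 / b) ^ N * (a ^ i * b ^ j)"
proof -
  obtain d where N: "N = i + j + d" using assms(2) by (metis le_iff_add)
  show ?thesis using assms(1) unfolding N by (simp add: power_add power_divide field_simps)
qed

text \<open>Multiplied by \<open>(s^2 * t * v)^2\<close>, a monomial of bidegree at most (2,2)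
  becomes a monomial in the chart of divisor 11, and its order along that divisor is
  \<open>4 - j - l\<close>.\<close>

lemma power_chart_11:
  fixes s t u v :: "'a::field"
  assumes nz: "s \<noteq> 0" "t \<noteq> 0" "v \<noteq> 0" and c: "i + j \<le> 2" "k + l \<le> 2" "j + l \<le> 4"
  shows "s ^ (4 - j - l) * t ^ (2 - i - j) * u ^ k * v ^ (2 - k - l) = (s^2 * t * v)^2 * ((1 / t) ^ i * (1 / (s * t)) ^ j * (u / v) ^ k * (1 / (s * v)) ^ l)"
proof -
  obtain a b d where e: "2 = i + j + a" "2 = k + l + b" "4 = j + l + d" using c by (metis le_iff_add)
  have d: "4 - j - l = d" "2 - i - j = a" "2 - k - l = b" using e by auto
  have "(s^2 * t * v)^2 = s ^ 4 * t ^ 2 * v ^ 2" by (simp add: power2_eq_square power4_eq_xxxx)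
  also have "\<dots> = s ^ (j + l + d) * t ^ (i + j + a) * v ^ (k + l + b)" using e by metis
  finally show ?thesis using nz unfolding d by (simp add: power_add power_divide power_mult_distrib field_simps)
qed

section \<open>Determination of the equation from its orders\<close>

context lines_setting
begin

text \<open>Poles of order two at the divisors at infinity bound the bidegree by (2,2), and order at
  least three along divisor 11 leaves only \<open>j + l \<le> 1\<close>. In each of the three charts
  distinct monomials remain distinct monomials, so each bound applies to every coefficient
  separately.\<close>

lemma form_exists:
  assumes f: "f \<in> polyring {x0, x1, x2, x3}" "f \<noteq> 0" and a: "ord_at Vinf_a f = - 2" and b: "ord_at Vinf_b f = - 2"
    and c11: "3 \<le> ord_at V11 (f * (z0^2 * (z1 / z0) * (z3 / z0))^2)"
  shows "\<exists>p q r. f = hf cst p q r x0 x1 x2 1 x3"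
proof -
  obtain F0 where F0: "f = ev (x0, x1, x2, x3) F0" using f(1) unfolding polyring_eq by blast
  obtain I c where I: "finite I" "F0 = (\<Sum>m\<in>I. C4 (c m) * mon m)" using mon_span by blast
  have fs: "f = (\<Sum>m\<in>I. cst (c m) * xmon m)"
    unfolding F0 I(2) ev_sum by (intro sum.cong refl) (auto simp: mult.assoc)
  have "finite ((\<lambda>(i, j, k, l). i + j + k + l) ` I)" using I(1) by simp
  then obtain M where M: "\<forall>n\<in>(\<lambda>(i, j, k, l). i + j + k + l) ` I. n \<le> M" using finite_nat_set_iff_bounded_le by blast
  \<comment> \<open>\<open>N\<close> bounds all degrees, so multiplication by the N-th power of
    \<open>z1\<close> or \<open>z3\<close> gives a polynomial in the other chart; being at least 2,
    it also keeps the natural number \<open>N - 2\<close> from being truncated.\<close>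
  define N where "N = M + 2"
  have N: "i + j \<le> N" "k + l \<le> N" if "(i, j, k, l) \<in> I" for i j k l
    using bspec[OF M imageI[OF that]] by (auto simp: N_def)
  have ca: "c (i, j, k, l) = 0" if m: "(i, j, k, l) \<in> I" "2 < i + j" for i j k l
  proof -
    let ?\<phi> = "\<lambda>(i, j, k, l). (i, N - i - j, k, l)"
    let ?\<Psi> = "\<Sum>m\<in>I. C4 (c m) * mon (?\<phi> m)"
    have "ev (z0, z1, x2, x3) ?\<Psi> = (\<Sum>m\<in>I. z1 ^ N * (cst (c m) * xmon m))"
    proof (unfold ev_sum, intro sum.cong refl)
      fix m assume m: "m \<in> I"
      obtain i j k l where e: "m = (i, j, k, l)" by (cases m)
      have "ev (z0, z1, x2, x3) (C4 (c m) * mon (?\<phi> m)) = cst (c m) * (z0 ^ i * z1 ^ (N - i - j) * x2 ^ k * x3 ^ l)"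
        unfolding e by (simp del: power_divide add: power_one_over[symmetric])
      also have "\<dots> = cst (c m) * (z1 ^ N * (x0 ^ i * x1 ^ j) * x2 ^ k * x3 ^ l)"
        unfolding power_inverse_shift[OF x_neq_0(2) N(1)[OF m[unfolded e]]] ..
      finally show "ev (z0, z1, x2, x3) (C4 (c m) * mon (?\<phi> m)) = z1 ^ N * (cst (c m) * xmon m)" unfolding e xmon.simps by (simp only: mult_ac)
    qed
    then have ev: "ev (z0, z1, x2, x3) ?\<Psi> = z1 ^ N * f" unfolding fs sum_distrib_left .
    have z1: "z1 ^ N \<noteq> 0" "z1 \<noteq> 0" using x_neq_0 by simp_all
    have "ord_at Vinf_a (z1 ^ N * f) = int N - 2"
      using dvr.ord_mult[OF dvr_Vinf(1) z1(1) f(2)] dvr.ord_power[OF dvr_Vinf(1) z1(2), of N] dvr.ord_pi[OF dvr_Vinf(1)] a by simp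
    then have o: "int (N - 2) \<le> ord_at (pdv (z0, z1, x2, x3) (X 1)) (ev (z0, z1, x2, x3) ?\<Psi>)" unfolding ev Vinf_a_def by (simp add: N_def)
    have "?\<Psi> \<noteq> 0" using ev z1 f(2) by auto
    then have d: "X 1 ^ (N - 2) dvd ?\<Psi>" by (intro dvd_of_ord[OF cs_zx _ _ o]) simp_all
    have inj: "inj_on ?\<phi> I"
    proof (rule inj_onI)
      fix x y assume xy: "x \<in> I" "y \<in> I" "?\<phi> x = ?\<phi> y"
      obtain i j k l i' j' k' l' where e: "x = (i, j, k, l)" "y = (i', j', k', l')" by (cases x, cases y)
      show "x = y" using N(1)[OF xy(1)[unfolded e]] N(1)[OF xy(2)[unfolded e]] xy(3) unfolding e by auto
    qed
    show ?thesis by (rule mon_coeff_zero[OF I(1) inj m(1) d]) (use m N(1)[OF m(1)] in auto)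
  qed
  have cb: "c (i, j, k, l) = 0" if m: "(i, j, k, l) \<in> I" "2 < k + l" for i j k l
  proof -
    let ?\<phi> = "\<lambda>(i, j, k, l). (i, j, k, N - k - l)"
    let ?\<Psi> = "\<Sum>m\<in>I. C4 (c m) * mon (?\<phi> m)"
    have "ev (x0, x1, z2, z3) ?\<Psi> = (\<Sum>m\<in>I. z3 ^ N * (cst (c m) * xmon m))"
    proof (unfold ev_sum, intro sum.cong refl)
      fix m assume m: "m \<in> I"
      obtain i j k l where e: "m = (i, j, k, l)" by (cases m)
      have "ev (x0, x1, z2, z3) (C4 (c m) * mon (?\<phi> m)) = cst (c m) * (x0 ^ i * x1 ^ j * (z2 ^ k * z3 ^ (N - k - l)))"
        unfolding e by (simp del: power_divide add: power_one_over[symmetric] mult.assoc)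
      also have "\<dots> = cst (c m) * (x0 ^ i * x1 ^ j * (z3 ^ N * (x2 ^ k * x3 ^ l)))"
        unfolding power_inverse_shift[OF x_neq_0(4) N(2)[OF m[unfolded e]]] ..
      finally show "ev (x0, x1, z2, z3) (C4 (c m) * mon (?\<phi> m)) = z3 ^ N * (cst (c m) * xmon m)" unfolding e xmon.simps by (simp only: mult_ac)
    qed
    then have ev: "ev (x0, x1, z2, z3) ?\<Psi> = z3 ^ N * f" unfolding fs sum_distrib_left .
    have z1: "z3 ^ N \<noteq> 0" "z3 \<noteq> 0" using x_neq_0 by simp_all
    have "ord_at Vinf_b (z3 ^ N * f) = int N - 2"
      using dvr.ord_mult[OF dvr_Vinf(2) z1(1) f(2)] dvr.ord_power[OF dvr_Vinf(2) z1(2), of N] dvr.ord_pi[OF dvr_Vinf(2)] b by simp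
    then have o: "int (N - 2) \<le> ord_at (pdv (x0, x1, z2, z3) (X 3)) (ev (x0, x1, z2, z3) ?\<Psi>)" unfolding ev Vinf_b_def by (simp add: N_def)
    have "?\<Psi> \<noteq> 0" using ev z1 f(2) by auto
    then have d: "X 3 ^ (N - 2) dvd ?\<Psi>" by (intro dvd_of_ord[OF cs_xz _ _ o]) simp_all
    have inj: "inj_on ?\<phi> I"
    proof (rule inj_onI)
      fix x y assume xy: "x \<in> I" "y \<in> I" "?\<phi> x = ?\<phi> y"
      obtain i j k l i' j' k' l' where e: "x = (i, j, k, l)" "y = (i', j', k', l')" by (cases x, cases y)
      show "x = y" using N(2)[OF xy(1)[unfolded e]] N(2)[OF xy(2)[unfolded e]] xy(3) unfolding e by auto
    qed
    show ?thesis by (rule mon_coeff_zero[OF I(1) inj m(1) d]) (use m N(2)[OF m(1)] in auto)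
  qed
  define I' where "I' = {m \<in> I. case m of (i, j, k, l) \<Rightarrow> i + j \<le> 2 \<and> k + l \<le> 2}"
  have I': "finite I'" using I(1) by (simp add: I'_def)
  have fs': "f = (\<Sum>m\<in>I'. cst (c m) * xmon m)"
    unfolding fs by (rule sum.mono_neutral_right[OF I(1)]) (use ca cb in \<open>force simp: I'_def\<close>)+
  have cc: "c (i, j, k, l) = 0" if m: "(i, j, k, l) \<in> I'" "1 < j + l" for i j k l
  proof -
    let ?\<phi> = "\<lambda>(i, j, k, l). (4 - j - l, 2 - i - j, k, 2 - k - l)"
    let ?\<Psi> = "\<Sum>m\<in>I'. C4 (c m) * mon (?\<phi> m)"
    let ?w = "z0^2 * (z1 / z0) * (z3 / z0)"
    have nz: "z0 \<noteq> 0" "z1 / z0 \<noteq> 0" "z3 / z0 \<noteq> 0" using x_neq_0 by simp_all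
    have xs: "1 / (z1 / z0) = x0" "1 / (z0 * (z1 / z0)) = x1" "u11 / (z3 / z0) = x2" "1 / (z0 * (z3 / z0)) = x3" using x_neq_0 by simp_all
    have "ev ch11 ?\<Psi> = (\<Sum>m\<in>I'. ?w^2 * (cst (c m) * xmon m))"
    proof (unfold ev_sum, intro sum.cong refl)
      fix m assume m: "m \<in> I'"
      obtain i j k l where e: "m = (i, j, k, l)" by (cases m)
      have le: "i + j \<le> 2" "k + l \<le> 2" "j + l \<le> 4" using m by (auto simp: e I'_def)
      have "ev (S, T, U, V) (C4 (c m) * mon (?\<phi> m)) = cst (c m) * (S ^ (4 - j - l) * T ^ (2 - i - j) * U ^ k * V ^ (2 - k - l))" for S T U V
        unfolding e by simp
      then have "ev ch11 (C4 (c m) * mon (?\<phi> m)) = cst (c m) * (z0 ^ (4 - j - l) * (z1 / z0) ^ (2 - i - j) * u11 ^ k * (z3 / z0) ^ (2 - k - l))" .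
      also have "\<dots> = cst (c m) * (?w^2 * (x0 ^ i * x1 ^ j * x2 ^ k * x3 ^ l))"
        unfolding power_chart_11[OF nz le] xs ..
      finally show "ev ch11 (C4 (c m) * mon (?\<phi> m)) = ?w^2 * (cst (c m) * xmon m)" unfolding e xmon.simps by (simp only: mult.left_commute)
    qed
    then have ev: "ev ch11 ?\<Psi> = ?w^2 * f" unfolding fs' sum_distrib_left .
    have w: "?w \<noteq> 0" using x_neq_0 by simp
    have o: "int 3 \<le> ord_at (pdv ch11 (X 0)) (ev ch11 ?\<Psi>)" using c11 unfolding ev V11_def mult.commute[of "?w^2"] by simp
    have "?\<Psi> \<noteq> 0"
    proof
      assume "?\<Psi> = 0"
      then have "?w^2 * f = 0" unfolding ev[symmetric] by simp
      then show False using w f(2) by (simp only: mult_eq_0_iff power_eq_0_iff) blast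
    qed
    then have d: "X 0 ^ 3 dvd ?\<Psi>" by (intro dvd_of_ord[OF cs_11 _ _ o]) simp_all
    have inj: "inj_on ?\<phi> I'"
    proof (rule inj_onI)
      fix x y assume xy: "x \<in> I'" "y \<in> I'" "?\<phi> x = ?\<phi> y"
      obtain i j k l i' j' k' l' where e: "x = (i, j, k, l)" "y = (i', j', k', l')" by (cases x, cases y)
      have "i + j \<le> 2" "k + l \<le> 2" "i' + j' \<le> 2" "k' + l' \<le> 2" using xy(1,2) by (auto simp: e I'_def)
      moreover have "4 - j - l = 4 - j' - l'" "2 - i - j = 2 - i' - j'" "k = k'" "2 - k - l = 2 - k' - l'" using xy(3) by (auto simp: e)
      ultimately show "x = y" unfolding e by auto
    qed
    show ?thesis by (rule mon_coeff_zero[OF I' inj m(1) d]) (use m in \<open>auto simp: I'_def\<close>)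
  qed
  define c' where "c' = (\<lambda>(i, j, k, l). if i + j \<le> 2 \<and> k + l \<le> 2 \<and> j + l \<le> 1 \<and> (i, j, k, l) \<in> I' then c (i, j, k, l) else 0)"
  have z: "c' (i, j, k, l) = 0" if "2 < i + j \<or> 2 < k + l \<or> 1 < j + l" for i j k l using that by (auto simp: c'_def)
  let ?box = "{..2::nat} \<times> {..2::nat} \<times> {..2::nat} \<times> {..2::nat}"
  have "f = (\<Sum>m\<in>?box. cst (c' m) * xmon m)"
    unfolding fs' by (rule sum.mono_neutral_cong[OF _ I']) (use cc in \<open>force simp: I'_def c'_def\<close>)+
  also have "\<dots> = (\<Sum>i\<le>2. \<Sum>j\<le>2. \<Sum>k\<le>2. \<Sum>l\<le>2. cst (c' (i, j, k, l)) * xmon (i, j, k, l))"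
    by (simp add: sum.cartesian_product case_prod_unfold del: xmon.simps)
  also have "\<dots> = hf cst (\<lambda>n. c' (n div 10 - 2, 0, n mod 10 - 2, 0)) (\<lambda>n. c' (n div 10 - 2, 1, n mod 10 - 2, 0)) (\<lambda>n. c' (n div 10 - 2, 0, n mod 10 - 2, 1)) x0 x1 x2 1 x3"
    unfolding hf_def by (simp add: numeral_2_eq_2 z algebra_simps)
  finally show ?thesis by blast
qed

text \<open>Divisors 5 and 10 contribute five equations each, and divisor 17 five for each value of
  \<open>\<sigma>\<close>. The constant term \<open>p 22\<close> stays free, and two further
  parameters survive.\<close>

lemma form_solved:
  assumes f: "f = hf cst p q r x0 x1 x2 1 x3" "f \<noteq> 0" and o5: "ord_at (exc 5) f = 4 - 2 * ord_at (exc 5) z3" and o10: "ord_at (exc 10) f = 4 - 2 * ord_at (exc 10) z1"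
    and o17: "ord_at (exc 17) f = 8 - 2 * ord_at (exc 17) (z0^2 * (z1 / z0) * (z3 / z0))"
  shows "\<exists>C0 C1 C2. f = FF h C0 C1 C2 x0 x1 x2 x3"
proof -
  have xs: "z2 / z3 = x2" "1 / z3 = x3" "z0 / z1 = x0" "1 / z1 = x1" "1 / (z1 / z0) = x0" "1 / (z0 * (z1 / z0)) = x1" "u11 / (z3 / z0) = x2" "1 / (z0 * (z3 / z0)) = x3"
    using x_neq_0 by simp_all
  note E = A.curve_equations[OF h0, unfolded xs, OF f o5[unfolded exc_simps(1)[of 5, simplified]]]
  have sw: "f = hf cst (\<lambda>n. p (swap_index n)) (\<lambda>n. r (swap_index n)) (\<lambda>n. q (swap_index n)) x2 x3 x0 1 x1" unfolding f(1) by (rule hf_swap)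
  have s: "swap_index 22 = 22" "swap_index 23 = 32" "swap_index 24 = 42" "swap_index 32 = 23" "swap_index 33 = 33" "swap_index 34 = 43" "swap_index 42 = 24" "swap_index 43 = 34" "swap_index 44 = 44"
    by (simp_all add: swap_index_def)
  have e10: "exc 10 = A'.VV h 5" using exc_simps(2)[of 10] by simp
  have e17: "exc 17 = C.VV 6" using exc_simps(4)[of 17] by simp
  note F = A'.curve_equations[OF h0, unfolded xs, OF sw f(2) o10[unfolded e10], unfolded s]
  note D = C.diag_equations_at[unfolded xs, OF f o17[unfolded e17]]
  have one: "(1::complex) \<noteq> 0" "(-1::complex) \<noteq> 0" by simp_all
  note D1 = D[OF one(1) refl refl refl refl refl refl refl refl refl refl refl refl refl] and D2 = D[OF one(2) refl refl refl refl refl refl refl refl refl refl refl refl refl]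
  \<comment> \<open>The equations of divisor 17 hold at \<open>\<sigma> = 1\<close> and at
    \<open>\<sigma> = - 1\<close>; adding and subtracting separates the even and the odd part in
    \<open>\<sigma>\<close>, here and in the following steps.\<close>
  have a0: "h * p 44 = 0 \<and> - q 33 + q 24 + 2 * (1 + h) * q 34 + (- r 42 + r 33 + (1 + h) * r 43) = 0"
    by (rule plus_minus_zero, rule trans[OF _ D1(2)], simp add: algebra_simps, rule trans[OF _ D2(2)], simp add: algebra_simps)
  then have p44: "p 44 = 0" using h0 by simp
  have "h * (- p 43 + p 34 + 2 * (1 + h) * p 44) + q 34 = 0 \<and> (q 32 - q 23 - (1 + h) * q 33 + 2 * (1 + h) * q 24 + (1 + h)^2 * q 34) + (- r 32 + r 23 + (1 + h) * r 33) = 0"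
    by (rule plus_minus_zero, rule trans[OF _ D1(3)], simp add: algebra_simps, rule trans[OF _ D2(3)], simp add: algebra_simps)
  note a1 = this[unfolded p44]
  have "h * (- p 43 + p 34 + 2 * (1 + h) * p 44) = 0 \<and>
      h * (p 32 - p 23 - (1 + h) * p 33 + 2 * (1 + h) * p 24 + (1 + h)^2 * p 34) + (q 32 - q 23 - (1 + h) * q 33 + 2 * (1 + h) * q 24 + (1 + h)^2 * q 34) = 0"
    by (rule plus_minus_zero, rule trans[OF _ D1(5)], simp add: algebra_simps, rule trans[OF _ D2(5)], simp add: algebra_simps)
  note a2 = this[unfolded p44]
  have pc: "p 34 = p 43" using a2 h0 by simp
  have q34: "q 34 = 0" using a1 pc by simp
  have r43: "r 43 = 0" using D1(1) q34 by simp
  have "h * (p 42 - p 33 - (1 + h) * p 43 + p 24 + 2 * (1 + h) * p 34 + (1 + h)^2 * p 44) + (- q 33 + q 24 + 2 * (1 + h) * q 34) = 0 \<and>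
      h * p 44 + (q 22 - (1 + h) * q 23 + (1 + h)^2 * q 24) + (- r 22 + (1 + h) * r 23) = 0"
    by (rule plus_minus_zero, rule trans[OF _ D1(4)], simp add: algebra_simps, rule trans[OF _ D2(4)], simp add: algebra_simps)
  note a3 = this[unfolded p44 q34]
  have e1: "r 23 + r 33 = 0" by (rule trans[OF _ E(1)]) (simp add: p44 pc q34 r43 algebra_simps)
  have e2: "h^2 * (p 24 + p 43) + (r 22 + r 32 + r 42 - h * r 33) = 0" by (rule trans[OF _ E(2)]) (simp add: p44 pc q34 r43 algebra_simps)
  have e3: "h * q 24 + (r 22 + r 32 + r 42 - h * r 33) = 0" by (rule trans[OF _ E(3)]) (simp add: p44 pc q34 r43 algebra_simps)
  have e4: "h^2 * (p 24 + p 43) + (h^2 * p 43 - h * (p 23 + p 33 + p 43)) + (r 32 + 2 * r 42) = 0" by (rule trans[OF _ E(4)]) (simp add: p44 pc q34 r43 algebra_simps)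
  have e5: "- (q 23 + q 33) + (r 32 + 2 * r 42) = 0" by (rule trans[OF _ E(5)]) (simp add: p44 pc q34 r43 algebra_simps)
  have f1: "q 32 + q 33 = 0" by (rule trans[OF _ F(1)]) (simp add: p44 pc q34 r43 algebra_simps)
  have f2: "h^2 * (p 42 + p 43) + (q 22 + q 23 + q 24 - h * q 33) = 0" by (rule trans[OF _ F(2)]) (simp add: p44 pc q34 r43 algebra_simps)
  have f3: "h * r 42 + (q 22 + q 23 + q 24 - h * q 33) = 0" by (rule trans[OF _ F(3)]) (simp add: p44 pc q34 r43 algebra_simps)
  have f4: "h^2 * (p 42 + p 43) + (h^2 * p 43 - h * (p 32 + p 33 + p 43)) + (q 23 + 2 * q 24) = 0" by (rule trans[OF _ F(4)]) (simp add: p44 pc q34 r43 algebra_simps)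
  have f5: "- (r 32 + r 33) + (q 23 + 2 * q 24) = 0" by (rule trans[OF _ F(5)]) (simp add: p44 pc q34 r43 algebra_simps)
  have g1: "- q 33 + q 24 - r 42 + r 33 = 0" by (rule trans[OF _ conjunct2[OF a0]]) (simp add: p44 pc q34 r43 algebra_simps)
  have g2: "q 32 - q 23 - (1 + h) * q 33 + 2 * (1 + h) * q 24 - r 32 + r 23 + (1 + h) * r 33 = 0" by (rule trans[OF _ conjunct2[OF a1]]) (simp add: p44 pc q34 r43 algebra_simps)
  have g3: "q 22 - (1 + h) * q 23 + (1 + h)^2 * q 24 - r 22 + (1 + h) * r 23 = 0" by (rule trans[OF _ conjunct2[OF a3]]) (simp add: p44 pc q34 r43 algebra_simps)
  have k2: "h * (p 42 - p 33 - (1 + h) * p 43 + p 24 + 2 * (1 + h) * p 43) - q 33 + q 24 = 0" by (rule trans[OF _ conjunct1[OF a3]]) (simp add: p44 pc q34 r43 algebra_simps)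
  have k3: "h * (p 32 - p 23 - (1 + h) * p 33 + 2 * (1 + h) * p 24 + (1 + h)^2 * p 43) + (q 32 - q 23 - (1 + h) * q 33 + 2 * (1 + h) * q 24) = 0" by (rule trans[OF _ conjunct2[OF a2]]) (simp add: p44 pc q34 r43 algebra_simps)
  note sol = solve_system[OF h0 e1 e2 e3 e4 e5 f1 f2 f3 f4 f5 g1 g2 g3 k2 k3]
  \<comment> \<open>The parameters are read off from one monomial each: \<open>x0^2 * x2\<close> has
    coefficient \<open>h\<close> in \<open>I1\<close> and does not occur in \<open>I2\<close>, while
    \<open>x0^2 * x3\<close> has coefficient \<open>h\<close> in \<open>I2\<close> and does not
    occur in \<open>I1\<close>.\<close>
  define C1 C2 where C: "C1 = p 43 / h" "C2 = r 42 / h"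
  have b: "p 43 = h * C1" "r 42 = h * C2" using h0 by (simp_all add: C)
  have "h * p 42 = h * (C2 - h * C1)" "h * p 24 = h * (C2 - h * C1)" "h * p 33 = h * (C2 + (h^2 - h) * C1)"
    using sol unfolding b by (simp_all add: algebra_simps)
  then have p3: "p 42 = C2 - h * C1" "p 24 = C2 - h * C1" "p 33 = C2 + (h^2 - h) * C1" using h0 by simp_all
  have rest: "p 32 = 2 * (h * C2)" "p 23 = 2 * (h * C2)" "q 24 = h * C2" "q 33 = 2 * (h * C2)" "r 33 = 2 * (h * C2)" "q 32 = - 2 * (h * C2)" "r 23 = - 2 * (h * C2)"
    "q 23 = (h - 1) * (h * C2)" "r 32 = (h - 1) * (h * C2)" "q 22 = 0" "r 22 = 0" "p 34 = h * C1"
    using sol pc unfolding b by simp_all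
  have "f = FF h (p 22) C1 C2 x0 x1 x2 x3"
    unfolding f(1) hf_def FF_def J1_def J2_def p44 q34 r43 b p3 rest
    by (simp add: cst_hom cst_numeral algebra_simps power2_eq_square)
  then show ?thesis by blast
qed

end

lemma FF_swap: "FF h C0 C1 C2 a b c d = FF h C0 C1 C2 c d a b"
  unfolding FF_def J_sym(1)[of "cst h" a c] J_sym(2)[of "cst h" a b c d] ..

text \<open>The numerator at infinity in one factor. The factor \<open>\<sigma> ^ 0\<close> puts it
  into the shape expected by \<open>ord_pdv_at\<close>, with cofactor of order zero.\<close>

lemma FF_inf:
  assumes "w \<noteq> 0"
  shows "FF h C0 C1 C2 (z / w) (1 / w) c d * w^2 = \<sigma> ^ 0 * (cst C0 * w^2 + cst C1 * (cst h * (- (z^2) - z * w * c + cst h * z * w * c + z^2 * c - w^2 * c^2 + z * w * c^2))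
    + cst C2 * (2 * cst h * z * w + z^2 - 2 * cst h * z + 2 * cst h * w^2 * c + z * w * c - cst h * w * c + (cst h)^2 * w * c + 2 * cst h * z * c + w^2 * c^2
      + cst h * w * c^2 - cst h * z * w * d + (cst h)^2 * z * w * d + cst h * z^2 * d - 2 * cst h * w^2 * c * d + 2 * cst h * z * w * c * d))"
  unfolding FF_def J1_def J2_def using assms by (simp add: field_simps power2_eq_square)

lemma FF_polyring: "FF h C0 C1 C2 x0 x1 x2 x3 \<in> polyring {x0, x1, x2, x3}"
proof -
  have two: "ev y (2 :: poly4) = 2" for y unfolding one_add_one[symmetric] by (simp only: ev_hom)
  have "FF h C0 C1 C2 x0 x1 x2 x3 = ev (x0, x1, x2, x3) (C4 C0 + C4 C1 * J1 (C4 h) (X 0) (X 2) + C4 C2 * J2 (C4 h) (X 0) (X 1) (X 2) (X 3))"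
    by (simp add: FF_def J1_def J2_def two)
  then show ?thesis unfolding polyring_eq by blast
qed

lemma I_FF: "cst C0 + cst C1 * I1 h = FF h C0 C1 0 x0 x1 x2 x3" "cst C0 + cst C1 * I1 h + cst C2 * I2 h = FF h C0 C1 C2 x0 x1 x2 x3"
  by (simp_all add: FF_def I1_def I2_def J1_def J2_def Let_def)

lemma FF_Vinf:
  assumes h: "h \<noteq> 0" and C: "C2 \<noteq> 0 \<or> C2 = 0 \<and> C1 \<noteq> 0"
  shows "ord_at Vinf_a (FF h C0 C1 C2 x0 x1 x2 x3) = - 2" "ord_at Vinf_b (FF h C0 C1 C2 x0 x1 x2 x3) = - 2"
proof -
  have z: "z1 \<noteq> 0" "z3 \<noteq> 0" using x_neq_0 by simp_all
  have xs: "z0 / z1 = x0" "1 / z1 = x1" "z2 / z3 = x2" "1 / z3 = x3" using x_neq_0 by simp_all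
  \<comment> \<open>At the witness point the cofactor is
    \<open>C1 * h * (c - 1) + C2 * (1 + 2 * h * (c - 1))\<close>; \<open>c = 1\<close> isolates
    \<open>C2\<close>, and \<open>c = 2\<close> leaves \<open>C1 * h\<close> when
    \<open>C2 = 0\<close>.\<close>
  define c v where cv: "c = (if C2 = 0 then 2 else 1 :: complex)" "v = (if C2 = 0 then C1 * h else C2)"
  have v: "v \<noteq> 0" using h C by (auto simp: cv)
  have e: "C1 * (h * (c - 1)) + C2 * (1 + 2 * h * (c - 1)) = v" using C by (auto simp: cv)
  note P = place_crd[OF cs_zx, of 0 "(1, 0, c, 0)"] place_crd[OF cs_zx, of 1 "(1, 0, c, 0)"] place_crd[OF cs_zx, of 2 "(1, 0, c, 0)"] place_crd[OF cs_zx, of 3 "(1, 0, c, 0)"]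
  note Q = place_crd[OF cs_xz, of 0 "(c, 0, 1, 0)"] place_crd[OF cs_xz, of 1 "(c, 0, 1, 0)"] place_crd[OF cs_xz, of 2 "(c, 0, 1, 0)"] place_crd[OF cs_xz, of 3 "(c, 0, 1, 0)"]
  obtain a0 a1 a2 a3 where a: "a0 = z0" "a1 = z1" "a2 = x2" "a3 = x3" by blast
  obtain b0 b1 b2 b3 where b: "b0 = x0" "b1 = x1" "b2 = z2" "b3 = z3" by blast
  have ca: "coordsys (a0, a1, a2, a3)" and cb: "coordsys (b0, b1, b2, b3)" unfolding a b by (rule cs_zx, rule cs_xz)
  note P = P[folded a, simplified] and Q = Q[folded b, simplified]
  have Wa: "Vinf_a = pdv (a0, a1, a2, a3) (X 1)" and Wb: "Vinf_b = pdv (b0, b1, b2, b3) (X 3)" unfolding a b Vinf_a_def Vinf_b_def by (rule refl)+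
  have za: "a1 \<noteq> 0" and zb: "b3 \<noteq> 0" unfolding a b by (fact z)+
  have "FF h C0 C1 C2 (a0 / a1) (1 / a1) a2 a3 \<noteq> 0 \<and> ord_at Vinf_a (FF h C0 C1 C2 (a0 / a1) (1 / a1) a2 a3) = int 0 - 2 * ord_at Vinf_a a1"
    by (rule ord_pdv_at[where i = 1 and b = "(1, 0, c, 0)" and c = v, OF ca _ _ Wa _ FF_inf[OF za] _ v za])
      ((use P in \<open>simp_all add: place[OF ca]\<close>)?, (use e in \<open>simp add: algebra_simps\<close>)?)
  then have "ord_at Vinf_a (FF h C0 C1 C2 x0 x1 x2 x3) = int 0 - 2 * ord_at Vinf_a z1" unfolding a xs by (rule conjunct2)
  then show "ord_at Vinf_a (FF h C0 C1 C2 x0 x1 x2 x3) = - 2" using dvr.ord_pi[OF dvr_Vinf(1)] by simp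
  have "FF h C0 C1 C2 (b2 / b3) (1 / b3) b0 b1 \<noteq> 0 \<and> ord_at Vinf_b (FF h C0 C1 C2 (b2 / b3) (1 / b3) b0 b1) = int 0 - 2 * ord_at Vinf_b b3"
    by (rule ord_pdv_at[where i = 3 and b = "(c, 0, 1, 0)" and c = v, OF cb _ _ Wb _ FF_inf[OF zb] _ v zb])
      ((use Q in \<open>simp_all add: place[OF cb]\<close>)?, (use e in \<open>simp add: algebra_simps\<close>)?)
  then have "ord_at Vinf_b (FF h C0 C1 C2 x2 x3 x0 x1) = int 0 - 2 * ord_at Vinf_b z3" unfolding b xs by (rule conjunct2)
  then show "ord_at Vinf_b (FF h C0 C1 C2 x0 x1 x2 x3) = - 2" unfolding FF_swap[of h C0 C1 C2 x0 x1 x2 x3] using dvr.ord_pi[OF dvr_Vinf(2)] by simp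
qed

section \<open>Multiplicities and required orders\<close>

definition m1 :: "nat \<Rightarrow> int" where
  "m1 i = (if i = 1 \<or> i = 6 then 2 else if i = 11 then 4 else if i \<in> {2, 4, 7, 9, 12, 13, 14, 16} then 1 else 0)"

definition m2 :: "nat \<Rightarrow> int" where
  "m2 i = (if i = 11 then 3 else if i \<in> {1, 2, 4, 5, 6, 7, 9, 10, 12, 13, 14, 16, 17} then 1 else 0)"

text \<open>Sums of the multiplicities \<open>m1\<close> against the columns of \<open>Emat\<close>:
  entry \<open>j\<close> is the order required along \<open>exc j\<close> once the poles have been
  cleared. Entry 0 is a placeholder, as the divisors are counted from 1.\<close>

definition "M1 = [0, 2, 3, 3, 4, 4, 2, 3, 3, 4, 4, 4, 1, 2, 7, 7, 8, 8 :: int]"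
definition "M2 = [0, 1, 2, 2, 3, 4, 1, 2, 2, 3, 4, 3, 1, 2, 6, 6, 7, 8 :: int]"

context lines_setting
begin

lemma sum17:
  fixes f :: "nat \<Rightarrow> int"
  shows "(\<Sum>i = 1..17. f i) = f 1 + f 2 + f 3 + f 4 + f 5 + f 6 + f 7 + f 8 + f 9 + f 10 + f 11 + f 12 + f 13 + f 14 + f 15 + f 16 + f 17"
  unfolding set17 by (simp only: sum_set_upt_conv_sum_list_nat list17 list.map sum_list.Cons sum_list.Nil) simp

lemma mult_sums:
  assumes "j \<in> {1..17}"
  shows "(\<Sum>i = 1..17. m1 i * Emat i j) = M1 ! j" "(\<Sum>i = 1..17. m2 i * Emat i j) = M2 ! j"
proof -
  have "list_all (\<lambda>j. (\<Sum>i = 1..17. m1 i * Emat i j) = M1 ! j) [1..<18]" "list_all (\<lambda>j. (\<Sum>i = 1..17. m2 i * Emat i j) = M2 ! j) [1..<18]"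
    unfolding list17 sum17 M1_def M2_def by (simp_all add: Emat_def m1_def m2_def)
  then show "(\<Sum>i = 1..17. m1 i * Emat i j) = M1 ! j" "(\<Sum>i = 1..17. m2 i * Emat i j) = M2 ! j"
    using assms unfolding set17 list_all_iff by blast+
qed

lemma comb_m:
  "comb 2 2 (\<lambda>i. - m1 i) = (\<lambda>V. 2 * H_a h la V + 2 * H_b h lb V - 2 * E h 1 V - 2 * E h 6 V - 4 * E h 11 V - (\<Sum>i \<in> {2, 4, 7, 9, 12, 13, 14, 16}. E h i V))"
  "comb 2 2 (\<lambda>i. - m2 i) = (\<lambda>V. 2 * H_a h la V + 2 * H_b h lb V - 3 * E h 11 V - (\<Sum>i \<in> {1, 2, 4, 5, 6, 7, 9, 10, 12, 13, 14, 16, 17}. E h i V))"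
  by (rule ext, simp only: comb_def sum17, simp add: m1_def, rule ext, simp only: comb_def sum17, simp add: m2_def)

text \<open>Its square clears the poles along \<open>exc j\<close> of a polynomial of bidegree
  (2,2). For \<open>j \<ge> 11\<close> it is the product of \<open>z1\<close> and \<open>z3\<close>,
  written in the chart coordinates over the point 11.\<close>

definition wt :: "nat \<Rightarrow> ratfun" where
  "wt j = (if j \<le> 5 then z3 else if j \<le> 10 then z1 else z0^2 * (z1 / z0) * (z3 / z0))"

lemma wt_ord:
  assumes j: "j \<in> {1..17}"
  shows "2 * ord_at (exc j) (wa j) + 2 * ord_at (exc j) (wb j) = - 2 * ord_at (exc j) (wt j)"
proof -
  interpret dvr "exc j" "unif j" by (rule dvr_exc[OF j])
  have i: "ord_at (exc j) z1 = - ord_at (exc j) x1" "ord_at (exc j) z3 = - ord_at (exc j) x3"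
    using ord_inverse[of x1] ord_inverse[of x3] x_neq_0 by (simp_all add: inverse_eq_divide)
  have "z0^2 * (z1 / z0) * (z3 / z0) = z1 * z3" using x_neq_0 by (simp add: field_simps power2_eq_square)
  then have "ord_at (exc j) (z0^2 * (z1 / z0) * (z3 / z0)) = ord_at (exc j) z1 + ord_at (exc j) z3"
    using ord_mult[of z1 z3] x_neq_0 by simp
  then show ?thesis unfolding wa_def wb_def wt_def using i ord_1 by simp
qed

lemma xs: "z2 / z3 = x2" "1 / z3 = x3" "z0 / z1 = x0" "1 / z1 = x1" "1 / (z1 / z0) = x0" "1 / (z0 * (z1 / z0)) = x1" "u11 / (z3 / z0) = x2" "1 / (z0 * (z3 / z0)) = x3"
  using x_neq_0 by simp_all

lemma nth_parts:
  assumes "j \<in> {1..17}"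
  shows "M1 ! j = (if j \<le> 5 then [0, 2, 3, 3, 4, 4] ! j else if j \<le> 10 then [0, 2, 3, 3, 4, 4] ! (j - 5) else if j = 11 then 4 else [0, 1, 2, 7, 7, 8, 8] ! (j - 11))"
    "M2 ! j = (if j \<le> 5 then [0, 1, 2, 2, 3, 4] ! j else if j \<le> 10 then [0, 1, 2, 2, 3, 4] ! (j - 5) else if j = 11 then 3 else [0, 1, 2, 6, 6, 7, 8] ! (j - 11))"
proof -
  have "list_all (\<lambda>j. M1 ! j = (if j \<le> 5 then [0, 2, 3, 3, 4, 4] ! j else if j \<le> 10 then [0, 2, 3, 3, 4, 4] ! (j - 5) else if j = 11 then 4 else [0, 1, 2, 7, 7, 8, 8] ! (j - 11))) [1..<18]"
    "list_all (\<lambda>j. M2 ! j = (if j \<le> 5 then [0, 1, 2, 2, 3, 4] ! j else if j \<le> 10 then [0, 1, 2, 2, 3, 4] ! (j - 5) else if j = 11 then 3 else [0, 1, 2, 6, 6, 7, 8] ! (j - 11))) [1..<18]"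
    unfolding list17 M1_def M2_def by simp_all
  then show "M1 ! j = (if j \<le> 5 then [0, 2, 3, 3, 4, 4] ! j else if j \<le> 10 then [0, 2, 3, 3, 4, 4] ! (j - 5) else if j = 11 then 4 else [0, 1, 2, 7, 7, 8, 8] ! (j - 11))"
    "M2 ! j = (if j \<le> 5 then [0, 1, 2, 2, 3, 4] ! j else if j \<le> 10 then [0, 1, 2, 2, 3, 4] ! (j - 5) else if j = 11 then 3 else [0, 1, 2, 6, 6, 7, 8] ! (j - 11))"
    using assms unfolding set17 list_all_iff by blast+
qed

lemma FF_orders_1:
  assumes C1: "C1 \<noteq> 0" and j: "j \<in> {1..17}"
  shows "FF h C0 C1 0 x0 x1 x2 x3 \<noteq> 0" "ord_at (exc j) (FF h C0 C1 0 x0 x1 x2 x3) = M1 ! j - 2 * ord_at (exc j) (wt j)"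
proof -
  show "FF h C0 C1 0 x0 x1 x2 x3 \<noteq> 0" using A.ord_C1(1)[OF h0 C1, of C0] unfolding xs by blast
  note a = A.ord_C1(2)[OF h0 C1, unfolded xs] and b = A'.ord_C1(2)[OF h0 C1, unfolded xs] and c = C.ord_C1(2,3)[OF C1, unfolded xs]
  show "ord_at (exc j) (FF h C0 C1 0 x0 x1 x2 x3) = M1 ! j - 2 * ord_at (exc j) (wt j)"
    using j
  proof (cases rule: range_cases)
    case 1
    have "1 \<le> j" "j \<le> 5" using 1 by auto
    from a[OF this] show ?thesis unfolding nth_parts(1)[OF j] exc_simps(1)[OF 1] wt_def using 1 by simp
  next
    case 2
    have "1 \<le> j - 5" "j - 5 \<le> 5" "\<not> j \<le> 5" "j \<le> 10" using 2 by auto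
    with b[OF this(1,2)] show ?thesis unfolding nth_parts(1)[OF j] exc_simps(2)[OF 2] wt_def FF_swap[of h C0 C1 0 x0] by simp
  next
    case 3
    have n: "\<not> (11::nat) \<le> 5" "\<not> (11::nat) \<le> 10" by simp_all
    have m: "M1 ! 11 = 4" by (simp add: M1_def)
    show ?thesis unfolding 3 exc_simps(3) wt_def V11_def m using c(1)[of C0] by (simp only: n if_False if_True simp_thms)
  next
    case 4
    have "1 \<le> j - 11" "j - 11 \<le> 6" "\<not> j \<le> 5" "\<not> j \<le> 10" "j \<noteq> 11" using 4 by auto
    with c(2)[OF this(1,2)] show ?thesis unfolding nth_parts(1)[OF j] exc_simps(4)[OF 4] wt_def by (simp only: if_False)
  qed
qed

lemma FF_orders_2:
  assumes C2: "C2 \<noteq> 0" and j: "j \<in> {1..17}"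
  shows "FF h C0 C1 C2 x0 x1 x2 x3 \<noteq> 0" "ord_at (exc j) (FF h C0 C1 C2 x0 x1 x2 x3) = M2 ! j - 2 * ord_at (exc j) (wt j)"
proof -
  show "FF h C0 C1 C2 x0 x1 x2 x3 \<noteq> 0" using A.ord_C2(1)[OF h0 C2, of C0 C1] unfolding xs by blast
  note a = A.ord_C2(2)[OF h0 C2, unfolded xs] and b = A'.ord_C2(2)[OF h0 C2, unfolded xs] and c = C.ord_C2(2,3)[OF C2, unfolded xs]
  show "ord_at (exc j) (FF h C0 C1 C2 x0 x1 x2 x3) = M2 ! j - 2 * ord_at (exc j) (wt j)"
    using j
  proof (cases rule: range_cases)
    case 1
    have "1 \<le> j" "j \<le> 5" using 1 by auto
    from a[OF this] show ?thesis unfolding nth_parts(2)[OF j] exc_simps(1)[OF 1] wt_def using 1 by simp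
  next
    case 2
    have "1 \<le> j - 5" "j - 5 \<le> 5" "\<not> j \<le> 5" "j \<le> 10" using 2 by auto
    with b[OF this(1,2)] show ?thesis unfolding nth_parts(2)[OF j] exc_simps(2)[OF 2] wt_def FF_swap[of h C0 C1 C2 x0] by simp
  next
    case 3
    have n: "\<not> (11::nat) \<le> 5" "\<not> (11::nat) \<le> 10" by simp_all
    have m: "M2 ! 11 = 3" by (simp add: M2_def)
    show ?thesis unfolding 3 exc_simps(3) wt_def V11_def m using c(1)[of C0 C1] by (simp only: n if_False if_True simp_thms)
  next
    case 4
    have "1 \<le> j - 11" "j - 11 \<le> 6" "\<not> j \<le> 5" "\<not> j \<le> 10" "j \<noteq> 11" using 4 by auto
    with c(2)[OF this(1,2)] show ?thesis unfolding nth_parts(2)[OF j] exc_simps(4)[OF 4] wt_def by (simp only: if_False)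
  qed
qed

lemma class_eq_iff:
  assumes basis: "Pic_free_basis h la lb" and f: "f \<noteq> 0" and m: "\<forall>j \<in> {1..17}. (\<Sum>i = 1..17. m i * Emat i j) = M ! j"
  shows "div_class (var_X h) (proper_transform (var_X h) P2xP2 (hypersurface f)) = div_class (var_X h) (comb 2 2 (\<lambda>i. - m i)) \<longleftrightarrow>
    ord_at Vinf_a f = - 2 \<and> ord_at Vinf_b f = - 2 \<and> (\<forall>j \<in> {1..17}. ord_at (exc j) f = M ! j - 2 * ord_at (exc j) (wt j))"
  unfolding class_iff[OF basis f] by (intro conj_cong refl ball_cong) (use m wt_ord in \<open>auto simp: algebra_simps\<close>)

text \<open>Besides the poles at infinity, only the orders along the last divisor of each chain and
  along divisor 11 enter; they already confine \<open>f\<close> to the span. Its constant members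
  are excluded because \<open>f\<close> must have a pole at infinity.\<close>

lemma FF_of_orders:
  assumes f: "f \<in> polyring {x0, x1, x2, x3}" "f \<noteq> 0" and M: "M ! 5 = 4" "M ! 10 = 4" "3 \<le> M ! 11" "M ! 17 = 8"
    and o: "ord_at Vinf_a f = - 2 \<and> ord_at Vinf_b f = - 2 \<and> (\<forall>j \<in> {1..17}. ord_at (exc j) f = M ! j - 2 * ord_at (exc j) (wt j))"
  obtains C0 C1 C2 where "f = FF h C0 C1 C2 x0 x1 x2 x3" "C1 \<noteq> 0 \<or> C2 \<noteq> 0"
proof -
  let ?w = "z0^2 * (z1 / z0) * (z3 / z0)"
  have oj: "j \<in> {1..17} \<Longrightarrow> ord_at (exc j) f = M ! j - 2 * ord_at (exc j) (wt j)" for j using o by blast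
  have w: "?w \<noteq> 0" using x_neq_0 by simp
  have "ord_at V11 (f * ?w^2) = ord_at V11 f + 2 * ord_at V11 ?w"
    using dvr.ord_mult[OF V11(2) f(2), of "?w^2"] dvr.ord_power[OF V11(2) w, of 2] w by simp
  then have "3 \<le> ord_at V11 (f * ?w^2)" using oj[of 11] M(3) unfolding exc_simps(3) wt_def by simp
  then obtain p q r where pqr: "f = hf cst p q r x0 x1 x2 1 x3" using form_exists[OF f] o by blast
  have o5: "ord_at (exc 5) f = 4 - 2 * ord_at (exc 5) z3" using oj[of 5] M(1) unfolding wt_def by simp
  have o10: "ord_at (exc 10) f = 4 - 2 * ord_at (exc 10) z1" using oj[of 10] M(2) unfolding wt_def by simp
  have o17: "ord_at (exc 17) f = 8 - 2 * ord_at (exc 17) ?w" using oj[of 17] M(4) unfolding wt_def by simp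
  obtain C0 C1 C2 where F: "f = FF h C0 C1 C2 x0 x1 x2 x3" using form_solved[OF pqr f(2) o5 o10 o17] by blast
  have "C1 \<noteq> 0 \<or> C2 \<noteq> 0"
  proof (rule ccontr)
    assume "\<not> ?thesis"
    then have c: "f = cst C0" unfolding F FF_def by simp
    then have "C0 \<noteq> 0" using f(2) by auto
    moreover have "range cst \<subseteq> Vinf_a" using cst_mem[of Vinf_a] P2xP2_prime[OF dvr_Vinf(1) Vinf_P2xP2(1)] by (simp add: prime_divisors_def)
    ultimately have "ord_at Vinf_a f = 0" unfolding c using ord_cst[OF dvr_Vinf(1)] by blast
    then show False using o by simp
  qed
  then show ?thesis using that F by blast
qed

text \<open>The orders confine the equation to the three-dimensional span, and divisor 11 decides
  about \<open>C2\<close>: a member with nonzero \<open>C2\<close> has normalized order 3 there,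
  whereas this class demands 4.\<close>

lemma hypersurfaces_1:
  assumes basis: "Pic_free_basis h la lb"
  shows "{D \<in> hypersurfaces. div_class (var_X h) (proper_transform (var_X h) P2xP2 D) = div_class (var_X h) (comb 2 2 (\<lambda>i. - m1 i))}
    = {hypersurface (FF h C0 C1 0 x0 x1 x2 x3) | C0 C1. C1 \<noteq> 0}" (is "?L = ?R")
proof
  have "\<forall>j \<in> {1..17}. (\<Sum>i = 1..17. m1 i * Emat i j) = M1 ! j" using mult_sums(1) by blast
  note ci = class_eq_iff[OF basis _ this]
  show "?L \<subseteq> ?R"
  proof
    fix D assume "D \<in> ?L"
    then obtain f where f: "f \<in> polyring {x0, x1, x2, x3}" "f \<noteq> 0" "D = hypersurface f"
      and cl: "div_class (var_X h) (proper_transform (var_X h) P2xP2 (hypersurface f)) = div_class (var_X h) (comb 2 2 (\<lambda>i. - m1 i))"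
      by (auto simp: hypersurfaces_def)
    note o = iffD1[OF ci[OF f(2)] cl]
    obtain C0 C1 C2 where F: "f = FF h C0 C1 C2 x0 x1 x2 x3" "C1 \<noteq> 0 \<or> C2 \<noteq> 0"
      by (rule FF_of_orders[OF f(1,2) _ _ _ _ o]) (simp_all add: M1_def)
    have j11: "11 \<in> {1..17::nat}" by simp
    have "C2 = 0"
    proof (rule ccontr)
      assume "C2 \<noteq> 0"
      then have "ord_at (exc 11) f = M2 ! 11 - 2 * ord_at (exc 11) (wt 11)" unfolding F(1) by (rule FF_orders_2) simp
      moreover have "ord_at (exc 11) f = M1 ! 11 - 2 * ord_at (exc 11) (wt 11)" using o j11 by blast
      ultimately show False by (simp add: M1_def M2_def)
    qed
    then show "D \<in> ?R" using F f(3) by blast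
  qed
  show "?R \<subseteq> ?L"
  proof
    fix D assume "D \<in> ?R"
    then obtain C0 C1 where D: "D = hypersurface (FF h C0 C1 0 x0 x1 x2 x3)" "C1 \<noteq> 0" by blast
    have nz: "FF h C0 C1 0 x0 x1 x2 x3 \<noteq> 0" by (rule FF_orders_1(1)[OF D(2), of 1]) simp
    have "ord_at Vinf_a (FF h C0 C1 0 x0 x1 x2 x3) = - 2 \<and> ord_at Vinf_b (FF h C0 C1 0 x0 x1 x2 x3) = - 2 \<and>
      (\<forall>j \<in> {1..17}. ord_at (exc j) (FF h C0 C1 0 x0 x1 x2 x3) = M1 ! j - 2 * ord_at (exc j) (wt j))"
      using FF_Vinf[OF h0, of 0 C1 C0] FF_orders_1(2)[OF D(2)] D(2) by blast
    then show "D \<in> ?L" using ci[OF nz] FF_polyring nz unfolding D(1) hypersurfaces_def by blast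
  qed
qed

text \<open>Divisor 11 decides again, in the opposite direction: a member with \<open>C2 = 0\<close>
  has normalized order 4 there, one more than this class allows.\<close>

lemma hypersurfaces_2:
  assumes basis: "Pic_free_basis h la lb"
  shows "{D \<in> hypersurfaces. div_class (var_X h) (proper_transform (var_X h) P2xP2 D) = div_class (var_X h) (comb 2 2 (\<lambda>i. - m2 i))}
    = {hypersurface (FF h C0 C1 C2 x0 x1 x2 x3) | C0 C1 C2. C2 \<noteq> 0}" (is "?L = ?R")
proof
  have "\<forall>j \<in> {1..17}. (\<Sum>i = 1..17. m2 i * Emat i j) = M2 ! j" using mult_sums(2) by blast
  note ci = class_eq_iff[OF basis _ this]
  show "?L \<subseteq> ?R"
  proof
    fix D assume "D \<in> ?L"
    then obtain f where f: "f \<in> polyring {x0, x1, x2, x3}" "f \<noteq> 0" "D = hypersurface f"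
      and cl: "div_class (var_X h) (proper_transform (var_X h) P2xP2 (hypersurface f)) = div_class (var_X h) (comb 2 2 (\<lambda>i. - m2 i))"
      by (auto simp: hypersurfaces_def)
    note o = iffD1[OF ci[OF f(2)] cl]
    obtain C0 C1 C2 where F: "f = FF h C0 C1 C2 x0 x1 x2 x3" "C1 \<noteq> 0 \<or> C2 \<noteq> 0"
      by (rule FF_of_orders[OF f(1,2) _ _ _ _ o]) (simp_all add: M2_def)
    have "C2 \<noteq> 0"
    proof
      assume C2: "C2 = 0"
      then have C1: "C1 \<noteq> 0" using F(2) by simp
      have "ord_at (exc 11) f = M1 ! 11 - 2 * ord_at (exc 11) (wt 11)" unfolding F(1) C2 by (rule FF_orders_1(2)[OF C1]) simp
      moreover have "11 \<in> {1..17::nat}" by simp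
      then have "ord_at (exc 11) f = M2 ! 11 - 2 * ord_at (exc 11) (wt 11)" using o by blast
      ultimately show False by (simp add: M1_def M2_def)
    qed
    then show "D \<in> ?R" using F f(3) by blast
  qed
  show "?R \<subseteq> ?L"
  proof
    fix D assume "D \<in> ?R"
    then obtain C0 C1 C2 where D: "D = hypersurface (FF h C0 C1 C2 x0 x1 x2 x3)" "C2 \<noteq> 0" by blast
    have nz: "FF h C0 C1 C2 x0 x1 x2 x3 \<noteq> 0" by (rule FF_orders_2(1)[OF D(2), of 1]) simp
    have "ord_at Vinf_a (FF h C0 C1 C2 x0 x1 x2 x3) = - 2 \<and> ord_at Vinf_b (FF h C0 C1 C2 x0 x1 x2 x3) = - 2 \<and>
      (\<forall>j \<in> {1..17}. ord_at (exc j) (FF h C0 C1 C2 x0 x1 x2 x3) = M2 ! j - 2 * ord_at (exc j) (wt j))"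
      using FF_Vinf[OF h0, of C2 C1 C0] FF_orders_2(2)[OF D(2)] D(2) by blast
    then show "D \<in> ?L" using ci[OF nz] FF_polyring nz unfolding D(1) hypersurfaces_def by blast
  qed
qed

end

theorem proposition2p4:
  fixes h :: complex and la lb :: "complex \<times> complex \<times> complex"
  assumes "h \<noteq> 0"
    and "la \<noteq> (0, 0, 0)" and "lb \<noteq> (0, 0, 0)"
    and "Pic_free_basis h la lb"
  shows
    "({D \<in> hypersurfaces.
        div_class (var_X h) (proper_transform (var_X h) P2xP2 D) =
        div_class (var_X h)
          (\<lambda>V. 2 * H_a h la V + 2 * H_b h lb V - 2 * E h 1 V - 2 * E h 6 V - 4 * E h 11 V
               - (\<Sum>i \<in> {2, 4, 7, 9, 12, 13, 14, 16}. E h i V))}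
     = {hypersurface (cst C0 + cst C1 * I1 h) | C0 C1. C1 \<noteq> 0}) \<and>
    ({D \<in> hypersurfaces.
        div_class (var_X h) (proper_transform (var_X h) P2xP2 D) =
        div_class (var_X h)
          (\<lambda>V. 2 * H_a h la V + 2 * H_b h lb V - 3 * E h 11 V
               - (\<Sum>i \<in> {1, 2, 4, 5, 6, 7, 9, 10, 12, 13, 14, 16, 17}. E h i V))}
     = {hypersurface (cst C0 + cst C1 * I1 h + cst C2 * I2 h) | C0 C1 C2. C2 \<noteq> 0})"
proof -
  interpret lines_setting h la lb by unfold_locales (fact assms)+
  show ?thesis
    unfolding I_FF(2) unfolding I_FF(1) comb_m[symmetric] by (rule conjI[OF hypersurfaces_1[OF assms(4)] hypersurfaces_2[OF assms(4)]])
qed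

end
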